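(* Let $1<p<\infty$, let $\Omega$ be a domain in $\mathbb{R}^N$, and let $V\ge 0$ be a function on $\Omega$. Put $\mathcal{Q}_V(u):=\int_\Omega|\nabla u|^p\,dx-\int_\Omega V|u|^p\,dx$ and assume that $\mathcal{Q}_V(u)>0$ for all $u\in\mathcal{D}(\Omega)\setminus\{0\}$. Assume moreover that there exist $q$ with $1<q\le p$ and $p-1<q$, a number $r$ with $$r=1\ \text{ if } N<q,\qquad 1<r<+\infty\ \text{ if } N=q,\qquad \frac1r+\frac{p-1}{q^*}=1\ \text{ if } N>q \quad\Big(q^*:=\frac{Nq}{N-q}\Big),$$ such that $V\in L^r_{\mathrm{loc}}(\Omega)$, and a function $W\in\mathcal{C}(\Omega)$, $W>0$, such that for all $u\in\mathcal{D}(\Omega)$, $$\left(\int_\Omega(|\nabla u|^q+|u|^q)W\,dx\right)^{p/q}\le\mathcal{Q}_V(u).$$ Let $f\in\mathcal{D}'(\Omega)$ be such that $$\sup\{\langle f,u\rangle : u\in\mathcal{D}(\Omega),\ \mathcal{Q}_V(u)=1\}<+\infty.$$ Then there exists $u\in W^{1,q}_0(\Omega,W\,dx)$ such that, in $\mathcal{D}'(\Omega)$, $$-\Delta_p u-V(x)|u|^{p-2}u=f(x).$$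
   Context: $\mathcal{D}(\Omega)$ is the space of (real-valued) test functions on $\Omega$ (smooth with compact support) and $\mathcal{D}'(\Omega)$ the space of distributions. $\Delta_p u:=\operatorname{div}(|\nabla u|^{p-2}\nabla u)$. $W^{1,q}_0(\Omega,W\,dx)$ is the completion of $\mathcal{D}(\Omega)$ with respect to the norm $\left(\int_\Omega(|\nabla u|^q+|u|^q)W\,dx\right)^{1/q}$; since $W$ is continuous and positive, it is a space of functions contained in $W^{1,q}_{\mathrm{loc}}(\Omega)$. The equation in $\mathcal{D}'(\Omega)$ means that $\int_\Omega|\nabla u|^{p-2}\nabla u\cdot\nabla\zeta\,dx-\int_\Omega V|u|^{p-2}u\,\zeta\,dx=\langle f,\zeta\rangle$ for all $\zeta\in\mathcal{D}(\Omega)$. *)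

theory Defs
  imports "HOL-Analysis.Analysis"
begin

definition pderiv_along :: "'a::euclidean_space \<Rightarrow> ('a \<Rightarrow> real) \<Rightarrow> 'a \<Rightarrow> real"
  where "pderiv_along b u x = frechet_derivative u (at x) b"

definition grad :: "('a::euclidean_space \<Rightarrow> real) \<Rightarrow> 'a \<Rightarrow> 'a"
  where "grad u x = (\<Sum>b\<in>Basis. pderiv_along b u x *\<^sub>R b)"

(* A list of basis vectors plays the role of a multi-index; its length is the order. *)
definition iter_pderiv :: "'a::euclidean_space list \<Rightarrow> ('a \<Rightarrow> real) \<Rightarrow> 'a \<Rightarrow> real"
  where "iter_pderiv bs u = foldr pderiv_along bs u"

(* C-infinity: differentiability of all iterated partial derivatives (hence their continuity). *)
definition smooth_fun :: "('a::euclidean_space \<Rightarrow> real) \<Rightarrow> bool"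
  where "smooth_fun u \<longleftrightarrow>
    (\<forall>bs. set bs \<subseteq> Basis \<longrightarrow> iter_pderiv bs u differentiable_on UNIV)"

definition supp :: "('a::topological_space \<Rightarrow> real) \<Rightarrow> 'a set"
  where "supp u = closure {x. u x \<noteq> 0}"

(* Test functions on Omega are identified with their extensions by zero to the whole space. *)
definition test_funs :: "'a::euclidean_space set \<Rightarrow> ('a \<Rightarrow> real) set"
  where "test_funs \<Omega> = {u. smooth_fun u \<and> compact (supp u) \<and> supp u \<subseteq> \<Omega>}"

(* Only the values of a distribution on test functions on Omega are relevant. Continuity is expressed by
   the usual seminorm estimates on the test functions supported in a fixed compact set. *)
definition distribution :: "'a::euclidean_space set \<Rightarrow> (('a \<Rightarrow> real) \<Rightarrow> real) \<Rightarrow> bool"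
  where "distribution \<Omega> f \<longleftrightarrow>
    (\<forall>u\<in>test_funs \<Omega>. \<forall>v\<in>test_funs \<Omega>. \<forall>a b.
        f (\<lambda>x. a * u x + b * v x) = a * f u + b * f v) \<and>
    (\<forall>K. compact K \<and> K \<subseteq> \<Omega> \<longrightarrow>
      (\<exists>C m. \<forall>u\<in>test_funs \<Omega>. supp u \<subseteq> K \<longrightarrow>
        \<bar>f u\<bar> \<le> C * (\<Sum>bs | set bs \<subseteq> Basis \<and> length bs \<le> m. SUP x. \<bar>iter_pderiv bs u x\<bar>)))"

definition L_loc :: "real \<Rightarrow> 'a::euclidean_space set \<Rightarrow> ('a \<Rightarrow> 'b::euclidean_space) \<Rightarrow> bool"
  where "L_loc r \<Omega> g \<longleftrightarrow> g \<in> borel_measurable (lebesgue_on \<Omega>) \<and>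
    (\<forall>K. compact K \<and> K \<subseteq> \<Omega> \<longrightarrow> integrable (lebesgue_on K) (\<lambda>x. norm (g x) powr r))"

definition weak_grad :: "'a::euclidean_space set \<Rightarrow> ('a \<Rightarrow> real) \<Rightarrow> ('a \<Rightarrow> 'a) \<Rightarrow> bool"
  where "weak_grad \<Omega> u G \<longleftrightarrow> L_loc 1 \<Omega> u \<and> L_loc 1 \<Omega> G \<and>
    (\<forall>\<zeta>\<in>test_funs \<Omega>. \<forall>b\<in>Basis.
      (LINT x|lebesgue_on \<Omega>. u x * pderiv_along b \<zeta> x)
        = - (LINT x|lebesgue_on \<Omega>. (G x \<bullet> b) * \<zeta> x))"

definition W1_loc :: "real \<Rightarrow> 'a::euclidean_space set \<Rightarrow> ('a \<Rightarrow> real) \<Rightarrow> ('a \<Rightarrow> 'a) \<Rightarrow> bool"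
  where "W1_loc q \<Omega> u G \<longleftrightarrow> weak_grad \<Omega> u G \<and> L_loc q \<Omega> u \<and> L_loc q \<Omega> G"

definition W1_loc_tendsto ::
    "real \<Rightarrow> 'a::euclidean_space set \<Rightarrow> (nat \<Rightarrow> 'a \<Rightarrow> real) \<Rightarrow> ('a \<Rightarrow> real) \<Rightarrow> ('a \<Rightarrow> 'a) \<Rightarrow> bool"
  where "W1_loc_tendsto q \<Omega> \<phi> u G \<longleftrightarrow> (\<forall>K. compact K \<and> K \<subseteq> \<Omega> \<longrightarrow>
    (\<lambda>n. LINT x|lebesgue_on K. norm (grad (\<phi> n) x - G x) powr q + \<bar>\<phi> n x - u x\<bar> powr q)
      \<longlonglongrightarrow> 0)"

definition W_energy :: "real \<Rightarrow> 'a::euclidean_space set \<Rightarrow> ('a \<Rightarrow> real) \<Rightarrow> ('a \<Rightarrow> real) \<Rightarrow> real"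
  where "W_energy q \<Omega> W u =
    (LINT x|lebesgue_on \<Omega>. (norm (grad u x) powr q + \<bar>u x\<bar> powr q) * W x)"

definition W_norm :: "real \<Rightarrow> 'a::euclidean_space set \<Rightarrow> ('a \<Rightarrow> real) \<Rightarrow> ('a \<Rightarrow> real) \<Rightarrow> real"
  where "W_norm q \<Omega> W u = W_energy q \<Omega> W u powr (1 / q)"

(* The completion of the test functions in W_norm, realised inside the local Sobolev space: an
   abstract element of the completion is represented by a Cauchy sequence of test functions and
   is identified with the local Sobolev limit u of that sequence. G is the weak gradient of u. *)
definition W1_0 ::
    "real \<Rightarrow> 'a::euclidean_space set \<Rightarrow> ('a \<Rightarrow> real) \<Rightarrow> ('a \<Rightarrow> real) \<Rightarrow> ('a \<Rightarrow> 'a) \<Rightarrow> bool"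
  where "W1_0 q \<Omega> W u G \<longleftrightarrow> W1_loc q \<Omega> u G \<and>
    (\<exists>\<phi>. (\<forall>n. \<phi> n \<in> test_funs \<Omega>) \<and>
      (\<forall>e>0. \<exists>M. \<forall>m\<ge>M. \<forall>n\<ge>M. W_norm q \<Omega> W (\<lambda>x. \<phi> m x - \<phi> n x) < e) \<and>
      W1_loc_tendsto q \<Omega> \<phi> u G)"

definition Q_fun :: "real \<Rightarrow> 'a::euclidean_space set \<Rightarrow> ('a \<Rightarrow> real) \<Rightarrow> ('a \<Rightarrow> real) \<Rightarrow> real"
  where "Q_fun p \<Omega> V u = (LINT x|lebesgue_on \<Omega>. norm (grad u x) powr p)
    - (LINT x|lebesgue_on \<Omega>. V x * \<bar>u x\<bar> powr p)"

definition sobolev_conj :: "'a::euclidean_space itself \<Rightarrow> real \<Rightarrow> real"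
  where "sobolev_conj _ q = real DIM('a) * q / (real DIM('a) - q)"

(* The equation in the sense of distributions for u with weak gradient G. Integrability is
   stated because a non-integrable function has Bochner integral 0. For p < 2 the products
   are 0 where G, respectively u, vanishes. *)
definition solves_distr ::
    "real \<Rightarrow> 'a::euclidean_space set \<Rightarrow> ('a \<Rightarrow> real) \<Rightarrow> (('a \<Rightarrow> real) \<Rightarrow> real)
      \<Rightarrow> ('a \<Rightarrow> real) \<Rightarrow> ('a \<Rightarrow> 'a) \<Rightarrow> bool"
  where "solves_distr p \<Omega> V f u G \<longleftrightarrow> (\<forall>\<zeta>\<in>test_funs \<Omega>.
    integrable (lebesgue_on \<Omega>) (\<lambda>x. (norm (G x) powr (p - 2) *\<^sub>R G x) \<bullet> grad \<zeta> x) \<and>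
    integrable (lebesgue_on \<Omega>) (\<lambda>x. V x * \<bar>u x\<bar> powr (p - 2) * u x * \<zeta> x) \<and>
    (LINT x|lebesgue_on \<Omega>. (norm (G x) powr (p - 2) *\<^sub>R G x) \<bullet> grad \<zeta> x)
      - (LINT x|lebesgue_on \<Omega>. V x * \<bar>u x\<bar> powr (p - 2) * u x * \<zeta> x) = f \<zeta>)"

end

theory Submission
  imports Defs "HOL-Complex_Analysis.Great_Picard"
begin

text \<open>
  Put \<open>\<Phi> = Q_V / p - f\<close>. By homogeneity the bound on \<open>f\<close> gives \<open>f u \<le> C Q_V(u)\<^sup>1\<^sup>/\<^sup>p\<close>, so \<open>\<Phi>\<close> is
  bounded below and a minimizing sequence \<open>u\<^sub>i\<close> of test functions is bounded in the weighted
  space, hence locally in \<open>W\<^sup>1\<^sup>,\<^sup>q\<close>; by Rellich a subsequence converges almost everywhere.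

  The functional is not convex, and \<open>f\<close> is only a distribution. Both difficulties disappear when
  \<open>u\<^sub>i\<close> and \<open>u\<^sub>j\<close> are moved towards each other by the same test function \<open>v = \<psi> T(u\<^sub>i - u\<^sub>j) / 2\<close>,
  where \<open>T(s) = \<delta> tanh (s / \<delta>)\<close>: in \<open>\<Phi>(u\<^sub>i - v) + \<Phi>(u\<^sub>j + v)\<close> the distribution cancels, the potential
  changes by \<open>O(\<delta>)\<close>, and on \<open>{\<bar>u\<^sub>i - u\<^sub>j\<bar> \<le> \<delta>}\<close> the gradient energy drops by a multiple of the
  convexity gap of \<open>\<bar>\<xi>\<bar>\<^sup>p\<close> at the two gradients, up to \<open>O(\<delta>)\<close>. Since the sequence is minimizing,
  the gradients are Cauchy in measure.

  As \<open>p - 1 < q\<close> and, by Sobolev's inequality, \<open>V \<bar>u\<^sub>i\<bar>\<^sup>p\<^sup>-\<^sup>1\<close> is locally equi-integrable, one may pass to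
  the limit in \<open>\<Phi>(u\<^sub>i + t \<zeta>) \<ge> \<Phi>(u\<^sub>i) - o(1)\<close> and then let \<open>t\<close> tend to zero. A Banach--Saks argument
  with dyadic convex combinations of the \<open>u\<^sub>i\<close> places the limit in the completion of the test functions.
\<close>

section \<open>Smooth functions and cut-offs\<close>

text \<open>The functional is compared at test functions only, because \<open>f\<close> is defined
  nowhere else. This rules out the sharp truncation at height \<delta>. A smooth one is needed, and
  \<open>tanh\<close> suits for two reasons: its derivative 1 - tanh^2 is positive and stays away
  from 0 on bounded sets, and \<delta> tanh (s / \<delta>) = t s with some t in [0, 1]. By the
  latter, U_i - v and U_j + v are pointwise convex combinations of U_i and U_j, so no new large
  values arise.

  Since q may be smaller than p, the gradient G of the limit is only locally q-integrable. Thus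
  Q_V(u) need not make sense, and u cannot be treated as a minimizer. Only increments of Q_V under a
  perturbation t \<zeta> are followed; they grow like the power p - 1 of the function and of its
  gradient.

  The critical relation between r and the Sobolev exponent \<sigma> is harmless because V is one
  fixed function: V |U_i|^(p-1) lies below a large multiple of 1 + V^r, which is independent of i,
  plus a small multiple of |U_i|^\<sigma>.\<close>

lemma smooth_fun_unfold:
  "smooth_fun u \<longleftrightarrow> u differentiable_on UNIV \<and> (\<forall>b\<in>Basis. smooth_fun (pderiv_along b u))"
proof
  assume L: "smooth_fun u"
  have "iter_pderiv [] u differentiable_on UNIV"
    using L unfolding smooth_fun_def by (metis empty_set empty_subsetI)
  hence "u differentiable_on UNIV" by (simp add: iter_pderiv_def)
  moreover have "smooth_fun (pderiv_along b u)" if b: "b\<in>Basis" for b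
    unfolding smooth_fun_def
  proof (intro allI impI)
    fix bs :: "'a list" assume bs: "set bs \<subseteq> Basis"
    hence "set (bs @ [b]) \<subseteq> Basis" using b by auto
    hence "iter_pderiv (bs@[b]) u differentiable_on UNIV"
      using L unfolding smooth_fun_def by blast
    thus "iter_pderiv bs (pderiv_along b u) differentiable_on UNIV" by (simp add: iter_pderiv_def)
  qed
  ultimately show "u differentiable_on UNIV \<and> (\<forall>b\<in>Basis. smooth_fun (pderiv_along b u))" by blast
next
  assume R: "u differentiable_on UNIV \<and> (\<forall>b\<in>Basis. smooth_fun (pderiv_along b u))"
  show "smooth_fun u" unfolding smooth_fun_def
  proof (intro allI impI)
    fix bs :: "'a list" assume bs: "set bs \<subseteq> Basis"
    show "iter_pderiv bs u differentiable_on UNIV"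
    proof (cases bs rule: rev_cases)
      case Nil then show ?thesis using R by (simp add: iter_pderiv_def)
    next
      case (snoc cs b)
      then have "smooth_fun (pderiv_along b u)" "set cs \<subseteq> Basis" using R bs by auto
      then show ?thesis using snoc unfolding smooth_fun_def by (simp add: iter_pderiv_def)
    qed
  qed
qed

text \<open>Smoothness is the largest class of differentiable functions closed under partial
  derivatives. Any such class \<open>S\<close> may therefore serve as an invariant, and higher
  derivatives never have to be computed.\<close>

lemma smooth_fun_coinduct:
  assumes S: "S u"
    and diff: "\<And>u. S u \<Longrightarrow> u differentiable_on UNIV"
    and step: "\<And>u b. S u \<Longrightarrow> b \<in> Basis \<Longrightarrow> S (pderiv_along b u)"
  shows "smooth_fun u"
proof -
  have "S (iter_pderiv bs u)" if "set bs \<subseteq> Basis" for bs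
    using that by (induction bs) (use S step in \<open>auto simp: iter_pderiv_def\<close>)
  thus ?thesis unfolding smooth_fun_def using diff by blast
qed

lemma pderiv_along_eq: "(u has_derivative D) (at x) \<Longrightarrow> pderiv_along b u x = D b"
  unfolding pderiv_along_def by (metis frechet_derivative_at)

lemma smooth_differentiable: "smooth_fun u \<Longrightarrow> u differentiable (at x)"
  using smooth_fun_unfold[of u] by (auto simp: differentiable_on_def)

lemma smooth_pderiv_along: "smooth_fun u \<Longrightarrow> b \<in> Basis \<Longrightarrow> smooth_fun (pderiv_along b u)"
  using smooth_fun_unfold[of u] by auto

lemma smooth_continuous: "smooth_fun u \<Longrightarrow> continuous_on S u"
  by (meson continuous_at_imp_continuous_on differentiable_imp_continuous_within smooth_differentiable)

lemma grad_inner_Basis: "b \<in> Basis \<Longrightarrow> grad u x \<bullet> b = pderiv_along b u x"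
  by (simp add: grad_def inner_sum_left inner_Basis if_distrib cong: if_cong)

lemma frechet_derivative_eq_grad:
  assumes "u differentiable (at x)"
  shows "frechet_derivative u (at x) h = grad u x \<bullet> h"
proof -
  have lin: "linear (frechet_derivative u (at x))" using assms by (rule linear_frechet_derivative)
  have "frechet_derivative u (at x) h = frechet_derivative u (at x) (\<Sum>b\<in>Basis. (h \<bullet> b) *\<^sub>R b)"
    by (simp add: euclidean_representation)
  also have "\<dots> = (\<Sum>b\<in>Basis. (h \<bullet> b) * frechet_derivative u (at x) b)"
    using lin by (simp add: linear_sum linear_scale)
  also have "\<dots> = grad u x \<bullet> h"
    by (simp add: grad_def inner_sum_left pderiv_along_def inner_commute[of h] mult.commute)
  finally show ?thesis .
qed

lemma smooth_has_derivative: "smooth_fun u \<Longrightarrow> (u has_derivative (\<lambda>h. grad u x \<bullet> h)) (at x)"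
  using frechet_derivative_eq_grad[OF smooth_differentiable[of u x]]
    frechet_derivative_works[of u "at x"] smooth_differentiable[of u x]
  by (metis (no_types, lifting) ext)

lemma grad_eqI: "(u has_derivative (\<lambda>h. g \<bullet> h)) (at x) \<Longrightarrow> grad u x = g"
  by (rule euclidean_eqI) (simp add: grad_inner_Basis pderiv_along_eq)

lemma continuous_grad: "smooth_fun u \<Longrightarrow> continuous_on S (grad u)"
  unfolding grad_def by (intro continuous_intros smooth_continuous smooth_pderiv_along)

text \<open>The invariant for \<open>smooth_fun_coinduct\<close>: the derivative of a product or of
  a composite is a sum of products, so the three operations have to be closed up simultaneously for
  the class to be stable under differentiation.\<close>

inductive smooth_alg :: "('a::euclidean_space \<Rightarrow> real) \<Rightarrow> bool" where
  base: "smooth_fun u \<Longrightarrow> smooth_alg u"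
| add: "smooth_alg u \<Longrightarrow> smooth_alg v \<Longrightarrow> smooth_alg (\<lambda>x. u x + v x)"
| mult: "smooth_alg u \<Longrightarrow> smooth_alg v \<Longrightarrow> smooth_alg (\<lambda>x. u x * v x)"
| comp: "smooth_fun (g :: real \<Rightarrow> real) \<Longrightarrow> smooth_alg u \<Longrightarrow> smooth_alg (\<lambda>x. g (u x))"

lemma smooth_real_DERIV:
  assumes "smooth_fun (g::real \<Rightarrow> real)"
  shows "(g has_real_derivative pderiv_along 1 g x) (at x)"
proof -
  have "grad g x = pderiv_along 1 g x" by (simp add: grad_def)
  thus ?thesis using smooth_has_derivative[OF assms, of x] by (simp add: has_field_derivative_def mult_commute_abs)
qed

lemma smooth_alg_deriv:
  "smooth_alg u \<Longrightarrow> (\<forall>x. u differentiable (at x)) \<and> (\<forall>b\<in>Basis. smooth_alg (pderiv_along b u))"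
proof (induction rule: smooth_alg.induct)
  case (base u)
  then show ?case by (auto intro: smooth_differentiable smooth_alg.base smooth_pderiv_along)
next
  case (add u v)
  have "pderiv_along b (\<lambda>x. u x + v x) = (\<lambda>x. pderiv_along b u x + pderiv_along b v x)" for b
  proof
    fix x
    have "((\<lambda>x. u x + v x) has_derivative (\<lambda>h. frechet_derivative u (at x) h + frechet_derivative v (at x) h)) (at x)"
      using add by (intro has_derivative_add) (auto simp: frechet_derivative_works)
    from pderiv_along_eq[OF this] show "pderiv_along b (\<lambda>x. u x + v x) x = pderiv_along b u x + pderiv_along b v x"
      by (simp add: pderiv_along_def)
  qed
  then show ?case using add by (auto intro: smooth_alg.add)
next
  case (mult u v)
  have "pderiv_along b (\<lambda>x. u x * v x) = (\<lambda>x. u x * pderiv_along b v x + pderiv_along b u x * v x)" for b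
  proof
    fix x
    have "((\<lambda>x. u x * v x) has_derivative (\<lambda>h. u x * frechet_derivative v (at x) h + frechet_derivative u (at x) h * v x)) (at x)"
      using mult by (intro has_derivative_mult) (auto simp: frechet_derivative_works)
    from pderiv_along_eq[OF this] show "pderiv_along b (\<lambda>x. u x * v x) x = u x * pderiv_along b v x + pderiv_along b u x * v x"
      by (simp add: pderiv_along_def)
  qed
  then show ?case using mult by (auto intro!: smooth_alg.add smooth_alg.mult)
next
  case (comp g u)
  have D: "((\<lambda>x. g (u x)) has_derivative (\<lambda>h. pderiv_along 1 g (u x) * frechet_derivative u (at x) h)) (at x)" for x
  proof -
    have "(u has_derivative frechet_derivative u (at x)) (at x)"
      using comp by (auto simp: frechet_derivative_works)
    moreover have "(g has_derivative (\<lambda>h. pderiv_along 1 g (u x) * h)) (at (u x))"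
      using smooth_real_DERIV[OF comp(1)] by (simp add: has_field_derivative_def)
    ultimately show ?thesis using has_derivative_compose[of u _ x UNIV g] by auto
  qed
  have "pderiv_along b (\<lambda>x. g (u x)) = (\<lambda>x. pderiv_along 1 g (u x) * pderiv_along b u x)" for b
    using pderiv_along_eq[OF D] by (auto simp: pderiv_along_def)
  moreover have "smooth_fun (pderiv_along 1 g)" using comp(1) by (intro smooth_pderiv_along) auto
  hence "smooth_alg (\<lambda>x. pderiv_along 1 g (u x))" using comp(2) by (rule smooth_alg.comp)
  ultimately have "smooth_alg (pderiv_along b (\<lambda>x. g (u x)))" if "b \<in> Basis" for b
    using comp that by (simp add: smooth_alg.mult)
  thus ?case using D unfolding differentiable_def by blast
qed

lemma smooth_alg_smooth: "smooth_alg u \<Longrightarrow> smooth_fun u"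
  by (rule smooth_fun_coinduct[of smooth_alg]) (auto dest: smooth_alg_deriv simp: differentiable_on_def)

lemma smooth_add: "smooth_fun u \<Longrightarrow> smooth_fun v \<Longrightarrow> smooth_fun (\<lambda>x. u x + v x)"
  and smooth_mult: "smooth_fun u \<Longrightarrow> smooth_fun v \<Longrightarrow> smooth_fun (\<lambda>x. u x * v x)"
  and smooth_compose: "smooth_fun g \<Longrightarrow> smooth_fun u \<Longrightarrow> smooth_fun (\<lambda>x. g (u x))"
  using smooth_alg_smooth smooth_alg.add[OF smooth_alg.base smooth_alg.base]
    smooth_alg.mult[OF smooth_alg.base smooth_alg.base] smooth_alg.comp[OF _ smooth_alg.base] by blast+

lemma pderiv_along_const: "pderiv_along b (\<lambda>x. c) = (\<lambda>x. 0)"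
  by (rule ext) (rule pderiv_along_eq, rule has_derivative_const)

lemma smooth_const: "smooth_fun (\<lambda>x. c)"
  by (rule smooth_fun_coinduct[of "\<lambda>u. \<exists>c. u = (\<lambda>x. c)"]) (auto simp: pderiv_along_const)

lemma smooth_inner: "smooth_fun (\<lambda>x. x \<bullet> a)"
proof -
  have "pderiv_along b (\<lambda>x. x \<bullet> a) = (\<lambda>x. b \<bullet> a)" for b
    by (rule ext) (rule pderiv_along_eq, auto intro!: derivative_eq_intros)
  moreover have "(\<lambda>x. x \<bullet> a) differentiable_on UNIV"
    by (auto simp: differentiable_on_def differentiable_def intro!: exI has_derivative_inner_left has_derivative_ident)
  ultimately show ?thesis by (subst smooth_fun_unfold) (auto simp: smooth_const)
qed

lemma smooth_cmult: "smooth_fun u \<Longrightarrow> smooth_fun (\<lambda>x. c * u x)"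
  by (intro smooth_mult smooth_const)

lemma smooth_diff: "smooth_fun u \<Longrightarrow> smooth_fun v \<Longrightarrow> smooth_fun (\<lambda>x. u x - v x)"
  using smooth_add[of u "\<lambda>x. (-1) * v x"] smooth_cmult[of v "-1"] by simp

lemma smooth_sum: "finite I \<Longrightarrow> (\<And>i. i \<in> I \<Longrightarrow> smooth_fun (u i)) \<Longrightarrow> smooth_fun (\<lambda>x. \<Sum>i\<in>I. u i x)"
  by (induction I rule: finite_induct) (auto intro: smooth_const smooth_add)

lemma smooth_fun_realI:
  assumes g: "S g" and step: "\<And>g. S g \<Longrightarrow> \<exists>g'. S g' \<and> (\<forall>x. (g has_real_derivative g' x) (at x))"
  shows "smooth_fun (g :: real \<Rightarrow> real)"
proof (rule smooth_fun_coinduct[of S])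
  fix g b assume "S g" and b: "(b::real) \<in> Basis"
  then obtain g' where g': "S g'" "\<And>x. (g has_real_derivative g' x) (at x)" using step by blast
  have "pderiv_along b g x = g' x" for x
    using pderiv_along_eq[of g "(*) (g' x)" x b] g'(2)[of x] b by (simp add: has_field_derivative_def)
  hence "pderiv_along b g = g'" by (rule ext)
  thus "S (pderiv_along b g)" using g'(1) by simp
next
  fix g assume "S g"
  then obtain g' where g': "S g'" "\<And>x. (g has_real_derivative g' x) (at x)" using step by blast
  thus "g differentiable_on UNIV"
    by (meson differentiable_on_def field_differentiable_imp_differentiable field_differentiable_def has_field_derivative_at_within)
qed (fact g)

text \<open>Polynomials in tanh are stable under differentiation, as tanh' = 1 - tanh^2: the
  derivative of P(tanh) is (P' (1 - X^2))(tanh).\<close>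

lemma smooth_tanh: "smooth_fun (tanh :: real \<Rightarrow> real)"
proof (rule smooth_fun_realI[of "\<lambda>g. \<exists>P. g = (\<lambda>x. poly P (tanh x))"])
  show "\<exists>P. tanh = (\<lambda>x::real. poly P (tanh x))" by (rule exI[of _ "[:0,1:]"]) auto
next
  fix g :: "real \<Rightarrow> real" assume "\<exists>P. g = (\<lambda>x. poly P (tanh x))"
  then obtain P where P: "g = (\<lambda>x. poly P (tanh x))" by blast
  show "\<exists>g'. (\<exists>P. g' = (\<lambda>x. poly P (tanh x))) \<and> (\<forall>x. (g has_real_derivative g' x) (at x))"
  proof (intro exI[of _ "\<lambda>x. poly (pderiv P * [:1,0,-1:]) (tanh x)"] conjI exI[of _ "pderiv P * [:1,0,-1:]"] refl allI)
    fix x :: real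
    have "cosh x \<noteq> 0" by simp
    thus "(g has_real_derivative poly (pderiv P * [:1,0,-1:]) (tanh x)) (at x)"
      unfolding P by (auto intro!: derivative_eq_intros DERIV_chain2[OF poly_DERIV] simp: power2_eq_square algebra_simps)
  qed
qed

text \<open>The classical function exp (-1/x), extended by 0 to x \<le> 0. The polynomial factor in
  1/x is carried along so that the family is stable under differentiation.\<close>

definition flat :: "real poly \<Rightarrow> real \<Rightarrow> real" where
  "flat P x = (if x > 0 then poly P (1 / x) * exp (- (1 / x)) else 0)"

lemma flat_tendsto_0: "(flat P \<longlongrightarrow> 0) (at 0)"
proof -
  have 1: "((\<lambda>y::real. poly P y * exp (- y)) \<longlongrightarrow> 0) at_top"
  proof -
    have "((\<lambda>y::real. \<Sum>i\<le>degree P. coeff P i * (y ^ i / exp y)) \<longlongrightarrow> (\<Sum>i\<le>degree P. coeff P i * 0)) at_top"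
      by (intro tendsto_intros tendsto_power_div_exp_0)
    thus ?thesis by (simp add: poly_altdef exp_minus sum_distrib_left divide_inverse mult_ac)
  qed
  have "((\<lambda>x. poly P (inverse x) * exp (- (inverse x))) \<longlongrightarrow> 0) (at_right (0::real))"
    by (rule filterlim_compose[OF 1 filterlim_inverse_at_top_right])
  moreover have "eventually (\<lambda>x. poly P (inverse x) * exp (- (inverse x)) = flat P x) (at_right (0::real))"
    using eventually_at_right_less[of "0::real"] by eventually_elim (simp add: flat_def inverse_eq_divide)
  ultimately have r: "(flat P \<longlongrightarrow> 0) (at_right 0)" by (rule Lim_transform_eventually)
  have "eventually (\<lambda>x. 0 = flat P x) (at_left (0::real))"
    by (auto simp: eventually_at_filter flat_def)
  with tendsto_const have "(flat P \<longlongrightarrow> 0) (at_left 0)" by (rule Lim_transform_eventually)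
  thus ?thesis using r by (simp add: filterlim_split_at)
qed

text \<open>For x > 0 the inner derivative of 1/x is -1/x^2, which accounts for the factor X^2 and
  turns P into P - P'. Only the point 0 needs an argument, namely the decay of every member of the
  family.\<close>

lemma flat_DERIV: "(flat P has_real_derivative flat ([:0,0,1:] * (P - pderiv P)) x) (at x)"
proof -
  consider "x < 0" | "x = 0" | "x > 0" by linarith
  thus ?thesis
  proof cases
    case 1
    have "((\<lambda>x. 0) has_real_derivative 0) (at x)" by simp
    moreover have "eventually (\<lambda>y. (0::real) = flat P y) (nhds x)"
      using eventually_nhds_in_open[of "{..<0}" x] 1 by (auto elim!: eventually_mono simp: flat_def)
    ultimately have "(flat P has_real_derivative 0) (at x)"
      using DERIV_cong_ev[OF refl _ refl, of "\<lambda>x. 0" "flat P" x 0] by blast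
    thus ?thesis using 1 by (simp add: flat_def)
  next
    case 2
    \<comment> \<open>Dividing by h multiplies the polynomial in 1/h by X, so the difference
      quotient at 0 is again a member of the family.\<close>
    have "((\<lambda>h. flat (pCons 0 P) h) \<longlongrightarrow> 0) (at 0)" by (rule flat_tendsto_0)
    moreover have "flat (pCons 0 P) h = (flat P (0 + h) - flat P 0) / h" for h
      by (simp add: flat_def)
    ultimately have "((\<lambda>h. (flat P (0 + h) - flat P 0) / h) \<longlongrightarrow> 0) (at 0)" by (simp only:)
    thus ?thesis using 2 by (simp add: DERIV_def flat_def)
  next
    case 3
    have "((\<lambda>x. poly P (1 / x) * exp (- (1 / x))) has_real_derivative
        poly ([:0,0,1:] * (P - pderiv P)) (1 / x) * exp (- (1 / x))) (at x)"
      using 3 by (auto intro!: derivative_eq_intros DERIV_chain2[OF poly_DERIV] simp: field_simps power2_eq_square)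
    moreover have "eventually (\<lambda>y. poly P (1 / y) * exp (- (1 / y)) = flat P y) (nhds x)"
      using eventually_nhds_in_open[of "{0<..}" x] 3 by (auto elim!: eventually_mono simp: flat_def)
    ultimately have "(flat P has_real_derivative poly ([:0,0,1:] * (P - pderiv P)) (1 / x) * exp (- (1 / x))) (at x)"
      using DERIV_cong_ev[OF refl _ refl, of "\<lambda>x. poly P (1 / x) * exp (- (1 / x))" "flat P" x] by blast
    thus ?thesis using 3 by (simp add: flat_def)
  qed
qed

lemma smooth_flat: "smooth_fun (flat P)"
  by (rule smooth_fun_realI[of "\<lambda>g. \<exists>P. g = flat P"]) (use flat_DERIV in blast)+

definition bump :: "'a::euclidean_space \<Rightarrow> real \<Rightarrow> 'a \<Rightarrow> real" where
  "bump c e x = flat 1 (e\<^sup>2 - (x - c) \<bullet> (x - c))"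

lemma smooth_bump: "smooth_fun (bump c e)"
proof -
  have "(\<lambda>x. e\<^sup>2 - (x - c) \<bullet> (x - c)) = (\<lambda>x. e\<^sup>2 - (\<Sum>b\<in>Basis. (x \<bullet> b - c \<bullet> b) * (x \<bullet> b - c \<bullet> b)))"
    by (subst euclidean_inner) (simp add: inner_diff_left)
  moreover have "smooth_fun (\<lambda>x. e\<^sup>2 - (\<Sum>b\<in>Basis. (x \<bullet> b - c \<bullet> b) * (x \<bullet> b - c \<bullet> b)))"
    by (intro smooth_diff smooth_sum smooth_mult smooth_inner smooth_const finite_Basis)
  ultimately have "smooth_fun (\<lambda>x. flat 1 (e\<^sup>2 - (x - c) \<bullet> (x - c)))"
    using smooth_compose[OF smooth_flat, of "\<lambda>x. e\<^sup>2 - (x - c) \<bullet> (x - c)" 1] by (simp only:)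
  thus ?thesis by (simp add: bump_def[abs_def])
qed

lemma bump_pos: "x \<in> ball c e \<Longrightarrow> 0 < bump c e x"
proof -
  assume "x \<in> ball c e"
  hence "norm (x - c) < e" by (simp add: dist_norm norm_minus_commute)
  hence "(norm (x - c))\<^sup>2 < e\<^sup>2" by (simp add: power_strict_mono)
  thus ?thesis by (simp add: bump_def flat_def power2_norm_eq_inner)
qed

lemma bump_nonneg: "0 \<le> bump c e x" by (simp add: bump_def flat_def)
lemma bump_le_1: "bump c e x \<le> 1" by (simp add: bump_def flat_def)

lemma bump_outside: "0 \<le> e \<Longrightarrow> x \<notin> cball c e \<Longrightarrow> bump c e x = 0"
proof -
  assume e: "0 \<le> e" and "x \<notin> cball c e"
  hence "e \<le> norm (x - c)" by (simp add: dist_norm norm_minus_commute)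
  hence "e\<^sup>2 \<le> (norm (x - c))\<^sup>2" using e by (simp add: power_mono)
  thus ?thesis by (simp add: bump_def flat_def power2_norm_eq_inner)
qed

section \<open>Test functions, their supports and cut-offs\<close>

lemma test_funsI:
  assumes "smooth_fun u" "compact K" "K \<subseteq> \<Omega>" "\<And>x. x \<notin> K \<Longrightarrow> u x = 0"
  shows "u \<in> test_funs \<Omega>"
proof -
  have "supp u \<subseteq> K" unfolding supp_def using assms by (intro closure_minimal compact_imp_closed) auto
  moreover from this have "compact (supp u)"
    using assms(2) by (metis closed_closure compact_Int_closed inf.absorb2 supp_def)
  ultimately show ?thesis using assms by (auto simp: test_funs_def)
qed

lemma test_fun_outside: "x \<notin> supp u \<Longrightarrow> u x = 0"
  unfolding supp_def using closure_subset[of "{x. u x \<noteq> 0}"] by auto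

lemma test_funs_smooth: "u \<in> test_funs \<Omega> \<Longrightarrow> smooth_fun u"
  and test_funs_compact: "u \<in> test_funs \<Omega> \<Longrightarrow> compact (supp u)"
  and test_funs_supp: "u \<in> test_funs \<Omega> \<Longrightarrow> supp u \<subseteq> \<Omega>"
  by (auto simp: test_funs_def)

lemma test_funs_comb:
  assumes "u \<in> test_funs \<Omega>" "v \<in> test_funs \<Omega>"
  shows "(\<lambda>x. a * u x + b * v x) \<in> test_funs \<Omega>"
proof (rule test_funsI[of _ "supp u \<union> supp v"])
  show "smooth_fun (\<lambda>x. a * u x + b * v x)"
    using assms by (intro smooth_add smooth_cmult test_funs_smooth)
qed (use assms in \<open>auto simp: test_funs_compact test_funs_supp test_fun_outside dest: test_funs_supp\<close>)

lemma test_funs_mult: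
  assumes "\<psi> \<in> test_funs \<Omega>" "smooth_fun v"
  shows "(\<lambda>x. \<psi> x * v x) \<in> test_funs \<Omega>"
  by (rule test_funsI[of _ "supp \<psi>"])
     (use assms in \<open>auto intro: smooth_mult test_funs_smooth simp: test_funs_compact test_fun_outside dest: test_funs_supp\<close>)

lemma grad_outside: "x \<notin> supp u \<Longrightarrow> grad u x = 0"
proof (rule grad_eqI)
  assume x: "x \<notin> supp u"
  have "((\<lambda>x. 0) has_derivative (\<lambda>h. 0)) (at x)" by simp
  hence "(u has_derivative (\<lambda>h. 0)) (at x)"
  proof (rule has_derivative_transform_within_open[of _ _ _ _ "- supp u"])
    show "open (- supp u)" unfolding supp_def by (intro open_Compl closed_closure)
    show "x \<in> - supp u" using x by simp
    show "0 = u y" if "y \<in> - supp u" for y using that test_fun_outside[of y u] by simp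
  qed
  thus "(u has_derivative (\<bullet>) 0) (at x)" by (simp add: inner_zero_left[abs_def])
qed

text \<open>A finite sum of bumps over a cover of K by balls whose closures lie in \<Omega>. A
  positive lower bound on K serves in place of the value 1, since the cut-off only enters as a
  weight; it comes from the minimum of a continuous function on a compact set.\<close>

lemma cutoff_exists:
  fixes \<Omega> :: "'a::euclidean_space set"
  assumes "open \<Omega>" "compact K" "K \<subseteq> \<Omega>"
  obtains \<psi> c where "\<psi> \<in> test_funs \<Omega>" "\<And>x. 0 \<le> \<psi> x" "\<And>x. \<psi> x \<le> 1" "0 < c" "\<And>x. x \<in> K \<Longrightarrow> c \<le> \<psi> x"
proof -
  have "\<forall>x\<in>K. \<exists>e>0. cball x e \<subseteq> \<Omega>" using assms by (meson open_contains_cball subset_iff)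
  then obtain e where e: "\<And>x. x \<in> K \<Longrightarrow> 0 < e x" "\<And>x. x \<in> K \<Longrightarrow> cball x (e x) \<subseteq> \<Omega>" by metis
  have "K \<subseteq> (\<Union>x\<in>K. ball x (e x))" using e by auto
  then obtain D where D: "D \<subseteq> K" "finite D" "K \<subseteq> (\<Union>x\<in>D. ball x (e x))"
    using compactE_image[OF assms(2), of K "\<lambda>x. ball x (e x)"] by auto
  \<comment> \<open>Each bump is at most 1, so dividing by the number of balls plus one gives \<psi>
    \<le> 1 and also makes sense for an empty cover.\<close>
  define \<psi> where "\<psi> x = (1 / (real (card D) + 1)) * (\<Sum>d\<in>D. bump d (e d) x)" for x
  have sm: "smooth_fun \<psi>" unfolding \<psi>_def[abs_def] by (intro smooth_cmult smooth_sum smooth_bump D)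
  have test: "\<psi> \<in> test_funs \<Omega>"
  proof (rule test_funsI[of _ "\<Union>d\<in>D. cball d (e d)"])
    fix x assume "x \<notin> (\<Union>d\<in>D. cball d (e d))"
    hence "\<And>d. d \<in> D \<Longrightarrow> bump d (e d) x = 0" using e D by (auto intro!: bump_outside simp: less_imp_le subset_iff)
    thus "\<psi> x = 0" by (simp add: \<psi>_def)
  next
    show "(\<Union>d\<in>D. cball d (e d)) \<subseteq> \<Omega>" using D(1) e(2) by (meson UN_least subset_iff)
  qed (use sm D in \<open>auto intro!: compact_UN\<close>)
  have nn: "0 \<le> \<psi> x" for x unfolding \<psi>_def by (intro mult_nonneg_nonneg sum_nonneg bump_nonneg) auto
  have le: "\<psi> x \<le> 1" for x
  proof -
    have "(\<Sum>d\<in>D. bump d (e d) x) \<le> (\<Sum>d\<in>D. 1)" by (intro sum_mono bump_le_1)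
    thus ?thesis by (simp add: \<psi>_def field_simps)
  qed
  have pos: "0 < \<psi> x" if "x \<in> K" for x
  proof -
    obtain d where d: "d \<in> D" "x \<in> ball d (e d)" using subsetD[OF D(3) \<open>x \<in> K\<close>] by blast
    have "0 < (\<Sum>d\<in>D. bump d (e d) x)"
      using sum_pos2[OF D(2) d(1), of "\<lambda>d. bump d (e d) x"] bump_pos[OF d(2)] bump_nonneg by blast
    thus ?thesis by (simp add: \<psi>_def)
  qed
  have "\<exists>c>0. \<forall>x\<in>K. c \<le> \<psi> x"
  proof (cases "K = {}")
    case False
    then obtain x where "x \<in> K" "\<forall>y\<in>K. \<psi> x \<le> \<psi> y"
      using continuous_attains_inf[OF assms(2) _ smooth_continuous[OF sm]] by blast
    thus ?thesis using pos by blast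
  qed (auto intro: exI[of _ 1])
  thus ?thesis using that test nn le by metis
qed

section \<open>Uniform convexity of powers of the norm\<close>

lemma powr_mvt:
  fixes a b p :: real
  assumes "0 \<le> a" "a < b" "1 < p"
  obtains z where "a < z" "z < b" "b powr p - a powr p = (b - a) * (p * z powr (p - 1))"
proof -
  show ?thesis
  proof (rule mvt[OF assms(2), of "\<lambda>x. x powr p" "\<lambda>x h. h * (p * x powr (p - 1))"])
    fix z assume "a < z" "z < b" "b powr p - a powr p = (b - a) * (p * z powr (p - 1))"
    thus ?thesis by (rule that)
  next
    show "continuous_on {a..b} (\<lambda>x. x powr p)" using assms by (intro continuous_on_powr') (auto intro!: continuous_intros)
    fix x assume "a < x" "x < b"
    hence "((\<lambda>x. x powr p) has_real_derivative p * x powr (p - 1)) (at x)"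
      using assms by (auto intro!: derivative_eq_intros simp: powr_diff)
    thus "((\<lambda>x. x powr p) has_derivative (\<lambda>h. h * (p * x powr (p - 1)))) (at x)"
      by (simp add: has_field_derivative_def mult_commute_abs)
  qed
qed

lemma powr_diff_le:
  assumes "0 \<le> a" "0 \<le> b" "1 < (p::real)"
  shows "\<bar>a powr p - b powr p\<bar> \<le> p * \<bar>a - b\<bar> * max a b powr (p - 1)"
proof -
  have *: "\<bar>b powr p - a powr p\<bar> \<le> p * \<bar>b - a\<bar> * b powr (p - 1)" if ab: "0 \<le> a" "a < b" for a b :: real
  proof -
    obtain z where z: "a < z" "z < b" "b powr p - a powr p = (b - a) * (p * z powr (p - 1))"
      using powr_mvt[OF ab assms(3)] .
    have "z powr (p - 1) \<le> b powr (p - 1)" using z ab assms by (intro powr_mono2) auto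
    hence "(b - a) * (p * z powr (p - 1)) \<le> (b - a) * (p * b powr (p - 1))"
      using ab assms by (intro mult_left_mono) auto
    moreover have "0 \<le> (b - a) * (p * z powr (p - 1))" using ab assms by auto
    ultimately show ?thesis using z ab by (simp add: mult_ac)
  qed
  consider "a < b" | "a = b" | "b < a" by linarith
  thus ?thesis
  proof cases
    case 1 thus ?thesis using *[of a b] assms by (simp add: abs_minus_commute max_def)
  next
    case 3 thus ?thesis using *[of b a] assms by (simp add: abs_minus_commute max_def)
  qed simp
qed

lemma norm_powr_diff_le:
  fixes A B :: "'b::real_normed_vector"
  assumes "1 < p" "norm A \<le> R" "norm B \<le> R"
  shows "\<bar>norm A powr p - norm B powr p\<bar> \<le> p * norm (A - B) * R powr (p - 1)"
proof -
  have "\<bar>norm A powr p - norm B powr p\<bar> \<le> p * \<bar>norm A - norm B\<bar> * max (norm A) (norm B) powr (p - 1)"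
    using assms by (intro powr_diff_le) auto
  also have "\<dots> \<le> p * norm (A - B) * R powr (p - 1)"
    using assms by (intro mult_mono powr_mono2 mult_nonneg_nonneg norm_triangle_ineq3) (auto simp: max_def)
  finally show ?thesis .
qed

lemma powr_strict_midpoint:
  assumes "0 \<le> a" "0 \<le> b" "a \<noteq> b" "1 < (p::real)"
  shows "2 * ((a + b) / 2) powr p < a powr p + b powr p"
proof -
  have *: "2 * ((a + b) / 2) powr p < a powr p + b powr p" if ab: "0 \<le> a" "a < b" for a b :: real
  proof -
    define m where "m = (a + b) / 2"
    have m: "a < m" "m < b" "m - a = b - m" using ab by (auto simp: m_def field_simps)
    obtain z where z: "a < z" "z < m" "m powr p - a powr p = (m - a) * (p * z powr (p - 1))"
      using powr_mvt[OF ab(1) m(1) assms(4)] .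
    obtain y where y: "m < y" "y < b" "b powr p - m powr p = (b - m) * (p * y powr (p - 1))"
      using powr_mvt[OF order_trans[OF ab(1) less_imp_le[OF m(1)]] m(2) assms(4)] .
    have "z powr (p - 1) < y powr (p - 1)" using z y ab assms by (intro powr_less_mono2) auto
    hence "(m - a) * (p * z powr (p - 1)) < (m - a) * (p * y powr (p - 1))"
      using m assms by (intro mult_strict_left_mono) auto
    thus ?thesis using z(3) y(3)[folded m(3)] unfolding m_def[symmetric] by linarith
  qed
  show ?thesis
  proof (cases "a < b")
    case True thus ?thesis using * assms by blast
  next
    case False thus ?thesis using *[of b a] assms by (simp add: add.commute)
  qed
qed

text \<open>The deficit in midpoint convexity of the p-th power of the norm. It gives a form of
  uniform convexity valid for every p > 1, without the distinction between p below and above 2 found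
  in Clarkson's inequalities.\<close>

definition gap :: "real \<Rightarrow> 'b::real_normed_vector \<Rightarrow> 'b \<Rightarrow> real" where
  "gap p A B = norm A powr p + norm B powr p - 2 * norm ((1/2) *\<^sub>R (A + B)) powr p"

lemma norm_midpoint_le: "norm ((1/2) *\<^sub>R (A + B)) \<le> (norm A + norm B) / 2"
  using norm_triangle_ineq[of A B] by simp

lemma gap_nonneg:
  assumes "1 < p" shows "0 \<le> gap p A B"
proof -
  have "norm ((1/2) *\<^sub>R (A + B)) powr p \<le> ((norm A + norm B) / 2) powr p"
    using assms by (intro powr_mono2 norm_midpoint_le) auto
  moreover have "2 * ((norm A + norm B) / 2) powr p \<le> norm A powr p + norm B powr p"
    using powr_strict_midpoint[of "norm A" "norm B" p] assms by (cases "norm A = norm B") auto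
  ultimately show ?thesis by (simp add: gap_def)
qed

text \<open>Strictness has two sources: for different norms the strict convexity of t^p, for equal
  norms the equality case of the triangle inequality in an inner product space.\<close>

lemma gap_pos:
  fixes A B :: "'b::real_inner"
  assumes "1 < p" "A \<noteq> B" shows "0 < gap p A B"
proof (cases "norm A = norm B")
  case False
  have "norm ((1/2) *\<^sub>R (A + B)) powr p \<le> ((norm A + norm B) / 2) powr p"
    using assms by (intro powr_mono2 norm_midpoint_le) auto
  moreover have "2 * ((norm A + norm B) / 2) powr p < norm A powr p + norm B powr p"
    using powr_strict_midpoint[of "norm A" "norm B" p] assms False by auto
  ultimately show ?thesis by (simp add: gap_def)
next
  case True
  have "norm (A + B) \<noteq> norm A + norm B"
  proof
    assume "norm (A + B) = norm A + norm B"
    hence "norm A *\<^sub>R B = norm B *\<^sub>R A" using norm_triangle_eq by metis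
    hence "norm A = 0 \<or> A = B" using True by (metis real_vector.scale_left_imp_eq)
    thus False using assms True by auto
  qed
  hence "norm (A + B) < norm A + norm B" using norm_triangle_ineq[of A B] by linarith
  hence "norm ((1/2) *\<^sub>R (A + B)) < norm A" using True by simp
  hence "norm ((1/2) *\<^sub>R (A + B)) powr p < norm A powr p" using assms by (intro powr_less_mono2) auto
  thus ?thesis using True by (simp add: gap_def)
qed

lemma continuous_norm_powr:
  assumes "continuous_on S f" "0 < (p::real)"
  shows "continuous_on S (\<lambda>x. norm (f x) powr p)"
  using assms by (intro continuous_on_powr' continuous_intros) auto

lemma gap_scale: "0 \<le> t \<Longrightarrow> gap p (t *\<^sub>R A) (t *\<^sub>R B) = t powr p * gap p A B"
proof -
  assume t: "0 \<le> t"
  have "(1/2) *\<^sub>R (t *\<^sub>R A + t *\<^sub>R B) = t *\<^sub>R ((1/2) *\<^sub>R (A + B))" by (simp add: scaleR_add_right)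
  thus ?thesis using t by (simp only: gap_def norm_scaleR powr_mult abs_of_nonneg norm_ge_zero) (simp add: algebra_simps)
qed

text \<open>By homogeneity it suffices to argue on the compact unit sphere.\<close>

lemma norm_diff_powr_le_gap:
  fixes p \<eta> :: real
  assumes p: "1 < p" and \<eta>: "0 < \<eta>"
  obtains C where "0 \<le> C"
    "\<And>A B::'b::euclidean_space. norm (A - B) powr p \<le> \<eta> * (norm A powr p + norm B powr p) + C * gap p A B"
proof -
  define N where "N = (\<lambda>z::'b\<times>'b. norm (fst z) powr p + norm (snd z) powr p)"
  define d where "d = (\<lambda>z::'b\<times>'b. norm (fst z - snd z) powr p)"
  define g where "g = (\<lambda>z::'b\<times>'b. gap p (fst z) (snd z))"
  \<comment> \<open>Off \<open>S\<close> the term \<eta> alone suffices. On \<open>S\<close> the two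
    vectors differ, so the gap is positive there and by compactness has a positive minimum.\<close>
  define S where "S = {z. N z = 1 \<and> \<eta> \<le> d z}"
  have cN: "continuous_on UNIV N" unfolding N_def using p by (intro continuous_intros continuous_norm_powr) auto
  have cd: "continuous_on UNIV d" unfolding d_def using p by (intro continuous_intros continuous_norm_powr) auto
  have cg: "continuous_on UNIV g" unfolding g_def gap_def using p by (intro continuous_intros continuous_norm_powr) auto
  have bd: "norm z \<le> 2" if "N z = 1" for z
  proof -
    have "norm (fst z) powr p \<le> 1" "norm (snd z) powr p \<le> 1"
      using that by (auto simp: N_def) (smt (verit) powr_ge_zero)+
    hence "norm (fst z) \<le> 1" "norm (snd z) \<le> 1"
      using p powr_le_cancel_iff by (smt (verit) powr_less_mono2 norm_ge_zero powr_one_eq_one)+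
    thus ?thesis using norm_Pair_le[of "fst z" "snd z"] by simp
  qed
  have "closed S"
  proof -
    have "S = N -` {1} \<inter> d -` {\<eta>..}" by (auto simp: S_def)
    moreover have "closed (N -` {1})" using cN by (intro closed_vimage) auto
    moreover have "closed (d -` {\<eta>..})" using cd by (intro closed_vimage) auto
    ultimately show ?thesis by auto
  qed
  moreover have "bounded S" unfolding bounded_iff S_def using bd by blast
  ultimately have cS: "compact S" by (simp add: compact_eq_bounded_closed)
  have gp: "0 < g z" if "z \<in> S" for z
  proof -
    have "fst z \<noteq> snd z" using that \<eta> p by (auto simp: S_def d_def)
    thus ?thesis using gap_pos[OF p] by (simp add: g_def)
  qed
  have "\<exists>c>0. \<forall>z\<in>S. c \<le> g z"
  proof (cases "S = {}")
    case False
    then obtain z where "z \<in> S" "\<forall>y\<in>S. g z \<le> g y"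
      using continuous_attains_inf[OF cS _ continuous_on_subset[OF cg]] by blast
    thus ?thesis using gp by blast
  qed (auto intro: exI[of _ 1])
  then obtain c where c: "0 < c" "\<And>z. z \<in> S \<Longrightarrow> c \<le> g z" by blast
  \<comment> \<open>On the sphere N = 1 both norms are at most 1, hence d \<le> 2^p, while the gap
    is at least \<open>c\<close> on \<open>S\<close>.\<close>
  define C where "C = 2 powr p / c"
  have C: "0 \<le> C" using c by (simp add: C_def)
  have unit: "d z \<le> \<eta> + C * g z" if "N z = 1" for z
  proof (cases "\<eta> \<le> d z")
    case True
    have "d z \<le> 2 powr p" unfolding d_def
    proof (rule powr_mono2)
      have "norm (fst z) powr p \<le> 1" "norm (snd z) powr p \<le> 1"
        using that by (auto simp: N_def) (smt (verit) powr_ge_zero)+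
      hence "norm (fst z) \<le> 1" "norm (snd z) \<le> 1"
        using p by (smt (verit) powr_less_mono2 norm_ge_zero powr_one_eq_one)+
      thus "norm (fst z - snd z) \<le> 2" using norm_triangle_ineq4[of "fst z" "snd z"] by linarith
    qed (use p in auto)
    also have "\<dots> = C * c" using c by (simp add: C_def)
    also have "\<dots> \<le> C * g z" using C c(2)[of z] that True by (intro mult_left_mono) (auto simp: S_def)
    finally show ?thesis using \<eta> by linarith
  next
    case False thus ?thesis using mult_nonneg_nonneg[OF C gap_nonneg[OF p, of "fst z" "snd z"]] by (simp add: g_def)
  qed
  show ?thesis
  proof (rule that[OF C])
    fix A B :: 'b
    define n where "n = norm A powr p + norm B powr p"
    show "norm (A - B) powr p \<le> \<eta> * (norm A powr p + norm B powr p) + C * gap p A B"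
    proof (cases "n = 0")
      case True
      hence "norm A powr p = 0" "norm B powr p = 0" unfolding n_def by (smt (verit) powr_ge_zero)+
      thus ?thesis using C gap_nonneg[OF p] p by (auto simp: gap_def)
    next
      case False
      hence n: "0 < n" unfolding n_def by (smt (verit) powr_ge_zero)
      \<comment> \<open>All three terms are homogeneous of degree p, so dividing both vectors by t
        leads to the case N = 1.\<close>
      define t where "t = n powr (1 / p)"
      have t: "0 < t" "t powr p = n" using n p by (auto simp: t_def powr_powr)
      define A' where "A' = (1/t) *\<^sub>R A"
      define B' where "B' = (1/t) *\<^sub>R B"
      have AB: "A = t *\<^sub>R A'" "B = t *\<^sub>R B'" using t by (auto simp: A'_def B'_def)
      have "n = n * (norm A' powr p + norm B' powr p)"
        using t by (subst (1) n_def, subst (1) AB(1), subst (1) AB(2)) (simp add: powr_mult distrib_left)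
      hence "N (A', B') = 1" using n by (simp add: N_def)
      from unit[OF this] have u: "norm (A' - B') powr p \<le> \<eta> + C * gap p A' B'" by (simp add: d_def g_def)
      have "norm (A - B) powr p = n * norm (A' - B') powr p"
        using t by (simp add: AB powr_mult flip: scaleR_diff_right)
      also have "\<dots> \<le> n * (\<eta> + C * gap p A' B')" using u n by (intro mult_left_mono) auto
      also have "\<dots> = \<eta> * n + C * gap p A B" using t by (simp add: AB gap_scale algebra_simps)
      finally show ?thesis by (simp add: n_def)
    qed
  qed
qed

lemma norm_powr_convex:
  fixes A B :: "'b::real_normed_vector"
  assumes p: "1 < p" and s: "0 \<le> s" "s \<le> 1"
  shows "norm ((1 - s) *\<^sub>R A + s *\<^sub>R B) powr p \<le> (1 - s) * norm A powr p + s * norm B powr p"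
proof -
  have *: "((1 - s) * a + s * b) powr p \<le> (1 - s) * a powr p + s * b powr p" if "0 \<le> a" "0 \<le> b" for a b
  proof (cases "a = 0 \<or> b = 0")
    \<comment> \<open>If a or b vanishes, the claim becomes s^p \<le> s for s in [0, 1], or the same
      with 1 - s.\<close>
    case True
    have le: "t powr p \<le> t" if "0 \<le> t" "t \<le> 1" for t :: real
      using that p powr_mono'[of 1 p t] by (cases "t = 0") auto
    have "(s * b) powr p \<le> s * b powr p" using le[of s] s that by (simp add: powr_mult mult_right_mono)
    moreover have "((1 - s) * a) powr p \<le> (1 - s) * a powr p" using le[of "1 - s"] s that by (simp add: powr_mult mult_right_mono)
    ultimately show ?thesis using True p by auto
  next
    case False
    thus ?thesis using convex_onD[OF powr_convex, of p s a b] p s that by auto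
  qed
  have "norm ((1 - s) *\<^sub>R A + s *\<^sub>R B) \<le> (1 - s) * norm A + s * norm B"
    using norm_triangle_ineq[of "(1 - s) *\<^sub>R A" "s *\<^sub>R B"] s by simp
  hence "norm ((1 - s) *\<^sub>R A + s *\<^sub>R B) powr p \<le> ((1 - s) * norm A + s * norm B) powr p"
    using p by (intro powr_mono2) auto
  also have "\<dots> \<le> (1 - s) * norm A powr p + s * norm B powr p" by (intro *) auto
  finally show ?thesis .
qed

text \<open>On a ball of radius R the two p-th powers are bounded, so the error term of the
  homogeneous inequality can be absorbed. The truncated distance on the left is the one that
  describes convergence in measure.\<close>

lemma min_norm_diff_le_gap:
  assumes p: "1 < (p::real)" and "0 < \<eta>" "0 < R"
  obtains C where "0 \<le> C"
    "\<And>A B::'b::euclidean_space. norm A \<le> R \<Longrightarrow> norm B \<le> R \<Longrightarrow> min 1 (norm (A - B)) \<le> \<eta> + C * gap p A B"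
proof -
  \<comment> \<open>With this choice e (R^p + R^p) = \<eta>^p / 2, half of the lower bound for |A -
    B|^p when |A - B| > \<eta>.\<close>
  define e where "e = \<eta> powr p / (4 * R powr p)"
  have e: "0 < e" using assms by (simp add: e_def)
  obtain C where C: "0 \<le> C" and
    le: "\<And>A B::'b::euclidean_space. norm (A - B) powr p \<le> e * (norm A powr p + norm B powr p) + C * gap p A B"
    using norm_diff_powr_le_gap[OF p e] by blast
  show ?thesis
  proof (rule that[of "2 * C / \<eta> powr p"])
    show "0 \<le> 2 * C / \<eta> powr p" using C by simp
    fix A B :: 'b assume A: "norm A \<le> R" and B: "norm B \<le> R"
    have g: "0 \<le> gap p A B" using gap_nonneg[OF p] .
    show "min 1 (norm (A - B)) \<le> \<eta> + 2 * C / \<eta> powr p * gap p A B"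
    proof (cases "norm (A - B) \<le> \<eta>")
      case True
      have "0 \<le> 2 * C / \<eta> powr p * gap p A B" using C g by simp
      thus ?thesis using True by linarith
    next
      case False
      have "\<eta> powr p \<le> norm (A - B) powr p" using False assms by (intro powr_mono2) auto
      also have "\<dots> \<le> e * (norm A powr p + norm B powr p) + C * gap p A B" by (rule le)
      also have "\<dots> \<le> e * (R powr p + R powr p) + C * gap p A B"
        using A B e p by (intro add_mono mult_left_mono powr_mono2 order_refl) auto
      also have "\<dots> = \<eta> powr p / 2 + C * gap p A B" using assms by (simp add: e_def)
      finally have "\<eta> powr p \<le> 2 * C * gap p A B" by simp
      hence "1 \<le> 2 * C / \<eta> powr p * gap p A B" using assms by (simp add: field_simps)
      thus ?thesis using assms by linarith
    qed
  qed
qed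

text \<open>The formula includes A = 0: there the difference quotient is of order |h|^(p-1), which
  tends to 0 since p > 1, and the right-hand side is 0 even for p < 2 because
  \<open>0 powr (p - 2) = 0\<close>.\<close>

lemma norm_powr_has_derivative:
  fixes A B :: "'b::real_inner"
  assumes p: "1 < p"
  shows "((\<lambda>t. norm (A + t *\<^sub>R B) powr p) has_real_derivative p * (norm A powr (p - 2) * (A \<bullet> B))) (at 0)"
proof (cases "A = 0")
  case True
  have lim: "((\<lambda>h::real. norm B powr p * \<bar>h\<bar> powr (p - 1)) \<longlongrightarrow> norm B powr p * 0) (at 0)"
  proof -
    have "((\<lambda>h::real. \<bar>h\<bar> powr (p - 1)) \<longlongrightarrow> \<bar>0\<bar> powr (p - 1)) (at 0)"
      using p by (intro tendsto_powr' tendsto_intros) auto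
    thus ?thesis using p by (intro tendsto_intros) auto
  qed
  have "norm ((norm (h *\<^sub>R B) powr p) / h) \<le> norm B powr p * \<bar>h\<bar> powr (p - 1)" for h :: real
  proof (cases "h = 0")
    case False
    thus ?thesis by (simp add: powr_mult powr_diff abs_mult mult.commute)
  qed simp
  hence "\<forall>\<^sub>F h in at 0. norm ((norm (h *\<^sub>R B) powr p) / h) \<le> norm B powr p * \<bar>h\<bar> powr (p - 1)"
    by (rule always_eventually[OF allI])
  hence "((\<lambda>h. norm (h *\<^sub>R B) powr p / h) \<longlongrightarrow> 0) (at 0)"
    by (rule Lim_null_comparison) (use lim in simp)
  thus ?thesis using True p by (simp add: DERIV_def)
next
  case False
  have 1: "((\<lambda>t. norm (A + t *\<^sub>R B)) has_real_derivative (A \<bullet> B) / norm A) (at 0)"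
  proof -
    have l: "((\<lambda>t. A + t *\<^sub>R B) has_derivative (\<lambda>h. h *\<^sub>R B)) (at 0)"
      by (auto intro!: derivative_eq_intros)
    have n: "(norm has_derivative (\<lambda>h. h \<bullet> sgn A)) (at (A + 0 *\<^sub>R B))"
      using has_derivative_norm[OF False] by simp
    have "((\<lambda>t. norm (A + t *\<^sub>R B)) has_derivative (\<lambda>h. (h *\<^sub>R B) \<bullet> sgn A)) (at 0)"
      by (rule has_derivative_compose[OF l n])
    moreover have "(\<lambda>h. (h *\<^sub>R B) \<bullet> sgn A) = (*) ((A \<bullet> B) / norm A)"
      by (auto simp: sgn_div_norm inner_commute divide_inverse mult_ac)
    ultimately show ?thesis by (simp add: has_field_derivative_def)
  qed
  have 2: "((\<lambda>x. x powr p) has_real_derivative p * norm A powr (p - 1)) (at (norm (A + 0 *\<^sub>R B)))"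
    using False by (auto intro!: derivative_eq_intros simp: powr_diff)
  have "((\<lambda>t. norm (A + t *\<^sub>R B) powr p) has_real_derivative p * norm A powr (p - 1) * ((A \<bullet> B) / norm A)) (at 0)"
    by (rule DERIV_chain2[OF 2 1])
  moreover have "norm A powr (p - 1) = norm A powr (p - 2) * norm A"
    using False powr_add[of "norm A" "p - 2" 1] by (simp add: algebra_simps)
  ultimately show ?thesis using False by (simp add: mult_ac)
qed

section \<open>Convergence of integrals\<close>

text \<open>Vitali's theorem, with uniform integrability expressed as domination by an integrable
  function up to a small multiple of an L^1-bounded sequence. Integrability of the limit follows
  from Fatou's lemma and the domination with e = 1.\<close>

lemma vitali_convergence:
  fixes h :: "nat \<Rightarrow> 'a \<Rightarrow> real"
  assumes h: "\<And>i. h i \<in> borel_measurable M" and h0: "h0 \<in> borel_measurable M"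
    and lim: "AE x in M. (\<lambda>i. h i x) \<longlonglongrightarrow> h0 x"
    and k: "\<And>i. integrable M (k i)" "\<And>i. AE x in M. 0 \<le> k i x" "\<And>i. integral\<^sup>L M (k i) \<le> C"
    and dom: "\<And>e. 0 < e \<Longrightarrow> \<exists>g. integrable M g \<and> (\<forall>i. AE x in M. \<bar>h i x\<bar> \<le> g x + e * k i x)"
  shows "integrable M h0" "(\<lambda>i. integral\<^sup>L M (h i)) \<longlonglongrightarrow> integral\<^sup>L M h0" "\<And>i. integrable M (h i)"
proof -
  obtain g1 where g1: "integrable M g1" "\<And>i. AE x in M. \<bar>h i x\<bar> \<le> g1 x + 1 * k i x"
    using dom[of 1] by auto
  show ih: "integrable M (h i)" for i
    by (rule Bochner_Integration.integrable_bound[of M "\<lambda>x. g1 x + k i x"])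
       (use g1(1) k(1) h g1(2)[of i] in \<open>auto elim!: eventually_mono\<close>)
  have bnd: "(\<integral>\<^sup>+x. ennreal \<bar>h i x\<bar> \<partial>M) \<le> ennreal (integral\<^sup>L M g1 + C)" for i
  proof -
    have "(\<integral>\<^sup>+x. ennreal \<bar>h i x\<bar> \<partial>M) = ennreal (\<integral>x. \<bar>h i x\<bar> \<partial>M)"
      using ih by (intro nn_integral_eq_integral) auto
    also have "(\<integral>x. \<bar>h i x\<bar> \<partial>M) \<le> (\<integral>x. g1 x + k i x \<partial>M)"
      using ih g1 k by (intro integral_mono_AE) auto
    also have "\<dots> \<le> integral\<^sup>L M g1 + C" using g1 k by simp
    finally show ?thesis by (simp add: ennreal_leI)
  qed
  have "(\<integral>\<^sup>+x. ennreal \<bar>h0 x\<bar> \<partial>M) \<le> (\<integral>\<^sup>+x. liminf (\<lambda>i. ennreal \<bar>h i x\<bar>) \<partial>M)"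
  proof (rule nn_integral_mono_AE)
    show "AE x in M. ennreal \<bar>h0 x\<bar> \<le> liminf (\<lambda>i. ennreal \<bar>h i x\<bar>)"
      using lim
    proof eventually_elim
      case (elim x)
      have "(\<lambda>i. ennreal \<bar>h i x\<bar>) \<longlonglongrightarrow> ennreal \<bar>h0 x\<bar>" using elim by (intro tendsto_ennrealI tendsto_rabs)
      hence "liminf (\<lambda>i. ennreal \<bar>h i x\<bar>) = ennreal \<bar>h0 x\<bar>" by (intro lim_imp_Liminf) auto
      thus ?case by simp
    qed
  qed
  also have "\<dots> \<le> liminf (\<lambda>i. \<integral>\<^sup>+x. ennreal \<bar>h i x\<bar> \<partial>M)"
    using h by (intro nn_integral_liminf) auto
  also have "\<dots> \<le> ennreal (integral\<^sup>L M g1 + C)"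
    by (intro Liminf_le) (auto intro!: always_eventually bnd)
  also have "\<dots> < \<infinity>" by simp
  finally show ih0: "integrable M h0" using h0 by (intro integrableI_bounded) auto
  have C0: "0 \<le> C"
    using k(3)[of 0] integral_nonneg_AE[OF k(2)[of 0]] by linarith
  show "(\<lambda>i. integral\<^sup>L M (h i)) \<longlonglongrightarrow> integral\<^sup>L M h0"
  proof (rule LIMSEQ_I)
    fix r :: real assume r: "0 < r"
    define e where "e = r / (2 * (C + 1))"
    have e: "0 < e" using r C0 by (simp add: e_def)
    obtain g where g: "integrable M g" "\<And>i. AE x in M. \<bar>h i x\<bar> \<le> g x + e * k i x"
      using dom[OF e] by auto
    \<comment> \<open>The sequence itself has no common majorant, but the part of |h_i - h0|
      exceeding e k_i is dominated by |g| + |h0|. Dominated convergence applies to it, and the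
      discarded part has integral at most e C.\<close>
    define d where "d i x = max 0 (\<bar>h i x - h0 x\<bar> - e * k i x)" for i x
    have kpos: "AE x in M. \<forall>i. 0 \<le> k i x" using k(2) by (simp add: AE_all_countable)
    have dl: "(\<lambda>i. integral\<^sup>L M (d i)) \<longlonglongrightarrow> integral\<^sup>L M (\<lambda>x. 0)"
    proof (rule integral_dominated_convergence[where w = "\<lambda>x. \<bar>g x\<bar> + \<bar>h0 x\<bar>"])
      show "AE x in M. (\<lambda>i. d i x) \<longlonglongrightarrow> 0"
        using lim kpos
      proof eventually_elim
        case (elim x)
        have "(\<lambda>i. \<bar>h i x - h0 x\<bar>) \<longlonglongrightarrow> 0" using elim(1) by (simp add: LIM_zero tendsto_rabs_zero)
        thus ?case
        proof (rule tendsto_sandwich[rotated 2, OF tendsto_const])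
          show "\<forall>\<^sub>F i in sequentially. 0 \<le> d i x" by (auto simp: d_def)
          show "\<forall>\<^sub>F i in sequentially. d i x \<le> \<bar>h i x - h0 x\<bar>"
            using elim(2) e by (auto simp: d_def)
        qed
      qed
      show "AE x in M. norm (d i x) \<le> \<bar>g x\<bar> + \<bar>h0 x\<bar>" for i
        using g(2)[of i] by eventually_elim (auto simp: d_def)
      show "d i \<in> borel_measurable M" for i using h h0 k(1)[of i] unfolding d_def by measurable
    qed (use g ih0 in auto)
    have di: "integrable M (d i)" for i unfolding d_def
      using ih ih0 k(1)[of i] by (intro integrable_max) auto
    from LIMSEQ_D[OF dl, of "r/2"] r obtain N where N: "\<And>i. i \<ge> N \<Longrightarrow> norm (integral\<^sup>L M (d i)) < r / 2" by auto
    show "\<exists>N. \<forall>i\<ge>N. norm (integral\<^sup>L M (h i) - integral\<^sup>L M h0) < r"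
    proof (intro exI allI impI)
      fix i assume i: "N \<le> i"
      have "norm (integral\<^sup>L M (h i) - integral\<^sup>L M h0) = norm (\<integral>x. h i x - h0 x \<partial>M)"
        using ih ih0 by simp
      also have "\<dots> \<le> (\<integral>x. \<bar>h i x - h0 x\<bar> \<partial>M)" using integral_norm_bound[of M "\<lambda>x. h i x - h0 x"] by simp
      also have "\<dots> \<le> (\<integral>x. d i x + e * k i x \<partial>M)"
        using ih ih0 di k(1) by (intro integral_mono) (auto simp: d_def)
      also have "\<dots> = integral\<^sup>L M (d i) + e * integral\<^sup>L M (k i)" using di k(1) by simp
      also have "\<dots> < r / 2 + e * C + e" using N[OF i] k(3)[of i] e
        by (smt (verit) mult_left_mono real_norm_def)
      also have "\<dots> = r"
      proof -
        have "e * C + e = e * (C + 1)" by (simp add: distrib_left)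
        also have "\<dots> = r / 2" using C0 unfolding e_def by (subst times_divide_eq_left, subst divide_eq_eq) (auto simp: algebra_simps)
        finally show ?thesis by simp
      qed
      finally show "norm (integral\<^sup>L M (h i) - integral\<^sup>L M h0) < r" .
    qed
  qed
qed

text \<open>The truncated L^1 distance with weight \<psi> n metrizes local convergence in measure.
  Along a subsequence with summable consecutive distances the increments are absolutely summable
  almost everywhere; the extraction is diagonal, so that one subsequence serves all weights.\<close>

lemma subsequence_AE_Cauchy:
  fixes F :: "nat \<Rightarrow> 'a \<Rightarrow> 'b::{banach, second_countable_topology}" and \<psi> :: "nat \<Rightarrow> 'a \<Rightarrow> real"
  assumes F: "\<And>i. F i \<in> borel_measurable M" and \<psi>: "\<And>n. \<psi> n \<in> borel_measurable M"
    and \<psi>0: "\<And>n x. 0 \<le> \<psi> n x"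
    and int: "\<And>n i j. integrable M (\<lambda>x. \<psi> n x * min 1 (norm (F i x - F j x)))"
    and Cau: "\<And>n e. 0 < e \<Longrightarrow> \<exists>N. \<forall>i\<ge>N. \<forall>j\<ge>N. (\<integral>x. \<psi> n x * min 1 (norm (F i x - F j x)) \<partial>M) < e"
  obtains k :: "nat \<Rightarrow> nat" where "strict_mono k" "AE x in M. (\<exists>n. 0 < \<psi> n x) \<longrightarrow> convergent (\<lambda>i. F (k i) x)"
proof -
  have "\<exists>N. \<forall>n\<le>m. \<forall>i\<ge>N. \<forall>j\<ge>N. (\<integral>x. \<psi> n x * min 1 (norm (F i x - F j x)) \<partial>M) < (1/2)^m" for m :: nat
  proof -
    have "\<forall>n. \<exists>N. \<forall>i\<ge>N. \<forall>j\<ge>N. (\<integral>x. \<psi> n x * min 1 (norm (F i x - F j x)) \<partial>M) < (1/2)^m"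
      using Cau by auto
    then obtain N where N: "\<And>n i j. N n \<le> i \<Longrightarrow> N n \<le> j \<Longrightarrow> (\<integral>x. \<psi> n x * min 1 (norm (F i x - F j x)) \<partial>M) < (1/2)^m"
      by metis
    have "N n \<le> (\<Sum>n\<le>m. N n)" if "n \<le> m" for n
      using that by (intro member_le_sum) auto
    thus ?thesis using N by (intro exI[of _ "\<Sum>n\<le>m. N n"]) (meson order_trans)
  qed
  then obtain N where N: "\<And>m n i j. n \<le> m \<Longrightarrow> N m \<le> i \<Longrightarrow> N m \<le> j \<Longrightarrow>
      (\<integral>x. \<psi> n x * min 1 (norm (F i x - F j x)) \<partial>M) < (1/2)^m" by metis
  \<comment> \<open>\<open>N m\<close> handles all weights n \<le> m with tolerance 2^(-m); the
    recursion keeps k strictly increasing and above \<open>N\<close>.\<close>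
  define k where "k = rec_nat (N 0) (\<lambda>m km. max (Suc km) (N (Suc m)))"
  have kS: "k (Suc m) = max (Suc (k m)) (N (Suc m))" for m by (simp add: k_def)
  have mono: "strict_mono k" unfolding strict_mono_Suc_iff by (simp add: kS less_max_iff_disj)
  have kN: "N m \<le> k m" for m by (cases m) (simp add: k_def, simp add: kS)
  \<comment> \<open>The shift by n starts the sum at the first step for which \<open>N\<close>
    covers the weight \<psi> n.\<close>
  have AEn: "AE x in M. summable (\<lambda>m. \<psi> n x * min 1 (norm (F (k (Suc (m + n))) x - F (k (m + n)) x)))" for n
  proof -
    define a where "a m x = \<psi> n x * min 1 (norm (F (k (Suc (m + n))) x - F (k (m + n)) x))" for m x
    have a0: "0 \<le> a m x" for m x using \<psi>0 by (simp add: a_def)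
    have am: "a m \<in> borel_measurable M" for m unfolding a_def using F \<psi> by measurable
    have le: "(\<integral>\<^sup>+x. ennreal (a m x) \<partial>M) \<le> ennreal ((1/2)^m)" for m
    proof -
      have "(\<integral>\<^sup>+x. ennreal (a m x) \<partial>M) = ennreal (\<integral>x. a m x \<partial>M)"
        using int a0 unfolding a_def by (intro nn_integral_eq_integral) auto
      also have "(\<integral>x. a m x \<partial>M) \<le> (1/2)^(m + n)"
        unfolding a_def using N[of n "m + n" "k (Suc (m + n))" "k (m + n)"] kN[of "m + n"] strict_monoD[OF mono, of "m + n" "Suc (m + n)"]
        by simp
      also have "(1/2::real)^(m + n) \<le> (1/2)^m" by (intro power_decreasing) auto
      finally show ?thesis by (simp add: ennreal_leI)
    qed
    have "(\<integral>\<^sup>+x. (\<Sum>m. ennreal (a m x)) \<partial>M) = (\<Sum>m. \<integral>\<^sup>+x. ennreal (a m x) \<partial>M)"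
      using am by (intro nn_integral_suminf) auto
    also have "\<dots> \<le> (\<Sum>m. ennreal ((1/2)^m))" by (intro suminf_le le) auto
    also have "\<dots> = ennreal (\<Sum>m. (1/2)^m)" by (intro suminf_ennreal2) (auto simp: summable_geometric)
    finally have "(\<integral>\<^sup>+x. (\<Sum>m. ennreal (a m x)) \<partial>M) \<noteq> \<infinity>" by (auto simp: top_unique)
    hence "AE x in M. (\<Sum>m. ennreal (a m x)) \<noteq> \<infinity>" using am by (intro nn_integral_PInf_AE) auto
    thus ?thesis unfolding a_def[symmetric]
      by eventually_elim (auto intro!: summable_suminf_not_top a0)
  qed
  have "AE x in M. \<forall>n. summable (\<lambda>m. \<psi> n x * min 1 (norm (F (k (Suc (m + n))) x - F (k (m + n)) x)))"
    using AEn by (simp add: AE_all_countable)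
  hence "AE x in M. (\<exists>n. 0 < \<psi> n x) \<longrightarrow> convergent (\<lambda>i. F (k i) x)"
  proof eventually_elim
    case (elim x)
    show ?case
    proof
      assume "\<exists>n. 0 < \<psi> n x"
      then obtain n where n: "0 < \<psi> n x" by blast
      define d where "d m = norm (F (k (Suc (m + n))) x - F (k (m + n)) x)" for m
      have "summable (\<lambda>m. \<psi> n x * min 1 (d m))" using elim by (simp add: d_def)
      hence s: "summable (\<lambda>m. min 1 (d m))" using n by (simp add: summable_cmult_iff)
      hence "(\<lambda>m. min 1 (d m)) \<longlonglongrightarrow> 0" by (rule summable_LIMSEQ_zero)
      \<comment> \<open>Terms of a summable series fall below 1, from where on the truncation is
        inactive and the series of the true increments converges.\<close>
      hence "eventually (\<lambda>m. min 1 (d m) < 1) sequentially" by (auto dest: order_tendstoD(2)[where a = 1])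
      hence "eventually (\<lambda>m. norm (F (k (Suc (m + n))) x - F (k (m + n)) x) \<le> min 1 (d m)) sequentially"
        by eventually_elim (auto simp: d_def min_def split: if_splits)
      hence "summable (\<lambda>m. F (k (Suc (m + n))) x - F (k (m + n)) x)"
        by (rule summable_comparison_test_ev[OF _ s])
      hence "convergent (\<lambda>l. \<Sum>m<l. F (k (Suc m + n)) x - F (k (m + n)) x)"
        by (simp add: summable_iff_convergent)
      hence "convergent (\<lambda>l. F (k (l + n)) x - F (k n) x)"
        by (subst (asm) sum_lessThan_telescope[of "\<lambda>m. F (k (m + n)) x"]) simp
      hence "convergent (\<lambda>l. F (k (l + n)) x)"
        using convergent_add[OF _ convergent_const[of "F (k n) x"]] by fastforce
      thus "convergent (\<lambda>i. F (k i) x)" by (simp add: convergent_ignore_initial_segment[of "\<lambda>i. F (k i) x"])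
    qed
  qed
  thus ?thesis using that mono by blast
qed

section \<open>Test functions on the whole space\<close>

lemma test_funs_UNIV: "u \<in> test_funs \<Omega> \<Longrightarrow> u \<in> test_funs UNIV"
  by (auto simp: test_funs_def)

lemma integrable_lborel_compact_support:
  fixes g :: "'a::euclidean_space \<Rightarrow> 'b::{banach, second_countable_topology}"
  assumes "continuous_on UNIV g" "compact K" "\<And>x. x \<notin> K \<Longrightarrow> g x = 0"
  shows "integrable lborel g"
proof -
  have "integrable lborel (\<lambda>x. indicat_real K x *\<^sub>R g x)"
    using assms by (intro borel_integrable_compact) (auto intro: continuous_on_subset)
  moreover have "(\<lambda>x. indicat_real K x *\<^sub>R g x) = g" using assms(3) by (auto simp: indicator_def)
  ultimately show ?thesis by simp
qed

lemma compact_support_bounded: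
  fixes g :: "'a::topological_space \<Rightarrow> 'b::real_normed_vector"
  assumes "continuous_on K g" "compact K" "\<And>x. x \<notin> K \<Longrightarrow> g x = 0"
  obtains L where "0 < L" "\<And>x. norm (g x) \<le> L"
proof -
  have "bounded (g ` K)" using assms by (intro compact_imp_bounded compact_continuous_image)
  then obtain L where L: "0 < L" "\<And>x. x \<in> K \<Longrightarrow> norm (g x) \<le> L" unfolding bounded_pos by auto
  have "norm (g x) \<le> L" for x using L assms(3)[of x] by (cases "x \<in> K") auto
  thus ?thesis using that L by blast
qed

lemma test_fun_bounded:
  assumes "u \<in> test_funs \<Omega>"
  obtains L where "0 < L" "\<And>x. \<bar>u x\<bar> \<le> L" "\<And>x. norm (grad u x) \<le> L"
proof -
  obtain L1 where L1: "0 < L1" "\<And>x. norm (u x) \<le> L1"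
    using compact_support_bounded[of "supp u" u, OF smooth_continuous[OF test_funs_smooth[OF assms]] test_funs_compact[OF assms] test_fun_outside[where u = u]]
    by blast
  obtain L2 where L2: "0 < L2" "\<And>x. norm (grad u x) \<le> L2"
    using compact_support_bounded[of "supp u" "grad u", OF continuous_grad[OF test_funs_smooth[OF assms]] test_funs_compact[OF assms] grad_outside[where u = u]]
    by blast
  show ?thesis using that[of "max L1 L2"] L1 L2 by (auto simp: le_max_iff_disj)
qed

section \<open>Restriction to lines, translations and integration by parts\<close>

lemma line_DERIV:
  assumes "smooth_fun u"
  shows "((\<lambda>s. u (x + s *\<^sub>R z)) has_real_derivative grad u (x + s *\<^sub>R z) \<bullet> z) (at s)"
proof -
  have "((\<lambda>s. x + s *\<^sub>R z) has_derivative (\<lambda>h. h *\<^sub>R z)) (at s)" by (auto intro!: derivative_eq_intros)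
  from has_derivative_compose[OF this smooth_has_derivative[OF assms]]
  show ?thesis by (simp add: has_field_derivative_def mult_commute_abs)
qed

lemma smooth_lipschitz:
  assumes "smooth_fun u" "\<And>x. norm (grad u x) \<le> L"
  shows "\<bar>u (x + z) - u x\<bar> \<le> L * norm z"
proof -
  have "norm (u (x + 1 *\<^sub>R z) - u (x + 0 *\<^sub>R z)) \<le> (L * norm z) * norm (1 - 0 :: real)"
  proof (rule field_differentiable_bound[of UNIV "\<lambda>s. u (x + s *\<^sub>R z)" "\<lambda>s. grad u (x + s *\<^sub>R z) \<bullet> z"])
    show "((\<lambda>s. u (x + s *\<^sub>R z)) has_field_derivative grad u (x + s *\<^sub>R z) \<bullet> z) (at s within UNIV)" for s
      using line_DERIV[OF assms(1)] .
    show "norm (grad u (x + s *\<^sub>R z) \<bullet> z) \<le> L * norm z" for s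
      using Cauchy_Schwarz_ineq2[of "grad u (x + s *\<^sub>R z)" z] mult_right_mono[OF assms(2)[of "x + s *\<^sub>R z"], of "norm z"]
      by simp
  qed auto
  thus ?thesis by simp
qed

lemma integral_lborel_translate:
  fixes g :: "'a::euclidean_space \<Rightarrow> real"
  assumes "g \<in> borel_measurable borel"
  shows "(\<integral>x. g (x + z) \<partial>lborel) = (\<integral>x. g x \<partial>lborel)"
proof -
  have "(\<integral>x. g x \<partial>lborel) = (\<integral>x. g x \<partial>(distr lborel borel ((+) z)))" by (simp add: lborel_distr_plus)
  also have "\<dots> = (\<integral>x. g (z + x) \<partial>lborel)" using assms by (intro integral_distr) auto
  finally show ?thesis by (simp add: add.commute)
qed

lemma nn_integral_lborel_translate:
  fixes g :: "'a::euclidean_space \<Rightarrow> ennreal"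
  assumes "g \<in> borel_measurable borel"
  shows "(\<integral>\<^sup>+x. g (x + z) \<partial>lborel) = (\<integral>\<^sup>+x. g x \<partial>lborel)"
proof -
  have "(\<integral>\<^sup>+x. g x \<partial>lborel) = (\<integral>\<^sup>+x. g x \<partial>(distr lborel borel ((+) z)))" by (simp add: lborel_distr_plus)
  also have "\<dots> = (\<integral>\<^sup>+x. g (z + x) \<partial>lborel)" using assms by (intro nn_integral_distr) auto
  finally show ?thesis by (simp add: add.commute)
qed

text \<open>Difference quotients have integral 0 by translation invariance of Lebesgue measure, and
  they converge to the partial derivative under a common bound.\<close>

lemma integral_pderiv_along_0:
  assumes w: "w \<in> test_funs UNIV" and b: "b \<in> Basis"
  shows "(\<integral>x. pderiv_along b w x \<partial>lborel) = 0"
proof -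
  note sm = test_funs_smooth[OF w]
  obtain L where L: "0 < L" "\<And>x. \<bar>w x\<bar> \<le> L" "\<And>x. norm (grad w x) \<le> L" using test_fun_bounded[OF w] by blast
  obtain R where R: "0 < R" "\<And>x. x \<in> supp w \<Longrightarrow> norm x \<le> R"
    using compact_imp_bounded[OF test_funs_compact[OF w]] unfolding bounded_pos by auto
  define t where "t n = inverse (real (Suc n))" for n
  have t: "0 < t n" "t n \<le> 1" for n by (auto simp: t_def inverse_le_1_iff)
  have iw: "integrable lborel w"
    using integrable_lborel_compact_support[of w "supp w", OF smooth_continuous[OF sm] test_funs_compact[OF w] test_fun_outside[where u = w]] by simp
  have wb: "w \<in> borel_measurable borel" by (rule borel_measurable_continuous_onI[OF smooth_continuous[OF sm]])
  define d where "d n x = (w (x + t n *\<^sub>R b) - w x) / t n" for n x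
  have id: "integrable lborel (\<lambda>x. w (x + t n *\<^sub>R b))" for n
  proof (rule integrable_lborel_compact_support[of _ "(\<lambda>x. x - t n *\<^sub>R b) ` supp w"])
    show "continuous_on UNIV (\<lambda>x. w (x + t n *\<^sub>R b))"
      by (rule continuous_on_compose2[OF smooth_continuous[OF sm, of UNIV]]) (auto intro!: continuous_intros)
    show "compact ((\<lambda>x. x - t n *\<^sub>R b) ` supp w)"
      using test_funs_compact[OF w] by (intro compact_continuous_image continuous_intros)
    show "w (x + t n *\<^sub>R b) = 0" if "x \<notin> (\<lambda>x. x - t n *\<^sub>R b) ` supp w" for x
    proof (rule test_fun_outside[where u = w], rule notI)
      assume "x + t n *\<^sub>R b \<in> supp w"
      hence "x + t n *\<^sub>R b - t n *\<^sub>R b \<in> (\<lambda>x. x - t n *\<^sub>R b) ` supp w" by blast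
      thus False using that by simp
    qed
  qed
  have d0: "(\<integral>x. d n x \<partial>lborel) = 0" for n
    using iw id[of n] integral_lborel_translate[OF wb] by (simp add: d_def)
  have "(\<lambda>n. \<integral>x. d n x \<partial>lborel) \<longlonglongrightarrow> (\<integral>x. pderiv_along b w x \<partial>lborel)"
  \<comment> \<open>The steps are at most 1, so every quotient vanishes outside the ball of radius R
    + 1; inside, the Lipschitz constant L bounds it.\<close>
  proof (rule integral_dominated_convergence[where w = "\<lambda>x. indicat_real (cball 0 (R + 1)) x *\<^sub>R L"])
    show "pderiv_along b w \<in> borel_measurable lborel"
      using borel_measurable_continuous_onI[OF smooth_continuous[OF smooth_pderiv_along[OF sm b]]] by simp
    show "integrable lborel (\<lambda>x. indicat_real (cball (0::'a) (R + 1)) x *\<^sub>R L)"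
      by (rule borel_integrable_compact) (auto intro!: continuous_intros)
    show "d n \<in> borel_measurable lborel" for n unfolding d_def[abs_def] using wb by measurable
    show "AE x in lborel. (\<lambda>n. d n x) \<longlonglongrightarrow> pderiv_along b w x"
    proof (rule AE_I2)
      fix x
      have "((\<lambda>s. w (x + s *\<^sub>R b)) has_real_derivative grad w (x + 0 *\<^sub>R b) \<bullet> b) (at 0)" by (rule line_DERIV[OF sm])
      hence "((\<lambda>s. (w (x + s *\<^sub>R b) - w x) / s) \<longlongrightarrow> pderiv_along b w x) (at 0)"
        using b by (simp add: DERIV_def grad_inner_Basis)
      moreover have "filterlim t (at 0) sequentially"
      proof -
        have "t \<longlonglongrightarrow> 0" unfolding t_def[abs_def] by (rule LIMSEQ_inverse_real_of_nat)
        thus ?thesis unfolding filterlim_at using t(1) by (auto intro!: always_eventually simp: less_imp_neq[symmetric])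
      qed
      ultimately show "(\<lambda>n. d n x) \<longlonglongrightarrow> pderiv_along b w x" unfolding d_def by (rule filterlim_compose)
    qed
    show "AE x in lborel. norm (d n x) \<le> indicat_real (cball 0 (R + 1)) x *\<^sub>R L" for n
    proof (rule AE_I2)
      fix x
      show "norm (d n x) \<le> indicat_real (cball 0 (R + 1)) x *\<^sub>R L"
      proof (cases "norm x \<le> R + 1")
        case True
        have "\<bar>w (x + t n *\<^sub>R b) - w x\<bar> \<le> L * norm (t n *\<^sub>R b)" using smooth_lipschitz[OF sm L(3)] .
        also have "\<dots> = L * t n" using t[of n] b by simp
        finally show ?thesis using True t[of n] by (simp add: d_def field_simps)
      next
        case False
        have "norm (x + t n *\<^sub>R b) \<ge> norm x - norm (t n *\<^sub>R b)" using norm_triangle_ineq4[of "x + t n *\<^sub>R b" "t n *\<^sub>R b"] by simp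
        hence "norm (x + t n *\<^sub>R b) > R" using False t[of n] b by simp
        hence "w (x + t n *\<^sub>R b) = 0" "w x = 0" using R False by (force intro!: test_fun_outside[where u = w])+
        thus ?thesis using L(1) by (simp add: d_def)
      qed
    qed
  qed
  thus ?thesis unfolding d0 by (simp add: LIMSEQ_const_iff)
qed

lemma pderiv_along_mult:
  assumes "smooth_fun u" "smooth_fun v"
  shows "pderiv_along b (\<lambda>x. u x * v x) x = u x * pderiv_along b v x + pderiv_along b u x * v x"
  using pderiv_along_eq[OF has_derivative_mult[OF smooth_has_derivative[OF assms(1)] smooth_has_derivative[OF assms(2)]], of b x]
    pderiv_along_eq[OF smooth_has_derivative[OF assms(1)], of b x] pderiv_along_eq[OF smooth_has_derivative[OF assms(2)], of b x]
  by simp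

lemma integration_by_parts:
  assumes u: "smooth_fun u" and z: "\<zeta> \<in> test_funs UNIV" and b: "b \<in> Basis"
  shows "(\<integral>x. u x * pderiv_along b \<zeta> x \<partial>lborel) = - (\<integral>x. pderiv_along b u x * \<zeta> x \<partial>lborel)"
proof -
  note sz = test_funs_smooth[OF z]
  have t: "(\<lambda>x. u x * \<zeta> x) \<in> test_funs UNIV" using test_funs_mult[OF z u] by (simp add: mult.commute)
  have pz: "x \<notin> supp \<zeta> \<Longrightarrow> pderiv_along b \<zeta> x = 0" for x
    using grad_outside[of x \<zeta>] grad_inner_Basis[OF b, of \<zeta> x] by simp
  have i1: "integrable lborel (\<lambda>x. u x * pderiv_along b \<zeta> x)"
    by (rule integrable_lborel_compact_support[OF _ test_funs_compact[OF z]])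
       (auto intro!: continuous_on_mult smooth_continuous[OF u] smooth_continuous[OF smooth_pderiv_along[OF sz b]] simp: pz)
  have i2: "integrable lborel (\<lambda>x. pderiv_along b u x * \<zeta> x)"
    by (rule integrable_lborel_compact_support[OF _ test_funs_compact[OF z]])
       (auto intro!: continuous_on_mult smooth_continuous[OF sz] smooth_continuous[OF smooth_pderiv_along[OF u b]] simp: test_fun_outside)
  have "0 = (\<integral>x. pderiv_along b (\<lambda>x. u x * \<zeta> x) x \<partial>lborel)" using integral_pderiv_along_0[OF t b] by simp
  also have "\<dots> = (\<integral>x. u x * pderiv_along b \<zeta> x + pderiv_along b u x * \<zeta> x \<partial>lborel)"
    by (simp add: pderiv_along_mult[OF u sz])
  also have "\<dots> = (\<integral>x. u x * pderiv_along b \<zeta> x \<partial>lborel) + (\<integral>x. pderiv_along b u x * \<zeta> x \<partial>lborel)"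
    using i1 i2 by simp
  finally show ?thesis by simp
qed

text \<open>The fundamental theorem as an inequality between extended nonnegative integrals, so that
  Tonelli's theorem can be applied afterwards without integrability conditions.\<close>

lemma ftc_nn_bound:
  fixes \<phi> :: "real \<Rightarrow> real"
  assumes "\<And>s. (\<phi> has_real_derivative \<phi>' s) (at s)" "\<And>s. \<bar>\<phi>' s\<bar> \<le> h s" "continuous_on UNIV h" "a \<le> b"
  shows "ennreal \<bar>\<phi> b - \<phi> a\<bar> \<le> (\<integral>\<^sup>+s. ennreal (h s) * indicator {a..b} s \<partial>lborel)"
proof -
  have F: "(\<phi>' has_integral (\<phi> b - \<phi> a)) {a..b}"
    using assms(1,4) by (intro fundamental_theorem_of_calculus)
      (auto simp: has_real_derivative_iff_has_vector_derivative[symmetric] intro: has_field_derivative_at_within)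
  have H: "h integrable_on {a..b}" using assms(3) by (intro integrable_continuous_real) (auto intro: continuous_on_subset)
  have h0: "0 \<le> h s" for s using assms(2)[of s] by linarith
  have "\<bar>\<phi> b - \<phi> a\<bar> \<le> integral {a..b} h"
    using integral_norm_bound_integral[of \<phi>' "{a..b}" h] F H assms(2) by (auto simp: integral_unique has_integral_integrable)
  moreover have "(\<integral>\<^sup>+s. ennreal (h s) * indicator {a..b} s \<partial>lborel) = ennreal (integral {a..b} h)"
  proof -
    have "(\<integral>\<^sup>+s. ennreal (indicator {a..b} s * h s) \<partial>lborel) = ennreal (integral {a..b} h)"
    proof (rule nn_integral_has_integral_lborel)
      show "((\<lambda>s. indicator {a..b} s * h s) has_integral integral {a..b} h) UNIV"
      proof -
        have "(\<lambda>s. indicator {a..b} s * h s) = (\<lambda>s. if s \<in> {a..b} then h s else 0)" by (auto simp: indicator_def)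
        thus ?thesis using integrable_integral[OF H] has_integral_restrict_UNIV[of "{a..b}" h] by simp
      qed
    qed (use borel_measurable_continuous_onI[OF assms(3)] h0 in auto)
    moreover have "ennreal (indicator {a..b} s * h s) = ennreal (h s) * indicator {a..b} s" for s
      by (auto simp: indicator_def)
    ultimately show ?thesis by simp
  qed
  ultimately show ?thesis by (simp add: ennreal_leI)
qed

lemma abs_powr_DERIV:
  "1 < p \<Longrightarrow> ((\<lambda>x::real. \<bar>x\<bar> powr p) has_real_derivative p * (\<bar>x\<bar> powr (p - 2) * x)) (at x)"
  using norm_powr_has_derivative[of p x "1::real"] DERIV_shift[of "\<lambda>x. \<bar>x\<bar> powr p" "p * (\<bar>x\<bar> powr (p - 2) * x)" 0 x]
  by (simp add: add.commute)

lemma abs_powr_minus_2: "\<bar>\<bar>x\<bar> powr (p - 2) * x\<bar> = \<bar>x::real\<bar> powr (p - 1)"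
  using powr_add[of "\<bar>x\<bar>" "p - 2" 1] by (cases "x = 0") (auto simp: abs_mult)

section \<open>The grid inequality\<close>

text \<open>The conventions \<open>\<infinity>\<^sup>0 = 0\<^sup>0 = 1\<close> make the exponent laws hold for all nonnegative exponents.\<close>

definition epow :: "ennreal \<Rightarrow> real \<Rightarrow> ennreal" where
  "epow x a = (if a = 0 then 1 else if x = \<infinity> then \<infinity> else ennreal (enn2real x powr a))"

lemma epow_measurable [measurable]:
  assumes [measurable]: "f \<in> borel_measurable M"
  shows "(\<lambda>x. epow (f x) a) \<in> borel_measurable M"
proof (cases "a = 0")
  case False
  have [measurable]: "{x \<in> space M. f x = \<infinity>} \<in> sets M"
    using measurable_sets[OF assms, of "{\<infinity>}"] by (simp add: vimage_def Int_def conj_commute)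
  show ?thesis using False unfolding epow_def by simp
qed (simp add: epow_def)

lemma epow_0 [simp]: "epow x 0 = 1" by (simp add: epow_def)

lemma epow_1 [simp]: "epow x 1 = x" by (cases x) (auto simp: epow_def)

lemma epow_zero: "0 < a \<Longrightarrow> epow 0 a = 0" by (simp add: epow_def)

lemma epow_top: "0 < a \<Longrightarrow> epow top a = top" by (simp add: epow_def)

lemma epow_ennreal: "0 \<le> x \<Longrightarrow> 0 < a \<Longrightarrow> epow (ennreal x) a = ennreal (x powr a)"
  by (simp add: epow_def)

lemma epow_add: "0 \<le> a \<Longrightarrow> 0 \<le> b \<Longrightarrow> epow x (a + b) = epow x a * epow x b"
proof (cases "a = 0 \<or> b = 0")
  case False
  assume "0 \<le> a" "0 \<le> b"
  thus ?thesis using False by (auto simp: epow_def powr_add ennreal_mult ennreal_top_mult)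
qed auto

lemma epow_mono: "0 \<le> a \<Longrightarrow> x \<le> y \<Longrightarrow> epow x a \<le> epow y a"
proof (cases "a = 0 \<or> y = \<infinity>")
  case False
  assume *: "0 \<le> a" "x \<le> y"
  hence "x \<noteq> \<infinity>" using False top_unique by auto
  moreover have "enn2real x \<le> enn2real y" using * False by (intro enn2real_mono) (auto simp: less_top)
  ultimately show ?thesis using * False by (auto simp: epow_def intro!: ennreal_leI powr_mono2)
qed (auto simp: epow_def)

section \<open>Hoelder's inequality for finitely many factors\<close>

lemma weighted_arith_geo:
  fixes x \<alpha> :: "'i \<Rightarrow> real"
  assumes "finite J" "\<And>j. j \<in> J \<Longrightarrow> 0 < \<alpha> j" "(\<Sum>j\<in>J. \<alpha> j) = 1" "\<And>j. j \<in> J \<Longrightarrow> 0 \<le> x j"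
  shows "(\<Prod>j\<in>J. x j powr \<alpha> j) \<le> (\<Sum>j\<in>J. \<alpha> j * x j)"
proof (cases "\<exists>j\<in>J. x j = 0")
  case True
  hence "(\<Prod>j\<in>J. x j powr \<alpha> j) = 0" using assms by (intro prod_zero) auto
  also have "0 \<le> (\<Sum>j\<in>J. \<alpha> j * x j)" using assms by (intro sum_nonneg mult_nonneg_nonneg) (auto simp: less_imp_le)
  finally show ?thesis .
next
  case False
  hence pos: "\<And>j. j \<in> J \<Longrightarrow> 0 < x j" using assms(4) by (metis less_eq_real_def)
  have "(\<Prod>j\<in>J. x j powr \<alpha> j) = exp (\<Sum>j\<in>J. \<alpha> j *\<^sub>R ln (x j))"
    by (subst exp_sum[OF assms(1)], intro prod.cong) (auto simp: powr_def dest: pos)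
  also have "\<dots> \<le> (\<Sum>j\<in>J. \<alpha> j * exp (ln (x j)))"
  proof (rule convex_on_sum[OF assms(1) _ exp_convex assms(3)])
    show "J \<noteq> {}" using assms(3) by auto
  qed (use assms in \<open>auto simp: less_imp_le\<close>)
  also have "\<dots> = (\<Sum>j\<in>J. \<alpha> j * x j)" using pos by (intro sum.cong) auto
  finally show ?thesis .
qed

text \<open>When all integrals A j are positive and finite, the weighted arithmetic-geometric
  inequality is applied pointwise to g j / A j and integrated. If some A j is 0, the product
  vanishes almost everywhere.\<close>

lemma Holder_prod_pos:
  fixes g :: "'i \<Rightarrow> 'a \<Rightarrow> ennreal" and \<alpha> :: "'i \<Rightarrow> real"
  assumes J: "finite J" and \<alpha>: "\<And>j. j \<in> J \<Longrightarrow> 0 < \<alpha> j" "(\<Sum>j\<in>J. \<alpha> j) = 1"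
    and g: "\<And>j. j \<in> J \<Longrightarrow> g j \<in> borel_measurable M"
  shows "(\<integral>\<^sup>+x. (\<Prod>j\<in>J. epow (g j x) (\<alpha> j)) \<partial>M) \<le> (\<Prod>j\<in>J. epow (\<integral>\<^sup>+x. g j x \<partial>M) (\<alpha> j))"
proof -
  define A where "A j = (\<integral>\<^sup>+x. g j x \<partial>M)" for j
  consider "\<exists>j\<in>J. A j = 0" | "\<forall>j\<in>J. A j \<noteq> 0" "\<exists>j\<in>J. A j = \<infinity>" | "\<forall>j\<in>J. A j \<noteq> 0 \<and> A j \<noteq> \<infinity>" by blast
  thus ?thesis
  proof cases
    case 1
    then obtain j where j: "j \<in> J" "A j = 0" by blast
    hence "AE x in M. g j x = 0" using g by (simp add: A_def nn_integral_0_iff_AE)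
    hence "AE x in M. (\<Prod>j\<in>J. epow (g j x) (\<alpha> j)) = 0"
      by eventually_elim (use J j \<alpha> in \<open>auto intro!: prod_zero bexI[of _ j] simp: epow_zero\<close>)
    hence "(\<integral>\<^sup>+x. (\<Prod>j\<in>J. epow (g j x) (\<alpha> j)) \<partial>M) = (\<integral>\<^sup>+x. 0 \<partial>M)" by (intro nn_integral_cong_AE) auto
    thus ?thesis by simp
  next
    case 2
    then obtain j where j: "j \<in> J" "A j = \<infinity>" by blast
    \<comment> \<open>No factor is 0, hence a single infinite one makes the right-hand side
      infinite; with a zero factor the product would be 0.\<close>
    have "epow (A i) (\<alpha> i) \<noteq> 0" if "i \<in> J" for i
      using 2(1) that \<alpha>(1)[of i] by (auto simp: epow_def enn2real_eq_0_iff)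
    hence "(\<Prod>i\<in>J-{j}. epow (A i) (\<alpha> i)) \<noteq> 0" using J by simp
    hence "(\<Prod>j\<in>J. epow (A j) (\<alpha> j)) = \<infinity>"
      using j J \<alpha> by (subst prod.remove[of J j]) (auto simp: epow_top ennreal_top_mult)
    thus ?thesis by (simp add: A_def)
  next
    case 3
    define a where "a j = enn2real (A j)" for j
    have a: "0 < a j" "A j = ennreal (a j)" if "j \<in> J" for j
      using 3 that by (auto simp: a_def enn2real_positive_iff less_top zero_less_iff_neq_zero)
    have AEf: "AE x in M. \<forall>j\<in>J. g j x \<noteq> \<infinity>"
      using J g 3 by (intro AE_finite_allI nn_integral_PInf_AE) (auto simp: A_def)
    have "(\<integral>\<^sup>+x. (\<Prod>j\<in>J. epow (g j x) (\<alpha> j)) \<partial>M) \<le> (\<integral>\<^sup>+x. ennreal (\<Prod>j\<in>J. a j powr \<alpha> j) * (\<Sum>j\<in>J. ennreal (\<alpha> j / a j) * g j x) \<partial>M)"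
    proof (rule nn_integral_mono_AE)
      show "AE x in M. (\<Prod>j\<in>J. epow (g j x) (\<alpha> j)) \<le> ennreal (\<Prod>j\<in>J. a j powr \<alpha> j) * (\<Sum>j\<in>J. ennreal (\<alpha> j / a j) * g j x)"
        using AEf
      proof eventually_elim
        case (elim x)
        define y where "y j = enn2real (g j x)" for j
        have y: "0 \<le> y j" "g j x = ennreal (y j)" if "j \<in> J" for j
          using elim that by (auto simp: y_def less_top)
        have "(\<Prod>j\<in>J. epow (g j x) (\<alpha> j)) = (\<Prod>j\<in>J. ennreal (y j powr \<alpha> j))"
          using y \<alpha> by (intro prod.cong) (auto simp: epow_ennreal)
        also have "\<dots> = ennreal (\<Prod>j\<in>J. y j powr \<alpha> j)" by (intro prod_ennreal) auto
        also have "(\<Prod>j\<in>J. y j powr \<alpha> j) = (\<Prod>j\<in>J. a j powr \<alpha> j * (y j / a j) powr \<alpha> j)"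
          using y a by (intro prod.cong refl) (auto simp: powr_divide dest: a(1))
        also have "\<dots> = (\<Prod>j\<in>J. a j powr \<alpha> j) * (\<Prod>j\<in>J. (y j / a j) powr \<alpha> j)" by (rule prod.distrib)
        also have "\<dots> \<le> (\<Prod>j\<in>J. a j powr \<alpha> j) * (\<Sum>j\<in>J. \<alpha> j * (y j / a j))"
          using a y by (intro mult_left_mono weighted_arith_geo J \<alpha> prod_nonneg) (auto simp: less_imp_le)
        also have "ennreal ((\<Prod>j\<in>J. a j powr \<alpha> j) * (\<Sum>j\<in>J. \<alpha> j * (y j / a j)))
            = ennreal (\<Prod>j\<in>J. a j powr \<alpha> j) * ennreal (\<Sum>j\<in>J. \<alpha> j / a j * y j)"
          using a y \<alpha> by (subst ennreal_mult) (auto intro!: prod_nonneg sum_nonneg mult_nonneg_nonneg divide_nonneg_nonneg simp: less_imp_le)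
        also have "ennreal (\<Sum>j\<in>J. \<alpha> j / a j * y j) = (\<Sum>j\<in>J. ennreal (\<alpha> j / a j * y j))"
          using a y \<alpha> by (intro sum_ennreal[symmetric]) (auto intro!: mult_nonneg_nonneg divide_nonneg_nonneg simp: less_imp_le)
        also have "\<dots> = (\<Sum>j\<in>J. ennreal (\<alpha> j / a j) * g j x)"
          using a y \<alpha> by (intro sum.cong refl) (auto simp: ennreal_mult[symmetric] less_imp_le)
        finally show ?case by (simp add: ennreal_leI)
      qed
    qed
    also have "\<dots> = ennreal (\<Prod>j\<in>J. a j powr \<alpha> j) * (\<Sum>j\<in>J. ennreal (\<alpha> j / a j) * A j)"
      using g by (simp add: nn_integral_cmult nn_integral_sum A_def)
    also have "(\<Sum>j\<in>J. ennreal (\<alpha> j / a j) * A j) = (\<Sum>j\<in>J. ennreal (\<alpha> j))"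
      using a \<alpha> by (intro sum.cong refl) (simp add: ennreal_mult[symmetric] less_imp_le less_imp_neq[symmetric])
    also have "\<dots> = 1" using \<alpha> by (subst sum_ennreal) (auto simp: less_imp_le)
    also have "ennreal (\<Prod>j\<in>J. a j powr \<alpha> j) * 1 = (\<Prod>j\<in>J. epow (A j) (\<alpha> j))"
      using a \<alpha> by (simp add: prod_ennreal[symmetric] epow_ennreal less_imp_le)
    finally show ?thesis by (simp add: A_def)
  qed
qed

text \<open>Exponents equal to 0 contribute the factor 1 on both sides, by the convention for
  \<open>epow\<close>, and are dropped. The case is needed at the end of the grid induction, where
  the exponent of \<open>f\<close> itself becomes 0.\<close>

lemma Holder_prod:
  fixes g :: "'i \<Rightarrow> 'a \<Rightarrow> ennreal" and \<alpha> :: "'i \<Rightarrow> real"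
  assumes J: "finite J" and \<alpha>: "\<And>j. j \<in> J \<Longrightarrow> 0 \<le> \<alpha> j" "(\<Sum>j\<in>J. \<alpha> j) = 1"
    and g: "\<And>j. j \<in> J \<Longrightarrow> g j \<in> borel_measurable M"
  shows "(\<integral>\<^sup>+x. (\<Prod>j\<in>J. epow (g j x) (\<alpha> j)) \<partial>M) \<le> (\<Prod>j\<in>J. epow (\<integral>\<^sup>+x. g j x \<partial>M) (\<alpha> j))"
proof -
  let ?K = "{j\<in>J. 0 < \<alpha> j}"
  have r: "(\<Prod>j\<in>J. epow (h j) (\<alpha> j)) = (\<Prod>j\<in>?K. epow (h j) (\<alpha> j))" for h
    using J \<alpha>(1) by (intro prod.mono_neutral_right) (auto simp: less_le)
  have "(\<Sum>j\<in>?K. \<alpha> j) = (\<Sum>j\<in>J. \<alpha> j)"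
    using J \<alpha>(1) by (intro sum.mono_neutral_left) (auto simp: less_le)
  thus ?thesis unfolding r using J g \<alpha>(2) by (intro Holder_prod_pos) auto
qed

text \<open>The factor \<open>f\<close> with exponent 1 - (n - 1) p is what makes the induction on
  the number n of coordinates close: integrating out one coordinate produces the same expression
  with the same p for the integrated function. For p = 1 / (n - 1) this factor disappears and the
  inequality behind the Gagliardo-Nirenberg estimate remains.\<close>

lemma grid_lemma:
  fixes f :: "('i \<Rightarrow> real) \<Rightarrow> ennreal" and p :: real
  assumes "finite I" "0 \<le> p" "(real (card I) - 1) * p \<le> 1"
    "f \<in> borel_measurable (PiM I (\<lambda>_. lborel))"
  shows "(\<integral>\<^sup>+x. epow (f x) (1 - (real (card I) - 1) * p) * (\<Prod>j\<in>I. epow (\<integral>\<^sup>+s. f (x(j := s)) \<partial>lborel) p) \<partial>PiM I (\<lambda>_. lborel))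
     \<le> epow (\<integral>\<^sup>+x. f x \<partial>PiM I (\<lambda>_. lborel)) (1 + p)"
  using assms
proof (induction I arbitrary: f rule: finite_induct)
  case empty
  have "(\<integral>\<^sup>+x. h x \<partial>PiM {} (\<lambda>_. lborel)) = h (\<lambda>_. undefined)" for h :: "('i \<Rightarrow> real) \<Rightarrow> ennreal"
    by (simp add: PiM_empty nn_integral_count_space_finite)
  thus ?case by simp
next
  case (insert i I)
  interpret product_sigma_finite "\<lambda>_::'i. lborel :: real measure" ..
  note fI = insert.hyps(1) and iI = insert.hyps(2) and p0 = insert.prems(1)
  note [measurable] = insert.prems(3)
  have c: "real (card (insert i I)) = real (card I) + 1" using fI iI by simp
  have cp: "real (card I) * p \<le> 1" using insert.prems(2) c by simp
  have cp': "(real (card I) - 1) * p \<le> 1"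
    using cp p0 by (smt (verit) mult_right_mono)
  \<comment> \<open>The function of the remaining coordinates to which the induction hypothesis is
    applied.\<close>
  define g where "g x = (\<integral>\<^sup>+s. f (x(i := s)) \<partial>lborel)" for x
  have fm: "(\<lambda>(x, y). f (x(i := y))) \<in> borel_measurable (PiM I (\<lambda>_. lborel) \<Otimes>\<^sub>M lborel)"
    using measurable_compose[OF measurable_add_dim[of i I "\<lambda>_. lborel"] insert.prems(3)] by (simp add: case_prod_unfold comp_def)
  have gm [measurable]: "g \<in> borel_measurable (PiM I (\<lambda>_. lborel))"
    unfolding g_def by (rule lborel.borel_measurable_nn_integral) (use fm in \<open>simp add: case_prod_unfold\<close>)
  have f1 [measurable]: "(\<lambda>y. f (x(i := y))) \<in> borel_measurable lborel" if "x \<in> space (PiM I (\<lambda>_. lborel))" for x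
    using measurable_compose[OF measurable_Pair1'[OF that] fm] by simp
  have f2: "(\<lambda>(y, s). f (x(j := s, i := y))) \<in> borel_measurable (lborel \<Otimes>\<^sub>M lborel)"
    if x: "x \<in> space (PiM I (\<lambda>_. lborel))" and j: "j \<in> I" for x j
  proof -
    have "(\<lambda>z::real\<times>real. x(j := snd z)) \<in> measurable (lborel \<Otimes>\<^sub>M lborel) (PiM I (\<lambda>_. lborel))"
      by (rule measurable_fun_upd[of I I]) (use j x in auto)
    hence "(\<lambda>z::real\<times>real. (x(j := snd z), fst z)) \<in> measurable (lborel \<Otimes>\<^sub>M lborel) (PiM I (\<lambda>_. lborel) \<Otimes>\<^sub>M lborel)"
      by measurable
    from measurable_compose[OF this fm] show ?thesis by (simp add: case_prod_unfold)
  qed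
  have f2': "(\<lambda>y. \<integral>\<^sup>+s. f (x(i := y, j := s)) \<partial>lborel) \<in> borel_measurable lborel"
    if x: "x \<in> space (PiM I (\<lambda>_. lborel))" and j: "j \<in> I" for x j
  proof -
    have "(\<lambda>y. \<integral>\<^sup>+s. f (x(j := s, i := y)) \<partial>lborel) \<in> borel_measurable lborel"
      by (rule lborel.borel_measurable_nn_integral[OF f2[OF x j]])
    moreover have "x(i := y, j := s) = x(j := s, i := y)" for y s using j iI by (auto simp: fun_upd_twist)
    ultimately show ?thesis by simp
  qed
  have fub: "(\<integral>\<^sup>+y. \<integral>\<^sup>+s. f (x(i := y, j := s)) \<partial>lborel \<partial>lborel) = (\<integral>\<^sup>+s. g (x(j := s)) \<partial>lborel)"
    if x: "x \<in> space (PiM I (\<lambda>_. lborel))" and j: "j \<in> I" for x j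
  proof -
    have tw: "x(i := y, j := s) = x(j := s, i := y)" for y s using j iI by (auto simp: fun_upd_twist)
    show ?thesis unfolding tw g_def using lborel_pair.Fubini'[OF f2[OF x j]] by simp
  qed
  define H where "H x = epow (f x) (1 - real (card I) * p) * (\<Prod>j\<in>insert i I. epow (\<integral>\<^sup>+s. f (x(j := s)) \<partial>lborel) p)" for x
  have Hm: "H \<in> borel_measurable (PiM (insert i I) (\<lambda>_. lborel))"
  proof -
    have "(\<lambda>x. \<integral>\<^sup>+s. f (x(j := s)) \<partial>lborel) \<in> borel_measurable (PiM (insert i I) (\<lambda>_. lborel))" if "j \<in> insert i I" for j
    proof (rule lborel.borel_measurable_nn_integral)
      have "(\<lambda>z. (fst z)(j := snd z)) \<in> measurable (PiM (insert i I) (\<lambda>_. lborel) \<Otimes>\<^sub>M lborel) (PiM (insert i I) (\<lambda>_. lborel))"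
        by (rule measurable_fun_upd[of "insert i I" "insert i I"]) (use that in auto)
      from measurable_compose[OF this insert.prems(3)]
      show "(\<lambda>(x, s). f (x(j := s))) \<in> borel_measurable (PiM (insert i I) (\<lambda>_. lborel) \<Otimes>\<^sub>M lborel)"
        by (simp add: case_prod_unfold fun_upd_def)
    qed
    thus ?thesis unfolding H_def by measurable
  qed
  have inner: "(\<integral>\<^sup>+y. H (x(i := y)) \<partial>lborel) \<le> epow (g x) (1 - (real (card I) - 1) * p) * (\<Prod>j\<in>I. epow (\<integral>\<^sup>+s. g (x(j := s)) \<partial>lborel) p)"
    if x: "x \<in> space (PiM I (\<lambda>_. lborel))" for x
  proof -
    note f1x = f1[OF x]
    \<comment> \<open>Hoelder's inequality in y is used for \<open>f\<close> with exponent 1 - |I| p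
      and for the |I| line integrals in the other directions with exponent p each; these exponents
      add up to 1.\<close>
    define u where "u j y = (if j = i then f (x(i := y)) else \<integral>\<^sup>+s. f (x(i := y, j := s)) \<partial>lborel)" for j y
    define \<alpha> where "\<alpha> j = (if j = i then 1 - real (card I) * p else p)" for j
    have um: "u j \<in> borel_measurable lborel" if "j \<in> insert i I" for j
      using that f1x f2'[OF x] iI by (cases "j = i") (auto simp: u_def[abs_def])
    have s\<alpha>: "(\<Sum>j\<in>insert i I. \<alpha> j) = 1"
    proof -
      have "(\<Sum>j\<in>I. \<alpha> j) = (\<Sum>j\<in>I. p)" using iI by (intro sum.cong) (auto simp: \<alpha>_def)
      thus ?thesis using fI iI by (simp add: \<alpha>_def)
    qed
    \<comment> \<open>The line integral in direction i does not depend on y and comes out as a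
      constant. Its exponent p combines later with 1 - |I| p to the exponent required for
      \<open>g\<close>.\<close>
    have Hx: "H (x(i := y)) = epow (g x) p * (\<Prod>j\<in>insert i I. epow (u j y) (\<alpha> j))" for y
    proof -
      have "(\<Prod>j\<in>I. epow (\<integral>\<^sup>+s. f (x(i := y, j := s)) \<partial>lborel) p) = (\<Prod>j\<in>I. epow (u j y) (\<alpha> j))"
        using iI by (intro prod.cong) (auto simp: u_def \<alpha>_def)
      thus ?thesis using fI iI by (simp add: H_def g_def u_def \<alpha>_def mult_ac)
    qed
    have "(\<integral>\<^sup>+y. H (x(i := y)) \<partial>lborel) = epow (g x) p * (\<integral>\<^sup>+y. (\<Prod>j\<in>insert i I. epow (u j y) (\<alpha> j)) \<partial>lborel)"
      unfolding Hx using um by (intro nn_integral_cmult borel_measurable_prod_ennreal epow_measurable) auto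
    also have "\<dots> \<le> epow (g x) p * (\<Prod>j\<in>insert i I. epow (\<integral>\<^sup>+y. u j y \<partial>lborel) (\<alpha> j))"
      using fI um s\<alpha> cp p0 by (intro mult_left_mono Holder_prod) (auto simp: \<alpha>_def)
    also have "(\<Prod>j\<in>insert i I. epow (\<integral>\<^sup>+y. u j y \<partial>lborel) (\<alpha> j))
        = epow (g x) (1 - real (card I) * p) * (\<Prod>j\<in>I. epow (\<integral>\<^sup>+s. g (x(j := s)) \<partial>lborel) p)"
    proof -
      have "(\<Prod>j\<in>I. epow (\<integral>\<^sup>+y. u j y \<partial>lborel) (\<alpha> j)) = (\<Prod>j\<in>I. epow (\<integral>\<^sup>+s. g (x(j := s)) \<partial>lborel) p)"
        using iI fub[OF x] by (intro prod.cong) (auto simp: u_def \<alpha>_def)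
      thus ?thesis using fI iI by (simp add: u_def \<alpha>_def g_def)
    qed
    also have "epow (g x) p * (epow (g x) (1 - real (card I) * p) * (\<Prod>j\<in>I. epow (\<integral>\<^sup>+s. g (x(j := s)) \<partial>lborel) p))
       = epow (g x) (1 - (real (card I) - 1) * p) * (\<Prod>j\<in>I. epow (\<integral>\<^sup>+s. g (x(j := s)) \<partial>lborel) p)"
      using epow_add[OF p0, of "1 - real (card I) * p" "g x"] cp by (simp add: algebra_simps)
    finally show ?thesis .
  qed
  have "(\<integral>\<^sup>+x. H x \<partial>PiM (insert i I) (\<lambda>_. lborel)) = (\<integral>\<^sup>+x. (\<integral>\<^sup>+y. H (x(i := y)) \<partial>lborel) \<partial>PiM I (\<lambda>_. lborel))"
    by (rule product_nn_integral_insert[OF fI iI Hm])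
  also have "\<dots> \<le> (\<integral>\<^sup>+x. epow (g x) (1 - (real (card I) - 1) * p) * (\<Prod>j\<in>I. epow (\<integral>\<^sup>+s. g (x(j := s)) \<partial>lborel) p) \<partial>PiM I (\<lambda>_. lborel))"
    by (rule nn_integral_mono) (rule inner)
  also have "\<dots> \<le> epow (\<integral>\<^sup>+x. g x \<partial>PiM I (\<lambda>_. lborel)) (1 + p)" by (rule insert.IH[OF p0 cp' gm])
  also have "(\<integral>\<^sup>+x. g x \<partial>PiM I (\<lambda>_. lborel)) = (\<integral>\<^sup>+x. f x \<partial>PiM (insert i I) (\<lambda>_. lborel))"
    unfolding g_def by (rule product_nn_integral_insert[OF fI iI insert.prems(3), symmetric])
  finally show ?case by (simp only: H_def c add_diff_cancel_right')
qed

section \<open>Sobolev and Morrey bounds\<close>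

lemma nn_integral_lborel_scale:
  fixes g :: "'a::euclidean_space \<Rightarrow> ennreal"
  assumes [measurable]: "g \<in> borel_measurable borel" and c: "0 < c"
  shows "(\<integral>\<^sup>+z. g (x + c *\<^sub>R z) \<partial>lborel) = ennreal (c powr - real DIM('a)) * (\<integral>\<^sup>+z. g z \<partial>lborel)"
proof -
  have "(\<integral>\<^sup>+z. g z \<partial>lborel) = (\<integral>\<^sup>+z. g z \<partial>density (distr lborel borel (\<lambda>z. x + c *\<^sub>R z)) (\<lambda>_. \<bar>c\<bar>^DIM('a)))"
    using lborel_affine[of c x] c by simp
  also have "\<dots> = (\<integral>\<^sup>+z. ennreal (c ^ DIM('a)) * g (x + c *\<^sub>R z) \<partial>lborel)"
    using c by (subst nn_integral_density) (auto simp: nn_integral_distr)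
  also have "\<dots> = ennreal (c ^ DIM('a)) * (\<integral>\<^sup>+z. g (x + c *\<^sub>R z) \<partial>lborel)" by (rule nn_integral_cmult) measurable
  finally have e: "(\<integral>\<^sup>+z. g z \<partial>lborel) = ennreal (c ^ DIM('a)) * (\<integral>\<^sup>+z. g (x + c *\<^sub>R z) \<partial>lborel)" .
  have "ennreal (c powr - real DIM('a)) * ennreal (c ^ DIM('a)) = 1"
    using c by (simp add: ennreal_mult[symmetric] powr_minus powr_realpow)
  thus ?thesis unfolding e by (simp add: mult.assoc[symmetric])
qed

text \<open>The grid inequality for p = 1 / (N - 1), carried over from the product measure by the
  coordinate isomorphism \<open>T\<close>. For N = 1 this exponent would be undefined.\<close>

lemma grid_lborel:
  fixes f :: "'a::euclidean_space \<Rightarrow> ennreal"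
  assumes f [measurable]: "f \<in> borel_measurable borel" and N: "2 \<le> DIM('a)"
  defines "p \<equiv> 1 / (real DIM('a) - 1)"
  shows "(\<integral>\<^sup>+x. (\<Prod>b\<in>Basis. epow (\<integral>\<^sup>+s. f (x + s *\<^sub>R b) \<partial>lborel) p) \<partial>lborel) \<le> epow (\<integral>\<^sup>+x. f x \<partial>lborel) (1 + p)"
proof -
  define T where "T x = (\<Sum>b\<in>Basis. x b *\<^sub>R (b::'a))" for x
  have T [measurable]: "T \<in> measurable (PiM Basis (\<lambda>_. lborel)) borel" unfolding T_def by measurable
  have lb: "lborel = distr (PiM Basis (\<lambda>_. lborel)) borel T" unfolding T_def[abs_def] by (rule lborel_eq)
  have p0: "0 \<le> p" using N by (simp add: p_def)
  have p1: "(real (card (Basis::'a set)) - 1) * p = 1" using N by (simp add: p_def)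
  \<comment> \<open>Moving by s along b and setting the b-th coordinate to s differ only by a shift
    of s, which the integral over the whole line ignores.\<close>
  have line: "(\<integral>\<^sup>+s. f (T x + s *\<^sub>R b) \<partial>lborel) = (\<integral>\<^sup>+s. f (T (x(b := s))) \<partial>lborel)" if b: "b \<in> Basis" for x b
  proof -
    have "T (x(b := s)) = T x + (s + - x b) *\<^sub>R b" for s
    proof -
      have "(\<Sum>i\<in>Basis - {b}. (x(b := s)) i *\<^sub>R i) = (\<Sum>i\<in>Basis - {b}. x i *\<^sub>R i)" by (intro sum.cong) auto
      thus ?thesis using b by (simp add: T_def sum.remove[of Basis b] scaleR_left_diff_distrib)
    qed
    thus ?thesis using nn_integral_lborel_translate[of "\<lambda>s. f (T x + s *\<^sub>R b)" "- x b"] by simp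
  qed
  have m: "(\<lambda>x. \<Prod>b\<in>Basis. epow (\<integral>\<^sup>+s. f (x + s *\<^sub>R b) \<partial>lborel) p) \<in> borel_measurable borel"
  proof (intro borel_measurable_prod_ennreal epow_measurable lborel.borel_measurable_nn_integral)
    fix b :: 'a
    show "(\<lambda>(x, s). f (x + s *\<^sub>R b)) \<in> borel_measurable (borel \<Otimes>\<^sub>M lborel)" by measurable
  qed
  have "(\<integral>\<^sup>+x. (\<Prod>b\<in>Basis. epow (\<integral>\<^sup>+s. f (x + s *\<^sub>R b) \<partial>lborel) p) \<partial>lborel)
     = (\<integral>\<^sup>+x. (\<Prod>b\<in>Basis. epow (\<integral>\<^sup>+s. f (T x + s *\<^sub>R b) \<partial>lborel) p) \<partial>PiM Basis (\<lambda>_. lborel))"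
    by (subst lb, subst nn_integral_distr) (use m in auto)
  also have "\<dots> = (\<integral>\<^sup>+x. epow (f (T x)) (1 - (real (card (Basis::'a set)) - 1) * p) * (\<Prod>b\<in>Basis. epow (\<integral>\<^sup>+s. f (T (x(b := s))) \<partial>lborel) p) \<partial>PiM Basis (\<lambda>_. lborel))"
    unfolding p1 using line by (intro nn_integral_cong) simp
  also have "\<dots> \<le> epow (\<integral>\<^sup>+x. f (T x) \<partial>PiM Basis (\<lambda>_. lborel)) (1 + p)"
    by (rule grid_lemma[where f = "\<lambda>x. f (T x)"]) (use p0 p1 in \<open>auto\<close>)
  also have "(\<integral>\<^sup>+x. f (T x) \<partial>PiM Basis (\<lambda>_. lborel)) = (\<integral>\<^sup>+x. f x \<partial>distr (PiM Basis (\<lambda>_. lborel)) borel T)"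
    by (subst nn_integral_distr) auto
  also have "distr (PiM Basis (\<lambda>_. lborel)) borel T = lborel" by (rule lb[symmetric])
  finally show ?thesis .
qed

lemma test_fun_line_bound:
  fixes w :: "'a::euclidean_space \<Rightarrow> real"
  assumes w: "w \<in> test_funs UNIV" and g: "1 < \<gamma>" and b: "norm b = 1"
  shows "ennreal (\<bar>w x\<bar> powr \<gamma>) \<le> (\<integral>\<^sup>+s. ennreal (\<gamma> * (\<bar>w (x + s *\<^sub>R b)\<bar> powr (\<gamma> - 1) * norm (grad w (x + s *\<^sub>R b)))) \<partial>lborel)"
proof -
  note sm = test_funs_smooth[OF w]
  obtain R where R: "0 < R" "\<And>x. x \<in> supp w \<Longrightarrow> norm x \<le> R"
    using compact_imp_bounded[OF test_funs_compact[OF w]] unfolding bounded_pos by auto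
  \<comment> \<open>Far enough along the line for the point to lie outside the ball containing the
    support, so the boundary term vanishes.\<close>
  define a where "a = - (norm x + R + 1)"
  define \<phi> where "\<phi> s = \<bar>w (x + s *\<^sub>R b)\<bar> powr \<gamma>" for s
  define h where "h s = \<gamma> * (\<bar>w (x + s *\<^sub>R b)\<bar> powr (\<gamma> - 1) * norm (grad w (x + s *\<^sub>R b)))" for s
  have "norm (x + a *\<^sub>R b) \<ge> \<bar>a\<bar> - norm x"
    using norm_triangle_ineq4[of "x + a *\<^sub>R b" x] b by simp
  hence "R < norm (x + a *\<^sub>R b)" using R by (simp add: a_def)
  hence wa: "w (x + a *\<^sub>R b) = 0" using R by (force intro!: test_fun_outside[where u = w])
  have cl: "continuous_on UNIV (\<lambda>s. x + s *\<^sub>R b)" by (intro continuous_intros)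
  have "ennreal \<bar>\<phi> 0 - \<phi> a\<bar> \<le> (\<integral>\<^sup>+s. ennreal (h s) * indicator {a..0} s \<partial>lborel)"
  proof (rule ftc_nn_bound)
    fix s
    show "(\<phi> has_real_derivative \<gamma> * (\<bar>w (x + s *\<^sub>R b)\<bar> powr (\<gamma> - 2) * w (x + s *\<^sub>R b)) * (grad w (x + s *\<^sub>R b) \<bullet> b)) (at s)"
      unfolding \<phi>_def by (rule DERIV_chain2[OF abs_powr_DERIV[OF g] line_DERIV[OF sm]])
    have "\<bar>grad w (x + s *\<^sub>R b) \<bullet> b\<bar> \<le> norm (grad w (x + s *\<^sub>R b))"
      using Cauchy_Schwarz_ineq2[of "grad w (x + s *\<^sub>R b)" b] b by simp
    moreover have "\<bar>\<gamma> * (\<bar>w (x + s *\<^sub>R b)\<bar> powr (\<gamma> - 2) * w (x + s *\<^sub>R b)) * (grad w (x + s *\<^sub>R b) \<bullet> b)\<bar>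
       = \<gamma> * (\<bar>w (x + s *\<^sub>R b)\<bar> powr (\<gamma> - 1) * \<bar>grad w (x + s *\<^sub>R b) \<bullet> b\<bar>)"
      using g by (simp only: abs_mult[of _ "grad w (x + s *\<^sub>R b) \<bullet> b"] abs_mult[of \<gamma>] abs_powr_minus_2)
    ultimately show "\<bar>\<gamma> * (\<bar>w (x + s *\<^sub>R b)\<bar> powr (\<gamma> - 2) * w (x + s *\<^sub>R b)) * (grad w (x + s *\<^sub>R b) \<bullet> b)\<bar> \<le> h s"
      using g by (auto simp: h_def intro!: mult_left_mono)
  next
    have "continuous_on UNIV (\<lambda>s. w (x + s *\<^sub>R b))" "continuous_on UNIV (\<lambda>s. grad w (x + s *\<^sub>R b))"
      using continuous_on_compose2[OF smooth_continuous[OF sm, of UNIV] cl] continuous_on_compose2[OF continuous_grad[OF sm, of UNIV] cl] by auto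
    thus "continuous_on UNIV h" unfolding h_def
      using g continuous_norm_powr[of UNIV "\<lambda>s. w (x + s *\<^sub>R b)" "\<gamma> - 1"] by (auto intro!: continuous_intros)
    show "a \<le> 0" using R norm_ge_zero[of x] unfolding a_def by linarith
  qed
  also have "\<dots> \<le> (\<integral>\<^sup>+s. ennreal (h s) \<partial>lborel)" by (intro nn_integral_mono) (auto simp: indicator_def)
  finally show ?thesis using wa g by (simp add: \<phi>_def h_def)
qed

text \<open>|w|^\<gamma> at x is bounded by its line integral in each of the N directions; the
  product of these bounds, each to the power 1 / (N - 1), is what the grid inequality integrates.
  The power \<gamma> > 1 keeps |w|^\<gamma> differentiable and leaves a free parameter for general
  q.\<close>

lemma gagliardo_nirenberg_powr:
  fixes w :: "'a::euclidean_space \<Rightarrow> real"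
  assumes w: "w \<in> test_funs UNIV" and g: "1 < \<gamma>" and N: "2 \<le> DIM('a)"
  defines "k \<equiv> real DIM('a) / (real DIM('a) - 1)"
  shows "(\<integral>\<^sup>+x. ennreal (\<bar>w x\<bar> powr (\<gamma> * k)) \<partial>lborel)
      \<le> epow (\<integral>\<^sup>+x. ennreal (\<gamma> * (\<bar>w x\<bar> powr (\<gamma> - 1) * norm (grad w x))) \<partial>lborel) k"
proof -
  note sm = test_funs_smooth[OF w]
  define p where "p = 1 / (real DIM('a) - 1)"
  have p0: "0 < p" using N by (simp add: p_def)
  have k: "k = 1 + p" using N by (simp add: k_def p_def field_simps)
  have kN: "k = p * real DIM('a)" by (simp add: k_def p_def)
  have [measurable]: "w \<in> borel_measurable borel" "grad w \<in> borel_measurable borel"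
    by (intro borel_measurable_continuous_onI smooth_continuous[OF sm] continuous_grad[OF sm])+
  define F where "F x = ennreal (\<gamma> * (\<bar>w x\<bar> powr (\<gamma> - 1) * norm (grad w x)))" for x
  have F [measurable]: "F \<in> borel_measurable borel" unfolding F_def by measurable
  have "(\<integral>\<^sup>+x. ennreal (\<bar>w x\<bar> powr (\<gamma> * k)) \<partial>lborel) \<le> (\<integral>\<^sup>+x. (\<Prod>b\<in>Basis. epow (\<integral>\<^sup>+s. F (x + s *\<^sub>R b) \<partial>lborel) p) \<partial>lborel)"
  proof (rule nn_integral_mono)
    fix x :: 'a
    have "\<bar>w x\<bar> powr (\<gamma> * k) = ((\<bar>w x\<bar> powr \<gamma>) powr p) ^ DIM('a)"
    proof -
      have "((\<bar>w x\<bar> powr \<gamma>) powr p) ^ DIM('a) = ((\<bar>w x\<bar> powr \<gamma>) powr p) powr real DIM('a)"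
        by (rule powr_realpow'[symmetric]) auto
      thus ?thesis by (simp add: kN powr_powr mult.assoc)
    qed
    hence "ennreal (\<bar>w x\<bar> powr (\<gamma> * k)) = (\<Prod>b\<in>(Basis::'a set). ennreal ((\<bar>w x\<bar> powr \<gamma>) powr p))"
      by (simp add: ennreal_power)
    also have "\<dots> = (\<Prod>b\<in>(Basis::'a set). epow (ennreal (\<bar>w x\<bar> powr \<gamma>)) p)"
      using p0 by (simp add: epow_ennreal)
    also have "\<dots> \<le> (\<Prod>b\<in>Basis. epow (\<integral>\<^sup>+s. F (x + s *\<^sub>R b) \<partial>lborel) p)"
      unfolding F_def using p0 g by (intro prod_mono_ennreal epow_mono test_fun_line_bound[OF w]) auto
    finally show "ennreal (\<bar>w x\<bar> powr (\<gamma> * k)) \<le> (\<Prod>b\<in>Basis. epow (\<integral>\<^sup>+s. F (x + s *\<^sub>R b) \<partial>lborel) p)" .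
  qed
  also have "\<dots> \<le> epow (\<integral>\<^sup>+x. F x \<partial>lborel) (1 + p)"
    unfolding p_def by (rule grid_lborel[OF F N])
  finally show ?thesis unfolding F_def k .
qed

text \<open>Young's inequality with parameter, with constants 1: either g \<le> l a, and the first
  term suffices, or a < g / l, and the second does.\<close>

lemma young_split:
  fixes a g l q :: real
  assumes "1 < q" "0 \<le> a" "0 \<le> g" "0 < l"
  shows "a powr (q - 1) * g \<le> l * a powr q + l powr (1 - q) * g powr q"
proof (cases "g \<le> l * a")
  case True
  have "a powr (q - 1) * g \<le> a powr (q - 1) * (l * a)" using True by (intro mult_left_mono) auto
  also have "\<dots> = l * a powr q" using powr_add[of a "q - 1" 1] assms by (cases "a = 0") auto
  finally show ?thesis by (smt (verit) mult_nonneg_nonneg powr_ge_zero)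
next
  case False
  hence g: "0 < g" using assms by (smt (verit) mult_nonneg_nonneg)
  have "a powr (q - 1) \<le> (g / l) powr (q - 1)"
    using False assms by (intro powr_mono2) (auto simp: field_simps)
  hence "a powr (q - 1) * g \<le> (g / l) powr (q - 1) * g" using assms by (intro mult_right_mono) auto
  also have "\<dots> = l powr (1 - q) * g powr q"
    using g assms powr_add[of g "q - 1" 1] by (simp add: powr_divide powr_diff field_simps)
  finally show ?thesis using assms by (smt (verit) mult_nonneg_nonneg powr_ge_zero)
qed

text \<open>Sobolev's inequality in the form needed: a bound for one norm in terms of a bound for
  the other. The exponent \<gamma> is determined by \<gamma> N / (N - 1) = \<sigma>, and then
  |w|^(\<gamma>-1) is the (q-1)-st power of |w|^\<kappa>, where \<kappa> q = \<sigma>. A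
  parametrized Young inequality with absorption replaces Hoelder's inequality.\<close>

lemma sobolev_bound:
  fixes q M :: real
  assumes q: "1 < q" "q < real DIM('a::euclidean_space)"
  defines "\<sigma> \<equiv> real DIM('a) * q / (real DIM('a) - q)"
  obtains C where "\<And>w :: 'a \<Rightarrow> real. w \<in> test_funs UNIV \<Longrightarrow> (\<integral>x. norm (grad w x) powr q \<partial>lborel) \<le> M \<Longrightarrow>
     (\<integral>x. \<bar>w x\<bar> powr \<sigma> \<partial>lborel) \<le> C"
proof -
  define N where "N = real DIM('a)"
  have N2: "2 \<le> DIM('a)" using q by linarith
  have Nq: "1 < q" "q < N" using q by (auto simp: N_def)
  define \<kappa> where "\<kappa> = N / (N - q)"
  define \<gamma> where "\<gamma> = (N - 1) * q / (N - q)"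
  define k where "k = N / (N - 1)"
  have \<sigma>: "\<sigma> = \<kappa> * q" by (simp add: \<sigma>_def \<kappa>_def N_def)
  have \<gamma>k: "\<gamma> * k = \<sigma>" using Nq by (simp add: \<gamma>_def k_def \<sigma>_def N_def)
  have \<gamma>1: "\<gamma> - 1 = \<kappa> * (q - 1)" using Nq by (simp add: \<gamma>_def \<kappa>_def field_simps)
  have \<kappa>0: "0 < \<kappa>" using Nq by (simp add: \<kappa>_def)
  have \<gamma>: "1 < \<gamma>" using \<gamma>1 \<kappa>0 Nq by (smt (verit) mult_pos_pos)
  have k0: "0 < k" using Nq by (simp add: k_def)
  have \<sigma>0: "0 < \<sigma>" using \<sigma> \<kappa>0 Nq by simp
  define C where "C = (2 * \<gamma> * M * (2 * \<gamma>) powr (q - 1)) powr \<kappa>"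
  show ?thesis
  proof (rule that[of C])
    fix w :: "'a \<Rightarrow> real" assume w: "w \<in> test_funs UNIV" and M: "(\<integral>x. norm (grad w x) powr q \<partial>lborel) \<le> M"
    note sm = test_funs_smooth[OF w]
    note ic = integrable_lborel_compact_support[OF _ test_funs_compact[OF w]]
    have iX: "integrable lborel (\<lambda>x. \<bar>w x\<bar> powr \<sigma>)"
      using \<sigma>0 continuous_norm_powr[OF smooth_continuous[OF sm]] by (intro ic) (auto simp: test_fun_outside)
    have iG: "integrable lborel (\<lambda>x. norm (grad w x) powr q)"
      using Nq by (intro ic continuous_norm_powr[OF continuous_grad[OF sm]]) (auto simp: grad_outside)
    have iY: "integrable lborel (\<lambda>x. \<gamma> * (\<bar>w x\<bar> powr (\<gamma> - 1) * norm (grad w x)))"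
    proof (intro ic)
      show "continuous_on UNIV (\<lambda>x. \<gamma> * (\<bar>w x\<bar> powr (\<gamma> - 1) * norm (grad w x)))"
        using \<gamma> continuous_norm_powr[OF smooth_continuous[OF sm, of UNIV], of "\<gamma> - 1"] continuous_grad[OF sm]
        by (auto intro!: continuous_intros)
    qed (auto simp: grad_outside)
    define X where "X = (\<integral>x. \<bar>w x\<bar> powr \<sigma> \<partial>lborel)"
    define Y where "Y = (\<integral>x. \<gamma> * (\<bar>w x\<bar> powr (\<gamma> - 1) * norm (grad w x)) \<partial>lborel)"
    have X0: "0 \<le> X" unfolding X_def by (intro integral_nonneg_AE) auto
    have Y0: "0 \<le> Y" unfolding Y_def using \<gamma> by (intro integral_nonneg_AE) auto
    have M0: "0 \<le> M" using M by (smt (verit) Bochner_Integration.integral_nonneg powr_ge_zero)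
    have "ennreal X \<le> epow (ennreal Y) k"
    proof -
      have "(\<integral>\<^sup>+x. ennreal (\<bar>w x\<bar> powr \<sigma>) \<partial>lborel) = ennreal X"
        unfolding X_def by (intro nn_integral_eq_integral iX) auto
      moreover have "(\<integral>\<^sup>+x. ennreal (\<gamma> * (\<bar>w x\<bar> powr (\<gamma> - 1) * norm (grad w x))) \<partial>lborel) = ennreal Y"
        unfolding Y_def using \<gamma> by (intro nn_integral_eq_integral iY) auto
      ultimately show ?thesis using gagliardo_nirenberg_powr[OF w \<gamma> N2] \<gamma>k by (simp add: k_def N_def)
    qed
    hence XY: "X \<le> Y powr k" using k0 Y0 by (simp add: epow_ennreal)
    have young: "Y \<le> \<gamma> * (l * X + l powr (1 - q) * M)" if l: "0 < l" for l
    proof -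
      have "Y \<le> (\<integral>x. \<gamma> * (l * \<bar>w x\<bar> powr \<sigma> + l powr (1 - q) * norm (grad w x) powr q) \<partial>lborel)"
        unfolding Y_def
      proof (rule integral_mono[OF iY])
        show "integrable lborel (\<lambda>x. \<gamma> * (l * \<bar>w x\<bar> powr \<sigma> + l powr (1 - q) * norm (grad w x) powr q))"
          using iX iG by simp
        fix x
        have "(\<bar>w x\<bar> powr \<kappa>) powr (q - 1) * norm (grad w x) \<le> l * (\<bar>w x\<bar> powr \<kappa>) powr q + l powr (1 - q) * norm (grad w x) powr q"
          using Nq l by (intro young_split) auto
        thus "\<gamma> * (\<bar>w x\<bar> powr (\<gamma> - 1) * norm (grad w x)) \<le> \<gamma> * (l * \<bar>w x\<bar> powr \<sigma> + l powr (1 - q) * norm (grad w x) powr q)"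
          using \<gamma> by (intro mult_left_mono) (auto simp: powr_powr \<gamma>1 \<sigma>)
      qed
      also have "\<dots> = \<gamma> * (l * X + l powr (1 - q) * (\<integral>x. norm (grad w x) powr q \<partial>lborel))"
        using iX iG by (simp add: X_def)
      also have "\<dots> \<le> \<gamma> * (l * X + l powr (1 - q) * M)"
        using \<gamma> M l by (intro mult_left_mono add_mono order_refl) auto
      finally show ?thesis .
    qed
    show "(\<integral>x. \<bar>w x\<bar> powr \<sigma> \<partial>lborel) \<le> C"
    proof (cases "X = 0")
      case True thus ?thesis by (simp add: X_def C_def)
    next
      case False
      hence X: "0 < X" using X0 by simp
      \<comment> \<open>Tuned so that \<gamma> l X is exactly half of X^(1/k) and can be moved to
        the left. This requires X > 0, and X < \<infinity> is known because w is a test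
        function.\<close>
      define l where "l = X powr (- (1 / N)) / (2 * \<gamma>)"
      have l: "0 < l" using X \<gamma> by (simp add: l_def)
      have "X powr (1 / k) \<le> (Y powr k) powr (1 / k)" using XY X0 k0 by (intro powr_mono2) auto
      also have "\<dots> = Y" using Y0 k0 by (simp add: powr_powr)
      finally have 1: "X powr (1 / k) \<le> Y" .
      have k1: "1 / k = - (1 / N) + 1" using Nq by (simp add: k_def field_simps)
      have 2: "\<gamma> * (l * X) = X powr (1 / k) / 2"
      proof -
        have "X powr (1 / k) = X powr (- (1 / N)) * X"
          by (subst k1, subst powr_add) (use X in simp)
        thus ?thesis using \<gamma> by (simp add: l_def)
      qed
      have 3: "l powr (1 - q) = X powr ((q - 1) / N) * (2 * \<gamma>) powr (q - 1)"
      proof -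
        have a: "(2 * \<gamma>) powr (1 - q) = 1 / (2 * \<gamma>) powr (q - 1)"
          using powr_minus_divide[of "2 * \<gamma>" "q - 1"] by simp
        have b: "- (1 / N) * (1 - q) = (q - 1) / N" by (simp add: diff_divide_distrib)
        have "l powr (1 - q) = (X powr (- (1 / N))) powr (1 - q) / (2 * \<gamma>) powr (1 - q)"
          unfolding l_def by (rule powr_divide)
        also have "\<dots> = X powr ((q - 1) / N) * (2 * \<gamma>) powr (q - 1)"
          unfolding a powr_powr b by simp
        finally show ?thesis .
      qed
      have "X powr (1 / k) \<le> 2 * (\<gamma> * (l powr (1 - q) * M))"
        using 1 2 young[OF l] by (simp add: distrib_left)
      also have "\<dots> = (2 * \<gamma> * M * (2 * \<gamma>) powr (q - 1)) * X powr ((q - 1) / N)" unfolding 3 by (simp add: mult_ac)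
      finally have 4: "X powr (1 / k) \<le> (2 * \<gamma> * M * (2 * \<gamma>) powr (q - 1)) * X powr ((q - 1) / N)" .
      have e: "1 / k - (q - 1) / N = 1 / \<kappa>" using Nq by (simp add: k_def \<kappa>_def field_simps)
      have "X powr (1 / \<kappa>) = X powr (1 / k) / X powr ((q - 1) / N)" unfolding e[symmetric] by (rule powr_diff)
      also have "\<dots> \<le> 2 * \<gamma> * M * (2 * \<gamma>) powr (q - 1)" using 4 X by (simp add: divide_le_eq)
      finally have "(X powr (1 / \<kappa>)) powr \<kappa> \<le> C" unfolding C_def using \<kappa>0 by (intro powr_mono2) auto
      thus ?thesis using X \<kappa>0 by (simp add: powr_powr X_def)
    qed
  qed
qed

lemma le_split_powr:
  fixes a l q :: real
  assumes "1 < q" "0 \<le> a" "0 < l"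
  shows "a \<le> l + l powr (1 - q) * a powr q"
  using young_split[of q 1 a l] young_split[of q "1::real" a l] assms
  by (simp add: powr_def split: if_splits)

text \<open>w(x) is compared with its values on the unit ball around x by integrating the gradient
  along rays. At distance parameter s, scaling costs s^(-N) in the q-th power integral, hence
  s^(-N/q) after balancing; this is integrable at 0 precisely because N < q.\<close>

lemma morrey_bound:
  fixes q M :: real
  assumes q: "1 < q" "real DIM('a::euclidean_space) < q"
  obtains C where "\<And>(w :: 'a \<Rightarrow> real) x. w \<in> test_funs UNIV \<Longrightarrow> (\<integral>x. norm (grad w x) powr q \<partial>lborel) \<le> M \<Longrightarrow>
     (\<integral>x. \<bar>w x\<bar> powr q \<partial>lborel) \<le> M \<Longrightarrow> \<bar>w x\<bar> \<le> C"
proof -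
  define N where "N = real DIM('a)"
  have N: "0 < N" "N < q" using q by (auto simp: N_def)
  define B where "B = ball (0::'a) 1"
  have Bm [measurable]: "B \<in> sets borel" by (simp add: B_def)
  define v where "v = measure lborel B"
  have ev: "emeasure lborel B = ennreal v"
    unfolding v_def B_def by (intro emeasure_eq_ennreal_measure) (simp add: emeasure_lborel_ball_finite less_imp_neq[OF emeasure_lborel_ball_finite, simplified])
  have v: "0 < v" unfolding v_def B_def by (simp add: content_ball_pos)
  \<comment> \<open>The ball volume v times |w x| is at most v + M from the average of |w| plus (v +
    M) times the integral of s^(-N/q) over [0, 1] from the gradient.\<close>
  define C where "C = (v + M + (v + M) * (1 / (1 - N / q))) / v"
  show ?thesis
  proof (rule that[of C])
    fix w :: "'a \<Rightarrow> real" and x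
    assume w: "w \<in> test_funs UNIV" and Mg: "(\<integral>x. norm (grad w x) powr q \<partial>lborel) \<le> M"
      and Mw: "(\<integral>x. \<bar>w x\<bar> powr q \<partial>lborel) \<le> M"
    note sm = test_funs_smooth[OF w]
    note ic = integrable_lborel_compact_support[OF _ test_funs_compact[OF w]]
    have M0: "0 \<le> M" using Mg by (smt (verit) Bochner_Integration.integral_nonneg powr_ge_zero)
    have [measurable]: "w \<in> borel_measurable borel" "grad w \<in> borel_measurable borel"
      by (intro borel_measurable_continuous_onI smooth_continuous[OF sm] continuous_grad[OF sm])+
    have "integrable lborel (\<lambda>x. \<bar>w x\<bar> powr q)"
      using q continuous_norm_powr[OF smooth_continuous[OF sm]] by (intro ic) (auto simp: test_fun_outside)
    hence Xw: "(\<integral>\<^sup>+x. ennreal (\<bar>w x\<bar> powr q) \<partial>lborel) \<le> ennreal M"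
      using Mw by (subst nn_integral_eq_integral) (auto intro: ennreal_leI)
    have "integrable lborel (\<lambda>x. norm (grad w x) powr q)"
      using q by (intro ic continuous_norm_powr[OF continuous_grad[OF sm]]) (auto simp: grad_outside)
    hence Xg: "(\<integral>\<^sup>+x. ennreal (norm (grad w x) powr q) \<partial>lborel) \<le> ennreal M"
      using Mg by (subst nn_integral_eq_integral) (auto intro: ennreal_leI)
    define h where "h z s = ennreal (norm (grad w (x + s *\<^sub>R z)))" for z s
    have hm [measurable]: "case_prod h \<in> borel_measurable (lborel \<Otimes>\<^sub>M lborel)" unfolding h_def by measurable
    have pw: "ennreal \<bar>w x\<bar> \<le> ennreal \<bar>w (x + z)\<bar> + (\<integral>\<^sup>+s. h z s * indicator {0..1} s \<partial>lborel)" if z: "z \<in> B" for z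
    proof -
      have cl: "continuous_on UNIV (\<lambda>s. x + s *\<^sub>R z)" by (intro continuous_intros)
      have "ennreal \<bar>w (x + 1 *\<^sub>R z) - w (x + 0 *\<^sub>R z)\<bar> \<le> (\<integral>\<^sup>+s. ennreal (norm (grad w (x + s *\<^sub>R z))) * indicator {0..1} s \<partial>lborel)"
      proof (rule ftc_nn_bound[where \<phi> = "\<lambda>s. w (x + s *\<^sub>R z)" and \<phi>' = "\<lambda>s. grad w (x + s *\<^sub>R z) \<bullet> z"])
        show "((\<lambda>s. w (x + s *\<^sub>R z)) has_real_derivative grad w (x + s *\<^sub>R z) \<bullet> z) (at s)" for s by (rule line_DERIV[OF sm])
        show "\<bar>grad w (x + s *\<^sub>R z) \<bullet> z\<bar> \<le> norm (grad w (x + s *\<^sub>R z))" for s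
          using Cauchy_Schwarz_ineq2[of "grad w (x + s *\<^sub>R z)" z] z mult_left_mono[of "norm z" 1 "norm (grad w (x + s *\<^sub>R z))"]
          by (simp add: B_def)
        show "continuous_on UNIV (\<lambda>s. norm (grad w (x + s *\<^sub>R z)))"
          by (intro continuous_on_norm continuous_on_compose2[OF continuous_grad[OF sm, of UNIV] cl]) auto
      qed simp
      moreover have "ennreal \<bar>w x\<bar> \<le> ennreal \<bar>w (x + z)\<bar> + ennreal \<bar>w (x + 1 *\<^sub>R z) - w (x + 0 *\<^sub>R z)\<bar>"
      proof -
        have "\<bar>w x\<bar> \<le> \<bar>w (x + z)\<bar> + \<bar>w (x + 1 *\<^sub>R z) - w (x + 0 *\<^sub>R z)\<bar>" by simp
        thus ?thesis by (subst ennreal_plus[symmetric]) (auto intro: ennreal_leI simp del: ennreal_plus)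
      qed
      ultimately show ?thesis unfolding h_def by (meson add_left_mono order_trans)
    qed
    have slice: "(\<integral>\<^sup>+z. h z s * indicator B z \<partial>lborel) \<le> ennreal ((v + M) * s powr (- (N / q)))" if s: "0 < s" for s
    proof -
      \<comment> \<open>Balances the two terms of the splitting: l^(1-q) s^(-N) = l.\<close>
      define l where "l = s powr (- (N / q))"
      have l: "0 < l" using s by (simp add: l_def)
      have ll: "l powr (1 - q) * s powr - N = l"
        using s q by (simp add: l_def powr_powr powr_add[symmetric]) (simp add: field_simps)
      have "(\<integral>\<^sup>+z. h z s * indicator B z \<partial>lborel)
         \<le> (\<integral>\<^sup>+z. ennreal l * indicator B z + ennreal (l powr (1 - q)) * ennreal (norm (grad w (x + s *\<^sub>R z)) powr q) \<partial>lborel)"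
      proof (rule nn_integral_mono)
        fix z :: 'a
        have "h z s \<le> ennreal l + ennreal (l powr (1 - q)) * ennreal (norm (grad w (x + s *\<^sub>R z)) powr q)"
          unfolding h_def using le_split_powr[OF q(1) norm_ge_zero l, of "grad w (x + s *\<^sub>R z)"] l
          by (simp add: ennreal_mult[symmetric] ennreal_plus[symmetric] ennreal_leI del: ennreal_plus)
        thus "h z s * indicator B z \<le> ennreal l * indicator B z + ennreal (l powr (1 - q)) * ennreal (norm (grad w (x + s *\<^sub>R z)) powr q)"
          by (auto simp: indicator_def)
      qed
      also have "\<dots> = ennreal l * ennreal v + ennreal (l powr (1 - q)) * (\<integral>\<^sup>+z. ennreal (norm (grad w (x + s *\<^sub>R z)) powr q) \<partial>lborel)"
        by (simp add: nn_integral_add nn_integral_cmult ev)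
      also have "(\<integral>\<^sup>+z. ennreal (norm (grad w (x + s *\<^sub>R z)) powr q) \<partial>lborel) = ennreal (s powr - N) * (\<integral>\<^sup>+z. ennreal (norm (grad w z) powr q) \<partial>lborel)"
        using nn_integral_lborel_scale[of "\<lambda>z. ennreal (norm (grad w z) powr q)" s x] s by (simp add: N_def)
      also have "ennreal l * ennreal v + ennreal (l powr (1 - q)) * (ennreal (s powr - N) * (\<integral>\<^sup>+z. ennreal (norm (grad w z) powr q) \<partial>lborel))
         \<le> ennreal l * ennreal v + ennreal (l powr (1 - q)) * (ennreal (s powr - N) * ennreal M)"
        using Xg by (intro add_left_mono mult_left_mono) auto
      also have "\<dots> = ennreal (l * v + l powr (1 - q) * s powr - N * M)"
        using l v M0 by (simp add: ennreal_mult ennreal_plus mult.assoc)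
      also have "l * v + l powr (1 - q) * s powr - N * M = (v + M) * l" unfolding ll by (simp add: algebra_simps)
      finally show ?thesis by (simp add: l_def)
    qed
    have "ennreal \<bar>w x\<bar> * ennreal v = (\<integral>\<^sup>+z. ennreal \<bar>w x\<bar> * indicator B z \<partial>lborel)"
      by (simp add: nn_integral_cmult ev)
    also have "\<dots> \<le> (\<integral>\<^sup>+z. ennreal \<bar>w (x + z)\<bar> * indicator B z + (\<integral>\<^sup>+s. h z s * indicator {0..1} s * indicator B z \<partial>lborel) \<partial>lborel)"
    proof (rule nn_integral_mono)
      fix z
      show "ennreal \<bar>w x\<bar> * indicator B z \<le> ennreal \<bar>w (x + z)\<bar> * indicator B z + (\<integral>\<^sup>+s. h z s * indicator {0..1} s * indicator B z \<partial>lborel)"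
        using pw[of z] by (auto simp: indicator_def)
    qed
    also have "\<dots> = (\<integral>\<^sup>+z. ennreal \<bar>w (x + z)\<bar> * indicator B z \<partial>lborel) + (\<integral>\<^sup>+z. (\<integral>\<^sup>+s. h z s * indicator {0..1} s * indicator B z \<partial>lborel) \<partial>lborel)"
      by (rule nn_integral_add) measurable
    also have "(\<integral>\<^sup>+z. (\<integral>\<^sup>+s. h z s * indicator {0..1} s * indicator B z \<partial>lborel) \<partial>lborel)
        = (\<integral>\<^sup>+s. (\<integral>\<^sup>+z. h z s * indicator {0..1} s * indicator B z \<partial>lborel) \<partial>lborel)"
      by (rule pair_sigma_finite.Fubini'[of lborel lborel "\<lambda>z s. h z s * indicator {0..1} s * indicator B z", symmetric])
         (auto intro!: pair_sigma_finite.intro sigma_finite_lborel)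
    also have "\<dots> \<le> (\<integral>\<^sup>+s. ennreal (indicator {0..1} s * ((v + M) * s powr (- (N / q)))) \<partial>lborel)"
    proof (rule nn_integral_mono_AE)
      show "AE s in lborel. (\<integral>\<^sup>+z. h z s * indicator {0..1} s * indicator B z \<partial>lborel) \<le> ennreal (indicator {0..1} s * ((v + M) * s powr (- (N / q))))"
        \<comment> \<open>The slice bound involves scaling by s, so the null set s = 0 is
          excluded.\<close>
        using AE_lborel_singleton[of "0::real"]
      proof eventually_elim
        case (elim s)
        show ?case using slice[of s] elim by (cases "s \<in> {0..1}") (auto simp: indicator_def)
      qed
    qed
    also have "\<dots> = ennreal ((v + M) * (1 / (1 - N / q)))"
    proof (rule nn_integral_has_integral_lborel)
      have "((\<lambda>s. s powr (- (N / q))) has_integral (1 powr (- (N / q) + 1) / (- (N / q) + 1))) {0..1}"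
        using N q by (intro has_integral_powr_from_0) auto
      hence "((\<lambda>s. (v + M) * s powr (- (N / q))) has_integral ((v + M) * (1 / (1 - N / q)))) {0..1}"
        using has_integral_mult_right[of "\<lambda>s. s powr (- (N / q))" "1 / (1 - N / q)" "{0..1}" "v + M"] by simp
      moreover have "(\<lambda>s. indicator {0..1} s * ((v + M) * s powr (- (N / q)))) = (\<lambda>s. if s \<in> {0..1} then (v + M) * s powr (- (N / q)) else 0)"
        by (auto simp: indicator_def)
      ultimately show "((\<lambda>s. indicator {0..1} s * ((v + M) * s powr (- (N / q)))) has_integral ((v + M) * (1 / (1 - N / q)))) UNIV"
        using has_integral_restrict_UNIV[of "{0..1}" "\<lambda>s. (v + M) * s powr (- (N / q))"] by (simp only:)
    qed (use v M0 in auto)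
    also have "(\<integral>\<^sup>+z. ennreal \<bar>w (x + z)\<bar> * indicator B z \<partial>lborel) \<le> ennreal (v + M)"
    proof -
      have "(\<integral>\<^sup>+z. ennreal \<bar>w (x + z)\<bar> * indicator B z \<partial>lborel) \<le> (\<integral>\<^sup>+z. indicator B z + ennreal (\<bar>w (z + x)\<bar> powr q) \<partial>lborel)"
      proof (rule nn_integral_mono)
        fix z
        have "ennreal \<bar>w (x + z)\<bar> \<le> 1 + ennreal (\<bar>w (z + x)\<bar> powr q)"
        proof -
          have "ennreal \<bar>w (x + z)\<bar> \<le> ennreal (1 + \<bar>w (z + x)\<bar> powr q)"
            using le_split_powr[OF q(1), of "\<bar>w (x + z)\<bar>" 1] by (intro ennreal_leI) (simp add: add.commute)
          thus ?thesis by (simp add: ennreal_plus)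
        qed
        thus "ennreal \<bar>w (x + z)\<bar> * indicator B z \<le> indicator B z + ennreal (\<bar>w (z + x)\<bar> powr q)"
          by (auto simp: indicator_def)
      qed
      also have "\<dots> = ennreal v + (\<integral>\<^sup>+z. ennreal (\<bar>w (z + x)\<bar> powr q) \<partial>lborel)"
        by (simp add: nn_integral_add ev)
      also have "(\<integral>\<^sup>+z. ennreal (\<bar>w (z + x)\<bar> powr q) \<partial>lborel) = (\<integral>\<^sup>+z. ennreal (\<bar>w z\<bar> powr q) \<partial>lborel)"
        by (rule nn_integral_lborel_translate[of "\<lambda>z. ennreal (\<bar>w z\<bar> powr q)"]) measurable
      also have "ennreal v + (\<integral>\<^sup>+z. ennreal (\<bar>w z\<bar> powr q) \<partial>lborel) \<le> ennreal (v + M)"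
        using Xw v M0 by (simp add: ennreal_plus add_left_mono)
      finally show ?thesis .
    qed
    finally have "ennreal \<bar>w x\<bar> * ennreal v \<le> ennreal (v + M) + ennreal ((v + M) * (1 / (1 - N / q)))"
      by (simp add: add_mono)
    hence "ennreal (\<bar>w x\<bar> * v) \<le> ennreal (v + M + (v + M) * (1 / (1 - N / q)))"
      using v M0 N q by (simp add: ennreal_mult ennreal_plus)
    hence "\<bar>w x\<bar> * v \<le> v + M + (v + M) * (1 / (1 - N / q))"
      using v M0 N q by (subst (asm) ennreal_le_iff) (auto intro!: add_nonneg_nonneg divide_nonneg_nonneg)
    thus "\<bar>w x\<bar> \<le> C" using v by (simp add: C_def field_simps)
  qed
qed

section \<open>Rellich compactness\<close>

text \<open>The increment is the integral of a directional derivative along the segment; Tonelli's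
  theorem and translation invariance give the same L^1 norm of the gradient for every point of the
  segment.\<close>

lemma L1_translation_bound:
  fixes w :: "'a::euclidean_space \<Rightarrow> real"
  assumes w: "w \<in> test_funs UNIV"
  shows "(\<integral>\<^sup>+x. ennreal \<bar>w (x + z) - w x\<bar> \<partial>lborel) \<le> ennreal (norm z * (\<integral>x. norm (grad w x) \<partial>lborel))"
proof -
  note sm = test_funs_smooth[OF w]
  have [measurable]: "w \<in> borel_measurable borel" "grad w \<in> borel_measurable borel"
    by (intro borel_measurable_continuous_onI smooth_continuous[OF sm] continuous_grad[OF sm])+
  define h where "h x s = ennreal (norm z * norm (grad w (x + s *\<^sub>R z))) * indicator {0..1} s" for x and s :: real
  have hm [measurable]: "case_prod h \<in> borel_measurable (lborel \<Otimes>\<^sub>M lborel)" unfolding h_def by measurable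
  have iG: "integrable lborel (\<lambda>x. norm (grad w x))"
    by (rule integrable_lborel_compact_support[OF _ test_funs_compact[OF w]])
       (auto intro!: continuous_on_norm continuous_grad[OF sm] simp: grad_outside)
  have "(\<integral>\<^sup>+x. ennreal \<bar>w (x + z) - w x\<bar> \<partial>lborel) \<le> (\<integral>\<^sup>+x. (\<integral>\<^sup>+s. h x s \<partial>lborel) \<partial>lborel)"
  proof (rule nn_integral_mono)
    fix x
    have cl: "continuous_on UNIV (\<lambda>s. x + s *\<^sub>R z)" by (intro continuous_intros)
    have "ennreal \<bar>w (x + 1 *\<^sub>R z) - w (x + 0 *\<^sub>R z)\<bar> \<le> (\<integral>\<^sup>+s. ennreal (norm z * norm (grad w (x + s *\<^sub>R z))) * indicator {0..1} s \<partial>lborel)"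
    proof (rule ftc_nn_bound[where \<phi> = "\<lambda>s. w (x + s *\<^sub>R z)" and \<phi>' = "\<lambda>s. grad w (x + s *\<^sub>R z) \<bullet> z"])
      show "((\<lambda>s. w (x + s *\<^sub>R z)) has_real_derivative grad w (x + s *\<^sub>R z) \<bullet> z) (at s)" for s by (rule line_DERIV[OF sm])
      show "\<bar>grad w (x + s *\<^sub>R z) \<bullet> z\<bar> \<le> norm z * norm (grad w (x + s *\<^sub>R z))" for s
        using Cauchy_Schwarz_ineq2[of "grad w (x + s *\<^sub>R z)" z] by (simp add: mult.commute)
      show "continuous_on UNIV (\<lambda>s. norm z * norm (grad w (x + s *\<^sub>R z)))"
        by (intro continuous_on_mult continuous_on_const continuous_on_norm continuous_on_compose2[OF continuous_grad[OF sm, of UNIV] cl]) auto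
    qed simp
    thus "ennreal \<bar>w (x + z) - w x\<bar> \<le> (\<integral>\<^sup>+s. h x s \<partial>lborel)" by (simp add: h_def)
  qed
  also have "\<dots> = (\<integral>\<^sup>+s. (\<integral>\<^sup>+x. h x s \<partial>lborel) \<partial>lborel)"
    by (rule pair_sigma_finite.Fubini'[of lborel lborel h, symmetric])
       (auto intro!: pair_sigma_finite.intro sigma_finite_lborel)
  also have "\<dots> = (\<integral>\<^sup>+s. ennreal (norm z * (\<integral>x. norm (grad w x) \<partial>lborel)) * indicator {0..1::real} s \<partial>lborel)"
  proof (rule nn_integral_cong)
    fix s :: real
    have "(\<integral>\<^sup>+x. h x s \<partial>lborel) = (\<integral>\<^sup>+x. ennreal (norm z * norm (grad w (x + s *\<^sub>R z))) \<partial>lborel) * indicator {0..1} s"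
      unfolding h_def by (rule nn_integral_multc) measurable
    also have "(\<integral>\<^sup>+x. ennreal (norm z * norm (grad w (x + s *\<^sub>R z))) \<partial>lborel) = (\<integral>\<^sup>+x. ennreal (norm z * norm (grad w x)) \<partial>lborel)"
      by (rule nn_integral_lborel_translate[of "\<lambda>x. ennreal (norm z * norm (grad w x))" "s *\<^sub>R z"]) measurable
    also have "\<dots> = ennreal (norm z * (\<integral>x. norm (grad w x) \<partial>lborel))"
      using iG by (subst nn_integral_eq_integral) auto
    finally show "(\<integral>\<^sup>+x. h x s \<partial>lborel) = ennreal (norm z * (\<integral>x. norm (grad w x) \<partial>lborel)) * indicator {0..1::real} s" .
  qed
  also have "\<dots> = ennreal (norm z * (\<integral>x. norm (grad w x) \<partial>lborel))"
    by (simp add: nn_integral_cmult)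
  finally show ?thesis .
qed

text \<open>An unnormalized ball average, used in the role of a mollification. For the compactness
  argument a Lipschitz bound on the averages is enough, so no smooth kernel is required.\<close>

definition ball_sum :: "real \<Rightarrow> ('a::euclidean_space \<Rightarrow> real) \<Rightarrow> 'a \<Rightarrow> real" where
  "ball_sum h w y = (\<integral>z. indicator (ball 0 h) z * w (y + z) \<partial>lborel)"

context
  fixes w :: "'a::euclidean_space \<Rightarrow> real" and C h :: real
  assumes w: "w \<in> test_funs UNIV" and h: "0 < h"
    and C: "(\<integral>x. \<bar>w x\<bar> \<partial>lborel) \<le> C" "(\<integral>x. norm (grad w x) \<partial>lborel) \<le> C"
begin

lemma L1_bound_nonneg: "0 \<le> C"
  using C(1) by (smt (verit) Bochner_Integration.integral_nonneg abs_ge_zero)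

lemma test_fun_borel_measurable [measurable]: "w \<in> borel_measurable borel"
  by (rule borel_measurable_continuous_onI[OF smooth_continuous[OF test_funs_smooth[OF w]]])

lemma test_fun_integrable: "integrable lborel w"
  using integrable_lborel_compact_support[of w "supp w", OF smooth_continuous[OF test_funs_smooth[OF w]] test_funs_compact[OF w] test_fun_outside[where u = w]] by simp

lemma test_fun_translate_integrable: "integrable lborel (\<lambda>z. w (y + z))"
proof -
  have "integrable (distr lborel borel ((+) y)) w" using test_fun_integrable by (simp add: lborel_distr_plus)
  thus ?thesis by (subst (asm) integrable_distr_eq) auto
qed

lemma ball_sum_integrable: "integrable lborel (\<lambda>z. indicator (ball 0 h) z * w (y + z))"
  using integrable_mult_indicator[OF _ test_fun_translate_integrable, of "ball 0 h" y] by simp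

lemma ball_sum_bound: "\<bar>ball_sum h w y\<bar> \<le> C"
proof -
  have "\<bar>ball_sum h w y\<bar> \<le> (\<integral>z. \<bar>indicator (ball 0 h) z * w (y + z)\<bar> \<partial>lborel)"
    unfolding ball_sum_def using integral_norm_bound[of lborel "\<lambda>z. indicator (ball 0 h) z * w (y + z)"] by simp
  also have "\<dots> \<le> (\<integral>z. \<bar>w (z + y)\<bar> \<partial>lborel)"
  proof (rule integral_mono)
    show "integrable lborel (\<lambda>z. \<bar>indicator (ball 0 h) z * w (y + z)\<bar>)"
      by (intro integrable_abs ball_sum_integrable)
    show "integrable lborel (\<lambda>z. \<bar>w (z + y)\<bar>)"
      using test_fun_translate_integrable[of y] by (simp add: add.commute)
  qed (auto simp: indicator_def abs_mult add.commute)
  also have "\<dots> = (\<integral>z. \<bar>w z\<bar> \<partial>lborel)" by (rule integral_lborel_translate[of "\<lambda>z. \<bar>w z\<bar>"]) measurable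
  finally show ?thesis using C by simp
qed

lemma L1_translation: "(\<integral>x. \<bar>w (x + z) - w x\<bar> \<partial>lborel) \<le> norm z * C"
proof -
  have i: "integrable lborel (\<lambda>x. \<bar>w (x + z) - w x\<bar>)"
    using test_fun_translate_integrable[of z] test_fun_integrable by (simp add: add.commute)
  have "ennreal (\<integral>x. \<bar>w (x + z) - w x\<bar> \<partial>lborel) = (\<integral>\<^sup>+x. ennreal \<bar>w (x + z) - w x\<bar> \<partial>lborel)"
    using i by (intro nn_integral_eq_integral[symmetric]) auto
  also have "\<dots> \<le> ennreal (norm z * (\<integral>x. norm (grad w x) \<partial>lborel))" by (rule L1_translation_bound[OF w])
  finally have "(\<integral>x. \<bar>w (x + z) - w x\<bar> \<partial>lborel) \<le> norm z * (\<integral>x. norm (grad w x) \<partial>lborel)"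
    by (subst (asm) ennreal_le_iff) auto
  thus ?thesis using mult_left_mono[OF C(2) norm_ge_zero[of z]] by linarith
qed

text \<open>Enlarging the domain from the ball to the whole space leaves the L^1 norm of a
  translation increment of w, so the Lipschitz constant C does not depend on the radius.\<close>

lemma ball_sum_lipschitz: "\<bar>ball_sum h w x - ball_sum h w y\<bar> \<le> norm (x - y) * C"
proof -
  have "ball_sum h w x - ball_sum h w y = (\<integral>z. indicator (ball 0 h) z * w (x + z) - indicator (ball 0 h) z * w (y + z) \<partial>lborel)"
    unfolding ball_sum_def using ball_sum_integrable by simp
  hence "\<bar>ball_sum h w x - ball_sum h w y\<bar> \<le> (\<integral>z. \<bar>indicator (ball 0 h) z * w (x + z) - indicator (ball 0 h) z * w (y + z)\<bar> \<partial>lborel)"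
    using integral_norm_bound[of lborel "\<lambda>z. indicator (ball 0 h) z * w (x + z) - indicator (ball 0 h) z * w (y + z)"] by simp
  also have "\<dots> \<le> (\<integral>z. \<bar>w (x + z) - w (y + z)\<bar> \<partial>lborel)"
    using ball_sum_integrable[of x] ball_sum_integrable[of y] test_fun_translate_integrable[of x] test_fun_translate_integrable[of y]
    by (intro integral_mono) (auto simp: indicator_def)
  also have "\<dots> = (\<integral>z. \<bar>w ((z + y) + (x - y)) - w (z + y)\<bar> \<partial>lborel)" by (simp add: algebra_simps)
  also have "\<dots> = (\<integral>z. \<bar>w (z + (x - y)) - w z\<bar> \<partial>lborel)"
    by (rule integral_lborel_translate[of "\<lambda>z. \<bar>w (z + (x - y)) - w z\<bar>"]) measurable
  also have "\<dots> \<le> norm (x - y) * C" by (rule L1_translation)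
  finally show ?thesis .
qed

lemma ball_sum_continuous: "continuous_on UNIV (ball_sum h w)"
proof (rule lipschitz_on_continuous_on)
  show "C-lipschitz_on UNIV (ball_sum h w)"
    using ball_sum_lipschitz L1_bound_nonneg by (auto simp: lipschitz_on_def dist_norm mult.commute)
qed

lemma ball_sum_outside:
  assumes "supp w \<subseteq> cball 0 R" "y \<notin> cball 0 (R + h)"
  shows "ball_sum h w y = 0"
proof -
  have "indicator (ball 0 h) z * w (y + z) = (0::real)" for z
  proof (cases "norm z < h")
    case True
    have "norm (y + z) \<ge> norm y - norm z" using norm_triangle_ineq4[of "y + z" z] by simp
    hence "y + z \<notin> supp w" using assms True by auto
    thus ?thesis by (simp add: test_fun_outside)
  qed (auto simp: indicator_def)
  hence "(\<lambda>z. indicator (ball 0 h) z * w (y + z)) = (\<lambda>z. 0::real)" by (rule ext)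
  thus ?thesis by (simp only: ball_sum_def) simp
qed

lemma ball_sum_L1_integrable: "integrable lborel (ball_sum h w)"
proof -
  obtain R where R: "0 < R" "\<And>x. x \<in> supp w \<Longrightarrow> norm x \<le> R"
    using compact_imp_bounded[OF test_funs_compact[OF w]] unfolding bounded_pos by auto
  show ?thesis
    by (rule integrable_lborel_compact_support[OF ball_sum_continuous compact_cball[of 0 "R + h"]])
       (use R ball_sum_outside[of R] in \<open>auto simp: subset_iff\<close>)
qed

text \<open>After exchanging the integrals, each shift z with |z| < h contributes at most h C; the
  ball volume appears as a factor because the average is not normalized.\<close>

lemma ball_sum_L1_bound:
  "(\<integral>y. \<bar>ball_sum h w y - measure lborel (ball (0::'a) h) * w y\<bar> \<partial>lborel) \<le> measure lborel (ball (0::'a) h) * (h * C)"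
proof -
  define B where "B = ball (0::'a) h"
  define v where "v = measure lborel B"
  have Bm [measurable]: "B \<in> sets borel" by (simp add: B_def)
  have ev: "emeasure lborel B = ennreal v"
    unfolding v_def B_def by (intro emeasure_eq_ennreal_measure) (simp add: emeasure_lborel_ball_finite less_imp_neq[OF emeasure_lborel_ball_finite, simplified])
  have iB: "integrable lborel (indicator B :: 'a \<Rightarrow> real)"
    unfolding B_def by (intro integrable_real_indicator) (use emeasure_lborel_ball_finite[of "0::'a" h] in auto)
  have i: "integrable lborel (\<lambda>y. \<bar>ball_sum h w y - v * w y\<bar>)"
    using ball_sum_L1_integrable test_fun_integrable by simp
  define g where "g y z = ennreal \<bar>w (y + z) - w y\<bar> * indicator B z" for y z
  have gm [measurable]: "case_prod g \<in> borel_measurable (lborel \<Otimes>\<^sub>M lborel)" unfolding g_def by measurable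
  have pw: "ennreal \<bar>ball_sum h w y - v * w y\<bar> \<le> (\<integral>\<^sup>+z. g y z \<partial>lborel)" for y
  proof -
    have ib: "integrable lborel (\<lambda>z. indicator B z * w (y + z))" using ball_sum_integrable by (simp add: B_def)
    have id: "integrable lborel (\<lambda>z. indicator B z * w (y + z) - w y * indicator B z)" using ib iB by simp
    have "ball_sum h w y - v * w y = (\<integral>z. indicator B z * w (y + z) - w y * indicator B z \<partial>lborel)"
      using ib iB by (simp add: ball_sum_def B_def[symmetric] v_def)
    hence "\<bar>ball_sum h w y - v * w y\<bar> \<le> (\<integral>z. \<bar>indicator B z * w (y + z) - w y * indicator B z\<bar> \<partial>lborel)"
      using integral_norm_bound[of lborel "\<lambda>z. indicator B z * w (y + z) - w y * indicator B z"] by simp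
    hence "ennreal \<bar>ball_sum h w y - v * w y\<bar> \<le> ennreal (\<integral>z. \<bar>indicator B z * w (y + z) - w y * indicator B z\<bar> \<partial>lborel)"
      by (rule ennreal_leI)
    also have "\<dots> = (\<integral>\<^sup>+z. ennreal \<bar>indicator B z * w (y + z) - w y * indicator B z\<bar> \<partial>lborel)"
      using id by (intro nn_integral_eq_integral[symmetric]) auto
    also have "\<dots> = (\<integral>\<^sup>+z. g y z \<partial>lborel)" by (intro nn_integral_cong) (auto simp: g_def indicator_def)
    finally show ?thesis .
  qed
  have "ennreal (\<integral>y. \<bar>ball_sum h w y - v * w y\<bar> \<partial>lborel) = (\<integral>\<^sup>+y. ennreal \<bar>ball_sum h w y - v * w y\<bar> \<partial>lborel)"
    using i by (intro nn_integral_eq_integral[symmetric]) auto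
  also have "\<dots> \<le> (\<integral>\<^sup>+y. (\<integral>\<^sup>+z. g y z \<partial>lborel) \<partial>lborel)" by (intro nn_integral_mono pw)
  also have "\<dots> = (\<integral>\<^sup>+z. (\<integral>\<^sup>+y. g y z \<partial>lborel) \<partial>lborel)"
    by (rule pair_sigma_finite.Fubini'[of lborel lborel g, symmetric])
       (auto intro!: pair_sigma_finite.intro sigma_finite_lborel)
  also have "\<dots> \<le> (\<integral>\<^sup>+z. ennreal (h * C) * indicator B z \<partial>lborel)"
  proof (rule nn_integral_mono)
    fix z
    have "(\<integral>\<^sup>+y. g y z \<partial>lborel) = (\<integral>\<^sup>+y. ennreal \<bar>w (y + z) - w y\<bar> \<partial>lborel) * indicator B z"
      unfolding g_def by (rule nn_integral_multc) measurable
    also have "\<dots> \<le> ennreal (h * C) * indicator B z"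
    proof (cases "z \<in> B")
      case True
      have "(\<integral>\<^sup>+y. ennreal \<bar>w (y + z) - w y\<bar> \<partial>lborel) \<le> ennreal (norm z * (\<integral>x. norm (grad w x) \<partial>lborel))"
        by (rule L1_translation_bound[OF w])
      also have "\<dots> \<le> ennreal (h * C)" using True C h by (intro ennreal_leI mult_mono) (auto simp: B_def)
      finally show ?thesis using True by simp
    qed simp
    finally show "(\<integral>\<^sup>+y. g y z \<partial>lborel) \<le> ennreal (h * C) * indicator B z" .
  qed
  also have "\<dots> = ennreal (h * C) * ennreal v" by (simp add: nn_integral_cmult ev)
  also have "\<dots> = ennreal (v * (h * C))"
    using h L1_bound_nonneg by (simp add: ennreal_mult[symmetric] v_def mult.commute)
  finally show ?thesis using h L1_bound_nonneg by (subst (asm) ennreal_le_iff) (auto simp: v_def B_def)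
qed

end

text \<open>For each radius the ball averages are bounded, equi-Lipschitz and supported in a fixed
  compact set, so pointwise convergence on a countable dense set extends to all points and to L^1.
  Letting the radius shrink transfers the Cauchy property from the averages to the
  functions.\<close>

lemma rellich:
  fixes w :: "nat \<Rightarrow> nat \<Rightarrow> 'a::euclidean_space \<Rightarrow> real"
  assumes w: "\<And>n i. w n i \<in> test_funs UNIV"
    and K: "\<And>n i. supp (w n i) \<subseteq> K n" "\<And>n. compact (K n)"
    and C: "\<And>n i. (\<integral>x. \<bar>w n i x\<bar> \<partial>lborel) \<le> C n" "\<And>n i. (\<integral>x. norm (grad (w n i) x) \<partial>lborel) \<le> C n"
  obtains k :: "nat \<Rightarrow> nat" where "strict_mono k"
    "\<And>n e. 0 < e \<Longrightarrow> \<exists>N. \<forall>i\<ge>N. \<forall>j\<ge>N. (\<integral>x. \<bar>w n (k i) x - w n (k j) x\<bar> \<partial>lborel) < e"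
proof -
  obtain D :: "'a set" where D: "countable D" "\<And>X. open X \<Longrightarrow> X \<noteq> {} \<Longrightarrow> \<exists>d\<in>D. d \<in> X"
    using countable_dense_exists[where 'a = 'a] by auto
  define r where "r m = 1 / (real m + 1)" for m
  have r: "0 < r m" "r m \<le> 1" for m by (auto simp: r_def)
  have C0: "0 \<le> C n" for n using L1_bound_nonneg[OF w r(1) C] by simp
  \<comment> \<open>The normalization puts all values into [-1, 1]. Since cut-off index, radius and
    dense point together form a countable index set, one extraction covers them all.\<close>
  define f where "f i = (\<lambda>(n, m, y). ball_sum (r m) (w n i) y / (C n + 1))" for i
  have "countable (UNIV \<times> UNIV \<times> D :: (nat \<times> nat \<times> 'a) set)" using D(1) by auto
  moreover have "norm (f i x) \<le> 1" if "x \<in> (UNIV \<times> UNIV \<times> D :: (nat \<times> nat \<times> 'a) set)" for i x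
  proof -
    obtain n m y where x: "x = (n, m, y)" by (cases x)
    have "\<bar>ball_sum (r m) (w n i) y\<bar> \<le> C n" by (rule ball_sum_bound[OF w r(1) C])
    thus ?thesis using C0[of n] by (simp add: x f_def divide_le_eq)
  qed
  ultimately obtain k where k: "strict_mono (k :: nat \<Rightarrow> nat)"
    and kc: "\<And>x. x \<in> (UNIV \<times> UNIV \<times> D :: (nat \<times> nat \<times> 'a) set) \<Longrightarrow> \<exists>l. (\<lambda>i. f (k i) x) \<longlonglongrightarrow> l"
    using function_convergent_subsequence[of "UNIV \<times> UNIV \<times> D :: (nat \<times> nat \<times> 'a) set" f 1] by blast
  have dense: "Cauchy (\<lambda>i. ball_sum (r m) (w n (k i)) y)" if yD: "y \<in> D" for n m y
  proof -
    obtain l where l: "(\<lambda>i. f (k i) (n, m, y)) \<longlonglongrightarrow> l" using kc[of "(n, m, y)"] yD by auto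
    have e: "(\<lambda>i. f (k i) (n, m, y) * (C n + 1)) = (\<lambda>i. ball_sum (r m) (w n (k i)) y)"
    proof
      fix i have "C n + 1 \<noteq> 0" using C0[of n] by linarith
      thus "f (k i) (n, m, y) * (C n + 1) = ball_sum (r m) (w n (k i)) y" by (simp add: f_def)
    qed
    have "(\<lambda>i. f (k i) (n, m, y) * (C n + 1)) \<longlonglongrightarrow> l * (C n + 1)" using l by (intro tendsto_intros)
    thus ?thesis unfolding e by (rule LIMSEQ_imp_Cauchy)
  qed
  have conv: "convergent (\<lambda>i. ball_sum (r m) (w n (k i)) y)" for n m y
  proof (rule Cauchy_convergent, rule metric_CauchyI)
    fix e :: real assume e: "0 < e"
    \<comment> \<open>Passing from y to a dense point within this distance changes every average by
      at most e / 3.\<close>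
    define \<delta> where "\<delta> = e / 3 / (C n + 1)"
    have \<delta>: "0 < \<delta>" using e C0[of n] by (simp add: \<delta>_def)
    obtain d where d: "d \<in> D" "d \<in> ball y \<delta>" using D(2)[of "ball y \<delta>"] \<delta> by auto
    have "norm (y - d) * C n \<le> \<delta> * (C n + 1)" using d \<delta> C0[of n] by (intro mult_mono) (auto simp: dist_norm)
    moreover have "C n + 1 \<noteq> 0" using C0[of n] by linarith
    hence "\<delta> * (C n + 1) = e / 3" unfolding \<delta>_def by (rule nonzero_eq_divide_eq[THEN iffD1, OF _ refl])
    ultimately have dc: "norm (y - d) * C n \<le> e / 3" by linarith
    have lip: "\<bar>ball_sum (r m) (w n i) y - ball_sum (r m) (w n i) d\<bar> \<le> e / 3" for i
      using ball_sum_lipschitz[OF w r(1) C, of m n i y d] dc by linarith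
    obtain M where M: "\<And>i j. i \<ge> M \<Longrightarrow> j \<ge> M \<Longrightarrow> dist (ball_sum (r m) (w n (k i)) d) (ball_sum (r m) (w n (k j)) d) < e / 3"
      using metric_CauchyD[OF dense[OF d(1), of m n], of "e/3"] e by auto
    show "\<exists>M. \<forall>i\<ge>M. \<forall>j\<ge>M. dist (ball_sum (r m) (w n (k i)) y) (ball_sum (r m) (w n (k j)) y) < e"
    proof (intro exI allI impI)
      fix i j assume "M \<le> i" "M \<le> j"
      thus "dist (ball_sum (r m) (w n (k i)) y) (ball_sum (r m) (w n (k j)) y) < e"
        using M[of i j] lip[of "k i"] lip[of "k j"] unfolding dist_real_def by linarith
    qed
  qed
  define L where "L n m y = lim (\<lambda>i. ball_sum (r m) (w n (k i)) y)" for n m y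
  have L: "(\<lambda>i. ball_sum (r m) (w n (k i)) y) \<longlonglongrightarrow> L n m y" for n m y
    unfolding L_def using conv by (simp add: convergent_LIMSEQ_iff)
  have bm [measurable]: "ball_sum (r m) (w n i) \<in> borel_measurable borel" for n m i
    by (rule borel_measurable_continuous_onI[OF ball_sum_continuous[OF w r(1) C]])
  have Lm [measurable]: "L n m \<in> borel_measurable borel" for n m
    by (rule borel_measurable_LIMSEQ_real[OF L]) measurable
  have Llim: "integrable lborel (L n m) \<and> (\<lambda>i. \<integral>y. \<bar>ball_sum (r m) (w n (k i)) y - L n m y\<bar> \<partial>lborel) \<longlonglongrightarrow> 0" for n m
  proof -
    obtain R where R: "0 < R" "\<And>x. x \<in> K n \<Longrightarrow> norm x \<le> R"
      using compact_imp_bounded[OF K(2)[of n]] unfolding bounded_pos by auto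
    have out: "ball_sum (r m) (w n i) y = 0" if "y \<notin> cball 0 (R + 1)" for i y
    proof (rule ball_sum_outside[OF w r(1) C])
      show "supp (w n i) \<subseteq> cball 0 R" using K(1)[of n i] R by auto
      show "y \<notin> cball 0 (R + r m)" using that r(2)[of m] by auto
    qed
    have bd: "\<bar>ball_sum (r m) (w n i) y\<bar> \<le> indicator (cball 0 (R + 1)) y * C n" for i y
      using ball_sum_bound[OF w r(1) C, of m n i y] out[of y i] by (cases "y \<in> cball 0 (R + 1)") (auto simp: indicator_def)
    have Lbd: "\<bar>L n m y\<bar> \<le> indicator (cball 0 (R + 1)) y * C n" for y
      using bd by (intro LIMSEQ_le_const2[OF tendsto_rabs[OF L]]) auto
    have ii: "integrable lborel (\<lambda>y::'a. indicator (cball 0 (R + 1)) y * C n)"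
      using borel_integrable_compact[of "cball (0::'a) (R + 1)" "\<lambda>_. C n"] by simp
    have iL: "integrable lborel (L n m)"
      by (rule Bochner_Integration.integrable_bound[OF ii]) (use Lbd C0[of n] in \<open>auto\<close>)
    have "(\<lambda>i. \<integral>y. \<bar>ball_sum (r m) (w n (k i)) y - L n m y\<bar> \<partial>lborel) \<longlonglongrightarrow> integral\<^sup>L lborel (\<lambda>y::'a. 0)"
    proof (rule integral_dominated_convergence[where w = "\<lambda>y. 2 * (indicator (cball 0 (R + 1)) y * C n)"])
      show "AE y in lborel. (\<lambda>i. \<bar>ball_sum (r m) (w n (k i)) y - L n m y\<bar>) \<longlonglongrightarrow> 0"
        using L by (intro AE_I2 tendsto_rabs_zero LIM_zero)
      show "AE y in lborel. norm \<bar>ball_sum (r m) (w n (k i)) y - L n m y\<bar> \<le> 2 * (indicator (cball 0 (R + 1)) y * C n)" for i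
      proof (rule AE_I2)
        fix y
        show "norm \<bar>ball_sum (r m) (w n (k i)) y - L n m y\<bar> \<le> 2 * (indicator (cball 0 (R + 1)) y * C n)"
          using bd[of "k i" y] Lbd[of y] by simp
      qed
    qed (use ii in auto)
    thus ?thesis using iL by simp
  qed
  show ?thesis
  proof (rule that[OF k])
    fix n and e :: real assume e: "0 < e"
    \<comment> \<open>A radius for which replacing either function by its average costs a quarter of
      e (times the ball volume); the other two quarters come from the averages approaching their
      limit.\<close>
    obtain m where m: "inverse (real (Suc m)) < e / 4 / (C n + 1)"
      using reals_Archimedean[of "e / 4 / (C n + 1)"] e C0[of n] by auto
    have hC: "r m * C n < e / 4"
    proof -
      have "r m * C n \<le> r m * (C n + 1)" using r(1)[of m] by simp
      also have "r m < e / 4 / (C n + 1)" using m by (simp add: r_def inverse_eq_divide add.commute)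
      hence "r m * (C n + 1) < e / 4 / (C n + 1) * (C n + 1)" using C0[of n] by (intro mult_strict_right_mono) auto
      also have "\<dots> = e / 4"
        by (rule nonzero_eq_divide_eq[THEN iffD1, OF _ refl]) (use C0[of n] in linarith)
      finally show ?thesis .
    qed
    define v where "v = measure lborel (ball (0::'a) (r m))"
    have v: "0 < v" unfolding v_def using r(1)[of m] by (simp add: content_ball_pos)
    obtain N where N: "\<And>i. i \<ge> N \<Longrightarrow> norm ((\<integral>y. \<bar>ball_sum (r m) (w n (k i)) y - L n m y\<bar> \<partial>lborel) - 0) < v * (e / 4)"
      using LIMSEQ_D[OF conjunct2[OF Llim[of n m]], of "v * (e / 4)"] v e by auto
    show "\<exists>N. \<forall>i\<ge>N. \<forall>j\<ge>N. (\<integral>x. \<bar>w n (k i) x - w n (k j) x\<bar> \<partial>lborel) < e"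
    proof (intro exI[of _ N] allI impI)
      fix i j assume ij: "N \<le> i" "N \<le> j"
      have iw: "integrable lborel (w n l)" for l by (rule test_fun_integrable[OF w r(1) C])
      have ib: "integrable lborel (ball_sum (r m) (w n l))" for l by (rule ball_sum_L1_integrable[OF w r(1) C])
      have iL: "integrable lborel (L n m)" using Llim by blast
      define a where "a l x = \<bar>ball_sum (r m) (w n l) x - v * w n l x\<bar>" for l x
      define b where "b l x = \<bar>ball_sum (r m) (w n l) x - L n m x\<bar>" for l x
      have ia: "integrable lborel (a l)" for l unfolding a_def[abs_def] using iw ib by simp
      have ibb: "integrable lborel (b l)" for l unfolding b_def[abs_def] using iL ib by simp
      have "v * (\<integral>x. \<bar>w n (k i) x - w n (k j) x\<bar> \<partial>lborel) = (\<integral>x. v * \<bar>w n (k i) x - w n (k j) x\<bar> \<partial>lborel)" by simp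
      also have "\<dots> \<le> (\<integral>x. (a (k i) x + a (k j) x) + (b (k i) x + b (k j) x) \<partial>lborel)"
      proof (rule integral_mono)
        fix x
        have "v * \<bar>w n (k i) x - w n (k j) x\<bar> = \<bar>v * w n (k i) x - v * w n (k j) x\<bar>"
          using v by (simp add: abs_mult right_diff_distrib[symmetric])
        thus "v * \<bar>w n (k i) x - w n (k j) x\<bar> \<le> (a (k i) x + a (k j) x) + (b (k i) x + b (k j) x)"
          unfolding a_def b_def by linarith
      qed (use iw ia ibb in auto)
      also have "\<dots> = (integral\<^sup>L lborel (a (k i)) + integral\<^sup>L lborel (a (k j))) + (integral\<^sup>L lborel (b (k i)) + integral\<^sup>L lborel (b (k j)))"
        using ia ibb by simp
      also have "\<dots> < (v * (e / 4) + v * (e / 4)) + (v * (e / 4) + v * (e / 4))"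
      proof -
        have "integral\<^sup>L lborel (a l) \<le> v * (e / 4)" for l
          using ball_sum_L1_bound[OF w r(1) C, of m n l] mult_left_mono[OF less_imp_le[OF hC] less_imp_le[OF v]]
          unfolding a_def[abs_def] v_def by linarith
        moreover have "integral\<^sup>L lborel (b (k l)) < v * (e / 4)" if "N \<le> l" for l
          using N[OF that] unfolding b_def[abs_def] by simp
        ultimately show ?thesis using ij by (smt (verit))
      qed
      also have "\<dots> = v * e" by (simp add: field_simps)
      finally show "(\<integral>x. \<bar>w n (k i) x - w n (k j) x\<bar> \<partial>lborel) < e" using v by simp
    qed
  qed
qed

section \<open>Pointwise inequalities and equi-integrability\<close>

lemma powr_add_le:
  fixes a b s :: real
  assumes "0 \<le> a" "0 \<le> b" "0 \<le> s"
  shows "(a + b) powr s \<le> 2 powr s * (a powr s + b powr s)"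
proof -
  have "(a + b) powr s \<le> (2 * max a b) powr s" using assms by (intro powr_mono2) auto
  also have "\<dots> = 2 powr s * max a b powr s" by (simp add: powr_mult)
  also have "max a b powr s \<le> a powr s + b powr s" by (auto simp: max_def)
  finally show ?thesis by simp
qed

lemma powr_le_one_plus:
  fixes t a b :: real
  assumes "0 \<le> t" "0 \<le> a" "a \<le> b"
  shows "t powr a \<le> 1 + t powr b"
proof (cases "t \<le> 1")
  case True
  have "t powr a \<le> 1" using True assms powr_mono2[of a t 1] by simp
  thus ?thesis by (smt (verit) powr_ge_zero)
next
  case False
  have "t powr a \<le> t powr b" using False assms by (intro powr_mono) auto
  thus ?thesis by simp
qed

text \<open>Beyond the threshold (1/e)^(1/(b-a)) one has 1 \<le> e t^(b-a); below it t^a is bounded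
  by its value at the threshold.\<close>

lemma powr_small_exponent:
  fixes a b e :: real
  assumes "0 \<le> a" "a < b" "0 < e"
  obtains A where "0 \<le> A" "\<And>t. 0 \<le> t \<Longrightarrow> t powr a \<le> A + e * t powr b"
proof (rule that[of "((1 / e) powr (1 / (b - a))) powr a"])
  fix t :: real assume t: "0 \<le> t"
  show "t powr a \<le> ((1 / e) powr (1 / (b - a))) powr a + e * t powr b"
  proof (cases "t \<le> (1 / e) powr (1 / (b - a))")
    case True
    have "t powr a \<le> ((1 / e) powr (1 / (b - a))) powr a" using True t assms by (intro powr_mono2) auto
    thus ?thesis using assms by (smt (verit) mult_nonneg_nonneg powr_ge_zero)
  next
    case False
    have "((1 / e) powr (1 / (b - a))) powr (b - a) \<le> t powr (b - a)" using False assms by (intro powr_mono2) auto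
    hence "1 \<le> e * t powr (b - a)" using assms by (simp add: powr_powr field_simps)
    hence "t powr a * 1 \<le> t powr a * (e * t powr (b - a))" by (intro mult_left_mono) auto
    also have "\<dots> = e * t powr b" using powr_add[of t a "b - a"] by simp
    finally show ?thesis by (smt (verit) powr_ge_zero)
  qed
qed auto

text \<open>Either v \<le> e a^\<delta>, where the product is at most e a^\<sigma>, or a is bounded
  by a power of v and the product by a power of v alone. The small parameter is available even with
  equality in the exponent condition, because the large constant falls on v.\<close>

lemma potential_split:
  fixes p r \<sigma> e :: real
  assumes "1 < p" "p - 1 < \<sigma>" "1 \<le> r" "1 / r + (p - 1) / \<sigma> \<le> 1" "0 < e"
  obtains A where "0 \<le> A" "\<And>v a. 0 \<le> v \<Longrightarrow> 0 \<le> a \<Longrightarrow> v * a powr (p - 1) \<le> A * (1 + v powr r) + e * a powr \<sigma>"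
proof -
  define \<delta> where "\<delta> = \<sigma> - (p - 1)"
  have \<delta>: "0 < \<delta>" using assms by (simp add: \<delta>_def)
  have \<sigma>0: "0 < \<sigma>" using assms by simp
  have "1 / r \<le> \<delta> / \<sigma>" using assms \<sigma>0 by (simp add: \<delta>_def diff_divide_distrib)
  \<comment> \<open>\<sigma> / \<delta> is the power of v that arises in the second case, and the
    exponent condition says exactly that it does not exceed r.\<close>
  hence \<sigma>r: "\<sigma> / \<delta> \<le> r" using assms \<sigma>0 \<delta> by (simp add: field_simps)
  define A where "A = (1 / e) powr ((p - 1) / \<delta>)"
  show ?thesis
  proof (rule that[of A])
    show "0 \<le> A" by (simp add: A_def)
    fix v a :: real assume v: "0 \<le> v" and a: "0 \<le> a"
    have Ap: "0 \<le> A * (1 + v powr r)" by (simp add: A_def add_nonneg_nonneg)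
    show "v * a powr (p - 1) \<le> A * (1 + v powr r) + e * a powr \<sigma>"
    proof (cases "v \<le> e * a powr \<delta>")
      case True
      have "v * a powr (p - 1) \<le> e * a powr \<delta> * a powr (p - 1)" using True by (intro mult_right_mono) auto
      also have "\<dots> = e * a powr \<sigma>" by (simp add: \<delta>_def powr_add[symmetric])
      finally show ?thesis using Ap by linarith
    next
      case False
      hence v0: "0 < v" using assms by (smt (verit) mult_nonneg_nonneg powr_ge_zero)
      have "a powr \<delta> \<le> v / e" using False assms by (simp add: field_simps)
      hence "(a powr \<delta>) powr ((p - 1) / \<delta>) \<le> (v / e) powr ((p - 1) / \<delta>)" using assms \<delta> by (intro powr_mono2) auto
      hence "a powr (p - 1) \<le> A * v powr ((p - 1) / \<delta>)"
        using \<delta> by (simp add: powr_powr A_def powr_divide)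
      hence "v * a powr (p - 1) \<le> v * (A * v powr ((p - 1) / \<delta>))" using v by (intro mult_left_mono)
      also have "\<dots> = A * v powr (1 + (p - 1) / \<delta>)" using v0 by (simp add: powr_add)
      also have "1 + (p - 1) / \<delta> = \<sigma> / \<delta>" using \<delta> by (simp add: \<delta>_def field_simps)
      also have "A * v powr (\<sigma> / \<delta>) \<le> A * (1 + v powr r)"
        using v \<sigma>0 \<delta> \<sigma>r by (intro mult_left_mono powr_le_one_plus) (auto simp: A_def)
      finally show ?thesis using assms by (smt (verit) mult_nonneg_nonneg powr_ge_zero)
    qed
  qed
qed

section \<open>Relations between Borel, Lebesgue and restricted integrals\<close>

lemma measurable_lebesgue_on: "g \<in> borel_measurable borel \<Longrightarrow> g \<in> borel_measurable (lebesgue_on S)"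
  by (intro measurable_restrict_space1 measurable_completion) simp

lemma
  fixes g :: "'a::euclidean_space \<Rightarrow> real"
  assumes "S \<in> sets lebesgue" "g \<in> borel_measurable borel" "\<And>x. x \<notin> S \<Longrightarrow> g x = 0"
  shows integrable_lebesgue_on_iff_lborel: "integrable (lebesgue_on S) g \<longleftrightarrow> integrable lborel g"
    and integral_lebesgue_on_eq_lborel: "(\<integral>x. g x \<partial>lebesgue_on S) = (\<integral>x. g x \<partial>lborel)"
proof -
  have e: "(\<lambda>x. indicator S x * g x) = g" using assms(3) by (auto simp: indicator_def fun_eq_iff)
  show "integrable (lebesgue_on S) g \<longleftrightarrow> integrable lborel g"
    using assms by (subst integrable_restrict_space) (auto simp: e integrable_completion)
  show "(\<integral>x. g x \<partial>lebesgue_on S) = (\<integral>x. g x \<partial>lborel)"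
    using assms by (subst integral_restrict_space) (auto simp: e integral_completion)
qed

lemma
  fixes h :: "'a::euclidean_space \<Rightarrow> real"
  assumes "K \<in> sets lebesgue" "S \<in> sets lebesgue" "K \<subseteq> S"
  shows integrable_lebesgue_on_subset: "integrable (lebesgue_on K) h \<longleftrightarrow> integrable (lebesgue_on S) (\<lambda>x. indicator K x * h x)"
    and integral_lebesgue_on_subset: "(\<integral>x. h x \<partial>lebesgue_on K) = (\<integral>x. indicator K x * h x \<partial>lebesgue_on S)"
proof -
  have e: "(\<lambda>x. indicator S x * (indicator K x * h x)) = (\<lambda>x. indicator K x * h x)"
    using assms(3) by (auto simp: indicator_def fun_eq_iff)
  show "integrable (lebesgue_on K) h \<longleftrightarrow> integrable (lebesgue_on S) (\<lambda>x. indicator K x * h x)"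
    using assms by (subst (1 2) integrable_restrict_space) (auto simp: e)
  show "(\<integral>x. h x \<partial>lebesgue_on K) = (\<integral>x. indicator K x * h x \<partial>lebesgue_on S)"
    using assms by (subst (1 2) integral_restrict_space) (auto simp: e)
qed

text \<open>Equi-integrability in the manner of de la Vallee Poussin.\<close>

definition equi_int :: "'a measure \<Rightarrow> (nat \<Rightarrow> 'a \<Rightarrow> real) \<Rightarrow> bool" where
  "equi_int M H \<longleftrightarrow> (\<exists>k C. (\<forall>i. integrable M (k i) \<and> (\<forall>x. 0 \<le> k i x) \<and> integral\<^sup>L M (k i) \<le> C) \<and>
     (\<forall>e>0. \<exists>g. integrable M g \<and> (\<forall>i. AE x in M. H i x \<le> g x + e * k i x)))"

text \<open>The form in which Vitali's theorem is used: the integrands are controlled by an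
  equi-integrable sequence together with a fixed integrable function.\<close>

lemma equi_int_dominated:
  fixes h :: "nat \<Rightarrow> 'a \<Rightarrow> real"
  assumes H: "equi_int M H" and g: "integrable M g" and c: "0 \<le> c"
    and le: "\<And>i. AE x in M. \<bar>h i x\<bar> \<le> c * (H i x + g x)"
    and h: "\<And>i. h i \<in> borel_measurable M" and h0: "h0 \<in> borel_measurable M"
    and lim: "AE x in M. (\<lambda>i. h i x) \<longlonglongrightarrow> h0 x"
  shows "integrable M h0" "(\<lambda>i. integral\<^sup>L M (h i)) \<longlonglongrightarrow> integral\<^sup>L M h0"
proof -
  obtain k C where k: "\<And>i. integrable M (k i)" "\<And>i x. 0 \<le> k i x" "\<And>i. integral\<^sup>L M (k i) \<le> C"
    and dom: "\<And>e. 0 < e \<Longrightarrow> \<exists>g. integrable M g \<and> (\<forall>i. AE x in M. H i x \<le> g x + e * k i x)"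
    using H unfolding equi_int_def by blast
  have d: "\<exists>g. integrable M g \<and> (\<forall>i. AE x in M. \<bar>h i x\<bar> \<le> g x + e * k i x)" if e: "0 < e" for e
  proof -
    have e': "0 < e / (c + 1)" using e c by simp
    obtain g' where g': "integrable M g'" "\<And>i. AE x in M. H i x \<le> g' x + e / (c + 1) * k i x"
      using dom[OF e'] by blast
    have "AE x in M. \<bar>h i x\<bar> \<le> c * (g' x + g x) + e * k i x" for i
      using g'(2)[of i] le[of i]
    proof eventually_elim
      case (elim x)
      have "c * (e / (c + 1)) \<le> e" using c e by (simp add: field_simps)
      hence "c * (e / (c + 1)) * k i x \<le> e * k i x" using k(2) by (rule mult_right_mono)
      moreover have "c * (H i x + g x) \<le> c * (g' x + e / (c + 1) * k i x + g x)"
        using elim c by (intro mult_left_mono) auto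
      ultimately show ?case using elim(2) by (simp add: algebra_simps)
    qed
    thus ?thesis using g g'(1) by (intro exI[of _ "\<lambda>x. c * (g' x + g x)"]) auto
  qed
  show "integrable M h0" "(\<lambda>i. integral\<^sup>L M (h i)) \<longlonglongrightarrow> integral\<^sup>L M h0"
    using vitali_convergence[OF h h0 lim k(1) _ k(3) d] k(2) by auto
qed

lemma equi_int_bounded:
  assumes H: "equi_int M H" and i: "\<And>i. integrable M (H i)"
  obtains C where "\<And>i. integral\<^sup>L M (H i) \<le> C"
proof -
  obtain k C where k: "\<And>i. integrable M (k i)" "\<And>i x. 0 \<le> k i x" "\<And>i. integral\<^sup>L M (k i) \<le> C"
    and dom: "\<And>e. 0 < e \<Longrightarrow> \<exists>g. integrable M g \<and> (\<forall>i. AE x in M. H i x \<le> g x + e * k i x)"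
    using H unfolding equi_int_def by blast
  obtain g where g: "integrable M g" "\<And>i. AE x in M. H i x \<le> g x + 1 * k i x" using dom[of 1] by auto
  show ?thesis
  proof (rule that)
    fix j
    have "integral\<^sup>L M (H j) \<le> (\<integral>x. g x + 1 * k j x \<partial>M)" using i g k by (intro integral_mono_AE) auto
    also have "\<dots> \<le> integral\<^sup>L M g + C" using g k by simp
    finally show "integral\<^sup>L M (H j) \<le> integral\<^sup>L M g + C" .
  qed
qed

section \<open>Calculus of gradients and the smooth truncation\<close>

lemma grad_add:
  "smooth_fun u \<Longrightarrow> smooth_fun v \<Longrightarrow> grad (\<lambda>x. u x + v x) x = grad u x + grad v x"
  by (rule grad_eqI, rule has_derivative_eq_rhs[OF has_derivative_add[OF smooth_has_derivative smooth_has_derivative]])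
     (auto simp: inner_add_left)

lemma grad_cmult: "smooth_fun u \<Longrightarrow> grad (\<lambda>x. c * u x) x = c *\<^sub>R grad u x"
  by (rule grad_eqI, rule has_derivative_eq_rhs[OF has_derivative_mult_right[OF smooth_has_derivative]]) auto

lemma grad_comb:
  "smooth_fun u \<Longrightarrow> smooth_fun v \<Longrightarrow> grad (\<lambda>x. a * u x + b * v x) x = a *\<^sub>R grad u x + b *\<^sub>R grad v x"
  by (simp add: grad_add smooth_cmult grad_cmult)

lemma grad_diff: "smooth_fun u \<Longrightarrow> smooth_fun v \<Longrightarrow> grad (\<lambda>x. u x - v x) x = grad u x - grad v x"
  using grad_comb[of u v 1 "-1" x] by simp

lemma grad_mult:
  "smooth_fun u \<Longrightarrow> smooth_fun v \<Longrightarrow> grad (\<lambda>x. u x * v x) x = u x *\<^sub>R grad v x + v x *\<^sub>R grad u x"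
  by (rule grad_eqI, rule has_derivative_eq_rhs[OF has_derivative_mult[OF smooth_has_derivative smooth_has_derivative]])
     (auto simp: inner_add_left)

lemma grad_tanh_scaled:
  assumes "smooth_fun u" "0 < \<delta>"
  shows "grad (\<lambda>x. \<delta> * tanh (u x / \<delta>)) x = (1 - (tanh (u x / \<delta>))\<^sup>2) *\<^sub>R grad u x"
proof (rule grad_eqI)
  have 1: "((\<lambda>s. \<delta> * tanh (s / \<delta>)) has_real_derivative (1 - (tanh (u x / \<delta>))\<^sup>2)) (at (u x))"
    using assms(2) by (auto intro!: derivative_eq_intros simp: cosh_real_nonzero)
  have "((\<lambda>x. \<delta> * tanh (u x / \<delta>)) has_derivative (\<lambda>h. (1 - (tanh (u x / \<delta>))\<^sup>2) * (grad u x \<bullet> h))) (at x)"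
    using has_derivative_compose[OF smooth_has_derivative[OF assms(1)] 1[unfolded has_field_derivative_def]] by simp
  thus "((\<lambda>x. \<delta> * tanh (u x / \<delta>)) has_derivative (\<bullet>) ((1 - (tanh (u x / \<delta>))\<^sup>2) *\<^sub>R grad u x)) (at x)"
    by (rule has_derivative_eq_rhs) (simp add: fun_eq_iff)
qed

lemma smooth_tanh_scaled: "smooth_fun u \<Longrightarrow> smooth_fun (\<lambda>x. \<delta> * tanh (u x / \<delta>))"
  using smooth_cmult[OF smooth_compose[OF smooth_tanh smooth_cmult[of u "1/\<delta>"]], of \<delta>] by simp

text \<open>Since |tanh y| \<le> |y| with equal signs, the truncation is a multiple t s with t in
  [0, 1]. Shifting two values towards each other by part of their truncated difference is then a
  convex combination of them.\<close>

lemma tanh_scaled_bounds: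
  fixes s \<delta> :: real
  assumes "0 < \<delta>"
  obtains t where "0 \<le> t" "t \<le> 1" "\<delta> * tanh (s / \<delta>) = t * s" "\<bar>\<delta> * tanh (s / \<delta>)\<bar> \<le> \<delta>"
proof -
  have le: "\<bar>tanh y\<bar> \<le> \<bar>y\<bar>" for y :: real
  proof -
    have *: "tanh y \<le> y" if "0 \<le> y" for y :: real
    proof -
      have "(\<lambda>x. x - tanh x) 0 \<le> (\<lambda>x. x - tanh x) y"
      proof (rule DERIV_nonneg_imp_nondecreasing[OF that])
        fix x :: real assume "0 \<le> x" "x \<le> y"
        show "\<exists>d. ((\<lambda>x. x - tanh x) has_real_derivative d) (at x) \<and> 0 \<le> d"
          by (rule exI[of _ "(tanh x)\<^sup>2"]) (auto intro!: derivative_eq_intros simp: cosh_real_nonzero)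
      qed
      thus ?thesis by simp
    qed
    show ?thesis using *[of y] *[of "-y"] by (cases "0 \<le> y") auto
  qed
  define t where "t = (if s = 0 then 0 else \<delta> * tanh (s / \<delta>) / s)"
  have "0 \<le> tanh (s / \<delta>) * s" using assms by (cases "0 \<le> s") (auto simp: zero_le_mult_iff divide_le_0_iff)
  moreover have "t = \<delta> * (tanh (s / \<delta>) * s) / (s * s)" by (simp add: t_def)
  ultimately have 1: "0 \<le> t" using assms by (metis divide_nonneg_nonneg less_imp_le mult_nonneg_nonneg zero_le_square)
  have "\<bar>\<delta> * tanh (s / \<delta>)\<bar> \<le> \<bar>s\<bar>" using le[of "s / \<delta>"] assms by (simp add: abs_mult field_simps)
  moreover have 3: "\<delta> * tanh (s / \<delta>) = t * s" by (simp add: t_def)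
  ultimately have "t * \<bar>s\<bar> \<le> 1 * \<bar>s\<bar>" using 1 by (simp add: abs_mult)
  hence 2: "t \<le> 1" by (cases "s = 0") (simp add: t_def, simp)
  have "\<bar>tanh (s / \<delta>)\<bar> \<le> 1" using tanh_real_bounds[of "s/\<delta>"] by (auto simp: abs_le_iff)
  hence "\<bar>\<delta> * tanh (s / \<delta>)\<bar> \<le> \<delta>" using assms by (simp add: abs_mult)
  thus ?thesis using that 1 2 3 by blast
qed

lemma one_minus_tanh_sq_bounds:
  fixes y :: real
  shows "0 < 1 - (tanh y)\<^sup>2" "1 - (tanh y)\<^sup>2 \<le> 1" "\<bar>y\<bar> \<le> 1 \<Longrightarrow> 1 - (tanh 1)\<^sup>2 \<le> 1 - (tanh y)\<^sup>2"
proof -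
  have "\<bar>tanh y\<bar> < 1" using tanh_real_bounds[of y] by auto
  thus "0 < 1 - (tanh y)\<^sup>2" using abs_square_less_1[of "tanh y"] by simp
  show "1 - (tanh y)\<^sup>2 \<le> 1" by simp
  assume "\<bar>y\<bar> \<le> 1"
  hence "\<bar>tanh y\<bar> \<le> tanh 1"
    using tanh_real_le_iff[of "\<bar>y\<bar>" 1] by (cases "0 \<le> y") auto
  thus "1 - (tanh 1)\<^sup>2 \<le> 1 - (tanh y)\<^sup>2" using power_mono[of "\<bar>tanh y\<bar>" "tanh 1" 2] by simp
qed

section \<open>The variational problem\<close>

text \<open>Local integrability by means of indicators over the one measure on \<Omega>, so that all
  limit theorems are applied to the same measure space.\<close>

definition loc_int :: "'a::euclidean_space set \<Rightarrow> ('a \<Rightarrow> real) \<Rightarrow> bool" where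
  "loc_int \<Omega> h \<longleftrightarrow> h \<in> borel_measurable (lebesgue_on \<Omega>) \<and>
     (\<forall>K. compact K \<longrightarrow> K \<subseteq> \<Omega> \<longrightarrow> integrable (lebesgue_on \<Omega>) (\<lambda>x. indicator K x * \<bar>h x\<bar>))"

lemma loc_int_mult:
  fixes g :: "'a::euclidean_space \<Rightarrow> real"
  assumes h: "loc_int \<Omega> h" and g: "continuous_on UNIV g" and K: "compact K" "K \<subseteq> \<Omega>" and z: "\<And>x. x \<notin> K \<Longrightarrow> g x = 0"
  shows "integrable (lebesgue_on \<Omega>) (\<lambda>x. h x * g x)"
proof -
  obtain L where L: "0 < L" "\<And>x. norm (g x) \<le> L"
    using compact_support_bounded[of K g, OF continuous_on_subset[OF g] K(1) z] by auto
  have "integrable (lebesgue_on \<Omega>) (\<lambda>x. L * (indicator K x * \<bar>h x\<bar>))"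
    using h K by (simp add: loc_int_def)
  thus ?thesis
  proof (rule Bochner_Integration.integrable_bound)
    show "(\<lambda>x. h x * g x) \<in> borel_measurable (lebesgue_on \<Omega>)"
      using h measurable_lebesgue_on[OF borel_measurable_continuous_onI[OF g], of \<Omega>]
      by (intro borel_measurable_times) (auto simp: loc_int_def)
    show "AE x in lebesgue_on \<Omega>. norm (h x * g x) \<le> norm (L * (indicator K x * \<bar>h x\<bar>))"
    proof (rule AE_I2)
      fix x
      show "norm (h x * g x) \<le> norm (L * (indicator K x * \<bar>h x\<bar>))"
      proof (cases "x \<in> K")
        case True
        have "\<bar>h x\<bar> * \<bar>g x\<bar> \<le> \<bar>h x\<bar> * L" using L(2)[of x] by (intro mult_left_mono) auto
        thus ?thesis using True L(1) by (simp add: abs_mult mult.commute)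
      qed (simp add: z)
    qed
  qed
qed

lemma loc_int_bounded:
  assumes "\<Omega> \<in> sets lebesgue" "h \<in> borel_measurable (lebesgue_on \<Omega>)"
    and bd: "\<And>K. compact K \<Longrightarrow> K \<subseteq> \<Omega> \<Longrightarrow> \<exists>L. \<forall>x\<in>K. \<bar>h x\<bar> \<le> L"
  shows "loc_int \<Omega> h"
  unfolding loc_int_def
proof (intro conjI allI impI)
  fix K assume K: "compact K" "K \<subseteq> \<Omega>"
  obtain L where L: "\<And>x. x \<in> K \<Longrightarrow> \<bar>h x\<bar> \<le> L" using bd[OF K] by blast
  have Kl: "K \<in> sets lebesgue" using K(1) by (simp add: compact_imp_closed borel_closed)
  have iL: "integrable (lebesgue_on \<Omega>) (\<lambda>x. indicator K x * L)"
  proof -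
    have "integrable lborel (\<lambda>x. indicator K x * L)"
      using borel_integrable_compact[OF K(1), of "\<lambda>_. L"] by simp
    thus ?thesis using K assms(1) by (subst integrable_lebesgue_on_iff_lborel) (auto simp: compact_imp_closed borel_closed indicator_def)
  qed
  have Km: "(indicator K :: _ \<Rightarrow> real) \<in> borel_measurable (lebesgue_on \<Omega>)"
    using K(1) by (intro measurable_lebesgue_on borel_measurable_indicator) (simp add: compact_imp_closed borel_closed)
  show "integrable (lebesgue_on \<Omega>) (\<lambda>x. indicator K x * \<bar>h x\<bar>)"
  proof (rule Bochner_Integration.integrable_bound[OF iL])
    show "(\<lambda>x. indicator K x * \<bar>h x\<bar>) \<in> borel_measurable (lebesgue_on \<Omega>)"
      using Km assms(2) by (intro borel_measurable_times borel_measurable_abs)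
    show "AE x in lebesgue_on \<Omega>. norm (indicator K x * \<bar>h x\<bar>) \<le> norm (indicator K x * L)"
      using L by (intro AE_I2) (auto simp: indicator_def intro: order_trans[OF _ abs_ge_self])
  qed
qed (fact assms(2))

text \<open>(1 - \<theta>) G + \<theta> H lies on the segment from G to the midpoint, at fraction 2
  \<theta>. Convexity on both halves of the segment gives the gain, and \<theta> \<le> 1/2 keeps
  each point in its own half.\<close>

lemma theta_gap:
  fixes G H :: "'b::real_inner"
  assumes p: "1 < p" and t: "0 \<le> \<theta>" "\<theta> \<le> 1/2"
  shows "norm ((1 - \<theta>) *\<^sub>R G + \<theta> *\<^sub>R H) powr p + norm ((1 - \<theta>) *\<^sub>R H + \<theta> *\<^sub>R G) powr p
    \<le> norm G powr p + norm H powr p - 2 * \<theta> * gap p G H"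
proof -
  define m where "m = (1/2) *\<^sub>R (G + H)"
  have e: "(1 - \<theta>) *\<^sub>R X + \<theta> *\<^sub>R Y = (1 - 2 * \<theta>) *\<^sub>R X + (2 * \<theta>) *\<^sub>R ((1/2) *\<^sub>R (X + Y))" for X Y :: 'b
    by (simp add: scaleR_add_right scaleR_left_diff_distrib scaleR_left_distrib[symmetric] algebra_simps)
  have 1: "norm ((1 - \<theta>) *\<^sub>R G + \<theta> *\<^sub>R H) powr p \<le> (1 - 2 * \<theta>) * norm G powr p + 2 * \<theta> * norm m powr p"
    unfolding e m_def by (rule norm_powr_convex[OF p]) (use t in auto)
  have 2: "norm ((1 - \<theta>) *\<^sub>R H + \<theta> *\<^sub>R G) powr p \<le> (1 - 2 * \<theta>) * norm H powr p + 2 * \<theta> * norm m powr p"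
    unfolding e m_def add.commute[of G H] by (rule norm_powr_convex[OF p]) (use t in auto)
  have gp: "gap p G H = norm G powr p + norm H powr p - 2 * norm m powr p" by (simp add: gap_def m_def)
  have "2 * \<theta> * gap p G H = 2 * \<theta> * norm G powr p + 2 * \<theta> * norm H powr p - 2 * (2 * \<theta> * norm m powr p)"
    unfolding gp by (simp add: algebra_simps)
  thus ?thesis using 1 2 unfolding left_diff_distrib mult_1 by linarith
qed

locale problem =
  fixes \<Omega> :: "'a::euclidean_space set" and V W :: "'a \<Rightarrow> real"
    and f :: "('a \<Rightarrow> real) \<Rightarrow> real" and p q r :: real
  assumes p: "1 < p" and open_\<Omega>: "open \<Omega>"
    and Q_pos: "\<And>u. u \<in> test_funs \<Omega> \<Longrightarrow> u \<noteq> (\<lambda>x. 0) \<Longrightarrow> 0 < Q_fun p \<Omega> V u"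
    and q: "1 < q" "q \<le> p" "p - 1 < q"
    and r_low: "real DIM('a) < q \<Longrightarrow> r = 1"
    and r_eq: "real DIM('a) = q \<Longrightarrow> 1 < r"
    and r_high: "real DIM('a) > q \<Longrightarrow> 1 / r + (p - 1) / sobolev_conj TYPE('a) q = 1"
    and V_loc: "L_loc r \<Omega> V"
    and W: "continuous_on \<Omega> W" "\<And>x. x \<in> \<Omega> \<Longrightarrow> 0 < W x"
    and Q_lower: "\<And>u. u \<in> test_funs \<Omega> \<Longrightarrow> W_energy q \<Omega> W u powr (p / q) \<le> Q_fun p \<Omega> V u"
    and f: "distribution \<Omega> f"
    and f_sup: "(SUP u\<in>{u \<in> test_funs \<Omega>. Q_fun p \<Omega> V u = 1}. ereal (f u)) < \<infinity>"
begin

abbreviation "M \<equiv> lebesgue_on \<Omega>"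
abbreviation "Q \<equiv> Q_fun p \<Omega> V"

lemma \<Omega>_sets: "\<Omega> \<in> sets lebesgue" using open_\<Omega> by simp

lemma sobolev_conj_gt: "real DIM('a) > q \<Longrightarrow> q < sobolev_conj TYPE('a) q"
  using q by (simp add: sobolev_conj_def field_simps)

lemma r_ge_1: "1 \<le> r"
proof -
  consider "real DIM('a) < q" | "real DIM('a) = q" | "real DIM('a) > q" by linarith
  thus ?thesis
  proof cases
    case 3
    have s: "p - 1 < sobolev_conj TYPE('a) q" using sobolev_conj_gt[OF 3] q by linarith
    have "0 < (p - 1) / sobolev_conj TYPE('a) q" "(p - 1) / sobolev_conj TYPE('a) q < 1" using s p by auto
    hence "0 < 1 / r" "1 / r < 1" using r_high[OF 3] by linarith+
    thus ?thesis by (simp add: divide_less_eq split: if_splits)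
  qed (use r_low r_eq in auto)
qed

lemma V_measurable [measurable]: "V \<in> borel_measurable M" using V_loc by (simp add: L_loc_def)

lemma compact_sets: "compact K \<Longrightarrow> K \<in> sets lebesgue"
  by (simp add: compact_imp_closed borel_closed)

lemma indicator_measurable: "compact K \<Longrightarrow> (indicator K :: 'a \<Rightarrow> real) \<in> borel_measurable M"
  by (intro measurable_lebesgue_on borel_measurable_indicator) (simp add: compact_imp_closed borel_closed)

lemma loc_int_1: "loc_int \<Omega> (\<lambda>x. 1)"
  by (rule loc_int_bounded[OF \<Omega>_sets]) (auto intro: exI[of _ 1])

lemma indicator_integrable: "compact K \<Longrightarrow> K \<subseteq> \<Omega> \<Longrightarrow> integrable M (indicator K :: 'a \<Rightarrow> real)"
  using loc_int_1 by (simp add: loc_int_def)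

lemma V_powr_integrable: "compact K \<Longrightarrow> K \<subseteq> \<Omega> \<Longrightarrow> integrable M (\<lambda>x. indicator K x * \<bar>V x\<bar> powr r)"
  using V_loc integrable_lebesgue_on_subset[OF compact_sets \<Omega>_sets, of K "\<lambda>x. \<bar>V x\<bar> powr r"]
  by (simp add: L_loc_def)

lemma loc_int_V: "loc_int \<Omega> V"
  unfolding loc_int_def
proof (intro conjI allI impI)
  fix K assume K: "compact K" "K \<subseteq> \<Omega>"
  have i: "integrable M (\<lambda>x. indicator K x + indicator K x * \<bar>V x\<bar> powr r)"
    using K by (intro Bochner_Integration.integrable_add V_powr_integrable indicator_integrable)
  show "integrable M (\<lambda>x. indicator K x * \<bar>V x\<bar>)"
  proof (rule Bochner_Integration.integrable_bound[OF i])
    show "(\<lambda>x. indicator K x * \<bar>V x\<bar>) \<in> borel_measurable M"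
      using indicator_measurable[OF K(1)] by (intro borel_measurable_times borel_measurable_abs V_measurable)
    show "AE x in M. norm (indicator K x * \<bar>V x\<bar>) \<le> norm (indicator K x + indicator K x * \<bar>V x\<bar> powr r)"
      using powr_le_one_plus[of "\<bar>V _\<bar>" 1 r] r_ge_1 by (intro AE_I2) (auto simp: indicator_def)
  qed
qed simp

lemma loc_int_W: "loc_int \<Omega> W"
proof (rule loc_int_bounded[OF \<Omega>_sets])
  show "W \<in> borel_measurable M"
    using W(1) \<Omega>_sets by (rule continuous_imp_measurable_on_sets_lebesgue)
  fix K assume K: "compact K" "K \<subseteq> \<Omega>"
  have "bounded (W ` K)" using K W(1) by (intro compact_imp_bounded compact_continuous_image) (auto intro: continuous_on_subset)
  thus "\<exists>L. \<forall>x\<in>K. \<bar>W x\<bar> \<le> L" unfolding bounded_iff by auto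
qed

lemma M_integrable:
  fixes g :: "'a \<Rightarrow> real"
  shows "continuous_on UNIV g \<Longrightarrow> compact K \<Longrightarrow> K \<subseteq> \<Omega> \<Longrightarrow> (\<And>x. x \<notin> K \<Longrightarrow> g x = 0) \<Longrightarrow> integrable M g"
  using loc_int_mult[OF loc_int_1, of g K] by simp

lemma continuous_grad_powr: "u \<in> test_funs \<Omega> \<Longrightarrow> 0 < s \<Longrightarrow> continuous_on UNIV (\<lambda>x. norm (grad u x) powr s)"
  by (intro continuous_norm_powr continuous_grad test_funs_smooth)

lemma continuous_abs_powr: "u \<in> test_funs \<Omega> \<Longrightarrow> 0 < s \<Longrightarrow> continuous_on UNIV (\<lambda>x. \<bar>u x\<bar> powr s)"
  using continuous_norm_powr[OF smooth_continuous[OF test_funs_smooth], of u \<Omega> s UNIV] by simp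

lemma grad_powr_integrable: "u \<in> test_funs \<Omega> \<Longrightarrow> 0 < s \<Longrightarrow> integrable M (\<lambda>x. norm (grad u x) powr s)"
  by (rule M_integrable[OF continuous_grad_powr test_funs_compact test_funs_supp]) (auto simp: grad_outside)

lemma abs_powr_integrable: "u \<in> test_funs \<Omega> \<Longrightarrow> 0 < s \<Longrightarrow> integrable M (\<lambda>x. \<bar>u x\<bar> powr s)"
  by (rule M_integrable[OF continuous_abs_powr test_funs_compact test_funs_supp]) (auto simp: test_fun_outside)

lemma V_abs_powr_integrable: "u \<in> test_funs \<Omega> \<Longrightarrow> 0 < s \<Longrightarrow> integrable M (\<lambda>x. V x * \<bar>u x\<bar> powr s)"
  by (rule loc_int_mult[OF loc_int_V continuous_abs_powr test_funs_compact test_funs_supp]) (auto simp: test_fun_outside)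

lemma weighted_gap_integrable:
  assumes \<psi>: "\<psi> \<in> test_funs \<Omega>" and "a \<in> test_funs \<Omega>" "b \<in> test_funs \<Omega>"
  shows "integrable M (\<lambda>x. \<psi> x * (1 - (tanh ((a x - b x) / \<delta>))\<^sup>2) * gap p (grad a x) (grad b x))"
proof (rule M_integrable[OF _ test_funs_compact[OF \<psi>] test_funs_supp[OF \<psi>]])
  have sab: "smooth_fun a" "smooth_fun b" using assms by (auto intro: test_funs_smooth)
  have "continuous_on UNIV (\<lambda>x. gap p (grad a x) (grad b x))"
    unfolding gap_def using p
    by (intro continuous_on_add continuous_on_diff continuous_on_mult continuous_on_const continuous_norm_powr
        continuous_on_scaleR continuous_grad sab) auto
  moreover have "continuous_on UNIV (\<lambda>x. tanh ((1 / \<delta>) * (a x - b x)))"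
    by (intro smooth_continuous smooth_compose[OF smooth_tanh] smooth_cmult smooth_diff sab)
  hence "continuous_on UNIV (\<lambda>x. 1 - (tanh ((1 / \<delta>) * (a x - b x)))\<^sup>2)"
    by (intro continuous_on_diff continuous_on_const continuous_on_power)
  hence "continuous_on UNIV (\<lambda>x. 1 - (tanh ((a x - b x) / \<delta>))\<^sup>2)" by simp
  ultimately show "continuous_on UNIV (\<lambda>x. \<psi> x * (1 - (tanh ((a x - b x) / \<delta>))\<^sup>2) * gap p (grad a x) (grad b x))"
    by (intro continuous_on_mult smooth_continuous[OF test_funs_smooth[OF \<psi>]])
qed (simp add: test_fun_outside)

lemma W_lower_bound:
  assumes K: "compact K" "K \<subseteq> \<Omega>"
  obtains c where "0 < c" "\<And>x. x \<in> K \<Longrightarrow> c \<le> W x"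
proof -
  have "\<exists>c>0. \<forall>x\<in>K. c \<le> W x"
  proof (cases "K = {}")
    case False
    then obtain x where "x \<in> K" "\<forall>y\<in>K. W x \<le> W y"
      using continuous_attains_inf[OF K(1) _ continuous_on_subset[OF W(1) K(2)]] by blast
    thus ?thesis using W(2)[of x] K(2) by blast
  qed (auto intro: exI[of _ 1])
  thus ?thesis using that by blast
qed

lemma test_grad_measurable: "u \<in> test_funs \<Omega> \<Longrightarrow> grad u \<in> borel_measurable borel"
  and test_measurable: "u \<in> test_funs \<Omega> \<Longrightarrow> u \<in> borel_measurable borel"
  by (auto intro!: borel_measurable_continuous_onI continuous_grad smooth_continuous test_funs_smooth)

section \<open>Coercivity of the functional and a minimizing sequence\<close>

lemma Q_scale:
  assumes "u \<in> test_funs \<Omega>" "0 < c"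
  shows "Q (\<lambda>x. c * u x) = c powr p * Q u"
  using assms test_funs_smooth[OF assms(1)]
  by (simp add: Q_fun_def grad_cmult powr_mult abs_mult mult.left_commute[of "V _"] right_diff_distrib)

lemma f_comb: "u \<in> test_funs \<Omega> \<Longrightarrow> v \<in> test_funs \<Omega> \<Longrightarrow> f (\<lambda>x. a * u x + b * v x) = a * f u + b * f v"
  using f unfolding distribution_def by blast

lemma zero_test: "(\<lambda>x. 0) \<in> test_funs \<Omega>"
  by (rule test_funsI[of _ "{}"]) (auto intro: smooth_const)

lemma f_0: "f (\<lambda>x. 0) = 0" using f_comb[OF zero_test zero_test, of 0 0] by simp

lemma f_cmult: "u \<in> test_funs \<Omega> \<Longrightarrow> f (\<lambda>x. c * u x) = c * f u"
  using f_comb[of u u c 0] by simp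

lemma grad_zero: "grad (\<lambda>x. 0) x = 0"
  by (rule grad_eqI) simp

lemma Q_0: "Q (\<lambda>x. 0) = 0" by (simp add: Q_fun_def grad_zero)

lemma Q_nonneg: "u \<in> test_funs \<Omega> \<Longrightarrow> 0 \<le> Q u"
  using Q_pos[of u] Q_0 by (cases "u = (\<lambda>x. 0)") (auto simp: less_imp_le)

text \<open>Normalize u by the factor Q(u)^(-1/p), which is possible by the strict positivity of Q.
  The maximum with 0 ensures a nonnegative constant, whatever the sign of the supremum.\<close>

lemma f_bounded:
  obtains C where "0 \<le> C" "\<And>u. u \<in> test_funs \<Omega> \<Longrightarrow> f u \<le> C * Q u powr (1 / p)"
proof -
  define s where "s = (SUP u\<in>{u \<in> test_funs \<Omega>. Q u = 1}. ereal (f u))"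
  have s: "ereal (f u) \<le> s" if "u \<in> test_funs \<Omega>" "Q u = 1" for u
    unfolding s_def using that by (intro SUP_upper) auto
  have "s \<noteq> \<infinity>" using f_sup by (simp add: s_def)
  have "\<exists>c. \<forall>u. u \<in> test_funs \<Omega> \<longrightarrow> Q u = 1 \<longrightarrow> f u \<le> c"
  proof (cases s)
    case (real c) thus ?thesis using s by auto
  next
    case MInf thus ?thesis using s by (metis MInfty_neq_ereal(1) ereal_infty_less_eq(2))
  qed (use \<open>s \<noteq> \<infinity>\<close> in simp)
  then obtain c where c: "\<And>u. u \<in> test_funs \<Omega> \<Longrightarrow> Q u = 1 \<Longrightarrow> f u \<le> c" by blast
  show ?thesis
  proof (rule that[of "max c 0"])
    fix u assume u: "u \<in> test_funs \<Omega>"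
    show "f u \<le> max c 0 * Q u powr (1 / p)"
    proof (cases "u = (\<lambda>x. 0)")
      case True thus ?thesis using f_0 Q_0 by simp
    next
      case False
      have Qu: "0 < Q u" using Q_pos[OF u False] .
      define t where "t = Q u powr (- (1 / p))"
      have t: "0 < t" using Qu by (simp add: t_def)
      have v: "(\<lambda>x. t * u x) \<in> test_funs \<Omega>" using test_funs_comb[OF u u, of t 0] by simp
      have "Q (\<lambda>x. t * u x) = t powr p * Q u" by (rule Q_scale[OF u t])
      also have "t powr p = Q u powr (- (1 / p) * p)" by (simp only: t_def powr_powr)
      also have "- (1 / p) * p = -1" using p by simp
      also have "Q u powr (-1) * Q u = 1" using Qu by (simp add: powr_minus)
      finally have "t * f u \<le> max c 0" using c[OF v] f_cmult[OF u, of t] by simp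
      hence "f u \<le> max c 0 / t" using t by (simp add: field_simps)
      also have "\<dots> = max c 0 * Q u powr (1 / p)" by (simp add: t_def powr_minus divide_inverse)
      finally show ?thesis .
    qed
  qed simp
qed

lemma minimizing_sequence:
  obtains U B where "\<And>i::nat. U i \<in> test_funs \<Omega>"
    "\<And>i v. v \<in> test_funs \<Omega> \<Longrightarrow> Q (U i) / p - f (U i) \<le> Q v / p - f v + 1 / (real i + 1)"
    "\<And>i. Q (U i) \<le> B"
proof -
  obtain C where C: "0 \<le> C" "\<And>u. u \<in> test_funs \<Omega> \<Longrightarrow> f u \<le> C * Q u powr (1 / p)" using f_bounded by blast
  \<comment> \<open>Young's parameter: l^(1-p) = 1 / (2 p C + 1), so f absorbs at most half of Q / p
    and the functional is at least Q / (2 p) - C l.\<close>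
  define l where "l = (2 * p * C + 1) powr (1 / (p - 1))"
  have pC: "0 < 2 * p * C + 1" using p C by (smt (verit) mult_nonneg_nonneg)
  have l: "0 < l" using pC by (simp add: l_def)
  have lp: "C * l powr (1 - p) \<le> 1 / (2 * p)"
  proof -
    have "1 / (p - 1) * (1 - p) = -1" using p by (simp add: field_simps)
    hence "l powr (1 - p) = 1 / (2 * p * C + 1)" using pC by (simp add: l_def powr_powr powr_minus_divide)
    moreover have "C * (1 / (2 * p * C + 1)) \<le> 1 / (2 * p)" using pC p by (simp add: field_simps)
    ultimately show ?thesis by simp
  qed
  have fQ: "f u \<le> C * l + Q u / (2 * p)" if u: "u \<in> test_funs \<Omega>" for u
  proof -
    have "Q u powr (1 / p) \<le> l + l powr (1 - p) * (Q u powr (1 / p)) powr p"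
      using p l by (intro le_split_powr) auto
    also have "(Q u powr (1 / p)) powr p = Q u" using Q_nonneg[OF u] p by (simp add: powr_powr)
    finally have "C * Q u powr (1 / p) \<le> C * (l + l powr (1 - p) * Q u)" using C by (intro mult_left_mono)
    also have "\<dots> = C * l + C * l powr (1 - p) * Q u" by (simp add: algebra_simps)
    also have "\<dots> \<le> C * l + 1 / (2 * p) * Q u" using lp Q_nonneg[OF u] by (intro add_left_mono mult_right_mono)
    finally show ?thesis using C(2)[OF u] by simp
  qed
  define S where "S = (\<lambda>u. Q u / p - f u) ` test_funs \<Omega>"
  have half: "Q u / p - Q u / (2 * p) = Q u / (2 * p)" for u using p by (simp add: field_simps)
  have low: "Q u / (2 * p) - C * l \<le> Q u / p - f u" if "u \<in> test_funs \<Omega>" for u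
    using fQ[OF that] half[of u] by linarith
  have bdd: "bdd_below S"
  proof (rule bdd_belowI[of _ "- (C * l)"])
    fix y assume "y \<in> S"
    then obtain u where u: "u \<in> test_funs \<Omega>" "y = Q u / p - f u" by (auto simp: S_def)
    have "0 \<le> Q u / (2 * p)" using Q_nonneg[OF u(1)] p by simp
    thus "- (C * l) \<le> y" using low[OF u(1)] u(2) by linarith
  qed
  have ne: "S \<noteq> {}" using zero_test by (auto simp: S_def)
  have "\<exists>u\<in>test_funs \<Omega>. Q u / p - f u < Inf S + 1 / (real i + 1)" for i :: nat
  proof -
    have "Inf S < Inf S + 1 / (real i + 1)" by simp
    then obtain y where "y \<in> S" "y < Inf S + 1 / (real i + 1)" using cInf_less_iff[OF ne bdd] by blast
    thus ?thesis unfolding S_def by blast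
  qed
  then obtain U where U: "\<And>i. U i \<in> test_funs \<Omega>" "\<And>i::nat. Q (U i) / p - f (U i) < Inf S + 1 / (real i + 1)" by metis
  have inf: "Inf S \<le> Q v / p - f v" if "v \<in> test_funs \<Omega>" for v
    using that bdd by (intro cInf_lower) (auto simp: S_def)
  show ?thesis
  \<comment> \<open>The infimum is at most the value 0 of the functional at the zero function, so
    its value along \<open>U\<close> is at most 1, and coercivity bounds Q.\<close>
  proof (rule that[of U "2 * p * (1 + C * l)"])
    show "U i \<in> test_funs \<Omega>" for i by (rule U)
    show "Q (U i) / p - f (U i) \<le> Q v / p - f v + 1 / (real i + 1)" if "v \<in> test_funs \<Omega>" for i v
      using U(2)[of i] inf[OF that] by linarith
    show "Q (U i) \<le> 2 * p * (1 + C * l)" for i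
    proof -
      have "Inf S \<le> 0" using inf[OF zero_test] Q_0 f_0 by simp
      moreover have "1 / (real i + 1) \<le> 1" by simp
      ultimately have "Q (U i) / (2 * p) \<le> 1 + C * l"
        using U(2)[of i] \<open>Inf S \<le> 0\<close> low[OF U(1)[of i]] by linarith
      thus ?thesis using p by (simp add: field_simps)
    qed
  qed
qed

end

text \<open>Almost minimality is stated against every test function rather than through the infimum;
  in this form it is inherited by subsequences and can be tested directly with perturbations of
  \<open>U i\<close>.\<close>

locale minseq = problem +
  fixes U :: "nat \<Rightarrow> 'a \<Rightarrow> real" and B :: real
  assumes U: "\<And>i. U i \<in> test_funs \<Omega>"
    and U_min: "\<And>i v. v \<in> test_funs \<Omega> \<Longrightarrow> Q (U i) / p - f (U i) \<le> Q v / p - f v + 1 / (real i + 1)"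
    and U_bound: "\<And>i. Q (U i) \<le> B"
begin

lemma minseq_subseq:
  assumes "strict_mono k"
  shows "minseq \<Omega> V W f p q r (\<lambda>i. U (k i)) B"
proof
  fix i v assume v: "v \<in> test_funs \<Omega>"
  have "1 / (real (k i) + 1) \<le> 1 / (real i + 1)"
    using seq_suble[OF assms, of i] by (intro divide_left_mono) auto
  thus "Q (U (k i)) / p - f (U (k i)) \<le> Q v / p - f v + 1 / (real i + 1)"
    using U_min[OF v, of "k i"] by linarith
qed (use U U_bound in auto)

lemma W_energy_bound: "W_energy q \<Omega> W (U i) \<le> B powr (q / p)"
proof -
  have nn: "0 \<le> W_energy q \<Omega> W (U i)"
    unfolding W_energy_def using W(2)
    by (intro integral_nonneg_AE AE_I2) (auto simp: space_restrict_space less_imp_le)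
  have "W_energy q \<Omega> W (U i) = (W_energy q \<Omega> W (U i) powr (p / q)) powr (q / p)"
    using nn p q by (simp add: powr_powr)
  also have "\<dots> \<le> B powr (q / p)"
    using Q_lower[OF U[of i]] U_bound[of i] p q by (intro powr_mono2) auto
  finally show ?thesis .
qed

definition en :: "nat \<Rightarrow> 'a \<Rightarrow> real" where
  "en i x = norm (grad (U i) x) powr q + \<bar>U i x\<bar> powr q"

lemma en_nonneg: "0 \<le> en i x" by (simp add: en_def)

lemma en_continuous: "continuous_on UNIV (en i)"
  unfolding en_def using q by (intro continuous_on_add continuous_grad_powr continuous_abs_powr U) auto

lemma en_integrable: "integrable M (en i)"
  unfolding en_def[abs_def] using q
  by (intro Bochner_Integration.integrable_add grad_powr_integrable abs_powr_integrable U) auto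

lemma indicator_mult_integrable:
  fixes g :: "'a \<Rightarrow> real"
  assumes "compact K" "integrable M g"
  shows "integrable M (\<lambda>x. indicator K x * g x)"
proof (rule Bochner_Integration.integrable_bound[OF assms(2)])
  show "(\<lambda>x. indicator K x * g x) \<in> borel_measurable M"
    using assms by (intro borel_measurable_times indicator_measurable) auto
qed (auto simp: indicator_def)

text \<open>Here the weighted bound becomes an unweighted local one, because W is continuous and
  positive and thus bounded below on compact sets.\<close>

lemma local_energy_bound:
  assumes K: "compact K" "K \<subseteq> \<Omega>"
  obtains C where "0 \<le> C" "\<And>i. (\<integral>x. indicator K x * en i x \<partial>M) \<le> C"
proof -
  obtain c where c: "0 < c" "\<And>x. x \<in> K \<Longrightarrow> c \<le> W x" using W_lower_bound[OF K] by blast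
  show ?thesis
  proof (rule that[of "B powr (q / p) / c"])
    show "0 \<le> B powr (q / p) / c" using c by simp
    fix i
    have iW: "integrable M (\<lambda>x. en i x * W x)"
      using loc_int_mult[OF loc_int_W en_continuous test_funs_compact[OF U] test_funs_supp[OF U], of i i]
      by (simp add: en_def grad_outside test_fun_outside mult.commute)
    have "c * (\<integral>x. indicator K x * en i x \<partial>M) = (\<integral>x. c * (indicator K x * en i x) \<partial>M)" by simp
    also have "\<dots> \<le> (\<integral>x. en i x * W x \<partial>M)"
    proof (rule integral_mono_AE)
      show "integrable M (\<lambda>x. c * (indicator K x * en i x))"
        using indicator_mult_integrable[OF K(1) en_integrable] by simp
      show "AE x in M. c * (indicator K x * en i x) \<le> en i x * W x"
      proof (rule AE_I2)
        fix x assume "x \<in> space M"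
        hence x: "x \<in> \<Omega>" by (simp add: space_restrict_space)
        show "c * (indicator K x * en i x) \<le> en i x * W x"
        proof (cases "x \<in> K")
          case True
          have "c * en i x \<le> W x * en i x" using c(2)[OF True] en_nonneg by (intro mult_right_mono)
          thus ?thesis using True by (simp add: mult.commute)
        next
          case False
          thus ?thesis using W(2)[OF x] en_nonneg[of i x] by simp
        qed
      qed
    qed (fact iW)
    also have "\<dots> = W_energy q \<Omega> W (U i)" by (simp add: W_energy_def en_def)
    also have "\<dots> \<le> B powr (q / p)" by (rule W_energy_bound)
    finally show "(\<integral>x. indicator K x * en i x \<partial>M) \<le> B powr (q / p) / c" using c(1) by (simp add: field_simps)
  qed
qed

lemma cutoff_test: "\<psi> \<in> test_funs \<Omega> \<Longrightarrow> (\<lambda>x. \<psi> x * U i x) \<in> test_funs \<Omega>"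
  by (intro test_funs_mult test_funs_smooth[OF U])

lemma lborel_eq_M:
  fixes g :: "'a \<Rightarrow> real"
  assumes "continuous_on UNIV g" "\<And>x. x \<notin> \<Omega> \<Longrightarrow> g x = 0"
  shows "(\<integral>x. g x \<partial>lborel) = (\<integral>x. g x \<partial>M)"
  using integral_lebesgue_on_eq_lborel[OF \<Omega>_sets borel_measurable_continuous_onI[OF assms(1)] assms(2)] by simp

lemma cutoff_bound:
  assumes \<psi>: "\<psi> \<in> test_funs \<Omega>"
  obtains C where "\<And>i. (\<integral>x. norm (grad (\<lambda>x. \<psi> x * U i x) x) powr q \<partial>lborel) \<le> C"
    "\<And>i. (\<integral>x. \<bar>\<psi> x * U i x\<bar> powr q \<partial>lborel) \<le> C"
proof -
  obtain L where L: "0 < L" "\<And>x. \<bar>\<psi> x\<bar> \<le> L" "\<And>x. norm (grad \<psi> x) \<le> L" using test_fun_bounded[OF \<psi>] by blast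
  have K: "compact (supp \<psi>)" "supp \<psi> \<subseteq> \<Omega>" using \<psi> by (auto intro: test_funs_compact dest: test_funs_supp)
  obtain C where C: "0 \<le> C" "\<And>i. (\<integral>x. indicator (supp \<psi>) x * en i x \<partial>M) \<le> C" using local_energy_bound[OF K] by blast
  define D where "D = L powr q * 2 powr q"
  have D: "0 \<le> D" by (simp add: D_def)
  have gr: "grad (\<lambda>x. \<psi> x * U i x) x = \<psi> x *\<^sub>R grad (U i) x + U i x *\<^sub>R grad \<psi> x" for i x
    by (rule grad_mult[OF test_funs_smooth[OF \<psi>] test_funs_smooth[OF U]])
  have b1: "norm (grad (\<lambda>x. \<psi> x * U i x) x) powr q \<le> D * (indicator (supp \<psi>) x * en i x)" for i x
  proof (cases "x \<in> supp \<psi>")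
    case True
    have "norm (grad (\<lambda>x. \<psi> x * U i x) x) \<le> \<bar>\<psi> x\<bar> * norm (grad (U i) x) + \<bar>U i x\<bar> * norm (grad \<psi> x)"
      unfolding gr by (rule order_trans[OF norm_triangle_ineq]) simp
    also have "\<dots> \<le> L * norm (grad (U i) x) + \<bar>U i x\<bar> * L"
      using L by (intro add_mono mult_right_mono mult_left_mono) auto
    also have "\<dots> = L * (norm (grad (U i) x) + \<bar>U i x\<bar>)" by (simp add: algebra_simps)
    finally have "norm (grad (\<lambda>x. \<psi> x * U i x) x) powr q \<le> (L * (norm (grad (U i) x) + \<bar>U i x\<bar>)) powr q"
      using q by (intro powr_mono2) auto
    also have "\<dots> = L powr q * (norm (grad (U i) x) + \<bar>U i x\<bar>) powr q" by (simp add: powr_mult)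
    also have "\<dots> \<le> L powr q * (2 powr q * en i x)"
      unfolding en_def using q by (intro mult_left_mono powr_add_le) auto
    finally show ?thesis using True by (simp add: D_def mult.assoc)
  next
    case False
    thus ?thesis by (simp add: gr test_fun_outside grad_outside)
  qed
  have b2: "\<bar>\<psi> x * U i x\<bar> powr q \<le> D * (indicator (supp \<psi>) x * en i x)" for i x
  proof (cases "x \<in> supp \<psi>")
    case True
    have "\<bar>\<psi> x * U i x\<bar> powr q \<le> (L * \<bar>U i x\<bar>) powr q"
      using L q by (intro powr_mono2) (auto simp: abs_mult mult_right_mono)
    also have "\<dots> = L powr q * (1 * \<bar>U i x\<bar> powr q)" using L by (simp add: powr_mult)
    also have "\<dots> \<le> L powr q * (2 powr q * en i x)"
      using q by (intro mult_left_mono mult_mono ge_one_powr_ge_zero) (auto simp: en_def)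
    finally show ?thesis using True by (simp add: D_def mult.assoc)
  next
    case False
    thus ?thesis by (simp add: test_fun_outside)
  qed
  have bi: "(\<integral>x. g x \<partial>lborel) \<le> D * C"
    if g: "continuous_on UNIV g" "\<And>x. g x \<le> D * (indicator (supp \<psi>) x * en i x)" "\<And>x. 0 \<le> g x" for g and i
  proof -
    have z: "g x = 0" if "x \<notin> supp \<psi>" for x using g(2,3)[of x] that by auto
    have "(\<integral>x. g x \<partial>lborel) = (\<integral>x. g x \<partial>M)" using z K(2) by (intro lborel_eq_M g) auto
    also have "\<dots> \<le> (\<integral>x. D * (indicator (supp \<psi>) x * en i x) \<partial>M)"
      using indicator_mult_integrable[OF K(1) en_integrable]
      by (intro integral_mono g M_integrable[OF g(1) K z]) auto
    also have "\<dots> \<le> D * C" using C(2)[of i] D by (simp add: mult_left_mono)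
    finally show ?thesis .
  qed
  show ?thesis
  proof (rule that[of "D * C"])
    show "(\<integral>x. norm (grad (\<lambda>x. \<psi> x * U i x) x) powr q \<partial>lborel) \<le> D * C" for i
      using q by (intro bi[of _ i] b1 continuous_grad_powr cutoff_test \<psi>) auto
    show "(\<integral>x. \<bar>\<psi> x * U i x\<bar> powr q \<partial>lborel) \<le> D * C" for i
      using q by (intro bi[of _ i] b2 continuous_abs_powr[OF cutoff_test[OF \<psi>]]) auto
  qed
qed

text \<open>On a set of finite measure t^s \<le> 1 + t^q passes the bound to smaller exponents. It
  is needed with s = 1 for Rellich's theorem and with some s < q when q equals the
  dimension.\<close>

lemma cutoff_bound_lower:
  assumes \<psi>: "\<psi> \<in> test_funs \<Omega>" and s: "0 < s" "s \<le> q"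
  obtains C where "\<And>i. (\<integral>x. norm (grad (\<lambda>x. \<psi> x * U i x) x) powr s \<partial>lborel) \<le> C"
    "\<And>i. (\<integral>x. \<bar>\<psi> x * U i x\<bar> powr s \<partial>lborel) \<le> C"
proof -
  obtain C where C: "\<And>i. (\<integral>x. norm (grad (\<lambda>x. \<psi> x * U i x) x) powr q \<partial>lborel) \<le> C"
    "\<And>i. (\<integral>x. \<bar>\<psi> x * U i x\<bar> powr q \<partial>lborel) \<le> C" using cutoff_bound[OF \<psi>] by blast
  note K = test_funs_compact[OF \<psi>]
  have iK: "integrable lborel (indicator (supp \<psi>) :: 'a \<Rightarrow> real)"
    using borel_integrable_compact[OF K, of "\<lambda>_. 1::real"] by simp
  have b: "(\<integral>x. t x powr s \<partial>lborel) \<le> (\<integral>x. indicator (supp \<psi>) x \<partial>lborel) + C"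
    if t: "integrable lborel (\<lambda>x. t x powr q)" "integrable lborel (\<lambda>x. t x powr s)" "\<And>x. 0 \<le> t x" "\<And>x. x \<notin> supp \<psi> \<Longrightarrow> t x = 0"
      "(\<integral>x. t x powr q \<partial>lborel) \<le> C" for t
  proof -
    have "(\<integral>x. t x powr s \<partial>lborel) \<le> (\<integral>x. indicator (supp \<psi>) x + t x powr q \<partial>lborel)"
    proof (rule integral_mono)
      show "t x powr s \<le> indicator (supp \<psi>) x + t x powr q" for x
        using powr_le_one_plus[OF t(3), of s q x] s t(4)[of x] by (cases "x \<in> supp \<psi>") auto
    qed (use iK t in auto)
    thus ?thesis using iK t by simp
  qed
  have z: "x \<notin> supp \<psi> \<Longrightarrow> \<psi> x * U i x = 0" "x \<notin> supp \<psi> \<Longrightarrow> grad (\<lambda>x. \<psi> x * U i x) x = 0" for i x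
    by (auto simp: grad_mult[OF test_funs_smooth[OF \<psi>] test_funs_smooth[OF U]] test_fun_outside grad_outside)
  have i1: "integrable lborel (\<lambda>x. norm (grad (\<lambda>x. \<psi> x * U i x) x) powr a)" if "0 < a" for a i
    using that by (intro integrable_lborel_compact_support[OF _ K] continuous_grad_powr cutoff_test \<psi>) (auto simp: z)
  have i2: "integrable lborel (\<lambda>x. \<bar>\<psi> x * U i x\<bar> powr a)" if "0 < a" for a i
    using that by (intro integrable_lborel_compact_support[OF _ K] continuous_abs_powr[OF cutoff_test[OF \<psi>]]) (auto simp: z)
  show ?thesis
    by (rule that) (use s q in \<open>auto intro!: b i1 i2 C simp: z\<close>)
qed

end

section \<open>The convexity gap along a minimizing sequence\<close>

context minseq
begin

text \<open>The local energy densities serve as the L^1-bounded sequence, so anything growing more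
  slowly than the energy is equi-integrable on K.\<close>

lemma equi_int_energyI:
  assumes K: "compact K" "K \<subseteq> \<Omega>"
    and H: "\<And>e. 0 < e \<Longrightarrow> \<exists>A. \<forall>i. \<forall>x\<in>K. H i x \<le> A + e * en i x"
    and z: "\<And>i x. x \<notin> K \<Longrightarrow> H i x = 0"
  shows "equi_int M H"
proof -
  obtain C where C: "0 \<le> C" "\<And>i. (\<integral>x. indicator K x * en i x \<partial>M) \<le> C" using local_energy_bound[OF K] by blast
  have "\<exists>g. integrable M g \<and> (\<forall>i. AE x in M. H i x \<le> g x + e * (indicator K x * en i x))" if e: "0 < e" for e
  proof -
    obtain A where A: "\<And>i x. x \<in> K \<Longrightarrow> H i x \<le> A + e * en i x" using H[OF e] by blast
    have "integrable M (\<lambda>x. indicator K x * A)" by (intro integrable_mult_left indicator_integrable[OF K])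
    moreover have "H i x \<le> indicator K x * A + e * (indicator K x * en i x)" for i x
      using A[of x i] z[of x i] by (cases "x \<in> K") auto
    ultimately show ?thesis by blast
  qed
  thus ?thesis unfolding equi_int_def
    using C indicator_mult_integrable[OF K(1) en_integrable] en_nonneg
    by (intro exI[of _ "\<lambda>i x. indicator K x * en i x"] exI[of _ C]) auto
qed

lemma equi_int_grad:
  assumes K: "compact K" "K \<subseteq> \<Omega>" and s: "0 \<le> s" "s < q"
  shows "equi_int M (\<lambda>i x. indicator K x * norm (grad (U i) x) powr s)"
proof (rule equi_int_energyI[OF K])
  fix e :: real assume e: "0 < e"
  obtain A where A: "\<And>t. 0 \<le> t \<Longrightarrow> t powr s \<le> A + e * t powr q" using powr_small_exponent[OF s e] by metis
  have "norm (grad (U i) x) powr s \<le> A + e * en i x" for i x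
  proof -
    have "e * norm (grad (U i) x) powr q \<le> e * en i x" using e by (intro mult_left_mono) (auto simp: en_def)
    thus ?thesis using A[of "norm (grad (U i) x)"] by simp
  qed
  thus "\<exists>A. \<forall>i. \<forall>x\<in>K. indicator K x * norm (grad (U i) x) powr s \<le> A + e * en i x" by auto
qed auto

lemma equi_int_abs:
  assumes K: "compact K" "K \<subseteq> \<Omega>" and s: "0 \<le> s" "s < q"
  shows "equi_int M (\<lambda>i x. indicator K x * \<bar>U i x\<bar> powr s)"
proof (rule equi_int_energyI[OF K])
  fix e :: real assume e: "0 < e"
  obtain A where A: "\<And>t. 0 \<le> t \<Longrightarrow> t powr s \<le> A + e * t powr q" using powr_small_exponent[OF s e] by metis
  have "\<bar>U i x\<bar> powr s \<le> A + e * en i x" for i x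
  proof -
    have "e * \<bar>U i x\<bar> powr q \<le> e * en i x" using e by (intro mult_left_mono) (auto simp: en_def)
    thus ?thesis using A[of "\<bar>U i x\<bar>"] by simp
  qed
  thus "\<exists>A. \<forall>i. \<forall>x\<in>K. indicator K x * \<bar>U i x\<bar> powr s \<le> A + e * en i x" by auto
qed auto

text \<open>Below the dimension s = q is taken, with its Sobolev conjugate. At q = N the Sobolev
  inequality is applied with some s < N whose conjugate is large; r > 1 leaves room for
  that.\<close>

lemma sobolev_exponents:
  assumes "q \<le> real DIM('a)"
  obtains s \<sigma> where "1 < s" "s \<le> q" "s < real DIM('a)" "\<sigma> = real DIM('a) * s / (real DIM('a) - s)"
    "p - 1 < \<sigma>" "1 / r + (p - 1) / \<sigma> \<le> 1"
proof (cases "q = real DIM('a)")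
  case False
  hence lt: "real DIM('a) > q" using assms by simp
  show ?thesis
    using that[of q "sobolev_conj TYPE('a) q"] q lt sobolev_conj_gt[OF lt] r_high[OF lt]
    by (auto simp: sobolev_conj_def)
next
  case True
  define N where "N = real DIM('a)"
  have N: "1 < N" "N = q" using True q by (auto simp: N_def)
  have "2 \<le> DIM('a)" using N by (simp add: N_def)
  hence N2: "2 \<le> N" by (simp add: N_def)
  have r1: "1 < r" using r_eq True by simp
  \<comment> \<open>The first entry is the threshold for 1 / r + (p - 1) / \<sigma> \<le> 1; the
    second gives p - 1 < \<sigma> and, as N < \<sigma>, also s > 1.\<close>
  define \<sigma> where "\<sigma> = max ((p - 1) * r / (r - 1)) (N + p)"
  have \<sigma>: "N + p \<le> \<sigma>" "(p - 1) * r / (r - 1) \<le> \<sigma>" by (auto simp: \<sigma>_def)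
  have \<sigma>0: "0 < \<sigma>" using \<sigma> N p by linarith
  \<comment> \<open>The exponent whose Sobolev conjugate is \<sigma>.\<close>
  define s where "s = N * \<sigma> / (N + \<sigma>)"
  have "N + \<sigma> < 2 * \<sigma>" using \<sigma> p by linarith
  also have "2 * \<sigma> \<le> N * \<sigma>" using N2 \<sigma>0 by (intro mult_right_mono) auto
  finally have s1: "1 < s" using N \<sigma>0 by (simp add: s_def)
  have sN: "s < N" using N \<sigma>0 by (simp add: s_def field_simps)
  have Ns: "N - s = N * N / (N + \<sigma>)" using N \<sigma>0 by (simp add: s_def field_simps)
  have "N * s / (N - s) = \<sigma>" unfolding Ns using N \<sigma>0 by (simp add: s_def)
  moreover have "1 / r + (p - 1) / \<sigma> \<le> 1"
  proof -
    have "(p - 1) * r \<le> \<sigma> * (r - 1)" using \<sigma>(2) r1 by (simp add: divide_le_eq)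
    hence "(p - 1) / \<sigma> \<le> (r - 1) / r" using \<sigma>0 r1 by (simp add: divide_le_eq field_simps)
    thus ?thesis using r1 by (simp add: diff_divide_distrib)
  qed
  ultimately show ?thesis using that[of s \<sigma>] s1 sN N \<sigma> p by (simp add: N_def)
qed

text \<open>For N < q Morrey's bound makes the sequence uniformly bounded on K, and a multiple of
  the locally integrable V dominates. Otherwise the powers |U i|^\<sigma> from Sobolev's inequality
  play the role of the L^1-bounded sequence.\<close>

lemma equi_int_V:
  assumes K: "compact K" "K \<subseteq> \<Omega>"
  shows "equi_int M (\<lambda>i x. indicator K x * (\<bar>V x\<bar> * \<bar>U i x\<bar> powr (p - 1)))"
proof -
  obtain \<psi> c where \<psi>: "\<psi> \<in> test_funs \<Omega>" "\<And>x. 0 \<le> \<psi> x" "\<And>x. \<psi> x \<le> 1" "0 < c" "\<And>x. x \<in> K \<Longrightarrow> c \<le> \<psi> x"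
    using cutoff_exists[OF open_\<Omega> K] by blast
  have wt: "(\<lambda>x. \<psi> x * U i x) \<in> test_funs UNIV" for i by (rule test_funs_UNIV[OF cutoff_test[OF \<psi>(1)]])
  have Uw: "\<bar>U i x\<bar> \<le> \<bar>\<psi> x * U i x\<bar> / c" if "x \<in> K" for i x
  proof -
    have "c * \<bar>U i x\<bar> \<le> \<bar>\<psi> x\<bar> * \<bar>U i x\<bar>" using \<psi>(5)[OF that] by (intro mult_right_mono) auto
    thus ?thesis using \<psi>(4) by (simp add: abs_mult field_simps)
  qed
  show ?thesis
  proof (cases "real DIM('a) < q")
    case True
    obtain C where C: "\<And>i. (\<integral>x. norm (grad (\<lambda>x. \<psi> x * U i x) x) powr q \<partial>lborel) \<le> C"
      "\<And>i. (\<integral>x. \<bar>\<psi> x * U i x\<bar> powr q \<partial>lborel) \<le> C" using cutoff_bound[OF \<psi>(1)] by blast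
    obtain D where D: "\<And>(w :: 'a \<Rightarrow> real) x. w \<in> test_funs UNIV \<Longrightarrow> (\<integral>x. norm (grad w x) powr q \<partial>lborel) \<le> C \<Longrightarrow>
       (\<integral>x. \<bar>w x\<bar> powr q \<partial>lborel) \<le> C \<Longrightarrow> \<bar>w x\<bar> \<le> D" using morrey_bound[OF q(1) True] by blast
    have UD: "\<bar>U i x\<bar> powr (p - 1) \<le> (D / c) powr (p - 1)" if "x \<in> K" for i x
    proof (rule powr_mono2)
      have "\<bar>\<psi> x * U i x\<bar> / c \<le> D / c" using D[OF wt C] \<psi>(4) by (intro divide_right_mono) auto
      thus "\<bar>U i x\<bar> \<le> D / c" using Uw[OF that, of i] by linarith
    qed (use p in auto)
    have "integrable M (\<lambda>x. (D / c) powr (p - 1) * (indicator K x * \<bar>V x\<bar>))"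
      using loc_int_V K by (simp add: loc_int_def)
    moreover have "indicator K x * (\<bar>V x\<bar> * \<bar>U i x\<bar> powr (p - 1)) \<le> (D / c) powr (p - 1) * (indicator K x * \<bar>V x\<bar>)" for i x
      using mult_left_mono[OF UD[of x i], of "\<bar>V x\<bar>"] by (auto simp: indicator_def mult.commute)
    ultimately show ?thesis unfolding equi_int_def
      by (intro exI[of _ "\<lambda>_ _. 0"] exI[of _ 0] conjI allI impI exI[of _ "\<lambda>x. (D / c) powr (p - 1) * (indicator K x * \<bar>V x\<bar>)"]) auto
  next
    case False
    obtain s \<sigma> where s: "1 < s" "s \<le> q" "s < real DIM('a)" and \<sigma>: "\<sigma> = real DIM('a) * s / (real DIM('a) - s)"
      "p - 1 < \<sigma>" "1 / r + (p - 1) / \<sigma> \<le> 1" using sobolev_exponents False by (metis not_less)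
    have \<sigma>0: "0 < \<sigma>" using \<sigma> p by linarith
    obtain C where C: "\<And>i. (\<integral>x. norm (grad (\<lambda>x. \<psi> x * U i x) x) powr s \<partial>lborel) \<le> C"
      "\<And>i. (\<integral>x. \<bar>\<psi> x * U i x\<bar> powr s \<partial>lborel) \<le> C"
      using cutoff_bound_lower[OF \<psi>(1) order.strict_trans[OF zero_less_one s(1)] s(2)] by blast
    obtain D where D: "\<And>w :: 'a \<Rightarrow> real. w \<in> test_funs UNIV \<Longrightarrow> (\<integral>x. norm (grad w x) powr s \<partial>lborel) \<le> C \<Longrightarrow>
      (\<integral>x. \<bar>w x\<bar> powr \<sigma> \<partial>lborel) \<le> D" using sobolev_bound[OF s(1,3), of C] unfolding \<sigma>(1)[symmetric] by blast
    define k where "k i x = (1 / c) powr \<sigma> * \<bar>\<psi> x * U i x\<bar> powr \<sigma>" for i x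
    have ki: "integrable M (k i)" for i
      unfolding k_def[abs_def] using abs_powr_integrable[OF cutoff_test[OF \<psi>(1)] \<sigma>0, of i] by simp
    have kC: "(\<integral>x. k i x \<partial>M) \<le> (1 / c) powr \<sigma> * D" for i
    proof -
      have "(\<integral>x. \<bar>\<psi> x * U i x\<bar> powr \<sigma> \<partial>lborel) = (\<integral>x. \<bar>\<psi> x * U i x\<bar> powr \<sigma> \<partial>M)"
        by (rule lborel_eq_M[OF continuous_abs_powr[OF cutoff_test[OF \<psi>(1)] \<sigma>0]])
           (use test_funs_supp[OF \<psi>(1)] test_fun_outside[of _ \<psi>] in auto)
      hence "(\<integral>x. \<bar>\<psi> x * U i x\<bar> powr \<sigma> \<partial>M) \<le> D" using D[OF wt C(1), of i] by simp
      hence "(1 / c) powr \<sigma> * (\<integral>x. \<bar>\<psi> x * U i x\<bar> powr \<sigma> \<partial>M) \<le> (1 / c) powr \<sigma> * D" by (intro mult_left_mono) auto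
      thus ?thesis by (simp add: k_def)
    qed
    have "\<exists>g. integrable M g \<and> (\<forall>i. AE x in M. indicator K x * (\<bar>V x\<bar> * \<bar>U i x\<bar> powr (p - 1)) \<le> g x + e * k i x)"
      if e: "0 < e" for e
    proof -
      obtain A where A: "0 \<le> A" "\<And>v a. 0 \<le> v \<Longrightarrow> 0 \<le> a \<Longrightarrow> v * a powr (p - 1) \<le> A * (1 + v powr r) + e * a powr \<sigma>"
        using potential_split[OF p \<sigma>(2) r_ge_1 \<sigma>(3) e] by blast
      have "indicator K x * (\<bar>V x\<bar> * \<bar>U i x\<bar> powr (p - 1)) \<le> A * (indicator K x + indicator K x * \<bar>V x\<bar> powr r) + e * k i x" for i x
      proof (cases "x \<in> K")
        case True
        have "\<bar>U i x\<bar> powr \<sigma> \<le> (\<bar>\<psi> x * U i x\<bar> / c) powr \<sigma>" using Uw[OF True] \<sigma>0 by (intro powr_mono2) auto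
        also have "\<dots> = k i x" by (simp add: k_def powr_divide)
        finally have "e * \<bar>U i x\<bar> powr \<sigma> \<le> e * k i x" using e by (intro mult_left_mono) auto
        thus ?thesis using A(2)[of "\<bar>V x\<bar>" "\<bar>U i x\<bar>"] True by simp
      next
        case False
        thus ?thesis using e by (simp add: k_def)
      qed
      thus ?thesis using indicator_integrable[OF K] V_powr_integrable[OF K]
        by (intro exI[of _ "\<lambda>x. A * (indicator K x + indicator K x * \<bar>V x\<bar> powr r)"]) auto
    qed
    moreover have "0 \<le> k i x" for i x by (simp add: k_def)
    ultimately show ?thesis unfolding equi_int_def using ki kC
      by (intro exI[of _ k] exI[of _ "(1 / c) powr \<sigma> * D"]) blast
  qed
qed

lemma local_grad_integrable:
  "compact K \<Longrightarrow> 0 < s \<Longrightarrow> integrable M (\<lambda>x. indicator K x * norm (grad (U i) x) powr s)"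
  by (rule indicator_mult_integrable[OF _ grad_powr_integrable[OF U]])

lemma local_V_integrable:
  assumes K: "compact K" "K \<subseteq> \<Omega>"
  shows "integrable M (\<lambda>x. indicator K x * (\<bar>V x\<bar> * \<bar>U i x\<bar> powr (p - 1)))"
proof -
  have "integrable M (\<lambda>x. indicator K x * \<bar>V x * \<bar>U i x\<bar> powr (p - 1)\<bar>)"
    using p by (intro indicator_mult_integrable[OF K(1)] integrable_abs V_abs_powr_integrable U) auto
  thus ?thesis by (simp add: abs_mult)
qed

text \<open>The distribution \<open>f\<close> cancels when \<open>U i\<close> and \<open>U j\<close> are moved towards each other by the
  same test function \<open>v\<close>, and the gradient energy gains the convexity gap.\<close>

lemma gap_estimate:
  assumes \<psi>: "\<psi> \<in> test_funs \<Omega>" "\<And>x. 0 \<le> \<psi> x" "\<And>x. \<psi> x \<le> 1"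
  obtains C where "0 \<le> C" "\<And>i j \<delta>. 0 < \<delta> \<Longrightarrow> \<delta> \<le> 1 \<Longrightarrow>
    (\<integral>x. \<psi> x * (1 - (tanh ((U i x - U j x) / \<delta>))\<^sup>2) * gap p (grad (U i) x) (grad (U j) x) \<partial>M)
      \<le> C * (\<delta> + 1 / (real i + 1) + 1 / (real j + 1))"
proof -
  define K where "K = supp \<psi>"
  have K: "compact K" "K \<subseteq> \<Omega>"
    unfolding K_def by (rule test_funs_compact[OF \<psi>(1)], rule test_funs_supp[OF \<psi>(1)])
  obtain L where L': "0 < L" "\<And>x. \<bar>\<psi> x\<bar> \<le> L" "\<And>x. norm (grad \<psi> x) \<le> L"
    using test_fun_bounded[OF \<psi>(1)] by blast
  note L = L'(1,3)
  obtain Cg where Cg: "\<And>i. (\<integral>x. indicator K x * norm (grad (U i) x) powr (p - 1) \<partial>M) \<le> Cg"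
    using equi_int_bounded[OF equi_int_grad[OF K, of "p - 1"] local_grad_integrable[OF K(1)]] p q by auto
  obtain Cv where Cv: "\<And>i. (\<integral>x. indicator K x * (\<bar>V x\<bar> * \<bar>U i x\<bar> powr (p - 1)) \<partial>M) \<le> Cv"
    using equi_int_bounded[OF equi_int_V[OF K] local_V_integrable[OF K]] by blast
  define mK where "mK = (\<integral>x. indicator K x * L powr (p - 1) \<partial>M)"
  \<comment> \<open>Bounds the integral of the growth factor (|G| + |H| + L)^(p-1) over K, uniformly
    in both indices.\<close>
  define E where "E = 2 powr (p - 1) * (2 powr (p - 1) * (Cg + Cg) + mK)"
  have Cg0: "0 \<le> Cg" using Cg[of 0] by (rule order_trans[OF integral_nonneg_AE, rotated]) auto
  have Cv0: "0 \<le> Cv" using Cv[of 0] by (rule order_trans[OF integral_nonneg_AE, rotated]) auto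
  have mK0: "0 \<le> mK" unfolding mK_def by (intro integral_nonneg_AE) auto
  have E0: "0 \<le> E" using Cg0 mK0 by (simp add: E_def)
  define C where "C = p * (1 + L * E + (Cv + Cv))"
  have C: "p \<le> C" "p * L * E + p * (Cv + Cv) \<le> C" "0 \<le> C"
  proof -
    have "0 \<le> p * (L * E)" "0 \<le> p * (Cv + Cv)" using p L E0 Cv0 by auto
    thus "p \<le> C" "p * L * E + p * (Cv + Cv) \<le> C" "0 \<le> C" using p by (auto simp: C_def algebra_simps)
  qed
  show ?thesis
  proof (rule that[OF C(3)])
    fix i j :: nat and \<delta> :: real assume \<delta>: "0 < \<delta>" "\<delta> \<le> 1"
    define a where "a = U i"
    define b where "b = U j"
    have ab: "a \<in> test_funs \<Omega>" "b \<in> test_funs \<Omega>" using U by (auto simp: a_def b_def)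
    have sab: "smooth_fun a" "smooth_fun b" using ab by (auto intro: test_funs_smooth)
    define T where "T x = \<delta> * tanh ((a x - b x) / \<delta>)" for x
    define \<tau> where "\<tau> x = 1 - (tanh ((a x - b x) / \<delta>))\<^sup>2" for x
    have sT: "smooth_fun T" unfolding T_def[abs_def] by (rule smooth_tanh_scaled[OF smooth_diff[OF sab]])
    have gT: "grad T x = \<tau> x *\<^sub>R (grad a x - grad b x)" for x
      unfolding T_def[abs_def] \<tau>_def using grad_tanh_scaled[OF smooth_diff[OF sab] \<delta>(1)] by (simp add: grad_diff[OF sab])
    have \<tau>: "0 < \<tau> x" "\<tau> x \<le> 1" for x unfolding \<tau>_def by (rule one_minus_tanh_sq_bounds)+
    define v where "v x = \<psi> x * T x" for x
    have v: "v \<in> test_funs \<Omega>" unfolding v_def[abs_def] by (rule test_funs_mult[OF \<psi>(1) sT])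
    have sv: "smooth_fun v" using v by (rule test_funs_smooth)
    have gv: "grad v x = (\<psi> x * \<tau> x) *\<^sub>R (grad a x - grad b x) + T x *\<^sub>R grad \<psi> x" for x
      unfolding v_def[abs_def] by (simp add: grad_mult[OF test_funs_smooth[OF \<psi>(1)] sT] gT)
    \<comment> \<open>The two competitors. Their sum is a + b, so by linearity f takes the same
      total value.\<close>
    define a' where "a' x = 1 * a x + (-1/2) * v x" for x
    define b' where "b' x = 1 * b x + (1/2) * v x" for x
    have ab': "a' \<in> test_funs \<Omega>" "b' \<in> test_funs \<Omega>"
      unfolding a'_def[abs_def] b'_def[abs_def] by (intro test_funs_comb ab v)+
    have f': "f a' + f b' = f a + f b"
      unfolding a'_def[abs_def] b'_def[abs_def] f_comb[OF ab(1) v] f_comb[OF ab(2) v] by simp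
    have ga': "grad a' x = grad a x - (1/2) *\<^sub>R grad v x" for x
      unfolding a'_def[abs_def] using grad_comb[OF sab(1) sv, of 1 "-1/2" x] by simp
    have gb': "grad b' x = grad b x + (1/2) *\<^sub>R grad v x" for x
      unfolding b'_def[abs_def] using grad_comb[OF sab(2) sv, of 1 "1/2" x] by simp
    define \<eta> where "\<eta> = 1 / (real i + 1) + 1 / (real j + 1)"
    have "Q a / p + Q b / p \<le> Q a' / p + Q b' / p + \<eta>"
      using U_min[OF ab'(1), of i] U_min[OF ab'(2), of j] f' by (simp add: a_def b_def \<eta>_def)
    hence "p * (Q a / p + Q b / p) \<le> p * (Q a' / p + Q b' / p + \<eta>)" using p by (intro mult_left_mono) auto
    \<comment> \<open>Almost minimality of both members; with the distribution cancelled this is an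
      inequality for Q alone.\<close>
    hence Qle: "Q a + Q b \<le> Q a' + Q b' + p * \<eta>" using p by (simp add: distrib_left)
    define e where "e = (\<lambda>u::'a \<Rightarrow> real. \<lambda>x. norm (grad u x) powr p)"
    define w where "w = (\<lambda>u::'a \<Rightarrow> real. \<lambda>x. V x * \<bar>u x\<bar> powr p)"
    have ie: "integrable M (e u)" and iw: "integrable M (w u)" if "u \<in> test_funs \<Omega>" for u
      unfolding e_def w_def using p that by (auto intro!: grad_powr_integrable V_abs_powr_integrable)
    have Qew: "Q u = integral\<^sup>L M (e u) - integral\<^sup>L M (w u)" for u by (simp add: Q_fun_def e_def w_def)
    define GG where "GG x = \<psi> x * \<tau> x * gap p (grad a x) (grad b x)" for x
    define HG where "HG x = 2 powr (p - 1) * (2 powr (p - 1) * (indicator K x * norm (grad a x) powr (p - 1) +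
         indicator K x * norm (grad b x) powr (p - 1)) + indicator K x * L powr (p - 1))" for x
    define HV where "HV x = indicator K x * (\<bar>V x\<bar> * \<bar>a x\<bar> powr (p - 1)) + indicator K x * (\<bar>V x\<bar> * \<bar>b x\<bar> powr (p - 1))" for x
    have iK: "integrable M (\<lambda>x. indicator K x * L powr (p - 1))" using indicator_integrable[OF K] by simp
    have iHG: "integrable M HG" unfolding HG_def[abs_def] a_def b_def using p
      by (intro integrable_mult_right Bochner_Integration.integrable_add local_grad_integrable[OF K(1)] iK) auto
    have iHV: "integrable M HV" unfolding HV_def[abs_def] a_def b_def
      by (intro Bochner_Integration.integrable_add local_V_integrable[OF K])
    have HGE: "integral\<^sup>L M HG \<le> E"
    proof -
      have "integral\<^sup>L M HG = 2 powr (p - 1) * (2 powr (p - 1) * ((\<integral>x. indicator K x * norm (grad a x) powr (p - 1) \<partial>M) +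
         (\<integral>x. indicator K x * norm (grad b x) powr (p - 1) \<partial>M)) + mK)"
        unfolding HG_def[abs_def] mK_def a_def b_def using p local_grad_integrable[OF K(1), of "p - 1"] iK
        by simp
      also have "\<dots> \<le> E" unfolding E_def a_def b_def using Cg by (intro mult_left_mono add_mono) auto
      finally show ?thesis .
    qed
    have HVE: "integral\<^sup>L M HV \<le> Cv + Cv"
      unfolding HV_def[abs_def] a_def b_def using local_V_integrable[OF K] Cv[of i] Cv[of j] by simp
    have iGG: "integrable M GG"
      unfolding GG_def[abs_def] \<tau>_def by (rule weighted_gap_integrable[OF \<psi>(1) ab])
    have pwG: "GG x \<le> e a x + e b x - e a' x - e b' x + p * \<delta> * L * HG x" for x
    proof (cases "x \<in> K")
      case False
      hence "\<psi> x = 0" "grad \<psi> x = 0" by (auto simp: K_def test_fun_outside grad_outside)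
      hence "grad v x = 0" by (simp add: gv)
      thus ?thesis using False \<open>\<psi> x = 0\<close> by (simp add: GG_def e_def ga' gb' HG_def)
    next
      case True
      define G where "G = grad a x"
      define H where "H = grad b x"
      \<comment> \<open>Half the gradient of v is \<theta> (G - H) + Z: the first part moves the
        gradients towards each other and produces the gap, the second comes from differentiating the
        cut-off and is of order \<delta>.\<close>
      define \<theta> where "\<theta> = \<psi> x * \<tau> x / 2"
      define Z where "Z = (T x / 2) *\<^sub>R grad \<psi> x"
      have pt: "0 \<le> \<psi> x * \<tau> x" "\<psi> x * \<tau> x \<le> 1"
        using \<psi>(2,3)[of x] \<tau>[of x] mult_mono[of "\<psi> x" 1 "\<tau> x" 1] by auto
      have \<theta>: "0 \<le> \<theta>" "\<theta> \<le> 1/2" using pt by (auto simp: \<theta>_def)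
      define G0 where "G0 = (1 - \<theta>) *\<^sub>R G + \<theta> *\<^sub>R H"
      define H0 where "H0 = (1 - \<theta>) *\<^sub>R H + \<theta> *\<^sub>R G"
      have G': "grad a' x = G0 - Z" unfolding ga' gv G0_def Z_def G_def H_def \<theta>_def
        by (simp add: algebra_simps)
      have H': "grad b' x = H0 + Z" unfolding gb' gv H0_def Z_def G_def H_def \<theta>_def
        by (simp add: algebra_simps)
      have T\<delta>: "\<bar>T x\<bar> \<le> \<delta>" using tanh_scaled_bounds[OF \<delta>(1), of "a x - b x"] unfolding T_def by metis
      have Z: "norm Z \<le> \<delta> * L / 2"
      proof -
        have "\<bar>T x\<bar> * norm (grad \<psi> x) \<le> \<delta> * L" using T\<delta> L(2)[of x] \<delta> by (intro mult_mono) auto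
        thus ?thesis by (simp add: Z_def)
      qed
      have "\<delta> * L \<le> 1 * L" using \<delta> L by (intro mult_right_mono) auto
      hence ZL: "norm Z \<le> L" using Z L by linarith
      \<comment> \<open>A common bound for the moved gradients with and without the error Z; |Z|
        \<le> L holds because \<delta> \<le> 1.\<close>
      define R where "R = norm G + norm H + L"
      have th: "norm ((1 - \<theta>) *\<^sub>R X + \<theta> *\<^sub>R Y) \<le> norm X + norm Y" for X Y :: 'a
      proof -
        have "norm ((1 - \<theta>) *\<^sub>R X + \<theta> *\<^sub>R Y) \<le> (1 - \<theta>) * norm X + \<theta> * norm Y"
          using norm_triangle_ineq[of "(1 - \<theta>) *\<^sub>R X" "\<theta> *\<^sub>R Y"] \<theta> by simp
        also have "\<dots> \<le> 1 * norm X + 1 * norm Y" using \<theta> by (intro add_mono mult_right_mono) auto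
        finally show ?thesis by simp
      qed
      have n0: "norm G0 \<le> norm G + norm H" "norm H0 \<le> norm G + norm H"
        unfolding G0_def H0_def using th[of G H] th[of H G] by auto
      have nR: "norm G0 \<le> R" "norm H0 \<le> R" "norm (G0 - Z) \<le> R" "norm (H0 + Z) \<le> R"
        unfolding R_def using n0 L ZL norm_triangle_ineq4[of G0 Z] norm_triangle_ineq[of H0 Z] by linarith+
      have "\<bar>norm (G0 - Z) powr p - norm G0 powr p\<bar> \<le> p * norm (G0 - Z - G0) * R powr (p - 1)"
        using p nR by (intro norm_powr_diff_le)
      also have "\<dots> \<le> p * (\<delta> * L / 2) * R powr (p - 1)" using Z p by (intro mult_right_mono mult_left_mono) auto
      finally have d1: "\<bar>norm (G0 - Z) powr p - norm G0 powr p\<bar> \<le> p * (\<delta> * L / 2) * R powr (p - 1)" .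
      have "\<bar>norm (H0 + Z) powr p - norm H0 powr p\<bar> \<le> p * norm (H0 + Z - H0) * R powr (p - 1)"
        using p nR by (intro norm_powr_diff_le)
      also have "\<dots> \<le> p * (\<delta> * L / 2) * R powr (p - 1)" using Z p by (intro mult_right_mono mult_left_mono) auto
      finally have d2: "\<bar>norm (H0 + Z) powr p - norm H0 powr p\<bar> \<le> p * (\<delta> * L / 2) * R powr (p - 1)" .
      have tg: "norm G0 powr p + norm H0 powr p \<le> norm G powr p + norm H powr p - GG x"
        using theta_gap[OF p \<theta>, of G H] unfolding G0_def H0_def by (simp add: GG_def G_def H_def \<theta>_def)
      have RH: "R powr (p - 1) \<le> HG x"
      proof -
        have "R powr (p - 1) \<le> 2 powr (p - 1) * ((norm G + norm H) powr (p - 1) + L powr (p - 1))"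
          unfolding R_def using p L by (intro powr_add_le) auto
        also have "\<dots> \<le> 2 powr (p - 1) * (2 powr (p - 1) * (norm G powr (p - 1) + norm H powr (p - 1)) + L powr (p - 1))"
          using p by (intro mult_left_mono add_right_mono powr_add_le) auto
        also have "\<dots> = HG x" using True by (simp add: HG_def G_def H_def)
        finally show ?thesis .
      qed
      have "p * (\<delta> * L / 2) * R powr (p - 1) \<le> p * (\<delta> * L / 2) * HG x" using RH p \<delta> L by (intro mult_left_mono) auto
      hence "GG x \<le> norm G powr p + norm H powr p - norm (G0 - Z) powr p - norm (H0 + Z) powr p + 2 * (p * (\<delta> * L / 2) * HG x)"
        using d1 d2 tg by linarith
      thus ?thesis by (simp add: e_def G' H' G_def H_def algebra_simps)
    qed
    have pwV: "w a x + w b x - w a' x - w b' x \<le> p * \<delta> * HV x" for x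
    proof (cases "x \<in> K")
      case False
      hence "v x = 0" by (simp add: v_def K_def test_fun_outside)
      thus ?thesis using False by (simp add: w_def a'_def b'_def HV_def)
    next
      case True
      obtain t where t: "0 \<le> t" "t \<le> 1" "T x = t * (a x - b x)" "\<bar>T x\<bar> \<le> \<delta>"
        using tanh_scaled_bounds[OF \<delta>(1), of "a x - b x"] unfolding T_def by metis
      define m where "m = \<psi> x * t / 2"
      have m: "0 \<le> m" "m \<le> 1/2" using t \<psi>(2,3)[of x] mult_mono[of "\<psi> x" 1 t 1] by (auto simp: m_def)
      define R where "R = max \<bar>a x\<bar> \<bar>b x\<bar>"
      have cc: "\<bar>(1 - m) * y + m * z\<bar> \<le> R" if "\<bar>y\<bar> \<le> R" "\<bar>z\<bar> \<le> R" for y z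
      proof -
        have "\<bar>(1 - m) * y + m * z\<bar> \<le> (1 - m) * \<bar>y\<bar> + m * \<bar>z\<bar>"
          using abs_triangle_ineq[of "(1 - m) * y" "m * z"] m by (simp add: abs_mult)
        also have "\<dots> \<le> (1 - m) * R + m * R" using m that by (intro add_mono mult_left_mono) auto
        finally show ?thesis by (simp add: algebra_simps)
      qed
      \<comment> \<open>As the truncation equals t (a - b), the new values are convex combinations
        of the old ones and remain below R in absolute value.\<close>
      have a'x: "a' x = (1 - m) * a x + m * b x" unfolding a'_def v_def t(3) m_def by (simp add: algebra_simps)
      have b'x: "b' x = (1 - m) * b x + m * a x" unfolding b'_def v_def t(3) m_def by (simp add: algebra_simps)
      have R: "\<bar>a x\<bar> \<le> R" "\<bar>b x\<bar> \<le> R" "\<bar>a' x\<bar> \<le> R" "\<bar>b' x\<bar> \<le> R"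
        unfolding a'x b'x using cc by (auto simp: R_def)
      have vx: "\<bar>v x / 2\<bar> \<le> \<delta> / 2"
        using mult_mono[of "\<bar>\<psi> x\<bar>" 1 "\<bar>T x\<bar>" \<delta>] \<psi>(2,3)[of x] t(4) \<delta> by (simp add: v_def abs_mult)
      have d: "\<bar>\<bar>y\<bar> powr p - \<bar>z\<bar> powr p\<bar> \<le> p * (\<delta> / 2) * R powr (p - 1)"
        if "\<bar>y\<bar> \<le> R" "\<bar>z\<bar> \<le> R" "\<bar>y - z\<bar> = \<bar>v x / 2\<bar>" for y z
      proof -
        have "\<bar>\<bar>y\<bar> powr p - \<bar>z\<bar> powr p\<bar> \<le> p * \<bar>y - z\<bar> * R powr (p - 1)"
          using norm_powr_diff_le[OF p, of y R z] that(1,2) by simp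
        also have "\<dots> \<le> p * (\<delta> / 2) * R powr (p - 1)" using that vx p by (intro mult_right_mono mult_left_mono) auto
        finally show ?thesis .
      qed
      have Rb: "R powr (p - 1) \<le> \<bar>a x\<bar> powr (p - 1) + \<bar>b x\<bar> powr (p - 1)" by (auto simp: R_def max_def)
      have d1: "\<bar>\<bar>a x\<bar> powr p - \<bar>a' x\<bar> powr p\<bar> \<le> p * (\<delta> / 2) * R powr (p - 1)"
        by (rule d[OF R(1,3)]) (simp add: a'_def)
      have d2: "\<bar>\<bar>b x\<bar> powr p - \<bar>b' x\<bar> powr p\<bar> \<le> p * (\<delta> / 2) * R powr (p - 1)"
        by (rule d[OF R(2,4)]) (simp add: b'_def)
      have "w a x + w b x - w a' x - w b' x = V x * ((\<bar>a x\<bar> powr p - \<bar>a' x\<bar> powr p) + (\<bar>b x\<bar> powr p - \<bar>b' x\<bar> powr p))"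
        by (simp add: w_def algebra_simps)
      also have "\<dots> \<le> \<bar>V x\<bar> * \<bar>(\<bar>a x\<bar> powr p - \<bar>a' x\<bar> powr p) + (\<bar>b x\<bar> powr p - \<bar>b' x\<bar> powr p)\<bar>"
        unfolding abs_mult[symmetric] by (rule abs_ge_self)
      also have "\<dots> \<le> \<bar>V x\<bar> * (p * \<delta> * (\<bar>a x\<bar> powr (p - 1) + \<bar>b x\<bar> powr (p - 1)))"
      proof (rule mult_left_mono)
        have "\<bar>(\<bar>a x\<bar> powr p - \<bar>a' x\<bar> powr p) + (\<bar>b x\<bar> powr p - \<bar>b' x\<bar> powr p)\<bar>
            \<le> \<bar>\<bar>a x\<bar> powr p - \<bar>a' x\<bar> powr p\<bar> + \<bar>\<bar>b x\<bar> powr p - \<bar>b' x\<bar> powr p\<bar>"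
          by (rule abs_triangle_ineq)
        also have "\<dots> \<le> p * (\<delta> / 2) * R powr (p - 1) + p * (\<delta> / 2) * R powr (p - 1)"
          by (intro add_mono d1 d2)
        also have "\<dots> = p * \<delta> * R powr (p - 1)" by simp
        also have "\<dots> \<le> p * \<delta> * (\<bar>a x\<bar> powr (p - 1) + \<bar>b x\<bar> powr (p - 1))"
          using Rb p \<delta> by (intro mult_left_mono) auto
        finally show "\<bar>(\<bar>a x\<bar> powr p - \<bar>a' x\<bar> powr p) + (\<bar>b x\<bar> powr p - \<bar>b' x\<bar> powr p)\<bar> \<le> p * \<delta> * (\<bar>a x\<bar> powr (p - 1) + \<bar>b x\<bar> powr (p - 1))" .
      qed simp
      also have "\<dots> = p * \<delta> * HV x" using True by (simp add: HV_def algebra_simps)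
      finally show ?thesis .
    qed
    have "integral\<^sup>L M GG \<le> (\<integral>x. e a x + e b x - e a' x - e b' x + p * \<delta> * L * HG x \<partial>M)"
      using iGG ie ab ab' iHG pwG by (intro integral_mono) auto
    also have "\<dots> = integral\<^sup>L M (e a) + integral\<^sup>L M (e b) - integral\<^sup>L M (e a') - integral\<^sup>L M (e b') + p * \<delta> * L * integral\<^sup>L M HG"
      using ie[OF ab(1)] ie[OF ab(2)] ie[OF ab'(1)] ie[OF ab'(2)] iHG by simp
    finally have 1: "integral\<^sup>L M GG \<le> integral\<^sup>L M (e a) + integral\<^sup>L M (e b) - integral\<^sup>L M (e a') - integral\<^sup>L M (e b') + p * \<delta> * L * integral\<^sup>L M HG" .
    have "(\<integral>x. w a x + w b x - w a' x - w b' x \<partial>M) \<le> (\<integral>x. p * \<delta> * HV x \<partial>M)"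
      using iw ab ab' iHV pwV by (intro integral_mono) auto
    hence 2: "integral\<^sup>L M (w a) + integral\<^sup>L M (w b) - integral\<^sup>L M (w a') - integral\<^sup>L M (w b') \<le> p * \<delta> * integral\<^sup>L M HV"
      using iw[OF ab(1)] iw[OF ab(2)] iw[OF ab'(1)] iw[OF ab'(2)] by simp
    have 3: "p * \<delta> * L * integral\<^sup>L M HG \<le> p * \<delta> * L * E" using HGE p \<delta> L by (intro mult_left_mono) auto
    have 4: "p * \<delta> * integral\<^sup>L M HV \<le> p * \<delta> * (Cv + Cv)" using HVE p \<delta> by (intro mult_left_mono) auto
    have "integral\<^sup>L M GG \<le> p * \<eta> + (p * L * E + p * (Cv + Cv)) * \<delta>"
      using 1 2 3 4 Qle unfolding Qew by (simp add: algebra_simps)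
    also have "\<dots> \<le> C * \<eta> + C * \<delta>" using C \<delta> by (intro add_mono mult_right_mono) (auto simp: \<eta>_def)
    finally show "(\<integral>x. \<psi> x * (1 - (tanh ((U i x - U j x) / \<delta>))\<^sup>2) * gap p (grad (U i) x) (grad (U j) x) \<partial>M)
      \<le> C * (\<delta> + 1 / (real i + 1) + 1 / (real j + 1))"
      by (simp add: GG_def[abs_def] \<tau>_def a_def b_def \<eta>_def algebra_simps)
  qed
qed

end

section \<open>Convergence of the gradients\<close>

text \<open>Fatou's lemma for integrable functions, with the bound required only from some index on;
  this allows a Cauchy estimate to be passed to the limit.\<close>

lemma fatou_integral:
  fixes h :: "nat \<Rightarrow> 'a \<Rightarrow> real"
  assumes h: "\<And>i. integrable M (h i)" "\<And>i x. 0 \<le> h i x" and h0: "h0 \<in> borel_measurable M"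
    and lim: "AE x in M. (\<lambda>i. h i x) \<longlonglongrightarrow> h0 x" and C: "\<And>i. N \<le> i \<Longrightarrow> integral\<^sup>L M (h i) \<le> C"
  shows "integrable M h0" "integral\<^sup>L M h0 \<le> C"
proof -
  have "0 \<le> integral\<^sup>L M (h N)" by (rule Bochner_Integration.integral_nonneg) (rule h(2))
  hence C0: "0 \<le> C" using C[of N] by simp
  have nn: "AE x in M. 0 \<le> h0 x"
    using lim by eventually_elim (rule LIMSEQ_le_const, assumption, use h(2) in auto)
  have "(\<integral>\<^sup>+x. ennreal (h0 x) \<partial>M) \<le> (\<integral>\<^sup>+x. liminf (\<lambda>i. ennreal (h i x)) \<partial>M)"
  proof (rule nn_integral_mono_AE)
    show "AE x in M. ennreal (h0 x) \<le> liminf (\<lambda>i. ennreal (h i x))"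
      using lim
    proof eventually_elim
      case (elim x)
      have "(\<lambda>i. ennreal (h i x)) \<longlonglongrightarrow> ennreal (h0 x)" using elim by (intro tendsto_ennrealI)
      hence "liminf (\<lambda>i. ennreal (h i x)) = ennreal (h0 x)" by (intro lim_imp_Liminf) auto
      thus ?case by simp
    qed
  qed
  also have "\<dots> \<le> liminf (\<lambda>i. \<integral>\<^sup>+x. ennreal (h i x) \<partial>M)"
    using h by (intro nn_integral_liminf) auto
  also have "\<dots> \<le> ennreal C"
  proof (intro Liminf_le)
    have "(\<integral>\<^sup>+x. ennreal (h i x) \<partial>M) \<le> ennreal C" if "N \<le> i" for i
      using h C[OF that] by (subst nn_integral_eq_integral) (auto intro: ennreal_leI)
    thus "\<forall>\<^sub>F i in sequentially. (\<integral>\<^sup>+x. ennreal (h i x) \<partial>M) \<le> ennreal C"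
      unfolding eventually_sequentially by blast
  qed simp
  finally have le: "(\<integral>\<^sup>+x. ennreal (h0 x) \<partial>M) \<le> ennreal C" .
  show i0: "integrable M h0"
    using le by (intro integrableI_nonneg[OF h0 nn]) (simp add: le_less_trans)
  have "ennreal (integral\<^sup>L M h0) \<le> ennreal C"
    using le by (subst nn_integral_eq_integral[OF i0 nn, symmetric])
  thus "integral\<^sup>L M h0 \<le> C" using C0 by (subst (asm) ennreal_le_iff)
qed

context minseq
begin

text \<open>Large gradients are rare by the energy bound, differences of the functions above
  \<delta> are rare by L^1 convergence, and on the rest the gap controls the truncated distance. The
  constants are fixed in the order R, \<eta>, then \<delta>, and only then the indices.\<close>

lemma grad_Cauchy_in_measure:
  assumes \<psi>: "\<psi> \<in> test_funs \<Omega>" "\<And>x. 0 \<le> \<psi> x" "\<And>x. \<psi> x \<le> 1"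
    and L1: "\<And>e. 0 < e \<Longrightarrow> \<exists>N. \<forall>i\<ge>N. \<forall>j\<ge>N. (\<integral>x. \<psi> x * \<bar>U i x - U j x\<bar> \<partial>M) < e"
    and e: "0 < e"
  shows "\<exists>N. \<forall>i\<ge>N. \<forall>j\<ge>N. (\<integral>x. \<psi> x * min 1 (norm (grad (U i) x - grad (U j) x)) \<partial>M) < e"
proof -
  define K where "K = supp \<psi>"
  have K: "compact K" "K \<subseteq> \<Omega>"
    unfolding K_def by (rule test_funs_compact[OF \<psi>(1)], rule test_funs_supp[OF \<psi>(1)])
  obtain Ce where Ce: "0 \<le> Ce" "\<And>i. (\<integral>x. indicator K x * en i x \<partial>M) \<le> Ce" using local_energy_bound[OF K] by blast
  obtain Cg where Cg: "0 \<le> Cg" "\<And>i j \<delta>. 0 < \<delta> \<Longrightarrow> \<delta> \<le> 1 \<Longrightarrow>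
    (\<integral>x. \<psi> x * (1 - (tanh ((U i x - U j x) / \<delta>))\<^sup>2) * gap p (grad (U i) x) (grad (U j) x) \<partial>M)
      \<le> Cg * (\<delta> + 1 / (real i + 1) + 1 / (real j + 1))" using gap_estimate[OF \<psi>] by blast
  define mK where "mK = (\<integral>x. (indicator K x :: real) \<partial>M)"
  have mK: "0 \<le> mK" unfolding mK_def by (intro integral_nonneg_AE) auto
  define c1 :: real where "c1 = 1 - (tanh 1)\<^sup>2"
  have c1: "0 < c1" unfolding c1_def by (rule one_minus_tanh_sq_bounds)
  \<comment> \<open>Chebyshev: the sets where one of the gradients exceeds R contribute at most 2 Ce
    / R^q \<le> e / 8.\<close>
  define R where "R = (16 * Ce / e + 1) powr (1 / q)"
  have Rq0: "0 < 16 * Ce / e + 1" using Ce e by (intro add_nonneg_pos) auto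
  have R: "0 < R" using Rq0 by (simp add: R_def)
  have Rq: "R powr q = 16 * Ce / e + 1" using Rq0 q by (simp add: R_def powr_powr)
  have b1: "(Ce + Ce) / R powr q \<le> e / 8"
  proof -
    have "e / 8 * (16 * Ce / e + 1) = Ce + Ce + e / 8" using e by (simp add: field_simps)
    hence "Ce + Ce \<le> e / 8 * (16 * Ce / e + 1)" using e by linarith
    thus ?thesis unfolding Rq using Rq0 by (simp add: divide_le_eq)
  qed
  define \<eta> where "\<eta> = e / 8 / (mK + 1)"
  have \<eta>: "0 < \<eta>" using e mK by (simp add: \<eta>_def)
  have b2: "\<eta> * mK \<le> e / 8"
  proof -
    have "\<eta> * (mK + 1) = e / 8" unfolding \<eta>_def by (rule nonzero_eq_divide_eq[THEN iffD1, OF _ refl]) (use mK in linarith)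
    thus ?thesis using \<eta> by (simp add: distrib_left)
  qed
  obtain C' where C': "0 \<le> C'" "\<And>A B::'a. norm A \<le> R \<Longrightarrow> norm B \<le> R \<Longrightarrow> min 1 (norm (A - B)) \<le> \<eta> + C' * gap p A B"
    using min_norm_diff_le_gap[OF p \<eta> R] by blast
  define D where "D = C' / c1 * Cg"
  have D: "0 \<le> D" using C' c1 Cg by (simp add: D_def)
  \<comment> \<open>\<open>D\<close> already contains the constant \<open>C'\<close> depending on R
    and \<eta>; \<delta> makes the part of the gap estimate independent of the indices at most e /
    8.\<close>
  define \<delta> where "\<delta> = min 1 (e / 8 / (D + 1))"
  have \<delta>: "0 < \<delta>" "\<delta> \<le> 1" using e D by (auto simp: \<delta>_def)
  have b3: "D * \<delta> \<le> e / 8"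
  proof -
    have eq: "(e / 8 / (D + 1)) * (D + 1) = e / 8" by (rule nonzero_eq_divide_eq[THEN iffD1, OF _ refl]) (use D in linarith)
    have "\<delta> * (D + 1) \<le> (e / 8 / (D + 1)) * (D + 1)" using D by (intro mult_right_mono) (auto simp: \<delta>_def)
    hence "\<delta> * (D + 1) \<le> e / 8" unfolding eq .
    thus ?thesis using \<delta> by (simp add: distrib_left mult.commute)
  qed
  obtain N1 where N1: "\<And>i j. N1 \<le> i \<Longrightarrow> N1 \<le> j \<Longrightarrow> (\<integral>x. \<psi> x * \<bar>U i x - U j x\<bar> \<partial>M) < \<delta> * (e / 8)"
    using L1[of "\<delta> * (e / 8)"] \<delta> e by auto
  obtain N2 :: nat where N2: "D * (16 / e) < real N2" using reals_Archimedean2 by blast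
  have b4: "D * (1 / (real i + 1)) \<le> e / 16" if "N2 \<le> i" for i
  proof -
    have "D * (16 / e) \<le> real i + 1" using N2 that by linarith
    hence "D * 16 \<le> e * (real i + 1)" using e by (simp add: field_simps)
    thus ?thesis by (simp add: divide_le_eq)
  qed
  show ?thesis
  proof (intro exI[of _ "max N1 N2"] allI impI)
    fix i j assume ij: "max N1 N2 \<le> i" "max N1 N2 \<le> j"
    define g where "g x = gap p (grad (U i) x) (grad (U j) x)" for x
    define \<tau> where "\<tau> x = 1 - (tanh ((U i x - U j x) / \<delta>))\<^sup>2" for x
    define P where "P x = \<psi> x * \<tau> x * g x" for x
    have sU: "smooth_fun (U l)" for l by (rule test_funs_smooth[OF U])
    note c\<psi> = smooth_continuous[OF test_funs_smooth[OF \<psi>(1)]]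
    have z\<psi>: "\<psi> x = 0" if "x \<notin> K" for x using that by (simp add: K_def test_fun_outside)
    have g0: "0 \<le> g x" for x unfolding g_def by (rule gap_nonneg[OF p])
    have iP: "integrable M P"
      unfolding P_def[abs_def] \<tau>_def g_def by (rule weighted_gap_integrable[OF \<psi>(1) U U])
    have iD: "integrable M (\<lambda>x. \<psi> x * \<bar>U i x - U j x\<bar>)"
      by (rule M_integrable[OF _ K]) (auto intro!: continuous_on_mult c\<psi> continuous_on_rabs continuous_on_diff smooth_continuous[OF sU] simp: z\<psi>)
    have iL: "integrable M (\<lambda>x. \<psi> x * min 1 (norm (grad (U i) x - grad (U j) x)))"
      by (rule M_integrable[OF _ K]) (auto intro!: continuous_on_mult c\<psi> continuous_on_min continuous_on_norm continuous_on_diff continuous_grad[OF sU] simp: z\<psi>)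
    note iE = indicator_mult_integrable[OF K(1) en_integrable]
    have pw: "\<psi> x * min 1 (norm (grad (U i) x - grad (U j) x))
       \<le> (indicator K x * en i x + indicator K x * en j x) / R powr q + \<eta> * indicator K x + C' / c1 * P x + 1 / \<delta> * (\<psi> x * \<bar>U i x - U j x\<bar>)" for x
    proof (cases "x \<in> K")
      case False
      thus ?thesis by (simp add: z\<psi> P_def)
    next
      case True
      have nn: "0 \<le> en i x / R powr q" "0 \<le> en j x / R powr q" "0 \<le> C' / c1 * P x" "0 \<le> 1 / \<delta> * (\<psi> x * \<bar>U i x - U j x\<bar>)"
        using en_nonneg C' c1 \<delta> \<psi>(2)[of x] g0[of x] one_minus_tanh_sq_bounds(1)[of "(U i x - U j x) / \<delta>"]
        by (auto simp: P_def \<tau>_def intro!: mult_nonneg_nonneg divide_nonneg_nonneg)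
      have m1: "\<psi> x * min 1 (norm (grad (U i) x - grad (U j) x)) \<le> 1"
        using mult_mono[of "\<psi> x" 1 "min 1 (norm (grad (U i) x - grad (U j) x))" 1] \<psi>(2,3)[of x] by simp
      have big: "1 \<le> en l x / R powr q" if "R < norm (grad (U l) x)" for l
      proof -
        have "R powr q \<le> norm (grad (U l) x) powr q" using that R q by (intro powr_mono2) auto
        also have "\<dots> \<le> en l x" by (simp add: en_def)
        finally show ?thesis using R by simp
      qed
      \<comment> \<open>Each case is paid for by its own term of the bound; in the last one the
        derivative of the truncation is at least \<open>c1\<close>.\<close>
      consider "\<delta> < \<bar>U i x - U j x\<bar>" | "R < norm (grad (U i) x)" | "R < norm (grad (U j) x)"
        | "\<bar>U i x - U j x\<bar> \<le> \<delta>" "norm (grad (U i) x) \<le> R" "norm (grad (U j) x) \<le> R" by linarith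
      thus ?thesis
      proof cases
        case 1
        have "\<psi> x * min 1 (norm (grad (U i) x - grad (U j) x)) \<le> \<psi> x * (\<bar>U i x - U j x\<bar> / \<delta>)"
          using 1 \<delta> \<psi>(2)[of x] by (intro mult_left_mono) (auto simp: min_le_iff_disj)
        thus ?thesis using True nn \<eta> by (simp add: add_divide_distrib)
      next
        case 2
        thus ?thesis using big[OF 2] m1 nn \<eta> True by (simp add: add_divide_distrib)
      next
        case 3
        thus ?thesis using big[OF 3] m1 nn \<eta> True by (simp add: add_divide_distrib)
      next
        case 4
        have "\<bar>(U i x - U j x) / \<delta>\<bar> \<le> 1" using 4(1) \<delta> by simp
        hence "c1 \<le> \<tau> x" unfolding c1_def \<tau>_def by (rule one_minus_tanh_sq_bounds)
        hence "c1 * (\<psi> x * g x) \<le> \<tau> x * (\<psi> x * g x)" using \<psi>(2)[of x] g0[of x] by (intro mult_right_mono) auto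
        hence "\<psi> x * g x \<le> P x / c1" using c1 by (simp add: P_def field_simps)
        hence 5: "C' * (\<psi> x * g x) \<le> C' * (P x / c1)" using C'(1) by (intro mult_left_mono)
        have "\<psi> x * min 1 (norm (grad (U i) x - grad (U j) x)) \<le> \<psi> x * (\<eta> + C' * g x)"
          unfolding g_def using C'(2)[OF 4(2,3)] \<psi>(2)[of x] by (intro mult_left_mono)
        also have "\<dots> = \<psi> x * \<eta> + C' * (\<psi> x * g x)" by (simp add: algebra_simps)
        also have "\<dots> \<le> 1 * \<eta> + C' * (P x / c1)" using 5 \<psi>(3)[of x] \<eta> by (intro add_mono mult_right_mono) auto
        finally show ?thesis using True nn by (simp add: add_divide_distrib)
      qed
    qed
    have "(\<integral>x. \<psi> x * min 1 (norm (grad (U i) x - grad (U j) x)) \<partial>M)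
       \<le> (\<integral>x. (indicator K x * en i x + indicator K x * en j x) / R powr q + \<eta> * indicator K x + C' / c1 * P x + 1 / \<delta> * (\<psi> x * \<bar>U i x - U j x\<bar>) \<partial>M)"
      by (rule integral_mono[OF iL _ pw])
         (intro Bochner_Integration.integrable_add integrable_mult_right integrable_divide iE iP iD indicator_integrable[OF K])
    also have "\<dots> = ((\<integral>x. indicator K x * en i x \<partial>M) + (\<integral>x. indicator K x * en j x \<partial>M)) / R powr q + \<eta> * mK
        + C' / c1 * integral\<^sup>L M P + 1 / \<delta> * (\<integral>x. \<psi> x * \<bar>U i x - U j x\<bar> \<partial>M)"
      using iE[of i] iE[of j] iP iD indicator_integrable[OF K] by (simp add: mK_def)
    also have "\<dots> < e"
    proof -
      have 1: "((\<integral>x. indicator K x * en i x \<partial>M) + (\<integral>x. indicator K x * en j x \<partial>M)) / R powr q \<le> e / 8"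
        using b1 Ce(2)[of i] Ce(2)[of j] by (smt (verit) divide_right_mono powr_ge_zero)
      have "C' / c1 * integral\<^sup>L M P \<le> C' / c1 * (Cg * (\<delta> + 1 / (real i + 1) + 1 / (real j + 1)))"
        unfolding P_def[abs_def] \<tau>_def g_def using C' c1 by (intro mult_left_mono Cg \<delta>) auto
      also have "\<dots> = D * \<delta> + D * (1 / (real i + 1)) + D * (1 / (real j + 1))" by (simp add: D_def algebra_simps)
      finally have 2: "C' / c1 * integral\<^sup>L M P \<le> e / 8 + e / 16 + e / 16" using b3 b4[of i] b4[of j] ij by linarith
      have "1 / \<delta> * (\<integral>x. \<psi> x * \<bar>U i x - U j x\<bar> \<partial>M) \<le> 1 / \<delta> * (\<delta> * (e / 8))"
        using N1[of i j] ij \<delta> by (intro mult_left_mono) auto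
      hence 3: "1 / \<delta> * (\<integral>x. \<psi> x * \<bar>U i x - U j x\<bar> \<partial>M) \<le> e / 8" using \<delta> by simp
      show ?thesis using 1 2 3 b2 e by linarith
    qed
    finally show "(\<integral>x. \<psi> x * min 1 (norm (grad (U i) x - grad (U j) x)) \<partial>M) < e" .
  qed
qed

text \<open>Two extractions: Rellich's theorem makes the localized functions Cauchy in L^1, which is
  the input for the gradients being Cauchy in measure, and then almost everywhere convergence is
  extracted. The cut-offs come from a countable exhaustion by compact sets.\<close>

lemma convergent_subsequence:
  obtains k :: "nat \<Rightarrow> nat" and u G where "strict_mono k" "u \<in> borel_measurable borel" "G \<in> borel_measurable borel"
    "AE x in M. (\<lambda>i. U (k i) x) \<longlonglongrightarrow> u x \<and> (\<lambda>i. grad (U (k i)) x) \<longlonglongrightarrow> G x"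
proof -
  obtain X where X: "\<And>n::nat. compact (X n)" "\<And>n. X n \<subseteq> \<Omega>" "\<Union> (range X) = \<Omega>"
    using open_Union_compact_subsets[OF open_\<Omega>] by metis
  have "\<forall>n. \<exists>\<psi>. \<psi> \<in> test_funs \<Omega> \<and> (\<forall>x. 0 \<le> \<psi> x) \<and> (\<forall>x. \<psi> x \<le> 1) \<and> (\<forall>x\<in>X n. 0 < \<psi> x)"
  proof
    fix n
    obtain \<psi> c where "\<psi> \<in> test_funs \<Omega>" "\<And>x. 0 \<le> \<psi> x" "\<And>x. \<psi> x \<le> 1" "0 < c" "\<And>x. x \<in> X n \<Longrightarrow> c \<le> \<psi> x"
      using cutoff_exists[OF open_\<Omega> X(1,2)] by blast
    thus "\<exists>\<psi>. \<psi> \<in> test_funs \<Omega> \<and> (\<forall>x. 0 \<le> \<psi> x) \<and> (\<forall>x. \<psi> x \<le> 1) \<and> (\<forall>x\<in>X n. 0 < \<psi> x)"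
      by (intro exI[of _ \<psi>]) (auto intro: less_le_trans)
  qed
  then obtain \<psi> where \<psi>: "\<And>n. \<psi> n \<in> test_funs \<Omega>" "\<And>n x. 0 \<le> \<psi> n x" "\<And>n x. \<psi> n x \<le> 1" "\<And>n x. x \<in> X n \<Longrightarrow> 0 < \<psi> n x"
    by metis
  define w where "w n i x = \<psi> n x * U i x" for n i x
  have w: "w n i \<in> test_funs \<Omega>" for n i unfolding w_def[abs_def] by (rule cutoff_test[OF \<psi>(1)])
  have "\<forall>n. \<exists>C. \<forall>i. (\<integral>x. \<bar>w n i x\<bar> \<partial>lborel) \<le> C \<and> (\<integral>x. norm (grad (w n i) x) \<partial>lborel) \<le> C"
  proof
    fix n
    obtain C where C: "\<And>i. (\<integral>x. norm (grad (\<lambda>x. \<psi> n x * U i x) x) powr 1 \<partial>lborel) \<le> C"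
      "\<And>i. (\<integral>x. \<bar>\<psi> n x * U i x\<bar> powr 1 \<partial>lborel) \<le> C" using cutoff_bound_lower[OF \<psi>(1), of 1 n] q by auto
    thus "\<exists>C. \<forall>i. (\<integral>x. \<bar>w n i x\<bar> \<partial>lborel) \<le> C \<and> (\<integral>x. norm (grad (w n i) x) \<partial>lborel) \<le> C"
      by (intro exI[of _ C]) (simp add: w_def[abs_def])
  qed
  then obtain C where C: "\<And>n i. (\<integral>x. \<bar>w n i x\<bar> \<partial>lborel) \<le> C n" "\<And>n i. (\<integral>x. norm (grad (w n i) x) \<partial>lborel) \<le> C n" by metis
  have sw: "supp (w n i) \<subseteq> supp (\<psi> n)" for n i
    unfolding supp_def w_def by (intro closure_mono) auto
  obtain k1 where k1: "strict_mono (k1 :: nat \<Rightarrow> nat)"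
    "\<And>n e. 0 < e \<Longrightarrow> \<exists>N. \<forall>i\<ge>N. \<forall>j\<ge>N. (\<integral>x. \<bar>w n (k1 i) x - w n (k1 j) x\<bar> \<partial>lborel) < e"
    using rellich[of w "\<lambda>n. supp (\<psi> n)" C, OF test_funs_UNIV[OF w] sw test_funs_compact[OF \<psi>(1)] C] by blast
  interpret S: minseq \<Omega> V W f p q r "\<lambda>i. U (k1 i)" B by (rule minseq_subseq[OF k1(1)])
  have eq: "(\<integral>x. \<psi> n x * \<bar>U (k1 i) x - U (k1 j) x\<bar> \<partial>M) = (\<integral>x. \<bar>w n (k1 i) x - w n (k1 j) x\<bar> \<partial>lborel)" for n i j
  proof -
    have e: "\<bar>w n (k1 i) x - w n (k1 j) x\<bar> = \<psi> n x * \<bar>U (k1 i) x - U (k1 j) x\<bar>" for x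
      using \<psi>(2)[of n x] by (simp add: w_def right_diff_distrib[symmetric] abs_mult)
    have z: "\<psi> n x = 0" if "x \<notin> \<Omega>" for x using that test_funs_supp[OF \<psi>(1), of n] test_fun_outside[of x "\<psi> n"] by auto
    show ?thesis unfolding e
      by (rule lborel_eq_M[symmetric])
         (auto intro!: continuous_on_mult continuous_on_rabs continuous_on_diff smooth_continuous[OF test_funs_smooth[OF U]]
           smooth_continuous[OF test_funs_smooth[OF \<psi>(1)]] simp: z)
  qed
  have L1: "\<exists>N. \<forall>i\<ge>N. \<forall>j\<ge>N. (\<integral>x. \<psi> n x * \<bar>U (k1 i) x - U (k1 j) x\<bar> \<partial>M) < e" if "0 < e" for n e
    unfolding eq by (rule k1(2)[OF that])
  \<comment> \<open>Functions and gradients are paired so that a single extraction treats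
    both.\<close>
  define F where "F i x = (U (k1 i) x, grad (U (k1 i)) x)" for i x
  have Fm: "F i \<in> borel_measurable M" for i
    unfolding F_def[abs_def] by (intro measurable_lebesgue_on borel_measurable_Pair test_measurable[OF U] test_grad_measurable[OF U])
  have cF: "continuous_on UNIV (F i)" for i
    unfolding F_def[abs_def] by (intro continuous_on_Pair smooth_continuous continuous_grad test_funs_smooth[OF U])
  note c\<psi> = smooth_continuous[OF test_funs_smooth[OF \<psi>(1)]]
  have iF: "integrable M (\<lambda>x. \<psi> n x * min 1 (norm (F i x - F j x)))" for n i j
    by (rule M_integrable[OF _ test_funs_compact[OF \<psi>(1)[of n]] test_funs_supp[OF \<psi>(1)[of n]]])
       (auto intro!: continuous_on_mult c\<psi> continuous_on_min continuous_on_norm continuous_on_diff cF simp: test_fun_outside)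
  have iD: "integrable M (\<lambda>x. \<psi> n x * \<bar>U (k1 i) x - U (k1 j) x\<bar>)" for n i j
    by (rule M_integrable[OF _ test_funs_compact[OF \<psi>(1)[of n]] test_funs_supp[OF \<psi>(1)[of n]]])
       (auto intro!: continuous_on_mult c\<psi> continuous_on_rabs continuous_on_diff smooth_continuous[OF test_funs_smooth[OF U]] simp: test_fun_outside)
  have iG: "integrable M (\<lambda>x. \<psi> n x * min 1 (norm (grad (U (k1 i)) x - grad (U (k1 j)) x)))" for n i j
    by (rule M_integrable[OF _ test_funs_compact[OF \<psi>(1)[of n]] test_funs_supp[OF \<psi>(1)[of n]]])
       (auto intro!: continuous_on_mult c\<psi> continuous_on_min continuous_on_norm continuous_on_diff continuous_grad[OF test_funs_smooth[OF U]] simp: test_fun_outside)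
  have CF: "\<exists>N. \<forall>i\<ge>N. \<forall>j\<ge>N. (\<integral>x. \<psi> n x * min 1 (norm (F i x - F j x)) \<partial>M) < e" if e: "0 < e" for n e
  proof -
    obtain N1 where N1: "\<And>i j. N1 \<le> i \<Longrightarrow> N1 \<le> j \<Longrightarrow> (\<integral>x. \<psi> n x * \<bar>U (k1 i) x - U (k1 j) x\<bar> \<partial>M) < e / 2"
      using L1[of "e / 2" n] e by auto
    obtain N2 where N2: "\<And>i j. N2 \<le> i \<Longrightarrow> N2 \<le> j \<Longrightarrow> (\<integral>x. \<psi> n x * min 1 (norm (grad (U (k1 i)) x - grad (U (k1 j)) x)) \<partial>M) < e / 2"
      using S.grad_Cauchy_in_measure[OF \<psi>(1,2,3)[of n] L1[of _ n], of "e / 2"] e by auto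
    have "(\<integral>x. \<psi> n x * min 1 (norm (F i x - F j x)) \<partial>M) < e" if ij: "max N1 N2 \<le> i" "max N1 N2 \<le> j" for i j
    proof -
      have "(\<integral>x. \<psi> n x * min 1 (norm (F i x - F j x)) \<partial>M)
        \<le> (\<integral>x. \<psi> n x * \<bar>U (k1 i) x - U (k1 j) x\<bar> + \<psi> n x * min 1 (norm (grad (U (k1 i)) x - grad (U (k1 j)) x)) \<partial>M)"
      proof (rule integral_mono[OF iF])
        fix x
        have "norm (F i x - F j x) \<le> \<bar>U (k1 i) x - U (k1 j) x\<bar> + norm (grad (U (k1 i)) x - grad (U (k1 j)) x)"
          using norm_Pair_le[of "U (k1 i) x - U (k1 j) x" "grad (U (k1 i)) x - grad (U (k1 j)) x"] by (simp add: F_def)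
        hence "min 1 (norm (F i x - F j x)) \<le> \<bar>U (k1 i) x - U (k1 j) x\<bar> + min 1 (norm (grad (U (k1 i)) x - grad (U (k1 j)) x))"
          by (auto simp: min_def)
        from mult_left_mono[OF this \<psi>(2)[of n x]]
        show "\<psi> n x * min 1 (norm (F i x - F j x))
          \<le> \<psi> n x * \<bar>U (k1 i) x - U (k1 j) x\<bar> + \<psi> n x * min 1 (norm (grad (U (k1 i)) x - grad (U (k1 j)) x))"
          by (simp add: distrib_left)
      qed (intro Bochner_Integration.integrable_add iD iG)
      also have "\<dots> = (\<integral>x. \<psi> n x * \<bar>U (k1 i) x - U (k1 j) x\<bar> \<partial>M) + (\<integral>x. \<psi> n x * min 1 (norm (grad (U (k1 i)) x - grad (U (k1 j)) x)) \<partial>M)"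
        by (rule Bochner_Integration.integral_add[OF iD iG])
      also have "\<dots> < e" using N1[of i j] N2[of i j] ij by simp
      finally show ?thesis .
    qed
    thus ?thesis by blast
  qed
  have \<psi>m: "\<psi> n \<in> borel_measurable M" for n by (intro measurable_lebesgue_on test_measurable \<psi>)
  obtain k2 :: "nat \<Rightarrow> nat" where k2: "strict_mono k2" "AE x in M. (\<exists>n. 0 < \<psi> n x) \<longrightarrow> convergent (\<lambda>i. F (k2 i) x)"
    using subsequence_AE_Cauchy[of F M \<psi>, OF Fm \<psi>m \<psi>(2) iF CF] by blast
  define k where "k = k1 \<circ> k2"
  \<comment> \<open>Defined at every point, also where there is no convergence, so as to be Borel
    measurable; the value there is immaterial.\<close>
  define u where "u x = lim (\<lambda>i. U (k i) x)" for x
  define G where "G x = lim (\<lambda>i. grad (U (k i)) x)" for x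
  show ?thesis
  proof (rule that[of k u G])
    show "strict_mono k" unfolding k_def by (rule strict_mono_o[OF k1(1) k2(1)])
    show "u \<in> borel_measurable borel" unfolding u_def[abs_def]
      by (intro borel_measurable_lim_metric test_measurable U)
    show "G \<in> borel_measurable borel" unfolding G_def[abs_def]
      by (intro borel_measurable_lim_metric test_grad_measurable U)
    show "AE x in M. (\<lambda>i. U (k i) x) \<longlonglongrightarrow> u x \<and> (\<lambda>i. grad (U (k i)) x) \<longlonglongrightarrow> G x"
      using k2(2) AE_space
    proof eventually_elim
      case (elim x)
      have "x \<in> \<Omega>" using elim(2) by (simp add: space_restrict_space)
      then obtain n where "x \<in> X n" using X(3) by blast
      hence "convergent (\<lambda>i. F (k2 i) x)" using elim(1) \<psi>(4) by blast
      then obtain l where l: "(\<lambda>i. F (k2 i) x) \<longlonglongrightarrow> l" unfolding convergent_def by blast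
      have "(\<lambda>i. U (k i) x) \<longlonglongrightarrow> fst l" using tendsto_fst[OF l] by (simp add: F_def k_def)
      moreover have "(\<lambda>i. grad (U (k i)) x) \<longlonglongrightarrow> snd l" using tendsto_snd[OF l] by (simp add: F_def k_def)
      ultimately show ?case unfolding u_def G_def by (simp add: limI)
    qed
  qed
qed

end

section \<open>Strong approximation by midpoints\<close>

lemma norm_powr_shift_le:
  fixes A Z :: "'b::real_normed_vector"
  assumes p: "1 < p"
  shows "\<bar>norm (A + Z) powr p - norm A powr p\<bar> \<le> p * norm Z * 2 powr (p - 1) * (norm A powr (p - 1) + norm Z powr (p - 1))"
proof -
  have "\<bar>norm (A + Z) powr p - norm A powr p\<bar> \<le> p * norm (A + Z - A) * (norm A + norm Z) powr (p - 1)"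
    by (rule norm_powr_diff_le[OF p norm_triangle_ineq]) simp
  also have "\<dots> = p * norm Z * (norm A + norm Z) powr (p - 1)" by simp
  also have "\<dots> \<le> p * norm Z * (2 powr (p - 1) * (norm A powr (p - 1) + norm Z powr (p - 1)))"
    using p by (intro mult_left_mono powr_add_le) auto
  finally show ?thesis by (simp add: mult.assoc)
qed

text \<open>The dyadic convex hull of the tail from index n. Closure under midpoints suffices
  because uniform convexity is used in its midpoint form, the gap.\<close>

inductive mid_hull :: "(nat \<Rightarrow> 'a \<Rightarrow> real) \<Rightarrow> nat \<Rightarrow> ('a \<Rightarrow> real) \<Rightarrow> bool" for U n where
  base: "n \<le> i \<Longrightarrow> mid_hull U n (U i)"
| mid: "mid_hull U n \<phi> \<Longrightarrow> mid_hull U n \<rho> \<Longrightarrow> mid_hull U n (\<lambda>x. (1/2) * \<phi> x + (1/2) * \<rho> x)"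

lemma mid_hull_antimono: "mid_hull U m \<phi> \<Longrightarrow> n \<le> m \<Longrightarrow> mid_hull U n \<phi>"
proof (induction rule: mid_hull.induct)
  case (base i) thus ?case by (intro mid_hull.base) simp
next
  case (mid \<phi> \<rho>) thus ?case by (intro mid_hull.mid)
qed

context problem
begin

section \<open>Uniform convexity of the weighted energy\<close>

lemma energy_W_integrable:
  assumes "\<phi> \<in> test_funs \<Omega>"
  shows "integrable M (\<lambda>x. (norm (grad \<phi> x) powr q + \<bar>\<phi> x\<bar> powr q) * W x)"
  using loc_int_mult[OF loc_int_W _ test_funs_compact[OF assms] test_funs_supp[OF assms],
      of "\<lambda>x. norm (grad \<phi> x) powr q + \<bar>\<phi> x\<bar> powr q"] q
    continuous_on_add[OF continuous_grad_powr[OF assms, of q] continuous_abs_powr[OF assms, of q]]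
  by (simp add: grad_outside test_fun_outside mult.commute)

lemma W_energy_nonneg: "0 \<le> W_energy q \<Omega> W \<phi>"
  unfolding W_energy_def using W(2)
  by (intro integral_nonneg_AE AE_I2) (auto simp: space_restrict_space less_imp_le)

definition W_gap :: "('a \<Rightarrow> real) \<Rightarrow> ('a \<Rightarrow> real) \<Rightarrow> real" where
  "W_gap \<phi> \<rho> = (\<integral>x. (gap q (grad \<phi> x) (grad \<rho> x) + gap q (\<phi> x) (\<rho> x)) * W x \<partial>M)"

text \<open>An identity taking the place of the parallelogram law: the gradient of a midpoint is the
  midpoint of the gradients, so the deficit of the energy is the integrated gap.\<close>

lemma W_energy_midpoint:
  assumes "\<phi> \<in> test_funs \<Omega>" "\<rho> \<in> test_funs \<Omega>"
  shows "integrable M (\<lambda>x. (gap q (grad \<phi> x) (grad \<rho> x) + gap q (\<phi> x) (\<rho> x)) * W x)"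
    and "2 * W_energy q \<Omega> W (\<lambda>x. (1/2) * \<phi> x + (1/2) * \<rho> x) = W_energy q \<Omega> W \<phi> + W_energy q \<Omega> W \<rho> - W_gap \<phi> \<rho>"
proof -
  define e where "e \<phi> x = (norm (grad \<phi> x) powr q + \<bar>\<phi> x\<bar> powr q) * W x" for \<phi> x
  define m where "m x = (1/2) * \<phi> x + (1/2) * \<rho> x" for x
  have m: "m \<in> test_funs \<Omega>" unfolding m_def[abs_def] by (rule test_funs_comb[OF assms])
  have gm: "grad m x = (1/2) *\<^sub>R (grad \<phi> x + grad \<rho> x)" for x
    unfolding m_def[abs_def] grad_comb[OF test_funs_smooth[OF assms(1)] test_funs_smooth[OF assms(2)]] scaleR_add_right ..
  have mx: "m x = (1/2) *\<^sub>R (\<phi> x + \<rho> x)" for x by (simp add: m_def)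
  have eq: "(gap q (grad \<phi> x) (grad \<rho> x) + gap q (\<phi> x) (\<rho> x)) * W x = e \<phi> x + e \<rho> x - 2 * e m x" for x
    unfolding gap_def e_def gm mx by (simp add: algebra_simps)
  have ie: "integrable M (e \<phi>)" "integrable M (e \<rho>)" "integrable M (e m)"
    unfolding e_def by (intro energy_W_integrable assms m)+
  show "integrable M (\<lambda>x. (gap q (grad \<phi> x) (grad \<rho> x) + gap q (\<phi> x) (\<rho> x)) * W x)"
    unfolding eq using ie by simp
  have "W_gap \<phi> \<rho> = integral\<^sup>L M (e \<phi>) + integral\<^sup>L M (e \<rho>) - 2 * integral\<^sup>L M (e m)"
    unfolding W_gap_def eq using ie by simp
  thus "2 * W_energy q \<Omega> W (\<lambda>x. (1/2) * \<phi> x + (1/2) * \<rho> x) = W_energy q \<Omega> W \<phi> + W_energy q \<Omega> W \<rho> - W_gap \<phi> \<rho>"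
    by (simp add: W_energy_def e_def[abs_def] m_def[abs_def])
qed

lemma W_gap_nonneg: "0 \<le> W_gap \<phi> \<rho>"
  unfolding W_gap_def using W(2) q
  by (intro integral_nonneg_AE AE_I2) (auto simp: space_restrict_space less_imp_le intro!: mult_nonneg_nonneg add_nonneg_nonneg gap_nonneg)

text \<open>The pointwise inequality \<open>norm_diff_powr_le_gap\<close> integrated against W, used
  once for gradients and once for values; the larger of the two constants serves both.\<close>

lemma W_energy_diff_le:
  assumes \<eta>: "0 < \<eta>"
  obtains C where "0 \<le> C" "\<And>\<phi> \<rho>. \<phi> \<in> test_funs \<Omega> \<Longrightarrow> \<rho> \<in> test_funs \<Omega> \<Longrightarrow>
     W_energy q \<Omega> W (\<lambda>x. \<phi> x - \<rho> x) \<le> \<eta> * (W_energy q \<Omega> W \<phi> + W_energy q \<Omega> W \<rho>) + C * W_gap \<phi> \<rho>"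
proof -
  obtain C1 where C1: "0 \<le> C1" "\<And>A B::'a. norm (A - B) powr q \<le> \<eta> * (norm A powr q + norm B powr q) + C1 * gap q A B"
    using norm_diff_powr_le_gap[OF q(1) \<eta>] by blast
  obtain C2 where C2: "0 \<le> C2" "\<And>A B::real. norm (A - B) powr q \<le> \<eta> * (norm A powr q + norm B powr q) + C2 * gap q A B"
    using norm_diff_powr_le_gap[OF q(1) \<eta>] by blast
  define C where "C = max C1 C2"
  show ?thesis
  proof (rule that[of C])
    show "0 \<le> C" using C1 by (simp add: C_def)
    fix \<phi> \<rho> assume t: "\<phi> \<in> test_funs \<Omega>" "\<rho> \<in> test_funs \<Omega>"
    define e where "e \<phi> x = (norm (grad \<phi> x) powr q + \<bar>\<phi> x\<bar> powr q) * W x" for \<phi> x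
    define g where "g x = gap q (grad \<phi> x) (grad \<rho> x) + gap q (\<phi> x) (\<rho> x)" for x
    define d where "d x = \<phi> x - \<rho> x" for x
    have d: "d \<in> test_funs \<Omega>" unfolding d_def[abs_def] using test_funs_comb[OF t, of 1 "-1"] by simp
    have gd: "grad d x = grad \<phi> x - grad \<rho> x" for x
      unfolding d_def[abs_def] by (rule grad_diff[OF test_funs_smooth[OF t(1)] test_funs_smooth[OF t(2)]])
    have pw: "norm (grad d x) powr q + \<bar>d x\<bar> powr q
       \<le> \<eta> * ((norm (grad \<phi> x) powr q + \<bar>\<phi> x\<bar> powr q) + (norm (grad \<rho> x) powr q + \<bar>\<rho> x\<bar> powr q)) + C * g x" for x
    proof -
      have "C1 * gap q (grad \<phi> x) (grad \<rho> x) \<le> C * gap q (grad \<phi> x) (grad \<rho> x)"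
        "C2 * gap q (\<phi> x) (\<rho> x) \<le> C * gap q (\<phi> x) (\<rho> x)"
        using gap_nonneg[OF q(1)] by (auto simp: C_def intro!: mult_right_mono)
      thus ?thesis using C1(2)[of "grad \<phi> x" "grad \<rho> x"] C2(2)[of "\<phi> x" "\<rho> x"]
        by (simp add: gd d_def g_def distrib_left)
    qed
    have ie: "integrable M (e \<phi>)" "integrable M (e \<rho>)" "integrable M (e d)" "integrable M (\<lambda>x. g x * W x)"
      unfolding e_def g_def by (intro energy_W_integrable t d W_energy_midpoint)+
    have "integral\<^sup>L M (e d) \<le> (\<integral>x. \<eta> * (e \<phi> x + e \<rho> x) + C * (g x * W x) \<partial>M)"
    proof (rule integral_mono_AE)
      show "AE x in M. e d x \<le> \<eta> * (e \<phi> x + e \<rho> x) + C * (g x * W x)"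
      proof (rule AE_I2)
        fix x assume "x \<in> space M"
        hence "0 \<le> W x" using W(2)[of x] by (simp add: space_restrict_space)
        from mult_right_mono[OF pw this, of x] show "e d x \<le> \<eta> * (e \<phi> x + e \<rho> x) + C * (g x * W x)"
          by (simp add: e_def algebra_simps)
      qed
    qed (use ie in auto)
    also have "\<dots> = \<eta> * (integral\<^sup>L M (e \<phi>) + integral\<^sup>L M (e \<rho>)) + C * W_gap \<phi> \<rho>"
      using ie by (simp add: W_gap_def g_def[abs_def])
    finally show "W_energy q \<Omega> W (\<lambda>x. \<phi> x - \<rho> x) \<le> \<eta> * (W_energy q \<Omega> W \<phi> + W_energy q \<Omega> W \<rho>) + C * W_gap \<phi> \<rho>"
      by (simp add: W_energy_def e_def[abs_def] d_def[abs_def])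
  qed
qed

end

context minseq
begin

lemma mid_hull_test: "mid_hull U n \<phi> \<Longrightarrow> \<phi> \<in> test_funs \<Omega>"
proof (induction rule: mid_hull.induct)
  case (base i) show ?case by (rule U)
next
  case (mid \<phi> \<rho>) show ?case by (rule test_funs_comb[OF mid.IH])
qed

lemma mid_hull_energy: "mid_hull U n \<phi> \<Longrightarrow> W_energy q \<Omega> W \<phi> \<le> B powr (q / p)"
proof (induction rule: mid_hull.induct)
  case (base i) show ?case by (rule W_energy_bound)
next
  case (mid \<phi> \<rho>)
  thus ?case using W_energy_midpoint(2)[OF mid_hull_test[OF mid.hyps(1)] mid_hull_test[OF mid.hyps(2)]] W_gap_nonneg[of \<phi> \<rho>]
    by linarith
qed

text \<open>A Banach--Saks argument: nearly energy-minimal elements of the convex hulls of the tails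
  form a Cauchy sequence by uniform convexity.\<close>

lemma convex_Cauchy_sequence:
  obtains w where "\<And>n. mid_hull U n (w n)"
    "\<And>e. 0 < e \<Longrightarrow> \<exists>N. \<forall>n\<ge>N. \<forall>m\<ge>N. W_energy q \<Omega> W (\<lambda>x. w n x - w m x) < e"
proof -
  define En where "En = W_energy q \<Omega> W"
  \<comment> \<open>The infima over the tails increase with n and are bounded by the energy bound,
    hence converge. This supplies the Cauchy property.\<close>
  define S where "S n = En ` {\<phi>. mid_hull U n \<phi>}" for n
  define d where "d n = Inf (S n)" for n
  have ne: "S n \<noteq> {}" for n using mid_hull.base[of n n U] by (auto simp: S_def)
  have bdd: "bdd_below (S n)" for n by (rule bdd_belowI[of _ 0]) (auto simp: S_def En_def W_energy_nonneg)
  have dle: "d n \<le> En \<phi>" if "mid_hull U n \<phi>" for n \<phi>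
    unfolding d_def using that bdd by (intro cInf_lower) (auto simp: S_def)
  have dmono: "d n \<le> d m" if "n \<le> m" for n m
    unfolding d_def[of m]
  proof (rule cInf_greatest[OF ne])
    fix y assume "y \<in> S m"
    then obtain \<phi> where "mid_hull U m \<phi>" "y = En \<phi>" by (auto simp: S_def)
    thus "d n \<le> y" using dle[OF mid_hull_antimono[OF _ that]] by simp
  qed
  have dB: "d n \<le> B powr (q / p)" for n
    using dle[OF mid_hull.base[of n n U]] W_energy_bound[of n] by (simp add: En_def)
  have "\<exists>\<phi>. mid_hull U n \<phi> \<and> En \<phi> < d n + 1 / (real n + 1)" for n
  proof -
    have "Inf (S n) < d n + 1 / (real n + 1)" by (simp add: d_def)
    then obtain y where "y \<in> S n" "y < d n + 1 / (real n + 1)" using cInf_less_iff[OF ne bdd] by blast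
    thus ?thesis by (auto simp: S_def)
  qed
  then obtain w where w: "\<And>n. mid_hull U n (w n)" "\<And>n. En (w n) < d n + 1 / (real n + 1)" by metis
  have "incseq d" using dmono by (simp add: incseq_def)
  then obtain l where "d \<longlonglongrightarrow> l" using incseq_convergent[of d "B powr (q / p)"] dB by blast
  hence Cd: "Cauchy d" by (rule LIMSEQ_imp_Cauchy)
  show ?thesis
  proof (rule that[OF w(1)])
    fix e :: real assume e: "0 < e"
    define E0 where "E0 = B powr (q / p)"
    have E0: "0 \<le> E0" by (simp add: E0_def)
    define \<eta> where "\<eta> = e / 4 / (E0 + 1)"
    have \<eta>: "0 < \<eta>" using e E0 by (simp add: \<eta>_def)
    have \<eta>E: "\<eta> * (E0 + E0) \<le> e / 2"
    proof -
      have "\<eta> * (E0 + 1) = e / 4" unfolding \<eta>_def by (rule nonzero_eq_divide_eq[THEN iffD1, OF _ refl]) (use E0 in linarith)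
      thus ?thesis using \<eta> by (simp add: distrib_left)
    qed
    obtain C where C: "0 \<le> C" "\<And>\<phi> \<rho>. \<phi> \<in> test_funs \<Omega> \<Longrightarrow> \<rho> \<in> test_funs \<Omega> \<Longrightarrow>
       En (\<lambda>x. \<phi> x - \<rho> x) \<le> \<eta> * (En \<phi> + En \<rho>) + C * W_gap \<phi> \<rho>" using W_energy_diff_le[OF \<eta>] unfolding En_def by blast
    define g where "g = e / 8 / (C + 1)"
    have g: "0 < g" using e C by (simp add: g_def)
    have Cg: "C * (4 * g) < e / 2"
    proof -
      have "g * (C + 1) = e / 8" unfolding g_def by (rule nonzero_eq_divide_eq[THEN iffD1, OF _ refl]) (use C in linarith)
      thus ?thesis using g by (simp add: algebra_simps)
    qed
    obtain N1 where N1: "\<And>n m. N1 \<le> n \<Longrightarrow> N1 \<le> m \<Longrightarrow> dist (d n) (d m) < g" using metric_CauchyD[OF Cd g] by blast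
    obtain N2 :: nat where N2: "1 / g < real N2" using reals_Archimedean2 by blast
    have N2': "1 / (real n + 1) \<le> g" if "N2 \<le> n" for n
    proof -
      have "1 / g \<le> real n + 1" using N2 that by linarith
      thus ?thesis using g by (simp add: field_simps)
    qed
    define N where "N = max N1 N2"
    show "\<exists>N. \<forall>n\<ge>N. \<forall>m\<ge>N. W_energy q \<Omega> W (\<lambda>x. w n x - w m x) < e"
    proof (intro exI[of _ N] allI impI)
      fix n m assume nm: "N \<le> n" "N \<le> m"
      have t: "w n \<in> test_funs \<Omega>" "w m \<in> test_funs \<Omega>" using w(1) mid_hull_test by blast+
      have "mid_hull U N (\<lambda>x. (1/2) * w n x + (1/2) * w m x)"
        using w(1) nm by (intro mid_hull.mid) (auto intro: mid_hull_antimono)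
      hence "d N \<le> En (\<lambda>x. (1/2) * w n x + (1/2) * w m x)" by (rule dle)
      moreover have "2 * En (\<lambda>x. (1/2) * w n x + (1/2) * w m x) = En (w n) + En (w m) - W_gap (w n) (w m)"
        unfolding En_def by (rule W_energy_midpoint(2)[OF t])
      moreover have "d n < d N + g" "d m < d N + g" using N1[of n N] N1[of m N] nm by (auto simp: dist_real_def N_def)
      moreover have "1 / (real n + 1) \<le> g" "1 / (real m + 1) \<le> g" using N2' nm by (auto simp: N_def)
      \<comment> \<open>The midpoint lies in the hull from \<open>N\<close>, so twice its energy is
        at least 2 \<open>d N\<close>, while each of the two energies is below \<open>d N\<close> +
        2 g.\<close>
      ultimately have "W_gap (w n) (w m) \<le> 4 * g" using w(2)[of n] w(2)[of m] by linarith
      hence 1: "C * W_gap (w n) (w m) \<le> C * (4 * g)" using C by (intro mult_left_mono)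
      have "En (w n) + En (w m) \<le> E0 + E0"
        unfolding En_def E0_def by (intro add_mono mid_hull_energy[OF w(1)])
      hence 2: "\<eta> * (En (w n) + En (w m)) \<le> \<eta> * (E0 + E0)" using \<eta> by (intro mult_left_mono) auto
      have "En (\<lambda>x. w n x - w m x) < e" using C(2)[OF t] 1 2 \<eta>E Cg by linarith
      thus "W_energy q \<Omega> W (\<lambda>x. w n x - w m x) < e" by (simp add: En_def)
    qed
  qed
qed

end

locale limit = minseq +
  fixes u :: "'a \<Rightarrow> real" and G :: "'a \<Rightarrow> 'a"
  assumes u_m: "u \<in> borel_measurable borel" and G_m: "G \<in> borel_measurable borel"
    and conv: "AE x in M. (\<lambda>i. U i x) \<longlonglongrightarrow> u x \<and> (\<lambda>i. grad (U i) x) \<longlonglongrightarrow> G x"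
begin

section \<open>Local integrability of the limit and its weak gradient\<close>

lemma u_M [measurable]: "u \<in> borel_measurable M" and G_M [measurable]: "G \<in> borel_measurable M"
  by (intro measurable_lebesgue_on u_m G_m)+

lemma U_M [measurable]: "U i \<in> borel_measurable M" and grad_M [measurable]: "grad (U i) \<in> borel_measurable M"
  by (intro measurable_lebesgue_on test_measurable test_grad_measurable U)+

lemma limit_energy:
  assumes K: "compact K" "K \<subseteq> \<Omega>"
  shows "integrable M (\<lambda>x. indicator K x * (norm (G x) powr q + \<bar>u x\<bar> powr q))"
proof -
  obtain C where C: "0 \<le> C" "\<And>i. (\<integral>x. indicator K x * en i x \<partial>M) \<le> C" using local_energy_bound[OF K] by blast
  note [measurable] = indicator_measurable[OF K(1)]
  show ?thesis
  proof (rule fatou_integral(1)[where h = "\<lambda>i x. indicator K x * en i x" and N = 0 and C = C])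
    show "AE x in M. (\<lambda>i. indicator K x * en i x) \<longlonglongrightarrow> indicator K x * (norm (G x) powr q + \<bar>u x\<bar> powr q)"
      using conv
    proof eventually_elim
      case (elim x)
      have "(\<lambda>i. norm (grad (U i) x) powr q) \<longlonglongrightarrow> norm (G x) powr q" "(\<lambda>i. \<bar>U i x\<bar> powr q) \<longlonglongrightarrow> \<bar>u x\<bar> powr q"
        using elim q by (auto intro!: tendsto_powr' tendsto_norm tendsto_rabs)
      thus ?case unfolding en_def by (intro tendsto_mult tendsto_add tendsto_const)
    qed
    show "(\<lambda>x. indicator K x * (norm (G x) powr q + \<bar>u x\<bar> powr q)) \<in> borel_measurable M" by measurable
  qed (use indicator_mult_integrable[OF K(1) en_integrable] en_nonneg C in auto)
qed

lemma local_powr_integrable: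
  assumes K: "compact K" "K \<subseteq> \<Omega>" and s: "0 \<le> s" "s \<le> q"
  shows "integrable M (\<lambda>x. indicator K x * norm (G x) powr s)" "integrable M (\<lambda>x. indicator K x * \<bar>u x\<bar> powr s)"
proof -
  note [measurable] = indicator_measurable[OF K(1)]
  have i: "integrable M (\<lambda>x. indicator K x + indicator K x * (norm (G x) powr q + \<bar>u x\<bar> powr q))"
    by (intro Bochner_Integration.integrable_add indicator_integrable[OF K] limit_energy[OF K])
  have le: "norm (G x) powr s \<le> 1 + (norm (G x) powr q + \<bar>u x\<bar> powr q)" "\<bar>u x\<bar> powr s \<le> 1 + (norm (G x) powr q + \<bar>u x\<bar> powr q)" for x
    using powr_le_one_plus[OF norm_ge_zero s, of "G x"] powr_le_one_plus[OF abs_ge_zero s, of "u x"]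
      powr_ge_zero[of "norm (G x)" q] powr_ge_zero[of "\<bar>u x\<bar>" q] by linarith+
  show "integrable M (\<lambda>x. indicator K x * norm (G x) powr s)"
  proof (rule Bochner_Integration.integrable_bound[OF i])
    show "(\<lambda>x. indicator K x * norm (G x) powr s) \<in> borel_measurable M" by measurable
  qed (use le in \<open>auto simp: indicator_def\<close>)
  show "integrable M (\<lambda>x. indicator K x * \<bar>u x\<bar> powr s)"
  proof (rule Bochner_Integration.integrable_bound[OF i])
    show "(\<lambda>x. indicator K x * \<bar>u x\<bar> powr s) \<in> borel_measurable M" by measurable
  qed (use le in \<open>auto simp: indicator_def\<close>)
qed

lemma L_loc_limit:
  assumes "0 \<le> s" "s \<le> q"
  shows "L_loc s \<Omega> u" "L_loc s \<Omega> G"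
  unfolding L_loc_def
  using local_powr_integrable[OF _ _ assms] integrable_lebesgue_on_subset[OF compact_sets \<Omega>_sets] by auto

lemma limit_V_integrable:
  assumes K: "compact K" "K \<subseteq> \<Omega>"
  shows "integrable M (\<lambda>x. indicator K x * (\<bar>V x\<bar> * \<bar>u x\<bar> powr (p - 1)))"
proof -
  note [measurable] = indicator_measurable[OF K(1)] V_measurable
  show ?thesis
  proof (rule equi_int_dominated(1)[OF equi_int_V[OF K], where g = "\<lambda>_. 0" and c = 1
        and h = "\<lambda>i x. indicator K x * (\<bar>V x\<bar> * \<bar>U i x\<bar> powr (p - 1))"])
    show "AE x in M. (\<lambda>i. indicator K x * (\<bar>V x\<bar> * \<bar>U i x\<bar> powr (p - 1))) \<longlonglongrightarrow> indicator K x * (\<bar>V x\<bar> * \<bar>u x\<bar> powr (p - 1))"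
      using conv by eventually_elim (use p in \<open>auto intro!: tendsto_intros tendsto_powr'\<close>)
    show "(\<lambda>x. indicator K x * (\<bar>V x\<bar> * \<bar>u x\<bar> powr (p - 1))) \<in> borel_measurable M" by measurable
    show "(\<lambda>x. indicator K x * (\<bar>V x\<bar> * \<bar>U i x\<bar> powr (p - 1))) \<in> borel_measurable M" for i by measurable
    show "AE x in M. \<bar>indicator K x * (\<bar>V x\<bar> * \<bar>U i x\<bar> powr (p - 1))\<bar> \<le> 1 * (indicator K x * (\<bar>V x\<bar> * \<bar>U i x\<bar> powr (p - 1)) + 0)" for i
      by (simp add: abs_mult)
  qed auto
qed

text \<open>Integration by parts holds for each \<open>U i\<close>. Both sides are linear in the
  function or its gradient, and since 1 < q equi-integrability on the support of \<zeta> carries the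
  identity to the limit.\<close>

lemma weak_grad_limit: "weak_grad \<Omega> u G"
  unfolding weak_grad_def
proof (intro conjI ballI)
  show "L_loc 1 \<Omega> u" "L_loc 1 \<Omega> G" using L_loc_limit[of 1] q by auto
  fix \<zeta> b assume \<zeta>: "\<zeta> \<in> test_funs \<Omega>" and b: "b \<in> (Basis :: 'a set)"
  define K where "K = supp \<zeta>"
  have K: "compact K" "K \<subseteq> \<Omega>"
    unfolding K_def by (rule test_funs_compact[OF \<zeta>], rule test_funs_supp[OF \<zeta>])
  obtain L where L: "0 < L" "\<And>x. \<bar>\<zeta> x\<bar> \<le> L" "\<And>x. norm (grad \<zeta> x) \<le> L" using test_fun_bounded[OF \<zeta>] by blast
  note s\<zeta> = test_funs_smooth[OF \<zeta>]
  have pb: "\<bar>pderiv_along b \<zeta> x\<bar> \<le> L" for x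
    using Basis_le_norm[OF b, of "grad \<zeta> x"] L(3)[of x] by (simp add: grad_inner_Basis[OF b])
  have pz: "pderiv_along b \<zeta> x = 0" if "x \<notin> K" for x
    using grad_outside[of x \<zeta>] that grad_inner_Basis[OF b, of \<zeta> x] by (simp add: K_def)
  have [measurable]: "\<zeta> \<in> borel_measurable M" "pderiv_along b \<zeta> \<in> borel_measurable M"
    by (intro measurable_lebesgue_on borel_measurable_continuous_onI smooth_continuous s\<zeta> smooth_pderiv_along[OF s\<zeta> b])+
  have e1: "(\<lambda>i. \<integral>x. U i x * pderiv_along b \<zeta> x \<partial>M) \<longlonglongrightarrow> (\<integral>x. u x * pderiv_along b \<zeta> x \<partial>M)"
  proof (rule equi_int_dominated(2)[OF equi_int_abs[OF K, of 1], where g = "\<lambda>_. 0" and c = L])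
    show "AE x in M. \<bar>U i x * pderiv_along b \<zeta> x\<bar> \<le> L * (indicator K x * \<bar>U i x\<bar> powr 1 + 0)" for i
    proof (rule AE_I2)
      fix x
      show "\<bar>U i x * pderiv_along b \<zeta> x\<bar> \<le> L * (indicator K x * \<bar>U i x\<bar> powr 1 + 0)"
        using mult_right_mono[OF pb, of "\<bar>U i x\<bar>" x] by (cases "x \<in> K") (auto simp: pz abs_mult mult.commute)
    qed
    show "AE x in M. (\<lambda>i. U i x * pderiv_along b \<zeta> x) \<longlonglongrightarrow> u x * pderiv_along b \<zeta> x"
      using conv by eventually_elim (auto intro!: tendsto_intros)
  qed (use q L in auto)
  have e2: "(\<lambda>i. \<integral>x. (grad (U i) x \<bullet> b) * \<zeta> x \<partial>M) \<longlonglongrightarrow> (\<integral>x. (G x \<bullet> b) * \<zeta> x \<partial>M)"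
  proof (rule equi_int_dominated(2)[OF equi_int_grad[OF K, of 1], where g = "\<lambda>_. 0" and c = L])
    show "AE x in M. \<bar>(grad (U i) x \<bullet> b) * \<zeta> x\<bar> \<le> L * (indicator K x * norm (grad (U i) x) powr 1 + 0)" for i
    proof (rule AE_I2)
      fix x
      have "\<bar>grad (U i) x \<bullet> b\<bar> * \<bar>\<zeta> x\<bar> \<le> norm (grad (U i) x) * L"
        using L by (intro mult_mono Basis_le_norm b) auto
      thus "\<bar>(grad (U i) x \<bullet> b) * \<zeta> x\<bar> \<le> L * (indicator K x * norm (grad (U i) x) powr 1 + 0)"
        by (cases "x \<in> K") (auto simp: K_def test_fun_outside abs_mult mult.commute)
    qed
    show "AE x in M. (\<lambda>i. (grad (U i) x \<bullet> b) * \<zeta> x) \<longlonglongrightarrow> (G x \<bullet> b) * \<zeta> x"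
      using conv by eventually_elim (auto intro!: tendsto_intros)
  qed (use q L in auto)
  have "(\<integral>x. U i x * pderiv_along b \<zeta> x \<partial>M) = - (\<integral>x. (grad (U i) x \<bullet> b) * \<zeta> x \<partial>M)" for i
  proof -
    have sU: "smooth_fun (U i)" by (rule test_funs_smooth[OF U])
    have "(\<integral>x. U i x * pderiv_along b \<zeta> x \<partial>lborel) = (\<integral>x. U i x * pderiv_along b \<zeta> x \<partial>M)"
      by (rule lborel_eq_M) (use K pz in \<open>auto intro!: continuous_on_mult smooth_continuous[OF sU] smooth_continuous[OF smooth_pderiv_along[OF s\<zeta> b]]\<close>)
    moreover have "(\<integral>x. pderiv_along b (U i) x * \<zeta> x \<partial>lborel) = (\<integral>x. pderiv_along b (U i) x * \<zeta> x \<partial>M)"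
      by (rule lborel_eq_M) (use K in \<open>auto intro!: continuous_on_mult smooth_continuous[OF s\<zeta>] smooth_continuous[OF smooth_pderiv_along[OF sU b]] test_fun_outside[where u = \<zeta>] simp: K_def\<close>)
    ultimately show ?thesis
      using integration_by_parts[OF sU test_funs_UNIV[OF \<zeta>] b] by (simp add: grad_inner_Basis[OF b])
  qed
  hence "(\<lambda>i. \<integral>x. U i x * pderiv_along b \<zeta> x \<partial>M) \<longlonglongrightarrow> - (\<integral>x. (G x \<bullet> b) * \<zeta> x \<partial>M)"
    using tendsto_minus[OF e2] by simp
  with e1 show "(\<integral>x. u x * pderiv_along b \<zeta> x \<partial>M) = - (\<integral>x. (G x \<bullet> b) * \<zeta> x \<partial>M)" by (rule LIMSEQ_unique)
qed

end

section \<open>The limit equation\<close>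

context limit
begin

text \<open>Only the increment is considered, since |G|^p need not be integrable when q < p. The
  increment grows like |G|^(p-1), which p - 1 < q makes equi-integrable along the sequence.\<close>

lemma energy_difference_limit:
  assumes \<zeta>: "\<zeta> \<in> test_funs \<Omega>"
  shows "integrable M (\<lambda>x. norm (G x + t *\<^sub>R grad \<zeta> x) powr p - norm (G x) powr p)"
    and "(\<lambda>i. \<integral>x. norm (grad (U i) x + t *\<^sub>R grad \<zeta> x) powr p - norm (grad (U i) x) powr p \<partial>M)
      \<longlonglongrightarrow> (\<integral>x. norm (G x + t *\<^sub>R grad \<zeta> x) powr p - norm (G x) powr p \<partial>M)"
proof -
  define K where "K = supp \<zeta>"
  have K: "compact K" "K \<subseteq> \<Omega>"
    unfolding K_def by (rule test_funs_compact[OF \<zeta>], rule test_funs_supp[OF \<zeta>])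
  obtain L where L: "0 < L" "\<And>x. \<bar>\<zeta> x\<bar> \<le> L" "\<And>x. norm (grad \<zeta> x) \<le> L" using test_fun_bounded[OF \<zeta>] by blast
  have [measurable]: "grad \<zeta> \<in> borel_measurable M"
    by (intro measurable_lebesgue_on test_grad_measurable \<zeta>)
  define c where "c = p * (\<bar>t\<bar> * L) * 2 powr (p - 1)"
  have c: "0 \<le> c" using p L by (simp add: c_def)
  have bd: "AE x in M. \<bar>norm (grad (U i) x + t *\<^sub>R grad \<zeta> x) powr p - norm (grad (U i) x) powr p\<bar>
       \<le> c * (indicator K x * norm (grad (U i) x) powr (p - 1) + indicator K x * (\<bar>t\<bar> * L) powr (p - 1))" for i
  proof (rule AE_I2)
    fix x
    show "\<bar>norm (grad (U i) x + t *\<^sub>R grad \<zeta> x) powr p - norm (grad (U i) x) powr p\<bar>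
       \<le> c * (indicator K x * norm (grad (U i) x) powr (p - 1) + indicator K x * (\<bar>t\<bar> * L) powr (p - 1))"
    proof (cases "x \<in> K")
      case False
      hence "grad \<zeta> x = 0" unfolding K_def by (rule grad_outside)
      thus ?thesis using False by simp
    next
      case True
      have n: "norm (t *\<^sub>R grad \<zeta> x) \<le> \<bar>t\<bar> * L" using L(3)[of x] by (simp add: mult_left_mono)
      have "\<bar>norm (grad (U i) x + t *\<^sub>R grad \<zeta> x) powr p - norm (grad (U i) x) powr p\<bar>
        \<le> p * norm (t *\<^sub>R grad \<zeta> x) * 2 powr (p - 1) * (norm (grad (U i) x) powr (p - 1) + norm (t *\<^sub>R grad \<zeta> x) powr (p - 1))"
        by (rule norm_powr_shift_le[OF p])
      also have "\<dots> \<le> c * (norm (grad (U i) x) powr (p - 1) + (\<bar>t\<bar> * L) powr (p - 1))"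
        unfolding c_def using n p L
        by (intro mult_mono add_mono powr_mono2 order_refl mult_nonneg_nonneg add_nonneg_nonneg) auto
      finally show ?thesis using True by simp
    qed
  qed
  have lim: "AE x in M. (\<lambda>i. norm (grad (U i) x + t *\<^sub>R grad \<zeta> x) powr p - norm (grad (U i) x) powr p)
      \<longlonglongrightarrow> norm (G x + t *\<^sub>R grad \<zeta> x) powr p - norm (G x) powr p"
    using conv by eventually_elim (use p in \<open>auto intro!: tendsto_intros tendsto_powr'\<close>)
  have g: "integrable M (\<lambda>x. indicator K x * (\<bar>t\<bar> * L) powr (p - 1))"
    by (intro integrable_mult_left indicator_integrable[OF K])
  have e: "equi_int M (\<lambda>i x. indicator K x * norm (grad (U i) x) powr (p - 1))"
    using p q by (intro equi_int_grad[OF K]) auto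
  show "integrable M (\<lambda>x. norm (G x + t *\<^sub>R grad \<zeta> x) powr p - norm (G x) powr p)"
    by (rule equi_int_dominated(1)[OF e g c bd _ _ lim]) measurable
  show "(\<lambda>i. \<integral>x. norm (grad (U i) x + t *\<^sub>R grad \<zeta> x) powr p - norm (grad (U i) x) powr p \<partial>M)
      \<longlonglongrightarrow> (\<integral>x. norm (G x + t *\<^sub>R grad \<zeta> x) powr p - norm (G x) powr p \<partial>M)"
    by (rule equi_int_dominated(2)[OF e g c bd _ _ lim]) measurable
qed

lemma potential_difference_limit:
  assumes \<zeta>: "\<zeta> \<in> test_funs \<Omega>"
  shows "integrable M (\<lambda>x. V x * (\<bar>u x + t * \<zeta> x\<bar> powr p - \<bar>u x\<bar> powr p))"
    and "(\<lambda>i. \<integral>x. V x * (\<bar>U i x + t * \<zeta> x\<bar> powr p - \<bar>U i x\<bar> powr p) \<partial>M)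
      \<longlonglongrightarrow> (\<integral>x. V x * (\<bar>u x + t * \<zeta> x\<bar> powr p - \<bar>u x\<bar> powr p) \<partial>M)"
proof -
  define K where "K = supp \<zeta>"
  have K: "compact K" "K \<subseteq> \<Omega>"
    unfolding K_def by (rule test_funs_compact[OF \<zeta>], rule test_funs_supp[OF \<zeta>])
  obtain L where L: "0 < L" "\<And>x. \<bar>\<zeta> x\<bar> \<le> L" "\<And>x. norm (grad \<zeta> x) \<le> L" using test_fun_bounded[OF \<zeta>] by blast
  have [measurable]: "\<zeta> \<in> borel_measurable M"
    by (intro measurable_lebesgue_on test_measurable \<zeta>)
  note [measurable] = V_measurable
  define c where "c = p * (\<bar>t\<bar> * L) * 2 powr (p - 1)"
  have c: "0 \<le> c" using p L by (simp add: c_def)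
  have bd: "AE x in M. \<bar>V x * (\<bar>U i x + t * \<zeta> x\<bar> powr p - \<bar>U i x\<bar> powr p)\<bar>
       \<le> c * (indicator K x * (\<bar>V x\<bar> * \<bar>U i x\<bar> powr (p - 1)) + (indicator K x * \<bar>V x\<bar>) * (\<bar>t\<bar> * L) powr (p - 1))" for i
  proof (rule AE_I2)
    fix x
    show "\<bar>V x * (\<bar>U i x + t * \<zeta> x\<bar> powr p - \<bar>U i x\<bar> powr p)\<bar>
       \<le> c * (indicator K x * (\<bar>V x\<bar> * \<bar>U i x\<bar> powr (p - 1)) + (indicator K x * \<bar>V x\<bar>) * (\<bar>t\<bar> * L) powr (p - 1))"
    proof (cases "x \<in> K")
      case False
      hence "\<zeta> x = 0" unfolding K_def by (rule test_fun_outside)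
      thus ?thesis using False by simp
    next
      case True
      have n: "\<bar>t * \<zeta> x\<bar> \<le> \<bar>t\<bar> * L" using L(2)[of x] by (simp add: abs_mult mult_left_mono)
      have "\<bar>\<bar>U i x + t * \<zeta> x\<bar> powr p - \<bar>U i x\<bar> powr p\<bar>
        \<le> p * \<bar>t * \<zeta> x\<bar> * 2 powr (p - 1) * (\<bar>U i x\<bar> powr (p - 1) + \<bar>t * \<zeta> x\<bar> powr (p - 1))"
        using norm_powr_shift_le[OF p, of "U i x" "t * \<zeta> x"] by simp
      also have "\<dots> \<le> c * (\<bar>U i x\<bar> powr (p - 1) + (\<bar>t\<bar> * L) powr (p - 1))"
        unfolding c_def using n p L
        by (intro mult_mono add_mono powr_mono2 order_refl mult_nonneg_nonneg add_nonneg_nonneg) auto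
      finally have "\<bar>V x\<bar> * \<bar>\<bar>U i x + t * \<zeta> x\<bar> powr p - \<bar>U i x\<bar> powr p\<bar> \<le> \<bar>V x\<bar> * (c * (\<bar>U i x\<bar> powr (p - 1) + (\<bar>t\<bar> * L) powr (p - 1)))"
        by (intro mult_left_mono) auto
      thus ?thesis using True by (simp add: abs_mult distrib_left mult.left_commute[of c])
    qed
  qed
  have lim: "AE x in M. (\<lambda>i. V x * (\<bar>U i x + t * \<zeta> x\<bar> powr p - \<bar>U i x\<bar> powr p))
      \<longlonglongrightarrow> V x * (\<bar>u x + t * \<zeta> x\<bar> powr p - \<bar>u x\<bar> powr p)"
    using conv by eventually_elim (use p in \<open>auto intro!: tendsto_intros tendsto_powr'\<close>)
  have g: "integrable M (\<lambda>x. (indicator K x * \<bar>V x\<bar>) * (\<bar>t\<bar> * L) powr (p - 1))"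
    using loc_int_V K by (intro integrable_mult_left) (simp add: loc_int_def)
  show "integrable M (\<lambda>x. V x * (\<bar>u x + t * \<zeta> x\<bar> powr p - \<bar>u x\<bar> powr p))"
    by (rule equi_int_dominated(1)[OF equi_int_V[OF K] g c bd _ _ lim]) measurable
  show "(\<lambda>i. \<integral>x. V x * (\<bar>U i x + t * \<zeta> x\<bar> powr p - \<bar>U i x\<bar> powr p) \<partial>M)
      \<longlonglongrightarrow> (\<integral>x. V x * (\<bar>u x + t * \<zeta> x\<bar> powr p - \<bar>u x\<bar> powr p) \<partial>M)"
    by (rule equi_int_dominated(2)[OF equi_int_V[OF K] g c bd _ _ lim]) measurable
qed

text \<open>Almost minimality of \<open>U i\<close> against \<open>U i\<close> + t \<zeta>, written
  with increments only and passed to the limit. The values of Q at the members of the sequence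
  cancel into these increments before the limit is taken.\<close>

lemma variational_inequality:
  assumes \<zeta>: "\<zeta> \<in> test_funs \<Omega>"
  shows "p * t * f \<zeta> \<le> (\<integral>x. norm (G x + t *\<^sub>R grad \<zeta> x) powr p - norm (G x) powr p \<partial>M)
     - (\<integral>x. V x * (\<bar>u x + t * \<zeta> x\<bar> powr p - \<bar>u x\<bar> powr p) \<partial>M)"
proof -
  have "p * t * f \<zeta> \<le> (\<integral>x. norm (grad (U i) x + t *\<^sub>R grad \<zeta> x) powr p - norm (grad (U i) x) powr p \<partial>M)
     - (\<integral>x. V x * (\<bar>U i x + t * \<zeta> x\<bar> powr p - \<bar>U i x\<bar> powr p) \<partial>M) + p * inverse (real (Suc i))" for i
  proof -
    define v where "v x = 1 * U i x + t * \<zeta> x" for x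
    have v: "v \<in> test_funs \<Omega>" unfolding v_def[abs_def] by (rule test_funs_comb[OF U \<zeta>])
    have gv: "grad v x = grad (U i) x + t *\<^sub>R grad \<zeta> x" for x
      unfolding v_def[abs_def] using grad_comb[OF test_funs_smooth[OF U] test_funs_smooth[OF \<zeta>], of 1 i t x] by simp
    have "f v = f (U i) + t * f \<zeta>" unfolding v_def[abs_def] f_comb[OF U \<zeta>] by simp
    hence "Q (U i) / p \<le> Q v / p - t * f \<zeta> + 1 / (real i + 1)" using U_min[OF v, of i] by linarith
    hence "p * (Q (U i) / p) \<le> p * (Q v / p - t * f \<zeta> + 1 / (real i + 1))" using p by (intro mult_left_mono) auto
    hence 1: "Q (U i) \<le> Q v - p * t * f \<zeta> + p * inverse (real (Suc i))"
      using p by (simp add: algebra_simps inverse_eq_divide)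
    have p0: "0 < p" using p by simp
    have 2: "(\<integral>x. norm (grad (U i) x + t *\<^sub>R grad \<zeta> x) powr p - norm (grad (U i) x) powr p \<partial>M)
        = (\<integral>x. norm (grad v x) powr p \<partial>M) - (\<integral>x. norm (grad (U i) x) powr p \<partial>M)"
      unfolding gv[symmetric] by (rule Bochner_Integration.integral_diff[OF grad_powr_integrable[OF v p0] grad_powr_integrable[OF U p0]])
    have 3: "(\<integral>x. V x * (\<bar>U i x + t * \<zeta> x\<bar> powr p - \<bar>U i x\<bar> powr p) \<partial>M)
        = (\<integral>x. V x * \<bar>v x\<bar> powr p \<partial>M) - (\<integral>x. V x * \<bar>U i x\<bar> powr p \<partial>M)"
      using V_abs_powr_integrable[OF v p0] V_abs_powr_integrable[OF U p0, of i] by (simp add: v_def right_diff_distrib)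
    show ?thesis using 1 unfolding Q_fun_def 2 3 by linarith
  qed
  moreover have "(\<lambda>i. (\<integral>x. norm (grad (U i) x + t *\<^sub>R grad \<zeta> x) powr p - norm (grad (U i) x) powr p \<partial>M)
     - (\<integral>x. V x * (\<bar>U i x + t * \<zeta> x\<bar> powr p - \<bar>U i x\<bar> powr p) \<partial>M) + p * inverse (real (Suc i)))
    \<longlonglongrightarrow> (\<integral>x. norm (G x + t *\<^sub>R grad \<zeta> x) powr p - norm (G x) powr p \<partial>M)
     - (\<integral>x. V x * (\<bar>u x + t * \<zeta> x\<bar> powr p - \<bar>u x\<bar> powr p) \<partial>M) + p * 0"
    by (intro tendsto_add tendsto_diff tendsto_mult tendsto_const energy_difference_limit(2)[OF \<zeta>]
        potential_difference_limit(2)[OF \<zeta>] LIMSEQ_inverse_real_of_nat)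
  ultimately show ?thesis by (intro LIMSEQ_le_const) auto
qed

lemma inverse_Suc_at_0: "filterlim (\<lambda>n. inverse (real (Suc n))) (at 0) sequentially"
  unfolding filterlim_at using LIMSEQ_inverse_real_of_nat by (auto intro!: always_eventually)

text \<open>The increments of t \<mapsto> |G + t \<nabla>\<zeta>|^p, divided by t, are dominated for
  t \<le> 1 by a multiple of |G|^(p-1) + L^(p-1) on the support of \<zeta>, so the pointwise
  derivative may be integrated.\<close>

lemma energy_derivative:
  assumes \<zeta>: "\<zeta> \<in> test_funs \<Omega>"
  shows "integrable M (\<lambda>x. (norm (G x) powr (p - 2) *\<^sub>R G x) \<bullet> grad \<zeta> x)"
    and "(\<lambda>n. (\<integral>x. norm (G x + inverse (real (Suc n)) *\<^sub>R grad \<zeta> x) powr p - norm (G x) powr p \<partial>M) / inverse (real (Suc n)))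
      \<longlonglongrightarrow> p * (\<integral>x. (norm (G x) powr (p - 2) *\<^sub>R G x) \<bullet> grad \<zeta> x \<partial>M)"
proof -
  define K where "K = supp \<zeta>"
  have K: "compact K" "K \<subseteq> \<Omega>"
    unfolding K_def by (rule test_funs_compact[OF \<zeta>], rule test_funs_supp[OF \<zeta>])
  obtain L where L: "0 < L" "\<And>x. \<bar>\<zeta> x\<bar> \<le> L" "\<And>x. norm (grad \<zeta> x) \<le> L" using test_fun_bounded[OF \<zeta>] by blast
  have [measurable]: "grad \<zeta> \<in> borel_measurable M"
    by (intro measurable_lebesgue_on test_grad_measurable \<zeta>)
  define t where "t n = inverse (real (Suc n))" for n
  have t: "0 < t n" "t n \<le> 1" for n by (auto simp: t_def inverse_le_1_iff)
  define c where "c = p * L * 2 powr (p - 1)"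
  define d where "d n x = (norm (G x + t n *\<^sub>R grad \<zeta> x) powr p - norm (G x) powr p) / t n" for n x
  define D where "D x = p * ((norm (G x) powr (p - 2) *\<^sub>R G x) \<bullet> grad \<zeta> x)" for x
  have [measurable]: "D \<in> borel_measurable M" "d n \<in> borel_measurable M" for n
    unfolding D_def[abs_def] d_def[abs_def] by measurable
  have w: "integrable M (\<lambda>x. c * (indicator K x * norm (G x) powr (p - 1) + indicator K x * L powr (p - 1)))"
    using p q by (intro integrable_mult_right Bochner_Integration.integrable_add local_powr_integrable[OF K]
        integrable_mult_left indicator_integrable[OF K]) auto
  have bd: "AE x in M. norm (d n x) \<le> c * (indicator K x * norm (G x) powr (p - 1) + indicator K x * L powr (p - 1))" for n
  proof (rule AE_I2)
    fix x
    show "norm (d n x) \<le> c * (indicator K x * norm (G x) powr (p - 1) + indicator K x * L powr (p - 1))"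
    proof (cases "x \<in> K")
      case False
      hence "grad \<zeta> x = 0" unfolding K_def by (rule grad_outside)
      thus ?thesis using False by (simp add: d_def)
    next
      case True
      have n1: "norm (t n *\<^sub>R grad \<zeta> x) \<le> t n * L" using L(3)[of x] t(1)[of n] by (simp add: mult_left_mono)
      have "t n * L \<le> 1 * L" using t(2)[of n] L by (intro mult_right_mono) auto
      hence n2: "norm (t n *\<^sub>R grad \<zeta> x) \<le> L" using n1 by linarith
      have "\<bar>norm (G x + t n *\<^sub>R grad \<zeta> x) powr p - norm (G x) powr p\<bar>
        \<le> p * norm (t n *\<^sub>R grad \<zeta> x) * 2 powr (p - 1) * (norm (G x) powr (p - 1) + norm (t n *\<^sub>R grad \<zeta> x) powr (p - 1))"
        by (rule norm_powr_shift_le[OF p])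
      also have "\<dots> \<le> p * (t n * L) * 2 powr (p - 1) * (norm (G x) powr (p - 1) + L powr (p - 1))"
        using n1 n2 p L t(1)[of n]
        by (intro mult_mono add_mono powr_mono2 order_refl mult_nonneg_nonneg add_nonneg_nonneg) auto
      also have "\<dots> = t n * (c * (norm (G x) powr (p - 1) + L powr (p - 1)))" by (simp add: c_def)
      finally show ?thesis using True t(1)[of n] by (simp add: d_def divide_le_eq mult.commute)
    qed
  qed
  have lim: "AE x in M. (\<lambda>n. d n x) \<longlonglongrightarrow> D x"
  proof (rule AE_I2)
    fix x
    have "((\<lambda>h. (norm (G x + h *\<^sub>R grad \<zeta> x) powr p - norm (G x) powr p) / h) \<longlongrightarrow> D x) (at 0)"
      using norm_powr_has_derivative[OF p, of "G x" "grad \<zeta> x"] by (simp add: DERIV_def D_def)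
    from filterlim_compose[OF this inverse_Suc_at_0] show "(\<lambda>n. d n x) \<longlonglongrightarrow> D x" by (simp add: d_def t_def)
  qed
  have iD: "integrable M D"
    by (rule integrable_dominated_convergence[OF _ _ w lim bd]) measurable
  hence "integrable M (\<lambda>x. (1 / p) * D x)" by simp
  thus "integrable M (\<lambda>x. (norm (G x) powr (p - 2) *\<^sub>R G x) \<bullet> grad \<zeta> x)" using p by (simp add: D_def)
  have "(\<lambda>n. integral\<^sup>L M (d n)) \<longlonglongrightarrow> integral\<^sup>L M D"
    by (rule integral_dominated_convergence[OF _ _ w lim bd]) measurable
  thus "(\<lambda>n. (\<integral>x. norm (G x + inverse (real (Suc n)) *\<^sub>R grad \<zeta> x) powr p - norm (G x) powr p \<partial>M) / inverse (real (Suc n)))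
      \<longlonglongrightarrow> p * (\<integral>x. (norm (G x) powr (p - 2) *\<^sub>R G x) \<bullet> grad \<zeta> x \<partial>M)"
    by (simp only: d_def[abs_def] D_def[abs_def] t_def integral_divide_zero integral_mult_right_zero)
qed

lemma potential_derivative:
  assumes \<zeta>: "\<zeta> \<in> test_funs \<Omega>"
  shows "integrable M (\<lambda>x. V x * \<bar>u x\<bar> powr (p - 2) * u x * \<zeta> x)"
    and "(\<lambda>n. (\<integral>x. V x * (\<bar>u x + inverse (real (Suc n)) * \<zeta> x\<bar> powr p - \<bar>u x\<bar> powr p) \<partial>M) / inverse (real (Suc n)))
      \<longlonglongrightarrow> p * (\<integral>x. V x * \<bar>u x\<bar> powr (p - 2) * u x * \<zeta> x \<partial>M)"
proof -
  define K where "K = supp \<zeta>"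
  have K: "compact K" "K \<subseteq> \<Omega>"
    unfolding K_def by (rule test_funs_compact[OF \<zeta>], rule test_funs_supp[OF \<zeta>])
  obtain L where L: "0 < L" "\<And>x. \<bar>\<zeta> x\<bar> \<le> L" "\<And>x. norm (grad \<zeta> x) \<le> L" using test_fun_bounded[OF \<zeta>] by blast
  have [measurable]: "\<zeta> \<in> borel_measurable M"
    by (intro measurable_lebesgue_on test_measurable \<zeta>)
  note [measurable] = V_measurable
  define t where "t n = inverse (real (Suc n))" for n
  have t: "0 < t n" "t n \<le> 1" for n by (auto simp: t_def inverse_le_1_iff)
  define c where "c = p * L * 2 powr (p - 1)"
  define d where "d n x = V x * (\<bar>u x + t n * \<zeta> x\<bar> powr p - \<bar>u x\<bar> powr p) / t n" for n x
  define D where "D x = p * (V x * \<bar>u x\<bar> powr (p - 2) * u x * \<zeta> x)" for x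
  have [measurable]: "D \<in> borel_measurable M" "d n \<in> borel_measurable M" for n
    unfolding D_def[abs_def] d_def[abs_def] by measurable
  have w: "integrable M (\<lambda>x. c * (indicator K x * (\<bar>V x\<bar> * \<bar>u x\<bar> powr (p - 1)) + (indicator K x * \<bar>V x\<bar>) * L powr (p - 1)))"
    using loc_int_V K by (intro integrable_mult_right Bochner_Integration.integrable_add limit_V_integrable[OF K]
        integrable_mult_left) (simp add: loc_int_def)
  have bd: "AE x in M. norm (d n x) \<le> c * (indicator K x * (\<bar>V x\<bar> * \<bar>u x\<bar> powr (p - 1)) + (indicator K x * \<bar>V x\<bar>) * L powr (p - 1))" for n
  proof (rule AE_I2)
    fix x
    show "norm (d n x) \<le> c * (indicator K x * (\<bar>V x\<bar> * \<bar>u x\<bar> powr (p - 1)) + (indicator K x * \<bar>V x\<bar>) * L powr (p - 1))"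
    proof (cases "x \<in> K")
      case False
      hence "\<zeta> x = 0" unfolding K_def by (rule test_fun_outside)
      thus ?thesis using False by (simp add: d_def)
    next
      case True
      have n1: "\<bar>t n * \<zeta> x\<bar> \<le> t n * L" using L(2)[of x] t(1)[of n] by (simp add: abs_mult mult_left_mono)
      have "t n * L \<le> 1 * L" using t(2)[of n] L by (intro mult_right_mono) auto
      hence n2: "\<bar>t n * \<zeta> x\<bar> \<le> L" using n1 by linarith
      have "\<bar>\<bar>u x + t n * \<zeta> x\<bar> powr p - \<bar>u x\<bar> powr p\<bar>
        \<le> p * \<bar>t n * \<zeta> x\<bar> * 2 powr (p - 1) * (\<bar>u x\<bar> powr (p - 1) + \<bar>t n * \<zeta> x\<bar> powr (p - 1))"
        using norm_powr_shift_le[OF p, of "u x" "t n * \<zeta> x"] by simp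
      also have "\<dots> \<le> p * (t n * L) * 2 powr (p - 1) * (\<bar>u x\<bar> powr (p - 1) + L powr (p - 1))"
        using n1 n2 p L t(1)[of n]
        by (intro mult_mono add_mono powr_mono2 order_refl mult_nonneg_nonneg add_nonneg_nonneg) auto
      also have "\<dots> = t n * (c * (\<bar>u x\<bar> powr (p - 1) + L powr (p - 1)))" by (simp add: c_def)
      finally have "\<bar>\<bar>u x + t n * \<zeta> x\<bar> powr p - \<bar>u x\<bar> powr p\<bar> / t n \<le> c * (\<bar>u x\<bar> powr (p - 1) + L powr (p - 1))"
        using t(1)[of n] by (simp add: divide_le_eq mult.commute)
      from mult_left_mono[OF this, of "\<bar>V x\<bar>"] show ?thesis
        using True t(1)[of n] by (simp add: d_def abs_mult distrib_left mult.left_commute[of c])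
    qed
  qed
  have lim: "AE x in M. (\<lambda>n. d n x) \<longlonglongrightarrow> D x"
  proof (rule AE_I2)
    fix x
    have "((\<lambda>h. (\<bar>u x + h * \<zeta> x\<bar> powr p - \<bar>u x\<bar> powr p) / h) \<longlongrightarrow> p * (\<bar>u x\<bar> powr (p - 2) * (u x * \<zeta> x))) (at 0)"
      using norm_powr_has_derivative[OF p, of "u x" "\<zeta> x"] by (simp add: DERIV_def)
    from tendsto_mult_left[OF filterlim_compose[OF this inverse_Suc_at_0], of "V x"]
    show "(\<lambda>n. d n x) \<longlonglongrightarrow> D x" by (simp add: d_def D_def t_def mult_ac)
  qed
  have iD: "integrable M D"
    by (rule integrable_dominated_convergence[OF _ _ w lim bd]) measurable
  hence "integrable M (\<lambda>x. (1 / p) * D x)" by simp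
  thus "integrable M (\<lambda>x. V x * \<bar>u x\<bar> powr (p - 2) * u x * \<zeta> x)" using p by (simp add: D_def)
  have "(\<lambda>n. integral\<^sup>L M (d n)) \<longlonglongrightarrow> integral\<^sup>L M D"
    by (rule integral_dominated_convergence[OF _ _ w lim bd]) measurable
  thus "(\<lambda>n. (\<integral>x. V x * (\<bar>u x + inverse (real (Suc n)) * \<zeta> x\<bar> powr p - \<bar>u x\<bar> powr p) \<partial>M) / inverse (real (Suc n)))
      \<longlonglongrightarrow> p * (\<integral>x. V x * \<bar>u x\<bar> powr (p - 2) * u x * \<zeta> x \<partial>M)"
    by (simp only: d_def[abs_def] D_def[abs_def] t_def integral_divide_zero integral_mult_right_zero)
qed

text \<open>Division of the variational inequality by positive t tending to 0 gives one inequality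
  only; the other will come from replacing \<zeta> by its negative.\<close>

lemma variational_le:
  assumes \<zeta>: "\<zeta> \<in> test_funs \<Omega>"
  shows "f \<zeta> \<le> (\<integral>x. (norm (G x) powr (p - 2) *\<^sub>R G x) \<bullet> grad \<zeta> x \<partial>M) - (\<integral>x. V x * \<bar>u x\<bar> powr (p - 2) * u x * \<zeta> x \<partial>M)"
proof -
  have "p * f \<zeta> \<le> (\<integral>x. norm (G x + inverse (real (Suc n)) *\<^sub>R grad \<zeta> x) powr p - norm (G x) powr p \<partial>M) / inverse (real (Suc n))
     - (\<integral>x. V x * (\<bar>u x + inverse (real (Suc n)) * \<zeta> x\<bar> powr p - \<bar>u x\<bar> powr p) \<partial>M) / inverse (real (Suc n))" for n
  proof -
    have t: "0 < inverse (real (Suc n))" by simp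
    have "p * f \<zeta> = (p * inverse (real (Suc n)) * f \<zeta>) / inverse (real (Suc n))" by simp
    also have "\<dots> \<le> ((\<integral>x. norm (G x + inverse (real (Suc n)) *\<^sub>R grad \<zeta> x) powr p - norm (G x) powr p \<partial>M)
       - (\<integral>x. V x * (\<bar>u x + inverse (real (Suc n)) * \<zeta> x\<bar> powr p - \<bar>u x\<bar> powr p) \<partial>M)) / inverse (real (Suc n))"
      by (rule divide_right_mono[OF variational_inequality[OF \<zeta>] less_imp_le[OF t]])
    finally show ?thesis unfolding diff_divide_distrib .
  qed
  hence "p * f \<zeta> \<le> p * (\<integral>x. (norm (G x) powr (p - 2) *\<^sub>R G x) \<bullet> grad \<zeta> x \<partial>M) - p * (\<integral>x. V x * \<bar>u x\<bar> powr (p - 2) * u x * \<zeta> x \<partial>M)"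
    by (intro LIMSEQ_le_const[OF tendsto_diff[OF energy_derivative(2)[OF \<zeta>] potential_derivative(2)[OF \<zeta>]]]) auto
  hence "p * f \<zeta> \<le> p * ((\<integral>x. (norm (G x) powr (p - 2) *\<^sub>R G x) \<bullet> grad \<zeta> x \<partial>M) - (\<integral>x. V x * \<bar>u x\<bar> powr (p - 2) * u x * \<zeta> x \<partial>M))"
    by (simp only: right_diff_distrib)
  thus ?thesis using p by (simp only: mult_le_cancel_left_pos)
qed

lemma limit_solves: "solves_distr p \<Omega> V f u G"
  unfolding solves_distr_def
proof (intro ballI conjI)
  fix \<zeta> assume \<zeta>: "\<zeta> \<in> test_funs \<Omega>"
  show "integrable M (\<lambda>x. (norm (G x) powr (p - 2) *\<^sub>R G x) \<bullet> grad \<zeta> x)" by (rule energy_derivative(1)[OF \<zeta>])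
  show "integrable M (\<lambda>x. V x * \<bar>u x\<bar> powr (p - 2) * u x * \<zeta> x)" by (rule potential_derivative(1)[OF \<zeta>])
  define I where "I = (\<integral>x. (norm (G x) powr (p - 2) *\<^sub>R G x) \<bullet> grad \<zeta> x \<partial>M)"
  define J where "J = (\<integral>x. V x * \<bar>u x\<bar> powr (p - 2) * u x * \<zeta> x \<partial>M)"
  \<comment> \<open>All three terms are linear in \<zeta>, so the inequality for -\<zeta> is the
    reverse one.\<close>
  have \<zeta>': "(\<lambda>x. (-1) * \<zeta> x) \<in> test_funs \<Omega>" using test_funs_comb[OF \<zeta> \<zeta>, of "-1" 0] by simp
  have "f (\<lambda>x. (-1) * \<zeta> x) \<le> - I - - J"
    using variational_le[OF \<zeta>'] unfolding grad_cmult[OF test_funs_smooth[OF \<zeta>]] by (simp add: I_def J_def)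
  moreover have "f (\<lambda>x. (-1) * \<zeta> x) = - f \<zeta>" using f_cmult[OF \<zeta>, of "-1"] by simp
  ultimately have "I - J \<le> f \<zeta>" by linarith
  thus "I - J = f \<zeta>" using variational_le[OF \<zeta>] by (simp add: I_def J_def)
qed

text \<open>Closed balls are stable under midpoints. Hence elements of the tail hulls inherit the
  pointwise limits of the sequence, which identifies the limit of the Cauchy sequence without any
  weak convergence.\<close>

lemma mid_hull_near:
  assumes "mid_hull U n \<phi>" "\<And>i. n \<le> i \<Longrightarrow> \<bar>U i x - a\<bar> \<le> e \<and> norm (grad (U i) x - A) \<le> e"
  shows "\<bar>\<phi> x - a\<bar> \<le> e \<and> norm (grad \<phi> x - A) \<le> e"
  using assms(1)
proof (induction rule: mid_hull.induct)
  case (base i) thus ?case using assms(2) by blast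
next
  case (mid \<phi> \<rho>)
  note t = test_funs_smooth[OF mid_hull_test[OF mid.hyps(1)]] test_funs_smooth[OF mid_hull_test[OF mid.hyps(2)]]
  have "norm ((1/2) *\<^sub>R grad \<phi> x + (1/2) *\<^sub>R grad \<rho> x - A) = norm ((1/2) *\<^sub>R (grad \<phi> x - A) + (1/2) *\<^sub>R (grad \<rho> x - A))"
    by (simp add: algebra_simps flip: scaleR_left_distrib)
  also have "\<dots> \<le> (1/2) * norm (grad \<phi> x - A) + (1/2) * norm (grad \<rho> x - A)"
    by (rule order_trans[OF norm_triangle_ineq]) simp
  also have "\<dots> \<le> e" using mid.IH by linarith
  finally have "norm ((1/2) *\<^sub>R grad \<phi> x + (1/2) *\<^sub>R grad \<rho> x - A) \<le> e" .
  moreover have "\<bar>(1/2) * \<phi> x + (1/2) * \<rho> x - a\<bar> \<le> e" using mid.IH by linarith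
  ultimately show ?case unfolding grad_comb[OF t] by blast
qed

text \<open>The hull elements are Cauchy in the weighted norm and converge pointwise to u and G.
  Fatou's lemma combines the two into local convergence, so the same sequence represents u in the
  completion.\<close>

lemma limit_W1_0: "W1_0 q \<Omega> W u G"
proof -
  obtain w where w: "\<And>n. mid_hull U n (w n)"
    and Cau: "\<And>e. 0 < e \<Longrightarrow> \<exists>N. \<forall>n\<ge>N. \<forall>m\<ge>N. W_energy q \<Omega> W (\<lambda>x. w n x - w m x) < e"
    using convex_Cauchy_sequence by blast
  have wt: "w n \<in> test_funs \<Omega>" for n by (rule mid_hull_test[OF w])
  have conv_w: "AE x in M. (\<lambda>i. w i x) \<longlonglongrightarrow> u x \<and> (\<lambda>i. grad (w i) x) \<longlonglongrightarrow> G x"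
    using conv
  proof eventually_elim
    case (elim x)
    have *: "\<exists>N. \<forall>n\<ge>N. \<bar>w n x - u x\<bar> \<le> e \<and> norm (grad (w n) x - G x) \<le> e" if e: "0 < e" for e
    proof -
      obtain N1 where N1: "\<And>i. N1 \<le> i \<Longrightarrow> norm (U i x - u x) < e" using LIMSEQ_D[OF conjunct1[OF elim] e] by blast
      obtain N2 where N2: "\<And>i. N2 \<le> i \<Longrightarrow> norm (grad (U i) x - G x) < e" using LIMSEQ_D[OF conjunct2[OF elim] e] by blast
      have "\<bar>w n x - u x\<bar> \<le> e \<and> norm (grad (w n) x - G x) \<le> e" if n: "max N1 N2 \<le> n" for n
      proof (rule mid_hull_near[OF w])
        fix i assume "n \<le> i"
        thus "\<bar>U i x - u x\<bar> \<le> e \<and> norm (grad (U i) x - G x) \<le> e" using N1[of i] N2[of i] n by (simp add: less_imp_le)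
      qed
      thus ?thesis by blast
    qed
    have "\<exists>N. \<forall>n\<ge>N. norm (w n x - u x) < e \<and> norm (grad (w n) x - G x) < e" if e: "0 < e" for e
    proof -
      obtain N where "\<And>n. N \<le> n \<Longrightarrow> \<bar>w n x - u x\<bar> \<le> e / 2 \<and> norm (grad (w n) x - G x) \<le> e / 2" using *[of "e / 2"] e by auto
      thus ?thesis using e by (intro exI[of _ N]) fastforce
    qed
    thus ?case by (intro conjI LIMSEQ_I) blast+
  qed
  have [measurable]: "w n \<in> borel_measurable M" "grad (w n) \<in> borel_measurable M" for n
    by (intro measurable_lebesgue_on test_measurable test_grad_measurable wt)+
  have "W1_loc q \<Omega> u G"
    unfolding W1_loc_def using weak_grad_limit L_loc_limit[of q] q by auto
  moreover have "\<exists>N. \<forall>m\<ge>N. \<forall>n\<ge>N. W_norm q \<Omega> W (\<lambda>x. w m x - w n x) < e" if e: "0 < e" for e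
  proof -
    have eq: "0 < e powr q" using e by simp
    obtain N where N: "\<And>m n. N \<le> m \<Longrightarrow> N \<le> n \<Longrightarrow> W_energy q \<Omega> W (\<lambda>x. w m x - w n x) < e powr q" using Cau[OF eq] by blast
    have "W_norm q \<Omega> W (\<lambda>x. w m x - w n x) < e" if "N \<le> m" "N \<le> n" for m n
    proof -
      have "W_energy q \<Omega> W (\<lambda>x. w m x - w n x) powr (1 / q) < (e powr q) powr (1 / q)"
        using q N[OF that] W_energy_nonneg by (intro powr_less_mono2) auto
      thus ?thesis using e q by (simp add: W_norm_def powr_powr)
    qed
    thus ?thesis by blast
  qed
  moreover have "W1_loc_tendsto q \<Omega> w u G"
    unfolding W1_loc_tendsto_def
  proof (intro allI impI)
    fix K :: "'a set" assume "compact K \<and> K \<subseteq> \<Omega>"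
    hence K: "compact K" "K \<subseteq> \<Omega>" by auto
    note [measurable] = indicator_measurable[OF K(1)]
    obtain c where c: "0 < c" "\<And>x. x \<in> K \<Longrightarrow> c \<le> W x" using W_lower_bound[OF K] by blast
    define h where "h n m x = indicator K x * (norm (grad (w n) x - grad (w m) x) powr q + \<bar>w n x - w m x\<bar> powr q)" for n m x
    define h0 where "h0 n x = indicator K x * (norm (grad (w n) x - G x) powr q + \<bar>w n x - u x\<bar> powr q)" for n x
    have eqI: "(\<integral>x. norm (grad (w n) x - G x) powr q + \<bar>w n x - u x\<bar> powr q \<partial>lebesgue_on K) = integral\<^sup>L M (h0 n)" for n
      unfolding h0_def[abs_def] by (rule integral_lebesgue_on_subset[OF compact_sets[OF K(1)] \<Omega>_sets K(2)])
    have d: "(\<lambda>x. w n x - w m x) \<in> test_funs \<Omega>" for n m using test_funs_comb[OF wt wt, of 1 n "-1" m] by simp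
    have gd: "grad (\<lambda>x. w n x - w m x) x = grad (w n) x - grad (w m) x" for n m x
      by (rule grad_diff[OF test_funs_smooth[OF wt] test_funs_smooth[OF wt]])
    have q0: "0 < q" using q by simp
    have ih: "integrable M (h n m)" for n m
      unfolding h_def[abs_def] gd[symmetric]
      by (intro indicator_mult_integrable[OF K(1)] Bochner_Integration.integrable_add grad_powr_integrable[OF d q0] abs_powr_integrable[OF d q0])
    have hE: "c * integral\<^sup>L M (h n m) \<le> W_energy q \<Omega> W (\<lambda>x. w n x - w m x)" for n m
    proof -
      have "c * integral\<^sup>L M (h n m) = (\<integral>x. c * h n m x \<partial>M)" by simp
      also have "\<dots> \<le> W_energy q \<Omega> W (\<lambda>x. w n x - w m x)"
        unfolding W_energy_def
      proof (rule integral_mono_AE)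
        show "integrable M (\<lambda>x. c * h n m x)" using ih by simp
        show "AE x in M. c * h n m x \<le> (norm (grad (\<lambda>x. w n x - w m x) x) powr q + \<bar>w n x - w m x\<bar> powr q) * W x"
        proof (rule AE_I2)
          fix x assume "x \<in> space M"
          hence x: "0 < W x" using W(2)[of x] by (simp add: space_restrict_space)
          define y where "y = norm (grad (w n) x - grad (w m) x) powr q + \<bar>w n x - w m x\<bar> powr q"
          have y: "0 \<le> y" by (simp add: y_def)
          have "c * (indicator K x * y) \<le> y * W x"
            using mult_right_mono[OF c(2) y, of x] x y by (cases "x \<in> K") (auto simp: mult.commute)
          thus "c * h n m x \<le> (norm (grad (\<lambda>x. w n x - w m x) x) powr q + \<bar>w n x - w m x\<bar> powr q) * W x"
            by (simp add: h_def gd y_def)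
        qed
      qed (rule energy_W_integrable[OF d])
      finally show ?thesis .
    qed
    have "(\<lambda>n. integral\<^sup>L M (h0 n)) \<longlonglongrightarrow> 0"
    proof (rule LIMSEQ_I)
      fix e :: real assume e: "0 < e"
      have "0 < c * (e / 2)" using c e by simp
      then obtain N where N: "\<And>n m. N \<le> n \<Longrightarrow> N \<le> m \<Longrightarrow> W_energy q \<Omega> W (\<lambda>x. w n x - w m x) < c * (e / 2)" using Cau by blast
      show "\<exists>N. \<forall>n\<ge>N. norm (integral\<^sup>L M (h0 n) - 0) < e"
      proof (intro exI[of _ N] allI impI)
        fix n assume n: "N \<le> n"
        have le: "integral\<^sup>L M (h n m) \<le> e / 2" if "N \<le> m" for m
        proof -
          have "c * integral\<^sup>L M (h n m) \<le> c * (e / 2)" using hE[of n m] N[OF n that] by linarith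
          thus ?thesis using c(1) by (simp only: mult_le_cancel_left_pos)
        qed
        have lim: "AE x in M. (\<lambda>m. h n m x) \<longlonglongrightarrow> h0 n x"
          using conv_w unfolding h_def h0_def
          by eventually_elim (use q in \<open>auto intro!: tendsto_intros tendsto_powr'\<close>)
        \<comment> \<open>Fatou's lemma in the second index m, with n fixed: the Cauchy bound for m
          \<ge> N survives when the m-th function is replaced by its pointwise limit.\<close>
        have "integral\<^sup>L M (h0 n) \<le> e / 2"
          by (rule fatou_integral(2)[where h = "h n", OF ih _ _ lim le]) (auto simp: h_def h0_def[abs_def])
        moreover have "0 \<le> integral\<^sup>L M (h0 n)" by (rule Bochner_Integration.integral_nonneg) (simp add: h0_def)
        ultimately show "norm (integral\<^sup>L M (h0 n) - 0) < e" using e by simp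
      qed
    qed
    thus "(\<lambda>n. \<integral>x. norm (grad (w n) x - G x) powr q + \<bar>w n x - u x\<bar> powr q \<partial>lebesgue_on K) \<longlonglongrightarrow> 0" by (simp only: eqI)
  qed
  ultimately show ?thesis unfolding W1_0_def using wt by blast
qed

end

theorem theorem4p5:
  fixes \<Omega> :: "'a::euclidean_space set"
    and V W :: "'a \<Rightarrow> real"
    and f :: "('a \<Rightarrow> real) \<Rightarrow> real"
    and p q r :: real
  assumes p: "1 < p"
    and domain: "open \<Omega>" "connected \<Omega>" "\<Omega> \<noteq> {}"
    and V_nonneg: "AE x in lebesgue_on \<Omega>. 0 \<le> V x"
    and Q_pos: "\<And>u. u \<in> test_funs \<Omega> \<Longrightarrow> u \<noteq> (\<lambda>x. 0) \<Longrightarrow> 0 < Q_fun p \<Omega> V u"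
    and q: "1 < q" "q \<le> p" "p - 1 < q"
    and r_low: "real DIM('a) < q \<Longrightarrow> r = 1"
    and r_eq: "real DIM('a) = q \<Longrightarrow> 1 < r"
    and r_high: "real DIM('a) > q \<Longrightarrow> 1 / r + (p - 1) / sobolev_conj TYPE('a) q = 1"
    and V_loc: "L_loc r \<Omega> V"
    and W: "continuous_on \<Omega> W" "\<And>x. x \<in> \<Omega> \<Longrightarrow> 0 < W x"
    and Q_lower: "\<And>u. u \<in> test_funs \<Omega> \<Longrightarrow> W_energy q \<Omega> W u powr (p / q) \<le> Q_fun p \<Omega> V u"
    and f: "distribution \<Omega> f"
    and f_sup: "(SUP u\<in>{u \<in> test_funs \<Omega>. Q_fun p \<Omega> V u = 1}. ereal (f u)) < \<infinity>"
  shows "\<exists>u G. W1_0 q \<Omega> W u G \<and> solves_distr p \<Omega> V f u G"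
proof -
  interpret problem \<Omega> V W f p q r
    by unfold_locales (fact p domain(1) Q_pos q r_low r_eq r_high V_loc W Q_lower f f_sup)+
  obtain U B where U: "\<And>i::nat. U i \<in> test_funs \<Omega>"
    "\<And>i v. v \<in> test_funs \<Omega> \<Longrightarrow> Q_fun p \<Omega> V (U i) / p - f (U i) \<le> Q_fun p \<Omega> V v / p - f v + 1 / (real i + 1)"
    "\<And>i. Q_fun p \<Omega> V (U i) \<le> B" using minimizing_sequence by blast
  interpret S: minseq \<Omega> V W f p q r U B by unfold_locales (fact U)+
  obtain k :: "nat \<Rightarrow> nat" and u G where k: "strict_mono k" "u \<in> borel_measurable borel" "G \<in> borel_measurable borel"
    "AE x in lebesgue_on \<Omega>. (\<lambda>i. U (k i) x) \<longlonglongrightarrow> u x \<and> (\<lambda>i. grad (U (k i)) x) \<longlonglongrightarrow> G x"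
    using S.convergent_subsequence by blast
  \<comment> \<open>Almost everywhere convergence is known only along the extracted subsequence,
    which is again minimizing and takes over from here.\<close>
  interpret K: minseq \<Omega> V W f p q r "\<lambda>i. U (k i)" B by (rule S.minseq_subseq[OF k(1)])
  interpret L: limit \<Omega> V W f p q r "\<lambda>i. U (k i)" B u G by unfold_locales (fact k)+
  show ?thesis using L.limit_W1_0 L.limit_solves by blast
qed

end
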